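(* Let $0\le\delta<1$ be a constant. Then $\mathsf{BP}_{1/2}\mathsf{CL}_{\delta}\mathsf{P}=\mathsf{CL}\mathsf{P}$.
   Context: A catalytic Turing machine has a read-only input tape, a write-only output tape, a read-write work tape and a read-write catalytic tape which initially holds an arbitrary string $\tau$; an (errorless) catalytic machine must, for every input and initial $\tau$, halt with exactly $\tau$ on the catalytic tape. $\mathsf{CL}\mathsf{P}$ is the class of languages decided by deterministic catalytic machines with $k\log n$ work space and $n^k$ catalytic space, always halting within $n^k$ steps, for some constant $k$. A randomized catalytic machine with $c$ catalytic bits additionally has read-only, read-once access to a uniformly random string $r\in\{0,1\}^{2^c}$. $\mathsf{BP}_{1/2}\mathsf{CL}_{\delta}\mathsf{P}$ is the class of languages $L$ for which there is a constant $k$ and a randomized catalytic machine $M$ with $k\log n$ work bits and $n^k$ catalytic bits that always halts within $n^k$ steps and, for every input $x$ and initial catalytic content $\tau$, outputs $L(x)$ with probability $1$ over $r$ and halts with exactly $\tau$ on its catalytic tape with probability at least $1-\delta$ over $r$. *)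

theory Defs
  imports Complex_Main
begin

text \<open>A catalytic Turing machine (possibly randomized). States are natural
numbers below nst; the machine has a read-only input tape (with end markers,
read as None), a read-write binary work tape of fixed length, a read-write binary
catalytic tape of fixed length, and a read-only one-way (read-once) binary random
tape. The decision (the single output bit) is given by halting in qacc / qrej.\<close>

datatype dir = MvL | MvN | MvR

record cmachine =
  nst   :: nat
  q0    :: nat
  qacc  :: nat
  qrej  :: nat
  delta :: "nat \<Rightarrow> bool option \<Rightarrow> bool \<Rightarrow> bool \<Rightarrow> bool
              \<Rightarrow> nat \<times> dir \<times> bool \<times> dir \<times> bool \<times> dir \<times> bool"
  \<comment> \<open>arguments: state, input symbol, work bit, catalytic bit, random bit;
     result: next state, input move, work write, work move, catalytic write,
     catalytic move, advance random head\<close>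

definition wf_machine :: "cmachine \<Rightarrow> bool" where
  "wf_machine M \<longleftrightarrow> q0 M < nst M \<and> qacc M < nst M \<and> qrej M < nst M \<and> qacc M \<noteq> qrej M \<and>
     (\<forall>q a b c d. q < nst M \<longrightarrow> fst (delta M q a b c d) < nst M)"

record config =
  st :: nat
  ih :: nat
  wt :: "bool list"
  wh :: nat
  ct :: "bool list"
  ch :: nat
  rh :: nat

definition move :: "dir \<Rightarrow> nat \<Rightarrow> nat \<Rightarrow> nat" where
  "move d h len = (case d of MvL \<Rightarrow> h - 1 | MvN \<Rightarrow> h | MvR \<Rightarrow> min (h + 1) (len - 1))"

definition rd :: "bool list \<Rightarrow> nat \<Rightarrow> bool" where
  "rd xs i = (if i < length xs then xs ! i else False)"

definition halted :: "cmachine \<Rightarrow> config \<Rightarrow> bool" where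
  "halted M c \<longleftrightarrow> st c = qacc M \<or> st c = qrej M"

definition step :: "cmachine \<Rightarrow> bool list \<Rightarrow> bool list \<Rightarrow> config \<Rightarrow> config" where
  "step M x r c =
    (if halted M c then c else
     (let inp = (if 1 \<le> ih c \<and> ih c \<le> length x then Some (x ! (ih c - 1)) else None);
          (q', di, ww, dw, cw, dc, adv) =
             delta M (st c) inp (rd (wt c) (wh c)) (rd (ct c) (ch c)) (rd r (rh c))
      in \<lparr> st = q',
           ih = move di (ih c) (length x + 2),
           wt = (wt c)[wh c := ww],
           wh = move dw (wh c) (length (wt c)),
           ct = (ct c)[ch c := cw],
           ch = move dc (ch c) (length (ct c)),
           rh = (if adv then rh c + 1 else rh c) \<rparr>))"

definition init :: "cmachine \<Rightarrow> nat \<Rightarrow> bool list \<Rightarrow> config" where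
  "init M w \<tau> = \<lparr> st = q0 M, ih = 0, wt = replicate w False, wh = 0,
                   ct = \<tau>, ch = 0, rh = 0 \<rparr>"

definition run :: "cmachine \<Rightarrow> bool list \<Rightarrow> bool list \<Rightarrow> nat \<Rightarrow> bool list \<Rightarrow> nat \<Rightarrow> config" where
  "run M x r w \<tau> t = (step M x r ^^ t) (init M w \<tau>)"

text \<open>Resource bounds n^k and k log n (n = input length; max n 2 avoids degenerate
values for n < 2; immaterial since k is existentially quantified).\<close>
definition polyb :: "nat \<Rightarrow> nat \<Rightarrow> nat" where
  "polyb k n = (max n 2) ^ k"

definition logb :: "nat \<Rightarrow> nat \<Rightarrow> nat" where
  "logb k n = k * nat \<lceil>log 2 (real (max n 2))\<rceil>"

text \<open>CLP: deterministic catalytic machines (no random tape: the random string is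
empty, so the random bit is constantly False).\<close>
definition CLP :: "bool list set set" where
  "CLP = {L. \<exists>k M. wf_machine M \<and>
     (\<forall>x \<tau>. length \<tau> = polyb k (length x) \<longrightarrow>
        (let c = run M x [] (logb k (length x)) \<tau> (polyb k (length x))
         in halted M c \<and> (st c = qacc M \<longleftrightarrow> x \<in> L) \<and> ct c = \<tau>))}"

definition bitstrings :: "nat \<Rightarrow> bool list set" where
  "bitstrings m = {r. length r = m}"

definition BPCLP :: "real \<Rightarrow> bool list set set" where
  "BPCLP \<delta> = {L. \<exists>k M. wf_machine M \<and>
     (\<forall>x \<tau>. length \<tau> = polyb k (length x) \<longrightarrow>
        (let n = length x; cb = polyb k n;
             fin = (\<lambda>r. run M x r (logb k n) \<tau> (polyb k n))
         in (\<forall>r \<in> bitstrings (2 ^ cb).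
                halted M (fin r) \<and> (st (fin r) = qacc M \<longleftrightarrow> x \<in> L)) \<and>
            real (card {r \<in> bitstrings (2 ^ cb). ct (fin r) = \<tau>})
              \<ge> (1 - \<delta>) * 2 ^ (2 ^ cb)))}"

end

theory Submission
  imports Defs
begin

text \<open>
One inclusion ignores the coin. For the other, fix an input and a randomized machine with
time bound T, guess the answer, and replace its coins by m samples: sample i tosses at time t the
inner product of the index i with a short seed stored for time t. The runs of all samples
form a forest, each of whose trees is rooted at a final tape, and a depth-first tour of a tree is a
reversible walk on the catalytic tape that needs only logarithmic work space. Since
the machine never errs, every initial configuration found on the tour of the tree whose root is the
current tape (a hit) reveals the answer.

If no hit shows up in the first Y steps of the tour, one bit of the tape can be freed. Either some
tour is longer than Y, and Y steps of it are an injective way to store the number y that occupied a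
field of the tape; or all tours are short, and then some seed is bad, i.e. it misrepresents the average
over the coin at some node by an amount that Chebyshev's inequality makes so rare that the seed is
cheaper to store by its rank among the bad seeds. Doing this in T disjoint blocks of the tape
either produces a hit or frees T cells, on which the machine is run with all coins zero. Undoing
the compression restores the tape.

The algorithm is written in a small expression language whose side effects are undone explicitly,
compiled to counter programs and these to catalytic machines.
\<close>


section \<open>Counter programs and their catalytic machines\<close>

text \<open>A run of the given machine may spoil the tape, and no copy of the tape fits into the
  work space. So the current tape is read as a final content: the runs ending in it form one tree,
  whose tour can always be walked back. Restoration with probability at least 1 - \<delta> puts a
  run started on the current tape itself into this tree, unless the seeds lose too much; a loss of
  m/E per step is harmless since E > T/(1 - \<delta>). A union bound over all nodes is hopeless,
  because there are exponentially many tapes. But a seed can be bad only at a node one of whose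
  successors leads to the root in at least m/E samples, and a tour of at most Y steps has room for
  at most E Y/m such successors. Hence short tours make bad seeds rare once m^2 exceeds a polynomial
  times Y, while Y only has to exceed m by a polynomial factor, so both can hold. Finally, bad seeds
  of time t are judged on the tree cut off at level t + 1, which ignores the seed of time t; so a
  rank can be decoded after that seed has been overwritten.\<close>

datatype lcom = Skip | Inc nat | Dec nat | CatM dir | CatW bool | InM dir | Seq lcom lcom
  | IfNZ nat lcom lcom | While nat lcom | IfCat lcom lcom | IfIn lcom lcom lcom | Acc | Rej

record lst =
  rg :: "nat \<Rightarrow> nat"
  li :: nat
  lc :: "bool list"
  lh :: nat

definition insym :: "bool list \<Rightarrow> nat \<Rightarrow> bool option" where
  "insym x i = (if 1 \<le> i \<and> i \<le> length x then Some (x ! (i - 1)) else None)"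

text \<open>\<open>C\<close> is a strict bound on the registers: a derivation certifies that no
  increment overflows its field on the work tape, and it counts the steps. \<open>Acc\<close> and
  \<open>Rej\<close> have no rule, as they never return.\<close>

inductive lx :: "nat \<Rightarrow> bool list \<Rightarrow> lcom \<Rightarrow> lst \<Rightarrow> nat \<Rightarrow> lst \<Rightarrow> bool" for C x where
  lx_Skip: "lx C x Skip s 1 s"
| lx_Inc: "rg s r + 1 < C \<Longrightarrow> lx C x (Inc r) s 1 (s\<lparr>rg := (rg s)(r := rg s r + 1)\<rparr>)"
| lx_Dec: "0 < rg s r \<Longrightarrow> lx C x (Dec r) s 1 (s\<lparr>rg := (rg s)(r := rg s r - 1)\<rparr>)"
| lx_CatM: "lx C x (CatM d) s 1 (s\<lparr>lh := move d (lh s) (length (lc s))\<rparr>)"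
| lx_CatW: "lx C x (CatW b) s 1 (s\<lparr>lc := (lc s)[lh s := b]\<rparr>)"
| lx_InM: "lx C x (InM d) s 1 (s\<lparr>li := move d (li s) (length x + 2)\<rparr>)"
| lx_Seq: "lx C x a s t1 s1 \<Longrightarrow> lx C x b s1 t2 s2 \<Longrightarrow> lx C x (Seq a b) s (t1 + t2 + 1) s2"
| lx_IfNZT: "rg s r \<noteq> 0 \<Longrightarrow> lx C x a s t s' \<Longrightarrow> lx C x (IfNZ r a b) s (t + 1) s'"
| lx_IfNZF: "rg s r = 0 \<Longrightarrow> lx C x b s t s' \<Longrightarrow> lx C x (IfNZ r a b) s (t + 1) s'"
| lx_WhileF: "rg s r = 0 \<Longrightarrow> lx C x (While r a) s 1 s"
| lx_WhileT: "rg s r \<noteq> 0 \<Longrightarrow> lx C x a s t1 s1 \<Longrightarrow> lx C x (While r a) s1 t2 s2 \<Longrightarrow>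
    lx C x (While r a) s (t1 + t2 + 1) s2"
| lx_IfCatT: "rd (lc s) (lh s) \<Longrightarrow> lx C x a s t s' \<Longrightarrow> lx C x (IfCat a b) s (t + 1) s'"
| lx_IfCatF: "\<not> rd (lc s) (lh s) \<Longrightarrow> lx C x b s t s' \<Longrightarrow> lx C x (IfCat a b) s (t + 1) s'"
| lx_IfInN: "insym x (li s) = None \<Longrightarrow> lx C x a s t s' \<Longrightarrow> lx C x (IfIn a b c) s (t + 1) s'"
| lx_IfInF: "insym x (li s) = Some False \<Longrightarrow> lx C x b s t s' \<Longrightarrow> lx C x (IfIn a b c) s (t + 1) s'"
| lx_IfInT: "insym x (li s) = Some True \<Longrightarrow> lx C x c s t s' \<Longrightarrow> lx C x (IfIn a b c) s (t + 1) s'"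

fun nregs :: "lcom \<Rightarrow> nat" where
  "nregs (Inc r) = r + 1"
| "nregs (Dec r) = r + 1"
| "nregs (Seq a b) = max (nregs a) (nregs b)"
| "nregs (IfNZ r a b) = max (r + 1) (max (nregs a) (nregs b))"
| "nregs (While r a) = max (r + 1) (nregs a)"
| "nregs (IfCat a b) = max (nregs a) (nregs b)"
| "nregs (IfIn a b c) = max (nregs a) (max (nregs b) (nregs c))"
| "nregs _ = 0"

text \<open>The control stack holds the residual program. Registers are interleaved on the work tape in
groups of g cells: cell 0 of a group marks the left end, cell g - 1 the right end, cell r + 1 of
group p is bit p of register r. Every register operation is one pass of a two-state transducer
to the right end followed by a return to the left end.\<close>

datatype mst = Su nat | SChk | SFix | Hm "lcom list" | Rt "lcom list" nat bool | Lf "lcom list" nat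

type_synonym act = "mst \<times> dir \<times> bool \<times> dir \<times> bool \<times> dir"

text \<open>The transducer state is the carry of \<open>Inc\<close>, the borrow of
  \<open>Dec\<close> and, for the two zero tests, the disjunction of the bits read so far.\<close>

fun passf :: "lcom \<Rightarrow> bool \<Rightarrow> bool \<Rightarrow> bool \<times> bool" where
  "passf (Inc r) u b = (b \<noteq> u, u \<and> b)"
| "passf (Dec r) u b = (b \<noteq> u, u \<and> \<not> b)"
| "passf _ u b = (b, u \<or> b)"

fun mu0 :: "lcom \<Rightarrow> bool" where
  "mu0 (Inc r) = True" | "mu0 (Dec r) = True" | "mu0 _ = False"

fun preg :: "lcom \<Rightarrow> nat" where
  "preg (Inc r) = r" | "preg (Dec r) = r" | "preg (IfNZ r a b) = r" | "preg (While r a) = r"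
| "preg _ = 0"

fun cont :: "lcom list \<Rightarrow> bool \<Rightarrow> lcom list" where
  "cont (IfNZ r a b # K) u = (if u then a # K else b # K)"
| "cont (While r a # K) u = (if u then a # While r a # K else K)"
| "cont (Inc r # K) u = K"
| "cont (Dec r # K) u = K"
| "cont K u = K"

fun hm :: "lcom list \<Rightarrow> bool option \<Rightarrow> bool \<Rightarrow> bool \<Rightarrow> act" where
  "hm [] a b c = (Hm [], MvN, b, MvN, c, MvN)"
| "hm (Skip # K) a b c = (Hm K, MvN, b, MvN, c, MvN)"
| "hm (CatM d # K) a b c = (Hm K, MvN, b, MvN, c, d)"
| "hm (CatW v # K) a b c = (Hm K, MvN, b, MvN, v, MvN)"
| "hm (InM d # K) a b c = (Hm K, d, b, MvN, c, MvN)"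
| "hm (Seq p q # K) a b c = (Hm (p # q # K), MvN, b, MvN, c, MvN)"
| "hm (IfCat p q # K) a b c = (Hm ((if c then p else q) # K), MvN, b, MvN, c, MvN)"
| "hm (IfIn p q r # K) a b c =
    (Hm ((case a of None \<Rightarrow> p | Some v \<Rightarrow> if v then r else q) # K), MvN, b, MvN, c, MvN)"
| "hm (Acc # K) a b c = (Hm (Acc # K), MvN, b, MvN, c, MvN)"
| "hm (Rej # K) a b c = (Hm (Rej # K), MvN, b, MvN, c, MvN)"
| "hm (Inc r # K) a b c = (Rt (Inc r # K) 0 True, MvN, b, MvN, c, MvN)"
| "hm (Dec r # K) a b c = (Rt (Dec r # K) 0 True, MvN, b, MvN, c, MvN)"
| "hm (IfNZ r p q # K) a b c = (Rt (IfNZ r p q # K) 0 False, MvN, b, MvN, c, MvN)"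
| "hm (While r p # K) a b c = (Rt (While r p # K) 0 False, MvN, b, MvN, c, MvN)"

text \<open>The set-up writes the end markers; the right end is found because a head moving right
from the last cell stays on the mark just written.\<close>

fun dl :: "lcom \<Rightarrow> nat \<Rightarrow> mst \<Rightarrow> bool option \<Rightarrow> bool \<Rightarrow> bool \<Rightarrow> act" where
  "dl P g (Su i) a b c =
    (if i = 0 then (Su 1, MvN, True, MvR, c, MvN)
     else if i mod g = g - 1 then (SChk, MvN, True, MvR, c, MvN)
     else (Su (i mod g + 1), MvN, b, MvR, c, MvN))"
| "dl P g SChk a b c =
    (if b then (Lf [P] (g - 1), MvN, b, MvN, c, MvN) else (SFix, MvN, b, MvL, c, MvN))"
| "dl P g SFix a b c = (Su g, MvN, False, MvR, c, MvN)"
| "dl P g (Hm K) a b c = hm K a b c"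
| "dl P g (Rt K i u) a b c =
    (let (b', u') = (if i = preg (hd K) + 1 then passf (hd K) u b else (b, u)) in
     if i = g - 1 \<and> b then (Lf (cont K u) (g - 1), MvN, b, MvN, c, MvN)
     else (Rt K ((i + 1) mod g) u', MvN, b', MvR, c, MvN))"
| "dl P g (Lf K i) a b c =
    (if i = 0 \<and> b then (Hm K, MvN, b, MvN, c, MvN)
     else (Lf K (if i = 0 then g - 1 else i - 1), MvN, b, MvL, c, MvN))"

type_synonym acfg = "mst \<times> nat \<times> bool list \<times> nat \<times> bool list \<times> nat"

definition astep :: "lcom \<Rightarrow> nat \<Rightarrow> bool list \<Rightarrow> acfg \<Rightarrow> acfg" where
  "astep P g x = (\<lambda>(q, i, w, h, t, j).
    let (q', di, ww, dw, cw, dc) = dl P g q (insym x i) (rd w h) (rd t j)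
    in (q', move di i (length x + 2), w[h := ww], move dw h (length w), t[j := cw],
        move dc j (length t)))"

lemma upd_rd [simp]: "w[h := rd w h] = w"
  by (cases "h < length w") (simp_all add: rd_def list_update_beyond)

lemma rd_nth: "i < length w \<Longrightarrow> rd w i = w ! i"
  by (simp add: rd_def)

lemma upd_nth: "w ! i = b \<Longrightarrow> w[i := b] = w"
  by auto

lemma move_simps [simp]: "move MvN h n = h" "move MvL h n = h - 1"
  "move MvR h n = min (h + 1) (n - 1)"
  by (simp_all add: move_def)

section \<open>Finiteness of the set of control stacks\<close>

fun stk :: "lcom \<Rightarrow> lcom list \<Rightarrow> lcom list set" where
  "stk (Seq a b) K = insert (Seq a b # K) (stk a (b # K) \<union> stk b K)"
| "stk (IfNZ r a b) K = insert (IfNZ r a b # K) (stk a K \<union> stk b K)"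
| "stk (While r a) K = insert (While r a # K) (stk a (While r a # K))"
| "stk (IfCat a b) K = insert (IfCat a b # K) (stk a K \<union> stk b K)"
| "stk (IfIn a b c) K = insert (IfIn a b c # K) (stk a K \<union> stk b K \<union> stk c K)"
| "stk p K = {p # K}"

fun succs :: "lcom list \<Rightarrow> lcom list set" where
  "succs (Seq a b # K) = {a # b # K}"
| "succs (IfNZ r a b # K) = {a # K, b # K}"
| "succs (While r a # K) = {a # While r a # K, K}"
| "succs (IfCat a b # K) = {a # K, b # K}"
| "succs (IfIn a b c # K) = {a # K, b # K, c # K}"
| "succs (Acc # K) = {}"
| "succs (Rej # K) = {}"
| "succs (p # K) = {K}"
| "succs [] = {}"

lemma finite_stk: "finite (stk p K)"
  by (induction p K rule: stk.induct) auto

lemma funpow_one: "f ^^ 1 = f" for f :: "'a \<Rightarrow> 'a"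
  by (simp add: fun_eq_iff)

lemma stk_self: "p # K \<in> stk p K"
  by (cases p) auto

text \<open>The body of a \<open>While\<close> runs on top of the \<open>While\<close> itself, so
  looping returns to an old stack instead of building a deeper one.\<close>

lemma stk_closed: "s \<in> stk p K \<Longrightarrow> succs s \<subseteq> insert K (stk p K)"
proof (induction p K arbitrary: s rule: stk.induct)
  case (1 a b K)
  then show ?case using stk_self[of a "b # K"] stk_self[of b K] by fastforce
next
  case (2 r a b K)
  then show ?case using stk_self[of a K] stk_self[of b K] by fastforce
next
  case (3 r a K)
  then show ?case using stk_self[of a "While r a # K"] by fastforce
next
  case (4 a b K)
  then show ?case using stk_self[of a K] stk_self[of b K] by fastforce
next
  case (5 a b c K)
  then show ?case using stk_self[of a K] stk_self[of b K] stk_self[of c K] by fastforce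
qed auto

definition stacks :: "lcom \<Rightarrow> lcom list set" where
  "stacks P = stk P [] \<union> {[], [Acc], [Rej]}"

lemma stacks_closed: "K \<in> stacks P \<Longrightarrow> succs K \<subseteq> stacks P"
  using stk_closed[of K P "[]"] by (auto simp: stacks_def)

definition states :: "lcom \<Rightarrow> nat \<Rightarrow> mst set" where
  "states P g = Su ` {..g} \<union> {SChk, SFix} \<union> Hm ` stacks P
     \<union> (\<lambda>(K, i, u). Rt K i u) ` (stacks P \<times> {..<g} \<times> UNIV)
     \<union> (\<lambda>(K, i). Lf K i) ` (stacks P \<times> {..<g})"

lemma finite_states: "finite (states P g)"
  by (simp add: states_def stacks_def finite_stk)

lemma states_iff: "q \<in> states P g \<longleftrightarrow> (case q of Su i \<Rightarrow> i \<le> g | SChk \<Rightarrow> True | SFix \<Rightarrow> True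
    | Hm K \<Rightarrow> K \<in> stacks P | Rt K i u \<Rightarrow> K \<in> stacks P \<and> i < g | Lf K i \<Rightarrow> K \<in> stacks P \<and> i < g)"
  by (cases q) (force simp: states_def image_iff)+

lemma cont_stacks: "K \<in> stacks P \<Longrightarrow> cont K u \<in> stacks P"
  using stacks_closed[of K P] by (cases "(K, u)" rule: cont.cases) auto

lemma hm_states: "K \<in> stacks P \<Longrightarrow> 0 < g \<Longrightarrow> fst (hm K a b c) \<in> states P g"
  using stacks_closed[of K P]
  by (cases "(K, a, b, c)" rule: hm.cases) (auto simp: states_iff split: option.splits)

lemma dl_states:
  assumes "q \<in> states P g" "2 \<le> g"
  shows "fst (dl P g q a b c) \<in> states P g"
proof -
  have P: "[P] \<in> stacks P" by (simp add: stacks_def stk_self)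
  have g: "i mod g < g" for i using assms(2) by simp
  show ?thesis
  proof (cases q)
    case (Su i)
    have "i mod g + 1 \<le> g" using g[of i] by linarith
    then show ?thesis using Su assms(2) by (auto simp: states_iff)
  next
    case (Hm K)
    then show ?thesis using assms hm_states[of K P g a b c] by (auto simp: states_iff)
  next
    case (Rt K i u)
    then show ?thesis using assms cont_stacks[of K P] g
      by (auto simp: states_iff Let_def split: prod.splits)
  next
    case (Lf K i)
    then show ?thesis using assms by (auto simp: states_iff)
  qed (use assms P in \<open>auto simp: states_iff\<close>)
qed

definition num :: "lcom \<Rightarrow> nat \<Rightarrow> mst \<Rightarrow> nat" where
  "num P g = (SOME f. bij_betw f (states P g) {0..<card (states P g)})"

lemma num_bij: "bij_betw (num P g) (states P g) {0..<card (states P g)}"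
  unfolding num_def using ex_bij_betw_finite_nat[OF finite_states] by (rule someI_ex)

definition tm_of :: "lcom \<Rightarrow> nat \<Rightarrow> cmachine" where
  "tm_of P g = \<lparr> nst = card (states P g), q0 = num P g (Su 0), qacc = num P g (Hm [Acc]),
     qrej = num P g (Hm [Rej]),
     delta = (\<lambda>q a b c r. let (q', di, ww, dw, cw, dc) =
        dl P g (inv_into (states P g) (num P g) q) a b c in (num P g q', di, ww, dw, cw, dc, False)) \<rparr>"

lemma special_states: "Su 0 \<in> states P g" "Hm [Acc] \<in> states P g" "Hm [Rej] \<in> states P g"
  by (auto simp: states_iff stacks_def)

lemma num_less: "q \<in> states P g \<Longrightarrow> num P g q < card (states P g)"
  using num_bij[of P g] by (auto simp: bij_betw_def)

lemma num_inj: "q \<in> states P g \<Longrightarrow> q' \<in> states P g \<Longrightarrow> num P g q = num P g q' \<longleftrightarrow> q = q'"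
  using num_bij[of P g] by (auto simp: bij_betw_def inj_on_def)

lemma num_inv: "q \<in> states P g \<Longrightarrow> inv_into (states P g) (num P g) (num P g q) = q"
  using num_bij[of P g] by (simp add: bij_betw_def)

lemma wf_tm_of: assumes "2 \<le> g" shows "wf_machine (tm_of P g)"
proof -
  have "fst (delta (tm_of P g) q a b c r) < nst (tm_of P g)" if "q < nst (tm_of P g)" for q a b c r
  proof -
    have "q \<in> num P g ` states P g"
      using that num_bij[of P g] by (simp add: tm_of_def bij_betw_def)
    then obtain p where p: "p \<in> states P g" "q = num P g p" by auto
    show ?thesis using dl_states[OF p(1) assms, of a b c] p
      by (auto simp: tm_of_def num_inv num_less split: prod.splits)
  qed
  then show ?thesis
    using special_states[of P g] by (auto simp: wf_machine_def num_less num_inj tm_of_def)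
qed

definition cfg :: "lcom \<Rightarrow> nat \<Rightarrow> acfg \<Rightarrow> config" where
  "cfg P g = (\<lambda>(q, i, w, h, t, j). \<lparr> st = num P g q, ih = i, wt = w, wh = h, ct = t, ch = j, rh = 0 \<rparr>)"

text \<open>\<open>step\<close> freezes halted configurations by definition, whereas
  \<open>astep\<close> has no such clause; the two agree because \<open>dl\<close> itself stays put
  in \<open>Hm [Acc]\<close> and \<open>Hm [Rej]\<close>, the only states numbered as
  halting.\<close>

lemma step_cfg:
  assumes "fst a \<in> states P g" "2 \<le> g"
  shows "step (tm_of P g) x r (cfg P g a) = cfg P g (astep P g x a) \<and> fst (astep P g x a) \<in> states P g"
proof -
  obtain q i w h t j where a: "a = (q, i, w, h, t, j)" by (cases a) auto
  have q: "q \<in> states P g" using assms a by simp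
  have ns: "fst (astep P g x a) \<in> states P g"
    using dl_states[OF q assms(2), of "insym x i" "rd w h" "rd t j"]
    by (auto simp: astep_def a Let_def split: prod.splits)
  have halt: "halted (tm_of P g) (cfg P g a) \<longleftrightarrow> q = Hm [Acc] \<or> q = Hm [Rej]"
    using q special_states[of P g] by (auto simp: halted_def a cfg_def tm_of_def num_inj)
  show ?thesis
  proof (cases "halted (tm_of P g) (cfg P g a)")
    case True
    then have "astep P g x a = a" using halt by (auto simp: astep_def a)
    then show ?thesis using True ns by (simp add: step_def)
  next
    case False
    obtain q' di ww dw cw dc where d: "dl P g q (insym x i) (rd w h) (rd t j) = (q', di, ww, dw, cw, dc)"
      by (metis prod.exhaust)
    show ?thesis
    proof (cases "1 \<le> i \<and> i \<le> length x")
      case True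
      then have "insym x i = Some (x ! (i - 1))" by (simp add: insym_def)
      then show ?thesis using False ns q d True
        by (simp add: step_def Let_def astep_def a cfg_def tm_of_def num_inv)
    next
      case nin: False
      then have "insym x i = None" by (auto simp: insym_def)
      then show ?thesis using False ns q d nin
        by (auto simp: step_def Let_def astep_def a cfg_def tm_of_def num_inv)
    qed
  qed
qed

lemma steps_cfg:
  assumes "fst a \<in> states P g" "2 \<le> g"
  shows "(step (tm_of P g) x r ^^ n) (cfg P g a) = cfg P g ((astep P g x ^^ n) a)
    \<and> fst ((astep P g x ^^ n) a) \<in> states P g"
  using assms by (induction n) (auto simp: step_cfg)


section \<open>Passes over the work tape\<close>

lemma right_pass:
  assumes g: "2 \<le> g" "g dvd L" "0 < L" and len: "length w = L" "length w' = L"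
    and r: "preg p + 1 < g - 1"
    and mark: "\<And>i. i < L \<Longrightarrow> i mod g = g - 1 \<Longrightarrow> w ! i \<longleftrightarrow> i = L - 1"
    and u0: "u 0 = v"
    and at: "\<And>i. i < L \<Longrightarrow> i mod g = preg p + 1 \<Longrightarrow> (w' ! i, u (Suc i)) = passf p (u i) (w ! i)"
    and off: "\<And>i. i < L \<Longrightarrow> i mod g \<noteq> preg p + 1 \<Longrightarrow> w' ! i = w ! i \<and> u (Suc i) = u i"
    and n: "n \<le> L - 1"
  shows "(astep P g x ^^ n) (Rt (p # K) 0 v, i, w, 0, t, j) =
    (Rt (p # K) (n mod g) (u n), i, take n w' @ drop n w, n, t, j)"
  using n
proof (induction n)
  case 0
  then show ?case using g u0 by simp
next
  case (Suc n)
  then have n: "n < L - 1" "n < L" by auto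
  let ?w = "take n w' @ drop n w"
  have len': "length ?w = L" using n len by simp
  have wn: "rd ?w n = w ! n" using n len by (simp add: rd_def nth_append)
  have upd: "?w[n := w' ! n] = take (Suc n) w' @ drop (Suc n) w"
    using n len by (simp add: list_update_append take_Suc_conv_app_nth Cons_nth_drop_Suc[symmetric])
  \<comment> \<open>The head is still left of the last cell, so no end mark can stop the pass
    here.\<close>
  have nomark: "\<not> (n mod g = g - 1 \<and> w ! n)" using mark[of n] n by auto
  have md: "(n mod g + 1) mod g = Suc n mod g" by (simp add: mod_Suc_eq)
  have "astep P g x (Rt (p # K) (n mod g) (u n), i, ?w, n, t, j) =
    (Rt (p # K) (Suc n mod g) (u (Suc n)), i, take (Suc n) w' @ drop (Suc n) w, Suc n, t, j)"
  proof (cases "n mod g = preg p + 1")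
    case True
    then show ?thesis using at[of n, symmetric] n wn nomark upd len' md
      by (auto simp: astep_def)
  next
    case False
    then show ?thesis using off[of n] n wn nomark upd len' md
      by (auto simp: astep_def)
  qed
  then show ?case using Suc n by simp
qed

lemma left_pass:
  assumes g: "2 \<le> g" "g dvd L" "0 < L" and len: "length w = L"
    and mark: "\<And>i. i < L \<Longrightarrow> i mod g = 0 \<Longrightarrow> w ! i \<longleftrightarrow> i = 0"
    and n: "n < L"
  shows "(astep P g x ^^ Suc n) (Lf K (n mod g), i, w, n, t, j) = (Hm K, i, w, 0, t, j)"
  using n
proof (induction n)
  case 0
  then show ?case using mark[of 0] len g by (simp add: astep_def rd_nth upd_nth)
next
  case (Suc n)
  have "\<not> (Suc n mod g = 0 \<and> w ! Suc n)" using mark[of "Suc n"] Suc.prems by auto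
  moreover have "(if Suc n mod g = 0 then g - 1 else Suc n mod g - 1) = n mod g"
    using g by (auto simp: mod_Suc split: if_splits)
  ultimately have "astep P g x (Lf K (Suc n mod g), i, w, Suc n, t, j) = (Lf K (n mod g), i, w, n, t, j)"
    using len Suc.prems by (auto simp: astep_def rd_nth upd_nth)
  then show ?case using Suc by (simp only: funpow_Suc_right o_apply)
qed

lemma last_mod: "2 \<le> g \<Longrightarrow> g dvd L \<Longrightarrow> 0 < L \<Longrightarrow> (L - 1) mod g = g - (1::nat)"
  by (metis Suc_diff_1 Suc_1 diff_Suc_1 dvd_imp_mod_0 less_le_trans mod_Suc nat.simps(3) zero_less_Suc)

lemma full_pass:
  assumes g: "2 \<le> g" "g dvd L" "0 < L" and len: "length w = L" "length w' = L"
    and r: "preg p + 1 < g - 1"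
    and hm: "\<And>a b c. hm (p # K) a b c = (Rt (p # K) 0 v, MvN, b, MvN, c, MvN)"
    and mark: "\<And>i. i < L \<Longrightarrow> i mod g = g - 1 \<Longrightarrow> w ! i \<longleftrightarrow> i = L - 1"
    and mark0: "\<And>i. i < L \<Longrightarrow> i mod g = 0 \<Longrightarrow> w ! i \<longleftrightarrow> i = 0"
    and u0: "u 0 = v"
    and at: "\<And>i. i < L \<Longrightarrow> i mod g = preg p + 1 \<Longrightarrow> (w' ! i, u (Suc i)) = passf p (u i) (w ! i)"
    and off: "\<And>i. i < L \<Longrightarrow> i mod g \<noteq> preg p + 1 \<Longrightarrow> w' ! i = w ! i \<and> u (Suc i) = u i"
  shows "(astep P g x ^^ (2 * L + 1)) (Hm (p # K), i, w, 0, t, j) = (Hm (cont (p # K) (u L)), i, w', 0, t, j)"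
proof -
  let ?f = "astep P g x"
  have lm: "(L - 1) mod g = g - 1" using last_mod g by blast
  have uL: "u L = u (L - 1)" "w' ! (L - 1) = w ! (L - 1)" using off[of "L - 1"] g lm r by auto
  have w': "take (L - 1) w' @ drop (L - 1) w = w'"
  proof -
    have "drop (L - 1) w = drop (L - 1) w'"
      using g len uL by (simp add: Cons_nth_drop_Suc[symmetric])
    then show ?thesis by simp
  qed
  have 1: "?f (Hm (p # K), i, w, 0, t, j) = (Rt (p # K) 0 v, i, w, 0, t, j)"
    by (simp add: astep_def hm)
  have 2: "(?f ^^ (L - 1)) (Rt (p # K) 0 v, i, w, 0, t, j) = (Rt (p # K) (g - 1) (u (L - 1)), i, w', L - 1, t, j)"
    using right_pass[OF g len r mark u0 at off, of "L - 1"] lm w' by simp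
  have 3: "?f (Rt (p # K) (g - 1) (u (L - 1)), i, w', L - 1, t, j) =
    (Lf (cont (p # K) (u L)) (g - 1), i, w', L - 1, t, j)"
    using mark[of "L - 1"] lm uL g len r by (simp add: astep_def rd_nth upd_nth)
  have 4: "(?f ^^ L) (Lf (cont (p # K) (u L)) (g - 1), i, w', L - 1, t, j) = (Hm (cont (p # K) (u L)), i, w', 0, t, j)"
  proof -
    have "w' ! i \<longleftrightarrow> i = 0" if "i < L" "i mod g = 0" for i using that mark0 off by auto
    then show ?thesis using left_pass[OF g len(2), of "L - 1" P x] lm g by simp
  qed
  \<comment> \<open>One step to leave home, L - 1 to reach the last cell, one to turn and L to
    return, the last of them recognising the left mark.\<close>
  have "2 * L + 1 = L + (1 + ((L - 1) + 1))" using g by simp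
  then show ?thesis using 1 2 3 4 by (simp only: funpow_add o_apply funpow_one)
qed

section \<open>Registers in binary\<close>

definition wtape :: "nat \<Rightarrow> nat \<Rightarrow> (nat \<Rightarrow> nat) \<Rightarrow> bool list" where
  "wtape g L R = map (\<lambda>i. if i mod g = 0 then i = 0 else if i mod g = g - 1 then i = L - 1
      else odd (R (i mod g - 1) div 2 ^ (i div g))) [0..<L]"

lemma length_wtape [simp]: "length (wtape g L R) = L"
  by (simp add: wtape_def)

lemma mod_pow_Suc: "v mod 2 ^ Suc p = v mod 2 ^ p + (if odd (v div 2 ^ p) then 2 ^ p else 0)" for v :: nat
  by (simp add: mod_mult2_eq mult.commute[of 2] odd_iff_mod_2_eq_one)

lemma div_pow_Suc: "Suc v div 2 ^ p = v div 2 ^ p + (if Suc (v mod 2 ^ p) = 2 ^ p then 1 else 0)" for v :: nat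
  by (auto simp: div_Suc mod_Suc)

text \<open>The carry into bit p when v is incremented: all lower bits are 1.\<close>

definition inc_carry :: "nat \<Rightarrow> nat \<Rightarrow> bool" where
  "inc_carry v p \<longleftrightarrow> Suc (v mod 2 ^ p) = 2 ^ p"

lemma inc_carry_Suc: "inc_carry v (Suc p) \<longleftrightarrow> inc_carry v p \<and> odd (v div 2 ^ p)"
proof -
  have lt: "v mod 2 ^ p < 2 ^ p" by simp
  then have "Suc (v mod 2 ^ p) \<noteq> 2 * 2 ^ p" by linarith
  then show ?thesis unfolding inc_carry_def mod_pow_Suc
    by (cases "odd (v div 2 ^ p)") auto
qed

lemma inc_bit: "odd (Suc v div 2 ^ p) \<longleftrightarrow> odd (v div 2 ^ p) \<noteq> inc_carry v p"
  unfolding inc_carry_def div_pow_Suc by auto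

text \<open>\<open>Suc v mod 2 ^ p = 0\<close> is the borrow into bit p when \<open>Suc v\<close> is
  decremented: all lower bits are 0.\<close>

lemma dec_borrow_Suc: "Suc v mod 2 ^ Suc p = 0 \<longleftrightarrow> Suc v mod 2 ^ p = 0 \<and> \<not> odd (Suc v div 2 ^ p)"
  unfolding mod_pow_Suc by auto

lemma dec_bit: "odd (v div 2 ^ p) \<longleftrightarrow> odd (Suc v div 2 ^ p) \<noteq> (Suc v mod 2 ^ p = 0)"
  unfolding div_pow_Suc by (auto simp: mod_Suc split: if_splits)

text \<open>The number of cells of register r strictly left of cell i.\<close>

definition cnt :: "nat \<Rightarrow> nat \<Rightarrow> nat \<Rightarrow> nat" where
  "cnt g r i = i div g + (if r + 1 < i mod g then 1 else 0)"

lemma cnt_Suc: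
  assumes "2 \<le> g" "r + 1 < g - 1"
  shows "cnt g r (Suc i) = cnt g r i + (if i mod g = r + 1 then 1 else 0)"
  using assms by (auto simp: cnt_def div_Suc mod_Suc)

text \<open>All register operations reduce to identities about single bits: \<open>U q\<close> is
  the transducer state after q bits of the register, and a head at cell i has passed
  \<open>cnt g r i\<close> of them. The operations differ only in the choice of
  \<open>U\<close>.\<close>

lemma wtape_pass:
  assumes g: "2 \<le> g" "g dvd L" "0 < L" and r: "preg p < g - 2"
    and hm: "\<And>a b c. hm (p # K) a b c = (Rt (p # K) 0 (U 0), MvN, b, MvN, c, MvN)"
    and R: "\<And>r. r \<noteq> preg p \<Longrightarrow> R' r = R r"
    and bit: "\<And>q. (odd (R' (preg p) div 2 ^ q), U (Suc q)) = passf p (U q) (odd (R (preg p) div 2 ^ q))"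
  shows "(astep P g x ^^ (2 * L + 1)) (Hm (p # K), i, wtape g L R, 0, t, j)
    = (Hm (cont (p # K) (U (L div g))), i, wtape g L R', 0, t, j)"
proof -
  let ?u = "\<lambda>i. U (cnt g (preg p) i)"
  have r': "preg p + 1 < g - 1" using r g by linarith
  have c0: "cnt g (preg p) 0 = 0" using g by (simp add: cnt_def)
  have cL: "cnt g (preg p) L = L div g" using g by (simp add: cnt_def)
  have "(astep P g x ^^ (2 * L + 1)) (Hm (p # K), i, wtape g L R, 0, t, j)
    = (Hm (cont (p # K) (?u L)), i, wtape g L R', 0, t, j)"
  proof (rule full_pass[OF g _ _ r' hm])
    show "(wtape g L R' ! i, ?u (Suc i)) = passf p (?u i) (wtape g L R ! i)"
      if i: "i < L" "i mod g = preg p + 1" for i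
    proof -
      have c: "cnt g (preg p) i = i div g" "cnt g (preg p) (Suc i) = Suc (i div g)"
        using i cnt_Suc[OF g(1) r'] by (auto simp: cnt_def)
      show ?thesis unfolding c using i bit[of "i div g"] r' by (simp add: wtape_def)
    qed
    show "wtape g L R' ! i = wtape g L R ! i \<and> ?u (Suc i) = ?u i"
      if i: "i < L" "i mod g \<noteq> preg p + 1" for i
      using i cnt_Suc[OF g(1) r', of i] R[of "i mod g - 1"] by (auto simp: wtape_def)
  qed (use g c0 in \<open>auto simp: wtape_def\<close>)
  then show ?thesis by (simp only: cL)
qed


definition enc :: "nat \<Rightarrow> nat \<Rightarrow> lcom list \<Rightarrow> lst \<Rightarrow> acfg" where
  "enc g L K s = (Hm K, li s, wtape g L (rg s), 0, lc s, lh s)"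

lemma inc_pass:
  assumes "2 \<le> g" "g dvd L" "0 < L" "r < g - 2"
  shows "(astep P g x ^^ (2 * L + 1)) (enc g L (Inc r # K) s)
    = enc g L K (s\<lparr>rg := (rg s)(r := rg s r + 1)\<rparr>)"
  using wtape_pass[of g L "Inc r" K "inc_carry (rg s r)" "(rg s)(r := rg s r + 1)" "rg s"] assms
  by (simp add: enc_def inc_bit inc_carry_Suc) (auto simp: inc_carry_def)

lemma dec_pass:
  assumes "2 \<le> g" "g dvd L" "0 < L" "r < g - 2" "0 < rg s r"
  shows "(astep P g x ^^ (2 * L + 1)) (enc g L (Dec r # K) s)
    = enc g L K (s\<lparr>rg := (rg s)(r := rg s r - 1)\<rparr>)"
proof -
  obtain v where v: "rg s r = Suc v" using assms by (cases "rg s r") auto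
  have b: "(odd (v div 2 ^ q), Suc v mod 2 ^ Suc q = 0) =
    passf (Dec r) (Suc v mod 2 ^ q = 0) (odd (Suc v div 2 ^ q))" for q
    using dec_bit[of v q] dec_borrow_Suc[of v q] by simp
  show ?thesis
    using wtape_pass[of g L "Dec r" K "\<lambda>p. Suc v mod 2 ^ p = 0" "(rg s)(r := v)" "rg s" P x "li s" "lc s" "lh s"]
      assms v b by (simp add: enc_def)
qed

text \<open>After q bits the transducer knows whether v mod 2^q is nonzero. The test is conclusive
  at the end because the register is below 2^W.\<close>

lemma nz_pass:
  assumes "2 \<le> g" "L = g * W" "0 < W" "preg p < g - 2" "rg s (preg p) < 2 ^ W"
    "p = IfNZ r a b \<or> p = While r a"
  shows "(astep P g x ^^ (2 * L + 1)) (enc g L (p # K) s) = enc g L (cont (p # K) (rg s (preg p) \<noteq> 0)) s"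
proof -
  have b: "(odd (v div 2 ^ q), v mod 2 ^ Suc q \<noteq> 0) = passf p (v mod 2 ^ q \<noteq> 0) (odd (v div 2 ^ q))" for q and v :: nat
    using mod_pow_Suc[of v q] assms(6) by auto
  have "L div g = W" using assms by simp
  moreover have "rg s (preg p) mod 2 ^ W = rg s (preg p)" using assms by simp
  ultimately show ?thesis
    using wtape_pass[of g L p K "\<lambda>q. rg s (preg p) mod 2 ^ q \<noteq> 0" "rg s" "rg s" P x "li s" "lc s" "lh s"]
      assms b by (auto simp: enc_def)
qed

text \<open>Every step of the program costs at most one full pass. The register bound has to be
  carried along, since the zero test is faithful only below \<open>2 ^ W\<close>.\<close>

lemma lx_sim:
  assumes "lx (2 ^ W) x p s t s'" "2 \<le> g" "L = g * W" "0 < W" "nregs p \<le> g - 2"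
    "\<forall>r<g - 2. rg s r < 2 ^ W"
  shows "(\<forall>r<g - 2. rg s' r < 2 ^ W) \<and>
    (\<exists>n \<le> t * (2 * L + 1). (astep P g x ^^ n) (enc g L (p # K) s) = enc g L K s')"
  using assms
proof (induction arbitrary: K rule: lx.induct)
  case (lx_Skip s)
  then show ?case by (intro conjI exI[of _ 1]) (auto simp: enc_def astep_def)
next
  case (lx_Inc s r)
  then show ?case using inc_pass[of g L r P x K s] by (intro conjI exI[of _ "2 * L + 1"]) auto
next
  case (lx_Dec s r)
  then show ?case using dec_pass[of g L r s P x K] by (intro conjI exI[of _ "2 * L + 1"]) (auto intro: less_imp_diff_less)
next
  case (lx_CatM d s)
  then show ?case by (intro conjI exI[of _ 1]) (auto simp: enc_def astep_def)
next
  case (lx_CatW b s)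
  then show ?case by (intro conjI exI[of _ 1]) (auto simp: enc_def astep_def)
next
  case (lx_InM d s)
  then show ?case by (intro conjI exI[of _ 1]) (auto simp: enc_def astep_def)
next
  case (lx_Seq a s t1 s1 b t2 s2)
  have s1: "\<forall>r<g - 2. rg s1 r < 2 ^ W" using lx_Seq by simp
  obtain n1 where n1: "n1 \<le> t1 * (2 * L + 1)" "(astep P g x ^^ n1) (enc g L (a # b # K) s) = enc g L (b # K) s1"
    using lx_Seq.IH(1)[of "b # K"] lx_Seq.prems by auto
  obtain n2 where n2: "n2 \<le> t2 * (2 * L + 1)" "(astep P g x ^^ n2) (enc g L (b # K) s1) = enc g L K s2"
    using lx_Seq.IH(2)[of K] lx_Seq.prems s1 by auto
  have "astep P g x (enc g L (Seq a b # K) s) = enc g L (a # b # K) s" by (simp add: enc_def astep_def)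
  then have "(astep P g x ^^ (n2 + (n1 + 1))) (enc g L (Seq a b # K) s) = enc g L K s2"
    using n1 n2 by (simp only: funpow_add o_apply funpow_one)
  then show ?case using n1 n2 lx_Seq.IH(2)[of K] lx_Seq.prems s1
    by (intro conjI exI[of _ "n2 + (n1 + 1)"]) (auto simp: algebra_simps)
next
  case (lx_IfNZT s r a t s' b)
  obtain n where n: "n \<le> t * (2 * L + 1)" "(astep P g x ^^ n) (enc g L (a # K) s) = enc g L K s'"
    using lx_IfNZT.IH[of K] lx_IfNZT.prems by auto
  have "(astep P g x ^^ (2 * L + 1)) (enc g L (IfNZ r a b # K) s) = enc g L (a # K) s"
    using nz_pass[of g L W "IfNZ r a b" s r a b P x K] lx_IfNZT by simp
  then have "(astep P g x ^^ (n + (2 * L + 1))) (enc g L (IfNZ r a b # K) s) = enc g L K s'"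
    using n by (simp only: funpow_add o_apply)
  then show ?case using n lx_IfNZT.IH[of K] lx_IfNZT.prems
    by (intro conjI exI[of _ "n + (2 * L + 1)"]) (auto simp: algebra_simps)
next
  case (lx_IfNZF s r b t s' a)
  obtain n where n: "n \<le> t * (2 * L + 1)" "(astep P g x ^^ n) (enc g L (b # K) s) = enc g L K s'"
    using lx_IfNZF.IH[of K] lx_IfNZF.prems by auto
  have "(astep P g x ^^ (2 * L + 1)) (enc g L (IfNZ r a b # K) s) = enc g L (b # K) s"
    using nz_pass[of g L W "IfNZ r a b" s r a b P x K] lx_IfNZF by simp
  then have "(astep P g x ^^ (n + (2 * L + 1))) (enc g L (IfNZ r a b # K) s) = enc g L K s'"
    using n by (simp only: funpow_add o_apply)
  then show ?case using n lx_IfNZF.IH[of K] lx_IfNZF.prems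
    by (intro conjI exI[of _ "n + (2 * L + 1)"]) (auto simp: algebra_simps)
next
  case (lx_WhileF s r a)
  have "(astep P g x ^^ (2 * L + 1)) (enc g L (While r a # K) s) = enc g L K s"
    using nz_pass[of g L W "While r a" s r a _ P x K] lx_WhileF by simp
  then show ?case using lx_WhileF by (intro conjI exI[of _ "2 * L + 1"]) auto
next
  case (lx_WhileT s r a t1 s1 t2 s2)
  have s1: "\<forall>r<g - 2. rg s1 r < 2 ^ W" using lx_WhileT by simp
  obtain n1 where n1: "n1 \<le> t1 * (2 * L + 1)"
    "(astep P g x ^^ n1) (enc g L (a # While r a # K) s) = enc g L (While r a # K) s1"
    using lx_WhileT.IH(1)[of "While r a # K"] lx_WhileT.prems by auto
  obtain n2 where n2: "n2 \<le> t2 * (2 * L + 1)" "(astep P g x ^^ n2) (enc g L (While r a # K) s1) = enc g L K s2"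
    using lx_WhileT.IH(2)[of K] lx_WhileT.prems s1 by auto
  have "(astep P g x ^^ (2 * L + 1)) (enc g L (While r a # K) s) = enc g L (a # While r a # K) s"
    using nz_pass[of g L W "While r a" s r a _ P x K] lx_WhileT by simp
  then have "(astep P g x ^^ (n2 + (n1 + (2 * L + 1)))) (enc g L (While r a # K) s) = enc g L K s2"
    using n1 n2 by (simp only: funpow_add o_apply)
  then show ?case using n1 n2 lx_WhileT.IH(2)[of K] lx_WhileT.prems s1
    by (intro conjI exI[of _ "n2 + (n1 + (2 * L + 1))"]) (auto simp: algebra_simps)
next
  case (lx_IfCatT s a t s' b)
  obtain n where n: "n \<le> t * (2 * L + 1)" "(astep P g x ^^ n) (enc g L (a # K) s) = enc g L K s'"
    using lx_IfCatT.IH[of K] lx_IfCatT.prems by auto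
  have "astep P g x (enc g L (IfCat a b # K) s) = enc g L (a # K) s"
    using lx_IfCatT upd_rd[of "lc s" "lh s"] by (simp add: enc_def astep_def)
  then have "(astep P g x ^^ (n + 1)) (enc g L (IfCat a b # K) s) = enc g L K s'"
    using n by (simp only: funpow_add o_apply funpow_one)
  then show ?case using n lx_IfCatT.IH[of K] lx_IfCatT.prems
    by (intro conjI exI[of _ "n + 1"]) (auto simp: algebra_simps)
next
  case (lx_IfCatF s b t s' a)
  obtain n where n: "n \<le> t * (2 * L + 1)" "(astep P g x ^^ n) (enc g L (b # K) s) = enc g L K s'"
    using lx_IfCatF.IH[of K] lx_IfCatF.prems by auto
  have "astep P g x (enc g L (IfCat a b # K) s) = enc g L (b # K) s"
    using lx_IfCatF upd_rd[of "lc s" "lh s"] by (simp add: enc_def astep_def)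
  then have "(astep P g x ^^ (n + 1)) (enc g L (IfCat a b # K) s) = enc g L K s'"
    using n by (simp only: funpow_add o_apply funpow_one)
  then show ?case using n lx_IfCatF.IH[of K] lx_IfCatF.prems
    by (intro conjI exI[of _ "n + 1"]) (auto simp: algebra_simps)
next
  case (lx_IfInN s a t s' b c)
  obtain n where n: "n \<le> t * (2 * L + 1)" "(astep P g x ^^ n) (enc g L (a # K) s) = enc g L K s'"
    using lx_IfInN.IH[of K] lx_IfInN.prems by auto
  have "astep P g x (enc g L (IfIn a b c # K) s) = enc g L (a # K) s"
    using lx_IfInN by (simp add: enc_def astep_def)
  then have "(astep P g x ^^ (n + 1)) (enc g L (IfIn a b c # K) s) = enc g L K s'"
    using n by (simp only: funpow_add o_apply funpow_one)
  then show ?case using n lx_IfInN.IH[of K] lx_IfInN.prems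
    by (intro conjI exI[of _ "n + 1"]) (auto simp: algebra_simps)
next
  case (lx_IfInF s b t s' a c)
  obtain n where n: "n \<le> t * (2 * L + 1)" "(astep P g x ^^ n) (enc g L (b # K) s) = enc g L K s'"
    using lx_IfInF.IH[of K] lx_IfInF.prems by auto
  have "astep P g x (enc g L (IfIn a b c # K) s) = enc g L (b # K) s"
    using lx_IfInF by (simp add: enc_def astep_def)
  then have "(astep P g x ^^ (n + 1)) (enc g L (IfIn a b c # K) s) = enc g L K s'"
    using n by (simp only: funpow_add o_apply funpow_one)
  then show ?case using n lx_IfInF.IH[of K] lx_IfInF.prems
    by (intro conjI exI[of _ "n + 1"]) (auto simp: algebra_simps)
next
  case (lx_IfInT s c t s' a b)
  obtain n where n: "n \<le> t * (2 * L + 1)" "(astep P g x ^^ n) (enc g L (c # K) s) = enc g L K s'"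
    using lx_IfInT.IH[of K] lx_IfInT.prems by auto
  have "astep P g x (enc g L (IfIn a b c # K) s) = enc g L (c # K) s"
    using lx_IfInT by (simp add: enc_def astep_def)
  then have "(astep P g x ^^ (n + 1)) (enc g L (IfIn a b c # K) s) = enc g L K s'"
    using n by (simp only: funpow_add o_apply funpow_one)
  then show ?case using n lx_IfInT.IH[of K] lx_IfInT.prems
    by (intro conjI exI[of _ "n + 1"]) (auto simp: algebra_simps)
qed

section \<open>Setting up the work tape\<close>

lemma setup_walk:
  fixes g L :: nat
  assumes g: "3 \<le> g" "g dvd L" "0 < L" and h: "1 \<le> h" "h < L"
  shows "\<exists>n q. n \<le> 3 * h \<and> 0 < q \<and> q mod g = h mod g \<and>
    (astep P g x ^^ n) (Su 0, 0, replicate L False, 0, t, 0) = (Su q, 0, (replicate L False)[0 := True], h, t, 0)"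
  using h
proof (induction h rule: nat_induct_at_least)
  case base
  have "astep P g x (Su 0, 0, replicate L False, 0, t, 0) = (Su 1, 0, (replicate L False)[0 := True], 1, t, 0)"
    using base by (simp add: astep_def)
  then show ?case by (intro exI[of _ 1] exI[of _ "1::nat"]) auto
next
  case (Suc h)
  let ?w = "(replicate L False)[0 := True]"
  obtain n q where n: "n \<le> 3 * h" "0 < q" "q mod g = h mod g"
    "(astep P g x ^^ n) (Su 0, 0, replicate L False, 0, t, 0) = (Su q, 0, ?w, h, t, 0)"
    using Suc by auto
  have wF: "rd ?w i = False" if "0 < i" for i using that by (simp add: rd_def)
  show ?case
  \<comment> \<open>At the end of a group the mark is written, the next cell is found unmarked, and
    the mark is erased: three steps. Afterwards the counter shows g rather than 0, because 0 is
    reserved for the leftmost cell.\<close>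
  proof (cases "h mod g = g - 1")
    case True
    have "(astep P g x ^^ 3) (Su q, 0, ?w, h, t, 0) = (Su g, 0, ?w, Suc h, t, 0)"
    proof -
      have 1: "astep P g x (Su q, 0, ?w, h, t, 0) = (SChk, 0, ?w[h := True], Suc h, t, 0)"
        using n True Suc.prems by (simp add: astep_def min_def)
      have r: "rd (?w[h := True]) (Suc h) = False" by (simp add: rd_def)
      have 2: "astep P g x (SChk, 0, ?w[h := True], Suc h, t, 0) = (SFix, 0, ?w[h := True], h, t, 0)"
        using r upd_rd[of "?w[h := True]" "Suc h"] by (simp add: astep_def)
      have 3: "astep P g x (SFix, 0, ?w[h := True], h, t, 0) = (Su g, 0, ?w, Suc h, t, 0)"
      proof -
        have "(?w[h := True])[h := False] = ?w"
          using wF[of h] upd_rd[of ?w h] Suc.hyps by simp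
        then show ?thesis using Suc.prems by (simp add: astep_def min_def)
      qed
      show ?thesis using 1 2 3 by (simp add: numeral_3_eq_3)
    qed
    then have "(astep P g x ^^ (3 + n)) (Su 0, 0, replicate L False, 0, t, 0) = (Su g, 0, ?w, Suc h, t, 0)"
      using n by (simp only: funpow_add o_apply)
    moreover have "g mod g = Suc h mod g" using True g by (simp add: mod_Suc)
    ultimately show ?thesis using n g by (intro exI[of _ "3 + n"] exI[of _ g]) auto
  next
    case False
    then have "astep P g x (Su q, 0, ?w, h, t, 0) = (Su (h mod g + 1), 0, ?w, Suc h, t, 0)"
      using n Suc.prems by (simp add: astep_def min_def)
    then have "(astep P g x ^^ (1 + n)) (Su 0, 0, replicate L False, 0, t, 0) = (Su (h mod g + 1), 0, ?w, Suc h, t, 0)"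
      using n by (simp only: funpow_add o_apply funpow_one)
    moreover have "(h mod g + 1) mod g = Suc h mod g" by (simp add: mod_Suc_eq)
    ultimately show ?thesis using n by (intro exI[of _ "1 + n"] exI[of _ "h mod g + 1"]) auto
  qed
qed

lemma setup_done:
  fixes g L :: nat
  assumes g: "3 \<le> g" "g dvd L" "0 < L"
  shows "\<exists>n \<le> 4 * L + 2. (astep P g x ^^ n) (Su 0, 0, replicate L False, 0, t, 0) =
     (Hm [P], 0, wtape g L (\<lambda>_. 0), 0, t, 0)"
proof -
  let ?w = "(replicate L False)[0 := True]"
  let ?v = "?w[L - 1 := True]"
  have "g \<le> L" using g by (simp add: dvd_imp_le)
  then have L: "3 \<le> L" using g by simp
  have lm: "(L - 1) mod g = g - 1" using last_mod[of g L] g by simp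
  obtain n q where n: "n \<le> 3 * (L - 1)" "0 < q" "q mod g = (L - 1) mod g"
    "(astep P g x ^^ n) (Su 0, 0, replicate L False, 0, t, 0) = (Su q, 0, ?w, L - 1, t, 0)"
    using setup_walk[OF g, of "L - 1" P x t] L by fastforce
  have v: "wtape g L (\<lambda>_. 0) = ?v"
    by (rule nth_equalityI) (use lm g in \<open>auto simp: wtape_def nth_list_update\<close>)
  have 1: "astep P g x (Su q, 0, ?w, L - 1, t, 0) = (SChk, 0, ?v, L - 1, t, 0)"
    using n lm L by (simp add: astep_def)
  have r: "rd ?v (L - 1)" using L by (simp add: rd_def)
  have "?v[L - 1 := True] = ?v" by simp
  then have 2: "astep P g x (SChk, 0, ?v, L - 1, t, 0) = (Lf [P] (g - 1), 0, ?v, L - 1, t, 0)"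
    using r by (simp add: astep_def)
  have m0: "wtape g L (\<lambda>_. 0) ! i \<longleftrightarrow> i = 0" if "i < L" "i mod g = 0" for i
    using that by (simp add: wtape_def)
  have 3: "(astep P g x ^^ L) (Lf [P] (g - 1), 0, ?v, L - 1, t, 0) = (Hm [P], 0, ?v, 0, t, 0)"
    using left_pass[of g L "wtape g L (\<lambda>_. 0)" "L - 1" P x "[P]" 0 t 0] lm L g m0
    by (simp add: v)
  have "(astep P g x ^^ (L + (1 + (1 + n)))) (Su 0, 0, replicate L False, 0, t, 0) = (Hm [P], 0, ?v, 0, t, 0)"
    using n 1 2 3 by (simp only: funpow_add o_apply funpow_one)
  moreover have "L + (1 + (1 + n)) \<le> 4 * L + 2" using n L by linarith
  ultimately show ?thesis using v by metis
qed

text \<open>Register 0 is turned into the decision at the end. From then on the abstract machine is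
  stationary, so every \<open>T\<close> beyond the bound will do.\<close>

theorem counter_program_machine:
  assumes lx: "lx (2 ^ W) x p \<lparr>rg = (\<lambda>_. 0), li = 0, lc = \<tau>, lh = 0\<rparr> t s'"
    and g: "nregs p + 3 \<le> g" and W: "0 < W"
    and T: "(t + 4) * (2 * (g * W) + 1) + 2 \<le> T"
  defines "M \<equiv> tm_of (Seq p (IfNZ 0 Acc Rej)) g"
  defines "c \<equiv> run M x [] (g * W) \<tau> T"
  shows "halted M c" "st c = qacc M \<longleftrightarrow> rg s' 0 \<noteq> 0" "ct c = lc s'"
proof -
  let ?P = "Seq p (IfNZ 0 Acc Rej)" and ?L = "g * W" and ?f = "astep (Seq p (IfNZ 0 Acc Rej)) g x"
  let ?s = "\<lparr>rg = (\<lambda>_. 0), li = 0, lc = \<tau>, lh = 0\<rparr>"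
  have gg: "2 \<le> g" "3 \<le> g" and nr: "nregs p \<le> g - 2" using g by auto
  define a0 :: acfg where "a0 = (Su 0, 0, replicate ?L False, 0, \<tau>, 0)"
  obtain n1 where n1: "n1 \<le> 4 * ?L + 2" "(?f ^^ n1) a0 = enc g ?L [?P] ?s"
    using setup_done[of g ?L ?P x \<tau>] gg W by (fastforce simp: enc_def a0_def)
  have e: "?f (enc g ?L [?P] ?s) = enc g ?L [p, IfNZ 0 Acc Rej] ?s" by (simp add: enc_def astep_def)
  obtain n2 where n2: "n2 \<le> t * (2 * ?L + 1)"
    "(?f ^^ n2) (enc g ?L [p, IfNZ 0 Acc Rej] ?s) = enc g ?L [IfNZ 0 Acc Rej] s'"
    and s': "\<forall>r<g - 2. rg s' r < 2 ^ W"
    using lx_sim[OF lx gg(1) refl W, of ?P "[IfNZ 0 Acc Rej]"] nr W by fastforce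
  let ?fin = "enc g ?L [if rg s' 0 \<noteq> 0 then Acc else Rej] s'"
  have "(?f ^^ (2 * ?L + 1)) (enc g ?L [IfNZ 0 Acc Rej] s') = ?fin"
    using nz_pass[of g ?L W "IfNZ 0 Acc Rej" s' 0 Acc Rej ?P x "[]"] gg g W s' by auto
  then have N: "(?f ^^ ((2 * ?L + 1) + (n2 + (1 + n1)))) a0 = ?fin"
    using n1 n2 e by (simp only: funpow_add o_apply funpow_one)
  have stay: "(?f ^^ m) ?fin = ?fin" for m
    by (induction m) (auto simp: enc_def astep_def)
  have le: "(2 * ?L + 1) + (n2 + (1 + n1)) \<le> T"
  proof -
    have "(2 * ?L + 1) + (n2 + (1 + n1)) \<le> (2 * ?L + 1) + (t * (2 * ?L + 1) + (1 + (4 * ?L + 2)))"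
      using n1 n2 by linarith
    also have "\<dots> \<le> (t + 4) * (2 * ?L + 1) + 2" by (simp add: algebra_simps)
    finally show ?thesis using T by linarith
  qed
  then obtain m where "T = m + ((2 * ?L + 1) + (n2 + (1 + n1)))" by (metis le_iff_add add.commute)
  then have fin: "(?f ^^ T) a0 = ?fin" using N stay by (simp only: funpow_add o_apply)
  have a0: "fst a0 \<in> states ?P g" by (simp add: a0_def special_states)
  have "init M ?L \<tau> = cfg ?P g a0" by (simp add: init_def M_def tm_of_def cfg_def a0_def)
  then have "c = cfg ?P g ?fin"
    using steps_cfg[OF a0 gg(1), where x=x and r="[]" and n=T] fin by (simp add: c_def run_def M_def)
  then show "halted M c" "st c = qacc M \<longleftrightarrow> rg s' 0 \<noteq> 0" "ct c = lc s'"
    using special_states[of ?P g]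
    by (auto simp: halted_def cfg_def enc_def M_def tm_of_def num_inj)
qed

section \<open>A small language with undoable side effects\<close>

text \<open>Frames are lists of variables. A binder (Sum, Let) appends its value to the frame, and the
second argument of a binary operation sees the value of the first one appended. Fresh k evaluates
in the frame of the last k variables, which gives non-capturing function calls. The value of
After c e c' is that of e after executing c; c' has to undo the effect of c.\<close>

datatype exp = Var nat | Cn nat | Len | Inp exp | Cat exp | Add exp exp | Sub exp exp
    | Ite exp exp exp | Sum exp exp | Let exp exp | Fresh nat exp | After com exp com
  and com = Assign nat exp | Write exp exp | CSeq com com | CIf exp com com | Loop exp com

text \<open>A compiled loop keeps its counter in the slot just behind the frame. The body therefore
  sees that slot as one more variable, which starts at 0 in each round and is dropped
  afterwards.\<close>

definition loop1 :: "(nat list \<times> bool list \<Rightarrow> nat list \<times> bool list) \<Rightarrow> nat list \<times> bool list \<Rightarrow> nat list \<times> bool list" where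
  "loop1 F = (\<lambda>(us, \<sigma>). case F (us @ [0], \<sigma>) of (ws, \<sigma>') \<Rightarrow> (take (length us) ws, \<sigma>'))"

text \<open>Assignments are cut off at variable 0, which thereby bounds the frame. Without this cap
  a loop could double a variable in each round and leave the polynomial range.\<close>

primrec eval :: "exp \<Rightarrow> bool list \<Rightarrow> nat list \<Rightarrow> bool list \<Rightarrow> nat"
  and exec :: "com \<Rightarrow> bool list \<Rightarrow> nat list \<times> bool list \<Rightarrow> nat list \<times> bool list" where
  "eval (Var k) x vs \<tau> = vs ! k"
| "eval (Cn n) x vs \<tau> = n"
| "eval Len x vs \<tau> = length x"
| "eval (Inp e) x vs \<tau> = (case insym x (eval e x vs \<tau>) of None \<Rightarrow> 0 | Some b \<Rightarrow> if b then 2 else 1)"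
| "eval (Cat e) x vs \<tau> = of_bool (rd \<tau> (eval e x vs \<tau>))"
| "eval (Add a b) x vs \<tau> = eval a x vs \<tau> + eval b x (vs @ [eval a x vs \<tau>]) \<tau>"
| "eval (Sub a b) x vs \<tau> = eval a x vs \<tau> - eval b x (vs @ [eval a x vs \<tau>]) \<tau>"
| "eval (Ite e a b) x vs \<tau> = (if eval e x vs \<tau> \<noteq> 0 then eval a x vs \<tau> else eval b x vs \<tau>)"
| "eval (Sum a b) x vs \<tau> = (\<Sum>i<eval a x vs \<tau>. eval b x (vs @ [i]) \<tau>)"
| "eval (Let a b) x vs \<tau> = eval b x (vs @ [eval a x vs \<tau>]) \<tau>"
| "eval (Fresh k e) x vs \<tau> = eval e x (drop (length vs - k) vs) \<tau>"
| "eval (After c e c') x vs \<tau> = (case exec c x (vs, \<tau>) of (vs', \<tau>') \<Rightarrow> eval e x vs' \<tau>')"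
| "exec (Assign k e) x S = (case S of (vs, \<tau>) \<Rightarrow> (vs[k := min (eval e x vs \<tau>) (vs ! 0)], \<tau>))"
| "exec (Write a e) x S = (case S of (vs, \<tau>) \<Rightarrow>
     (vs, \<tau>[eval a x vs \<tau> := (eval e x (vs @ [eval a x vs \<tau>]) \<tau> \<noteq> 0)]))"
| "exec (CSeq c1 c2) x S = exec c2 x (exec c1 x S)"
| "exec (CIf e c1 c2) x S = (case S of (vs, \<tau>) \<Rightarrow> if eval e x vs \<tau> \<noteq> 0 then exec c1 x S else exec c2 x S)"
| "exec (Loop e c) x S = (case S of (vs, \<tau>) \<Rightarrow> (loop1 (exec c x) ^^ eval e x vs \<tau>) S)"

text \<open>The content lies in the clause for \<open>After\<close>: wherever one is reached, the
  undoing command gives back frame and tape exactly, the value being the only trace. Hence the tape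
  may serve as memory inside an expression that has no effect as a whole.\<close>

primrec und :: "exp \<Rightarrow> bool list \<Rightarrow> nat list \<Rightarrow> bool list \<Rightarrow> bool"
  and undc :: "com \<Rightarrow> bool list \<Rightarrow> nat list \<times> bool list \<Rightarrow> bool" where
  "und (Var k) x vs \<tau> = True"
| "und (Cn n) x vs \<tau> = True"
| "und Len x vs \<tau> = True"
| "und (Inp e) x vs \<tau> = und e x vs \<tau>"
| "und (Cat e) x vs \<tau> = und e x vs \<tau>"
| "und (Add a b) x vs \<tau> = (und a x vs \<tau> \<and> und b x (vs @ [eval a x vs \<tau>]) \<tau>)"
| "und (Sub a b) x vs \<tau> = (und a x vs \<tau> \<and> und b x (vs @ [eval a x vs \<tau>]) \<tau>)"
| "und (Ite e a b) x vs \<tau> = (und e x vs \<tau> \<and> (if eval e x vs \<tau> \<noteq> 0 then und a x vs \<tau> else und b x vs \<tau>))"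
| "und (Sum a b) x vs \<tau> = (und a x vs \<tau> \<and> (\<forall>i<eval a x vs \<tau>. und b x (vs @ [i]) \<tau>))"
| "und (Let a b) x vs \<tau> = (und a x vs \<tau> \<and> und b x (vs @ [eval a x vs \<tau>]) \<tau>)"
| "und (Fresh k e) x vs \<tau> = und e x (drop (length vs - k) vs) \<tau>"
| "und (After c e c') x vs \<tau> = (undc c x (vs, \<tau>) \<and> (case exec c x (vs, \<tau>) of (vs', \<tau>') \<Rightarrow>
     und e x vs' \<tau>' \<and> undc c' x (vs' @ [eval e x vs' \<tau>'], \<tau>') \<and>
     exec c' x (vs' @ [eval e x vs' \<tau>'], \<tau>') = (vs @ [eval e x vs' \<tau>'], \<tau>)))"
| "undc (Assign k e) x S = (case S of (vs, \<tau>) \<Rightarrow> und e x vs \<tau>)"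
| "undc (Write a e) x S = (case S of (vs, \<tau>) \<Rightarrow> und a x vs \<tau> \<and> und e x (vs @ [eval a x vs \<tau>]) \<tau>)"
| "undc (CSeq c1 c2) x S = (undc c1 x S \<and> undc c2 x (exec c1 x S))"
| "undc (CIf e c1 c2) x S = (case S of (vs, \<tau>) \<Rightarrow> und e x vs \<tau> \<and>
     (if eval e x vs \<tau> \<noteq> 0 then undc c1 x S else undc c2 x S))"
| "undc (Loop e c) x S = (case S of (vs, \<tau>) \<Rightarrow> und e x vs \<tau> \<and> (\<forall>j<eval e x vs \<tau>.
     case (loop1 (exec c x) ^^ j) S of (us, \<sigma>) \<Rightarrow> undc c x (us @ [0], \<sigma>)))"

text \<open>The number is the frame length. \<open>0 < k\<close> protects the cap in variable 0 from
  assignments.\<close>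

primrec wfe :: "exp \<Rightarrow> nat \<Rightarrow> bool" and wfc :: "com \<Rightarrow> nat \<Rightarrow> bool" where
  "wfe (Var k) v = (k < v)"
| "wfe (Cn n) v = True"
| "wfe Len v = True"
| "wfe (Inp e) v = wfe e v"
| "wfe (Cat e) v = wfe e v"
| "wfe (Add a b) v = (wfe a v \<and> wfe b (Suc v))"
| "wfe (Sub a b) v = (wfe a v \<and> wfe b (Suc v))"
| "wfe (Ite e a b) v = (wfe e v \<and> wfe a v \<and> wfe b v)"
| "wfe (Sum a b) v = (wfe a v \<and> wfe b (Suc v))"
| "wfe (Let a b) v = (wfe a v \<and> wfe b (Suc v))"
| "wfe (Fresh k e) v = (k \<le> v \<and> wfe e k)"
| "wfe (After c e c') v = (wfc c v \<and> wfe e v \<and> wfc c' (Suc v))"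
| "wfc (Assign k e) v = (0 < k \<and> k < v \<and> wfe e v)"
| "wfc (Write a e) v = (wfe a v \<and> wfe e (Suc v))"
| "wfc (CSeq c1 c2) v = (wfc c1 v \<and> wfc c2 v)"
| "wfc (CIf e c1 c2) v = (wfe e v \<and> wfc c1 v \<and> wfc c2 v)"
| "wfc (Loop e c) v = (wfe e v \<and> wfc c (Suc v))"

text \<open>A common bound for the value, the running time, the registers and the addresses, given that
the frame and the input length are bounded by B.\<close>

primrec GE :: "exp \<Rightarrow> nat \<Rightarrow> nat" and GC :: "com \<Rightarrow> nat \<Rightarrow> nat" where
  "GE (Var k) B = 10 * B + 10"
| "GE (Cn n) B = 2 * n + 2"
| "GE Len B = 20 * B + 30"
| "GE (Inp e) B = 30 * (GE e B + 1)"
| "GE (Cat e) B = 30 * (GE e B + 1)"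
| "GE (Add a b) B = 10 * (GE a B + GE b (B + GE a B) + 1)"
| "GE (Sub a b) B = 10 * (GE a B + GE b (B + GE a B) + 1)"
| "GE (Ite e a b) B = 10 * (GE e B + GE a B + GE b B + 1)"
| "GE (Sum a b) B = 30 * ((GE a B + 1) * (GE b (B + GE a B) + 1))"
| "GE (Let a b) B = 10 * (GE a B + GE b (B + GE a B) + 1)"
| "GE (Fresh k e) B = GE e B"
| "GE (After c e c') B = GC c B + GE e B + GC c' (B + GE e B) + 2"
| "GC (Assign k e) B = 40 * (GE e B + B + 1)"
| "GC (Write a e) B = 30 * (GE a B + GE e (B + GE a B) + 1)"
| "GC (CSeq c1 c2) B = GC c1 B + GC c2 B + 1"
| "GC (CIf e c1 c2) B = 10 * (GE e B + GC c1 B + GC c2 B + 1)"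
| "GC (Loop e c) B = 30 * ((GE e B + 1) * (GC c B + B + 1))"

section \<open>Compilation to counter programs\<close>

definition mv :: "nat \<Rightarrow> nat \<Rightarrow> lcom" where "mv a b = While a (Seq (Dec a) (Inc b))"
definition cp :: "nat \<Rightarrow> nat \<Rightarrow> nat \<Rightarrow> lcom" where "cp a b c = While a (Seq (Dec a) (Seq (Inc b) (Inc c)))"
definition clr :: "nat \<Rightarrow> lcom" where "clr a = While a (Dec a)"
definition sbt :: "nat \<Rightarrow> nat \<Rightarrow> lcom" where "sbt a b = While b (Seq (Dec b) (IfNZ a (Dec a) Skip))"
definition mnm :: "nat \<Rightarrow> nat \<Rightarrow> nat \<Rightarrow> lcom" where
  "mnm a b c = While b (Seq (Dec b) (IfNZ a (Seq (Dec a) (Inc c)) Skip))"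
definition goc :: "nat \<Rightarrow> nat \<Rightarrow> lcom" where "goc a b = While a (Seq (Dec a) (Seq (Inc b) (CatM MvR)))"
definition bkc :: "nat \<Rightarrow> lcom" where "bkc b = While b (Seq (Dec b) (CatM MvL))"
definition goi :: "nat \<Rightarrow> nat \<Rightarrow> dir \<Rightarrow> lcom" where "goi a b d = While a (Seq (Dec a) (Seq (Inc b) (InM d)))"
definition bki :: "nat \<Rightarrow> lcom" where "bki b = While b (Seq (Dec b) (InM MvL))"

primrec incs :: "nat \<Rightarrow> nat \<Rightarrow> lcom" where
  "incs 0 r = Skip" | "incs (Suc n) r = Seq (incs n r) (Inc r)"

text \<open>Slot j stands for the registers 3 j, 3 j + 1 and 3 j + 2: a value and two scratch
  registers. The frame starts in slot \<open>f\<close>, \<open>D\<close> is the first free slot, and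
  the result goes to register 3 D. \<open>Fresh k\<close> merely moves the start of the frame to
  slot D - k. Registers can be read only destructively, hence the detour through a scratch register
  for \<open>Var\<close>.\<close>

primrec comp :: "exp \<Rightarrow> nat \<Rightarrow> nat \<Rightarrow> lcom" and compc :: "com \<Rightarrow> nat \<Rightarrow> nat \<Rightarrow> lcom" where
  "comp (Var k) f D = Seq (cp (3 * (f + k)) (3 * D) (3 * D + 1)) (mv (3 * D + 1) (3 * (f + k)))"
| "comp (Cn n) f D = incs n (3 * D)"
| "comp Len f D = Seq (InM MvR) (Seq (Inc (3 * D + 1)) (Seq
     (While (3 * D + 1) (IfIn (Dec (3 * D + 1)) (Seq (Inc (3 * D)) (InM MvR)) (Seq (Inc (3 * D)) (InM MvR))))
     (Seq (goi (3 * D) (3 * D + 1) MvL) (Seq (InM MvL) (mv (3 * D + 1) (3 * D))))))"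
| "comp (Inp e) f D = Seq (comp e f D) (Seq (goi (3 * D) (3 * D + 1) MvR) (Seq
     (IfIn Skip (Inc (3 * D + 2)) (Seq (Inc (3 * D + 2)) (Inc (3 * D + 2))))
     (Seq (bki (3 * D + 1)) (mv (3 * D + 2) (3 * D)))))"
| "comp (Cat e) f D = Seq (comp e f D) (Seq (goc (3 * D) (3 * D + 1)) (Seq
     (IfCat (Inc (3 * D + 2)) Skip) (Seq (bkc (3 * D + 1)) (mv (3 * D + 2) (3 * D)))))"
| "comp (Add a b) f D = Seq (comp a f D) (Seq (comp b f (D + 1)) (mv (3 * (D + 1)) (3 * D)))"
| "comp (Sub a b) f D = Seq (comp a f D) (Seq (comp b f (D + 1)) (sbt (3 * D) (3 * (D + 1))))"
| "comp (Ite e a b) f D = Seq (comp e f D) (IfNZ (3 * D) (Seq (clr (3 * D)) (comp a f D)) (comp b f D))"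
| "comp (Sum a b) f D = Seq (comp a f D) (Seq (mv (3 * D) (3 * D + 1)) (Seq
     (While (3 * D + 1) (Seq (comp b f (D + 1)) (Seq (mv (3 * (D + 1)) (3 * D + 2)) (Seq (Inc (3 * D)) (Dec (3 * D + 1))))))
     (Seq (clr (3 * D)) (mv (3 * D + 2) (3 * D)))))"
| "comp (Let a b) f D = Seq (comp a f D) (Seq (comp b f (D + 1)) (Seq (clr (3 * D)) (mv (3 * (D + 1)) (3 * D))))"
| "comp (Fresh k e) f D = comp e (D - k) D"
| "comp (After c e c') f D = Seq (compc c f D) (Seq (comp e f D) (compc c' f (D + 1)))"
| "compc (Assign k e) f D = Seq (comp e f D) (Seq (cp (3 * f) (3 * (D + 1)) (3 * D + 1)) (Seq (mv (3 * D + 1) (3 * f))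
     (Seq (clr (3 * (f + k))) (Seq (mnm (3 * D) (3 * (D + 1)) (3 * (f + k))) (clr (3 * D))))))"
| "compc (Write a e) f D = Seq (comp a f D) (Seq (comp e f (D + 1)) (Seq (goc (3 * D) (3 * D + 1))
     (Seq (IfNZ (3 * (D + 1)) (CatW True) (CatW False)) (Seq (bkc (3 * D + 1)) (clr (3 * (D + 1)))))))"
| "compc (CSeq c1 c2) f D = Seq (compc c1 f D) (compc c2 f D)"
| "compc (CIf e c1 c2) f D = Seq (comp e f D) (IfNZ (3 * D) (Seq (clr (3 * D)) (compc c1 f D)) (compc c2 f D))"
| "compc (Loop e c) f D = Seq (comp e f D) (Seq (mv (3 * D) (3 * D + 1))
     (While (3 * D + 1) (Seq (compc c f (D + 1)) (Seq (clr (3 * D)) (Dec (3 * D + 1))))))"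

definition lxb :: "nat \<Rightarrow> bool list \<Rightarrow> lcom \<Rightarrow> lst \<Rightarrow> nat \<Rightarrow> lst \<Rightarrow> bool" where
  "lxb C x p s T s' \<longleftrightarrow> (\<exists>t \<le> T. lx C x p s t s')"

lemma lxb_mono: "lxb C x p s T s' \<Longrightarrow> T \<le> T' \<Longrightarrow> lxb C x p s T' s'"
  by (auto simp: lxb_def intro: le_trans)

lemma lxb_Seq: "lxb C x a s T1 s1 \<Longrightarrow> lxb C x b s1 T2 s2 \<Longrightarrow> T1 + T2 + 1 \<le> T \<Longrightarrow> lxb C x (Seq a b) s T s2"
  unfolding lxb_def by (meson add_le_mono le_trans lx_Seq le_refl)

lemma lxb_While:
  assumes "\<And>j. j < n \<Longrightarrow> rg (S j) r \<noteq> 0 \<and> lxb C x b (S j) T (S (Suc j))" "rg (S n) r = 0"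
    "n * (T + 1) + 1 \<le> T'"
  shows "lxb C x (While r b) (S 0) T' (S n)"
proof -
  have "lxb C x (While r b) (S j) ((n - j) * (T + 1) + 1) (S n)" if "j \<le> n" for j
    using that
  proof (induction j rule: inc_induct)
    case base
    then show ?case using assms(2) unfolding lxb_def by (metis lx_WhileF diff_self_eq_0 mult_0 add_0 order_refl)
  next
    case (step j)
    obtain t1 t2 where t: "t1 \<le> T" "lx C x b (S j) t1 (S (Suc j))"
      "t2 \<le> (n - Suc j) * (T + 1) + 1" "lx C x (While r b) (S (Suc j)) t2 (S n)"
      using step assms(1)[of j] by (auto simp: lxb_def)
    have "n - j = Suc (n - Suc j)" using step by simp
    then have "t1 + t2 + 1 \<le> (n - j) * (T + 1) + 1" using t by simp
    moreover have "rg (S j) r \<noteq> 0" using assms(1) step by blast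
    ultimately show ?case unfolding lxb_def using lx_WhileT[OF _ t(2) t(4)] by blast
  qed
  from this[of 0] show ?thesis using assms(3) lxb_mono by simp
qed

lemma lxb_Skip: "1 \<le> T \<Longrightarrow> lxb C x Skip s T s"
  unfolding lxb_def by (metis lx_Skip)
lemma lxb_Inc: "rg s r + 1 < C \<Longrightarrow> 1 \<le> T \<Longrightarrow> s' = s\<lparr>rg := (rg s)(r := rg s r + 1)\<rparr> \<Longrightarrow> lxb C x (Inc r) s T s'"
  unfolding lxb_def by (metis lx_Inc)
lemma lxb_Dec: "0 < rg s r \<Longrightarrow> 1 \<le> T \<Longrightarrow> s' = s\<lparr>rg := (rg s)(r := rg s r - 1)\<rparr> \<Longrightarrow> lxb C x (Dec r) s T s'"
  unfolding lxb_def by (metis lx_Dec)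
lemma lxb_CatM: "1 \<le> T \<Longrightarrow> s' = s\<lparr>lh := move d (lh s) (length (lc s))\<rparr> \<Longrightarrow> lxb C x (CatM d) s T s'"
  unfolding lxb_def by (metis lx_CatM)
lemma lxb_CatW: "1 \<le> T \<Longrightarrow> s' = s\<lparr>lc := (lc s)[lh s := b]\<rparr> \<Longrightarrow> lxb C x (CatW b) s T s'"
  unfolding lxb_def by (metis lx_CatW)
lemma lxb_InM: "1 \<le> T \<Longrightarrow> s' = s\<lparr>li := move d (li s) (length x + 2)\<rparr> \<Longrightarrow> lxb C x (InM d) s T s'"
  unfolding lxb_def by (metis lx_InM)

lemma lxb_step: "(\<And>t. lx C x a s t s' \<Longrightarrow> lx C x p s (t + 1) s') \<Longrightarrow> lxb C x a s T s' \<Longrightarrow> T + 1 \<le> T' \<Longrightarrow>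
  lxb C x p s T' s'"
  unfolding lxb_def by (meson add_le_mono1 le_trans)

lemma lxb_IfNZ: "(rg s r \<noteq> 0 \<Longrightarrow> lxb C x a s T s') \<Longrightarrow> (rg s r = 0 \<Longrightarrow> lxb C x b s T s') \<Longrightarrow> T + 1 \<le> T' \<Longrightarrow>
  lxb C x (IfNZ r a b) s T' s'"
  by (metis lxb_step lx_IfNZT lx_IfNZF)

lemma lxb_IfCat: "(rd (lc s) (lh s) \<Longrightarrow> lxb C x a s T s') \<Longrightarrow> (\<not> rd (lc s) (lh s) \<Longrightarrow> lxb C x b s T s') \<Longrightarrow> T + 1 \<le> T' \<Longrightarrow>
  lxb C x (IfCat a b) s T' s'"
  by (metis lxb_step lx_IfCatT lx_IfCatF)

lemma lxb_IfIn: "(insym x (li s) = None \<Longrightarrow> lxb C x a s T s') \<Longrightarrow> (insym x (li s) = Some False \<Longrightarrow> lxb C x b s T s') \<Longrightarrow>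
  (insym x (li s) = Some True \<Longrightarrow> lxb C x c s T s') \<Longrightarrow> T + 1 \<le> T' \<Longrightarrow> lxb C x (IfIn a b c) s T' s'"
  by (metis (full_types) lxb_step lx_IfInN lx_IfInF lx_IfInT not_None_eq)

lemma lxb_mv:
  assumes "a \<noteq> b" "rg s a + rg s b < C" "4 * rg s a + 1 \<le> T"
  shows "lxb C x (mv a b) s T (s\<lparr>rg := (rg s)(b := rg s b + rg s a, a := 0)\<rparr>)"
proof -
  let ?S = "\<lambda>j. s\<lparr>rg := (rg s)(b := rg s b + j, a := rg s a - j)\<rparr>"
  have "lxb C x (mv a b) (?S 0) T (?S (rg s a))"
    unfolding mv_def
  proof (rule lxb_While[where T = 3])
    fix j assume j: "j < rg s a"
    have "lxb C x (Seq (Dec a) (Inc b)) (?S j) 3 (?S (Suc j))"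
      by (rule lxb_Seq[OF lxb_Dec[where T=1, OF _ _ refl] lxb_Inc[where T=1]])
        (use j assms in \<open>auto simp: fun_eq_iff\<close>)
    then show "rg (?S j) a \<noteq> 0 \<and> lxb C x (Seq (Dec a) (Inc b)) (?S j) 3 (?S (Suc j))"
      using j assms by auto
  qed (use assms in auto)
  then show ?thesis using assms by simp
qed

lemma lxb_clr:
  assumes "2 * rg s a + 1 \<le> T"
  shows "lxb C x (clr a) s T (s\<lparr>rg := (rg s)(a := 0)\<rparr>)"
proof -
  let ?S = "\<lambda>j. s\<lparr>rg := (rg s)(a := rg s a - j)\<rparr>"
  have "lxb C x (clr a) (?S 0) T (?S (rg s a))"
    unfolding clr_def
  proof (rule lxb_While[where T = 1])
    fix j assume j: "j < rg s a"
    have "lxb C x (Dec a) (?S j) 1 (?S (Suc j))"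
      by (rule lxb_Dec) (use j assms in \<open>auto simp: fun_eq_iff\<close>)
    then show "rg (?S j) a \<noteq> 0 \<and> lxb C x (Dec a) (?S j) 1 (?S (Suc j))"
      using j assms by auto
  qed (use assms in auto)
  then show ?thesis by simp
qed

lemma lxb_cp:
  assumes "a \<noteq> b" "a \<noteq> c" "b \<noteq> c" "rg s a + rg s b < C" "rg s a + rg s c < C" "6 * rg s a + 1 \<le> T"
  shows "lxb C x (cp a b c) s T (s\<lparr>rg := (rg s)(b := rg s b + rg s a, c := rg s c + rg s a, a := 0)\<rparr>)"
proof -
  let ?S = "\<lambda>j. s\<lparr>rg := (rg s)(b := rg s b + j, c := rg s c + j, a := rg s a - j)\<rparr>"
  have "lxb C x (cp a b c) (?S 0) T (?S (rg s a))"
    unfolding cp_def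
  proof (rule lxb_While[where T = 5])
    fix j assume j: "j < rg s a"
    have "lxb C x (Seq (Dec a) (Seq (Inc b) (Inc c))) (?S j) 5 (?S (Suc j))"
      by (rule lxb_Seq[OF lxb_Dec[where T=1, OF _ _ refl] lxb_Seq[where T=3, OF lxb_Inc[where T=1, OF _ _ refl] lxb_Inc[where T=1]]])
        (use j assms in \<open>auto simp: fun_eq_iff\<close>)
    then show "rg (?S j) a \<noteq> 0 \<and> lxb C x (Seq (Dec a) (Seq (Inc b) (Inc c))) (?S j) 5 (?S (Suc j))"
      using j assms by auto
  qed (use assms in auto)
  then show ?thesis using assms by simp
qed

lemma lxb_sbt:
  assumes "a \<noteq> b" "5 * rg s b + 1 \<le> T"
  shows "lxb C x (sbt a b) s T (s\<lparr>rg := (rg s)(a := rg s a - rg s b, b := 0)\<rparr>)"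
proof -
  let ?S = "\<lambda>j. s\<lparr>rg := (rg s)(a := rg s a - j, b := rg s b - j)\<rparr>"
  have "lxb C x (sbt a b) (?S 0) T (?S (rg s b))"
    unfolding sbt_def
  proof (rule lxb_While[where T = 4])
    fix j assume j: "j < rg s b"
    have "lxb C x (Seq (Dec b) (IfNZ a (Dec a) Skip)) (?S j) 4 (?S (Suc j))"
    proof (rule lxb_Seq[OF lxb_Dec[where T=1, OF _ _ refl] lxb_IfNZ[where T=1 and T'=2]])
      assume "rg ((?S j)\<lparr>rg := (rg (?S j))(b := rg (?S j) b - 1)\<rparr>) a = 0"
      then have "?S (Suc j) = (?S j)\<lparr>rg := (rg (?S j))(b := rg (?S j) b - 1)\<rparr>"
        using assms by (auto simp: fun_eq_iff)
      then show "lxb C x Skip ((?S j)\<lparr>rg := (rg (?S j))(b := rg (?S j) b - 1)\<rparr>) 1 (?S (Suc j))"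
        by (simp only:) (simp add: lxb_Skip)
    next
      assume "rg ((?S j)\<lparr>rg := (rg (?S j))(b := rg (?S j) b - 1)\<rparr>) a \<noteq> 0"
      then show "lxb C x (Dec a) ((?S j)\<lparr>rg := (rg (?S j))(b := rg (?S j) b - 1)\<rparr>) 1 (?S (Suc j))"
        using assms by (intro lxb_Dec) (auto simp: fun_eq_iff)
    qed (use j assms in auto)
    then show "rg (?S j) b \<noteq> 0 \<and> lxb C x (Seq (Dec b) (IfNZ a (Dec a) Skip)) (?S j) 4 (?S (Suc j))"
      using j assms by auto
  qed (use assms in auto)
  then show ?thesis using assms by simp
qed

lemma lxb_mnm:
  assumes "a \<noteq> b" "a \<noteq> c" "b \<noteq> c" "7 * rg s b + 1 \<le> T" "rg s c + rg s a < C"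
  shows "lxb C x (mnm a b c) s T (s\<lparr>rg := (rg s)(a := rg s a - rg s b, c := rg s c + min (rg s a) (rg s b), b := 0)\<rparr>)"
proof -
  let ?S = "\<lambda>j. s\<lparr>rg := (rg s)(a := rg s a - j, c := rg s c + min (rg s a) j, b := rg s b - j)\<rparr>"
  have "lxb C x (mnm a b c) (?S 0) T (?S (rg s b))"
    unfolding mnm_def
  proof (rule lxb_While[where T = 6])
    fix j assume j: "j < rg s b"
    let ?t = "(?S j)\<lparr>rg := (rg (?S j))(b := rg (?S j) b - 1)\<rparr>"
    have "lxb C x (Seq (Dec b) (IfNZ a (Seq (Dec a) (Inc c)) Skip)) (?S j) 6 (?S (Suc j))"
    proof (rule lxb_Seq[OF lxb_Dec[where T=1, OF _ _ refl] lxb_IfNZ[where T=3 and T'=4]])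
      assume "rg ?t a = 0"
      then have "?S (Suc j) = ?t" using assms by (auto simp: fun_eq_iff)
      then show "lxb C x Skip ?t 3 (?S (Suc j))"
        by (simp only:) (simp add: lxb_Skip)
    next
      assume "rg ?t a \<noteq> 0"
      then show "lxb C x (Seq (Dec a) (Inc c)) ?t 3 (?S (Suc j))"
        using assms by (intro lxb_Seq[OF lxb_Dec[where T=1, OF _ _ refl] lxb_Inc[where T=1]]) (auto simp: fun_eq_iff)
    qed (use j assms in auto)
    then show "rg (?S j) b \<noteq> 0 \<and> lxb C x (Seq (Dec b) (IfNZ a (Seq (Dec a) (Inc c)) Skip)) (?S j) 6 (?S (Suc j))"
      using j assms by auto
  qed (use assms in auto)
  then show ?thesis using assms by simp
qed

lemma lxb_goc:
  assumes "a \<noteq> b" "rg s a + rg s b < C" "lh s + rg s a < length (lc s)" "6 * rg s a + 1 \<le> T"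
  shows "lxb C x (goc a b) s T (s\<lparr>rg := (rg s)(b := rg s b + rg s a, a := 0), lh := lh s + rg s a\<rparr>)"
proof -
  let ?S = "\<lambda>j. s\<lparr>rg := (rg s)(b := rg s b + j, a := rg s a - j), lh := lh s + j\<rparr>"
  have "lxb C x (goc a b) (?S 0) T (?S (rg s a))"
    unfolding goc_def
  proof (rule lxb_While[where T = 5])
    fix j assume j: "j < rg s a"
    have "lxb C x (Seq (Dec a) (Seq (Inc b) (CatM MvR))) (?S j) 5 (?S (Suc j))"
      by (rule lxb_Seq[OF lxb_Dec[where T=1, OF _ _ refl] lxb_Seq[where T=3, OF lxb_Inc[where T=1, OF _ _ refl] lxb_CatM[where T=1]]])
        (use j assms in \<open>auto simp: fun_eq_iff\<close>)
    then show "rg (?S j) a \<noteq> 0 \<and> lxb C x (Seq (Dec a) (Seq (Inc b) (CatM MvR))) (?S j) 5 (?S (Suc j))"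
      using j assms by auto
  qed (use assms in auto)
  then show ?thesis using assms by simp
qed

lemma lxb_bkc:
  assumes "4 * rg s b + 1 \<le> T"
  shows "lxb C x (bkc b) s T (s\<lparr>rg := (rg s)(b := 0), lh := lh s - rg s b\<rparr>)"
proof -
  let ?S = "\<lambda>j. s\<lparr>rg := (rg s)(b := rg s b - j), lh := lh s - j\<rparr>"
  have "lxb C x (bkc b) (?S 0) T (?S (rg s b))"
    unfolding bkc_def
  proof (rule lxb_While[where T = 3])
    fix j assume j: "j < rg s b"
    have "lxb C x (Seq (Dec b) (CatM MvL)) (?S j) 3 (?S (Suc j))"
      by (rule lxb_Seq[OF lxb_Dec[where T=1, OF _ _ refl] lxb_CatM[where T=1]])
        (use j assms in \<open>auto simp: fun_eq_iff\<close>)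
    then show "rg (?S j) b \<noteq> 0 \<and> lxb C x (Seq (Dec b) (CatM MvL)) (?S j) 3 (?S (Suc j))"
      using j assms by auto
  qed (use assms in auto)
  then show ?thesis using assms by simp
qed

lemma lxb_goi:
  assumes "a \<noteq> b" "rg s a + rg s b < C" "6 * rg s a + 1 \<le> T"
  shows "lxb C x (goi a b d) s T (s\<lparr>rg := (rg s)(b := rg s b + rg s a, a := 0),
     li := ((\<lambda>h. move d h (length x + 2)) ^^ rg s a) (li s)\<rparr>)"
proof -
  let ?S = "\<lambda>j. s\<lparr>rg := (rg s)(b := rg s b + j, a := rg s a - j), li := ((\<lambda>h. move d h (length x + 2)) ^^ j) (li s)\<rparr>"
  have "lxb C x (goi a b d) (?S 0) T (?S (rg s a))"
    unfolding goi_def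
  proof (rule lxb_While[where T = 5])
    fix j assume j: "j < rg s a"
    have "lxb C x (Seq (Dec a) (Seq (Inc b) (InM d))) (?S j) 5 (?S (Suc j))"
      by (rule lxb_Seq[OF lxb_Dec[where T=1, OF _ _ refl] lxb_Seq[where T=3, OF lxb_Inc[where T=1, OF _ _ refl] lxb_InM[where T=1]]])
        (use j assms in \<open>auto simp: fun_eq_iff\<close>)
    then show "rg (?S j) a \<noteq> 0 \<and> lxb C x (Seq (Dec a) (Seq (Inc b) (InM d))) (?S j) 5 (?S (Suc j))"
      using j assms by auto
  qed (use assms in auto)
  then show ?thesis using assms by simp
qed

lemma lxb_bki:
  assumes "4 * rg s b + 1 \<le> T"
  shows "lxb C x (bki b) s T (s\<lparr>rg := (rg s)(b := 0), li := li s - rg s b\<rparr>)"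
proof -
  let ?S = "\<lambda>j. s\<lparr>rg := (rg s)(b := rg s b - j), li := li s - j\<rparr>"
  have "lxb C x (bki b) (?S 0) T (?S (rg s b))"
    unfolding bki_def
  proof (rule lxb_While[where T = 3])
    fix j assume j: "j < rg s b"
    have "lxb C x (Seq (Dec b) (InM MvL)) (?S j) 3 (?S (Suc j))"
      by (rule lxb_Seq[OF lxb_Dec[where T=1, OF _ _ refl] lxb_InM[where T=1]])
        (use j assms in \<open>auto simp: fun_eq_iff\<close>)
    then show "rg (?S j) b \<noteq> 0 \<and> lxb C x (Seq (Dec b) (InM MvL)) (?S j) 3 (?S (Suc j))"
      using j assms by auto
  qed (use assms in auto)
  then show ?thesis using assms by simp
qed

lemma succ_min_funpow: "((\<lambda>h. Suc (min h n)) ^^ j) 0 = min j (Suc n)"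
  by (induction j) auto

lemma pred_funpow: "((\<lambda>h. h - Suc 0) ^^ j) i = i - j"
  by (induction j) auto

lemma lxb_incs:
  assumes "rg s r + n < C" "2 * n + 1 \<le> T"
  shows "lxb C x (incs n r) s T (s\<lparr>rg := (rg s)(r := rg s r + n)\<rparr>)"
  using assms
proof (induction n arbitrary: T)
  case 0
  then show ?case by (simp add: lxb_Skip)
next
  case (Suc n)
  show ?case unfolding incs.simps
    by (rule lxb_Seq[OF Suc.IH[of "2 * n + 1"] lxb_Inc[where T=1]]) (use Suc.prems in \<open>auto simp: fun_eq_iff\<close>)
qed


section \<open>Bounds on frames and values\<close>

lemma loop1_len:
  assumes "\<And>us \<sigma>. length (fst (F (us, \<sigma>))) = length us \<and> length (snd (F (us, \<sigma>))) = length \<sigma>"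
  shows "length (fst ((loop1 F ^^ n) (vs, \<tau>))) = length vs \<and> length (snd ((loop1 F ^^ n) (vs, \<tau>))) = length \<tau>"
proof (induction n)
  case (Suc n)
  obtain us \<sigma> where S: "(loop1 F ^^ n) (vs, \<tau>) = (us, \<sigma>)" by fastforce
  show ?case using Suc assms[of "us @ [0]" \<sigma>] by (simp add: S) (auto simp: loop1_def split: prod.splits)
qed simp

lemma exec_len_aux: fixes e :: exp
  shows "e = e" and "length (fst (exec c x (vs, \<tau>))) = length vs \<and> length (snd (exec c x (vs, \<tau>))) = length \<tau>"
proof (induction e and c arbitrary: and vs \<tau>)
  case (CSeq c1 c2)
  then show ?case by (metis exec.simps(3) prod.collapse)
next
  case (Loop e c)
  then show ?case using loop1_len[of "exec c x"] by simp
qed auto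

lemmas exec_len = exec_len_aux(2)

lemma exec_len': "exec c x (vs, \<tau>) = (vs', \<tau>') \<Longrightarrow> length vs' = length vs \<and> length \<tau>' = length \<tau>"
  using exec_len[of c x vs \<tau>] by simp

lemma loop1_len': "(loop1 (exec c x) ^^ n) (vs, \<tau>) = (vs', \<tau>') \<Longrightarrow> length vs' = length vs \<and> length \<tau>' = length \<tau>"
  using loop1_len[of "exec c x" n vs \<tau>] exec_len by simp

text \<open>For commands the same B bounds the frame before and after, since an assigned value is at
  most variable 0. So the bound does not grow with the number of rounds of a loop.\<close>

lemma eval_exec_bound:
  shows "wfe e (length vs) \<Longrightarrow> \<forall>v\<in>set vs. v \<le> B \<Longrightarrow> length x \<le> B \<Longrightarrow> eval e x vs \<tau> \<le> GE e B"
    and "wfc c (length vs) \<Longrightarrow> \<forall>v\<in>set vs. v \<le> B \<Longrightarrow> length x \<le> B \<Longrightarrow> \<forall>v\<in>set (fst (exec c x (vs, \<tau>))). v \<le> B"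
proof (induction e and c arbitrary: vs \<tau> B and vs \<tau> B)
  case (Var k)
  then have "vs ! k \<le> B" by simp
  then show ?case by simp
next
  case (Inp e)
  then show ?case by (auto split: option.splits)
next
  case (Cat e)
  then show ?case by (auto simp: of_bool_def)
next
  case (Add a b)
  have "eval a x vs \<tau> \<le> GE a B" using Add by auto
  moreover have "eval b x (vs @ [eval a x vs \<tau>]) \<tau> \<le> GE b (B + GE a B)"
    using Add.prems calculation by (intro Add.IH) auto
  ultimately show ?case by simp
next
  case (Sub a b)
  have "eval a x vs \<tau> \<le> GE a B" using Sub by auto
  then show ?case by simp
next
  case (Ite e a b)
  have "eval a x vs \<tau> \<le> GE a B" "eval b x vs \<tau> \<le> GE b B" using Ite by auto
  then show ?case by simp
next
  case (Sum a b)
  have a: "eval a x vs \<tau> \<le> GE a B" using Sum by auto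
  have "eval b x (vs @ [i]) \<tau> \<le> GE b (B + GE a B)" if "i < eval a x vs \<tau>" for i
    using Sum.prems a that by (intro Sum.IH) auto
  then have "(\<Sum>i<eval a x vs \<tau>. eval b x (vs @ [i]) \<tau>) \<le> of_nat (card {..<eval a x vs \<tau>}) * GE b (B + GE a B)"
    by (intro sum_bounded_above) auto
  also have "\<dots> \<le> GE a B * GE b (B + GE a B)" using a by simp
  also have "\<dots> \<le> GE (Sum a b) B" by (simp add: algebra_simps)
  finally show ?case by simp
next
  case (Let a b)
  have a: "eval a x vs \<tau> \<le> GE a B" using Let by auto
  have "eval b x (vs @ [eval a x vs \<tau>]) \<tau> \<le> GE b (B + GE a B)"
    using Let.prems a by (intro Let.IH) auto
  then show ?case by simp
next
  case (Fresh k e)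
  have "\<forall>v\<in>set (drop (length vs - k) vs). v \<le> B" using Fresh.prems(2) in_set_dropD by fast
  moreover have "length (drop (length vs - k) vs) = k" using Fresh.prems(1) by simp
  ultimately show ?case unfolding eval.simps GE.simps
    using Fresh.prems by (intro Fresh.IH) (simp_all only: wfe.simps)
next
  case (After c e c')
  obtain vs' \<tau>' where S: "exec c x (vs, \<tau>) = (vs', \<tau>')" by fastforce
  have "\<forall>v\<in>set vs'. v \<le> B" using After.IH(1)[of vs B \<tau>] After.prems S by simp
  then have "eval e x vs' \<tau>' \<le> GE e B" using After.prems exec_len'[OF S] by (intro After.IH) auto
  then show ?case by (simp add: S)
next
  case (Assign k e)
  have "vs ! 0 \<le> B" using Assign.prems by (metis length_greater_0_conv list.size(3) not_less_zero nth_mem wfc.simps(1))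
  then show ?case using Assign.prems by (auto dest!: subsetD[OF set_update_subset_insert])
next
  case (CSeq c1 c2)
  obtain vs' \<tau>' where S: "exec c1 x (vs, \<tau>) = (vs', \<tau>')" by fastforce
  show ?case using CSeq.IH(1)[of vs B \<tau>] CSeq.IH(2)[of vs' B \<tau>'] CSeq.prems exec_len'[OF S] by (simp add: S)
next
  case (Loop e c)
  have "\<forall>v\<in>set (fst ((loop1 (exec c x) ^^ n) (vs, \<tau>))). v \<le> B" for n
  proof (induction n)
    case 0
    then show ?case using Loop by simp
  next
    case (Suc n)
    obtain us \<sigma> where S: "(loop1 (exec c x) ^^ n) (vs, \<tau>) = (us, \<sigma>)" by fastforce
    have "\<forall>v\<in>set (fst (exec c x (us @ [0], \<sigma>))). v \<le> B"
      using Loop.IH(2)[of "us @ [0]" B \<sigma>] Suc S Loop.prems loop1_len'[OF S] by auto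
    then show ?case by (simp add: S) (auto simp: loop1_def split: prod.splits dest: in_set_takeD)
  qed
  then show ?case by simp
next
  case (CIf e c1 c2)
  have "\<forall>v\<in>set (fst (exec c1 x (vs, \<tau>))). v \<le> B" "\<forall>v\<in>set (fst (exec c2 x (vs, \<tau>))). v \<le> B"
    using CIf.IH(2)[of vs B \<tau>] CIf.IH(3)[of vs B \<tau>] CIf.prems by (metis wfc.simps(4))+
  then show ?case by simp
next
  case (Write a e)
  then show ?case by simp
next
  case (Cn n)
  then show ?case by simp
next
  case Len
  then show ?case by simp
qed

text \<open>Nothing is said about the scratch registers of the slots of the frame itself: enclosing
  loops keep their counters there.\<close>

definition okst :: "nat \<Rightarrow> nat list \<Rightarrow> bool list \<Rightarrow> lst \<Rightarrow> bool" where
  "okst f vs \<tau> s \<longleftrightarrow> (\<forall>k<length vs. rg s (3 * (f + k)) = vs ! k) \<and> (\<forall>r\<ge>3 * (f + length vs). rg s r = 0) \<and>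
     li s = 0 \<and> lh s = 0 \<and> lc s = \<tau>"

text \<open>Only these registers may differ after a command; all others have to come back, among
  them the loop counters of the surroundings.\<close>

definition frm :: "nat \<Rightarrow> nat \<Rightarrow> nat \<Rightarrow> bool" where
  "frm f v r \<longleftrightarrow> (\<exists>k<v. r = 3 * (f + k))"

lemma okst_snoc: "okst f vs \<tau> s \<Longrightarrow> okst f (vs @ [u]) \<tau> (s\<lparr>rg := (rg s)(3 * (f + length vs) := u)\<rparr>)"
  by (auto simp: okst_def nth_append less_Suc_eq)

lemma okst_drop: "okst f vs \<tau> s \<Longrightarrow> k \<le> length vs \<Longrightarrow> okst (f + length vs - k) (drop (length vs - k) vs) \<tau> s"
proof -
  assume a: "okst f vs \<tau> s" "k \<le> length vs"
  have "rg s (3 * (f + length vs - k + i)) = vs ! (length vs - k + i)" if "i < k" for i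
  proof -
    have "f + length vs - k + i = f + (length vs - k + i)" "length vs - k + i < length vs"
      using a that by auto
    then show ?thesis using a by (auto simp: okst_def simp del: mult_Suc_right distrib_left_numeral)
  qed
  then show ?thesis using a by (auto simp: okst_def)
qed

lemma okst_zero: "okst f vs \<tau> s \<Longrightarrow> D = f + length vs \<Longrightarrow>
    rg s (3 * D) = 0 \<and> rg s (3 * D + 1) = 0 \<and> rg s (3 * D + 2) = 0 \<and> rg s (3 * D + 3) = 0 \<and> rg s (3 + 3 * D) = 0"
  by (auto simp: okst_def)

lemma lxb_eqI: "lxb C x p s T s1 \<Longrightarrow> (\<And>r. rg s1 r = rg s' r) \<Longrightarrow> li s1 = li s' \<Longrightarrow> lc s1 = lc s' \<Longrightarrow> lh s1 = lh s' \<Longrightarrow>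
  lxb C x p s T (s' :: lst)"
  by (subgoal_tac "s1 = s'") (auto intro!: lst.equality)

lemma lst_eqI: "rg s = rg s' \<Longrightarrow> li s = li s' \<Longrightarrow> lc s = lc s' \<Longrightarrow> lh s = lh s' \<Longrightarrow> s = (s' :: lst)"
  by simp

lemma comp_Var:
  assumes "k < length vs" "vs ! k \<le> B" "10 * B + 10 < C" "okst f vs \<tau> s" "D = f + length vs"
  shows "lxb C x (comp (Var k) f D) s (10 * B + 10) (s\<lparr>rg := (rg s)(3 * D := vs ! k)\<rparr>)"
proof -
  have z: "rg s (3 * D) = 0" "rg s (3 * D + 1) = 0" "rg s (3 * (f + k)) = vs ! k"
    using assms okst_zero[of f vs \<tau> s D] by (auto simp: okst_def)
  have ne: "3 * (f + k) \<noteq> 3 * D" "3 * (f + k) \<noteq> 3 * D + 1" using assms by auto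
  show ?thesis unfolding comp.simps
    by (rule lxb_Seq[OF lxb_cp[where T="6 * B + 1"] lxb_eqI[OF lxb_mv[where T="4 * B + 1"]]])
      (use assms z ne in \<open>auto simp: fun_eq_iff\<close>)
qed

lemma comp_Len:
  assumes "length x + 2 \<le> B" "20 * B + 30 < C" "okst f vs \<tau> s" "D = f + length vs"
  shows "lxb C x (comp Len f D) s (20 * B + 30) (s\<lparr>rg := (rg s)(3 * D := length x)\<rparr>)"
proof -
  let ?a = "3 * D" and ?b = "3 * D + 1"
  have z: "rg s ?a = 0" "rg s ?b = 0" "li s = 0"
    using assms okst_zero[of f vs \<tau> s D] by (auto simp: okst_def)
  define s1 where "s1 = s\<lparr>rg := (rg s)(?b := 1), li := 1\<rparr>"
  define S where "S j = (if j \<le> length x then s\<lparr>rg := (rg s)(?a := j, ?b := 1), li := j + 1\<rparr>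
    else s\<lparr>rg := (rg s)(?a := length x), li := length x + 1\<rparr>)" for j
  have W: "lxb C x (While ?b (IfIn (Dec ?b) (Seq (Inc ?a) (InM MvR)) (Seq (Inc ?a) (InM MvR)))) (S 0) (5 * B + 1) (S (length x + 1))"
  proof (rule lxb_While[where T = 4])
    fix j assume j: "j < length x + 1"
    have "lxb C x (IfIn (Dec ?b) (Seq (Inc ?a) (InM MvR)) (Seq (Inc ?a) (InM MvR))) (S j) 4 (S (Suc j))"
    proof (cases "j < length x")
      case True
      have i: "lxb C x (Seq (Inc ?a) (InM MvR)) (S j) 3 (S (Suc j))"
        by (rule lxb_Seq[OF lxb_Inc[where T=1, OF _ _ refl] lxb_InM[where T=1]])
          (use True assms in \<open>auto simp: S_def fun_eq_iff\<close>)
      have "insym x (li (S j)) \<noteq> None" using True by (simp add: S_def insym_def)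
      then show ?thesis using i by (intro lxb_IfIn[where T = 3]) auto
    next
      case False
      then have jj: "j = length x" using j by simp
      have i: "lxb C x (Dec ?b) (S j) 3 (S (Suc j))"
        by (rule lxb_Dec) (use jj z in \<open>auto simp: S_def fun_eq_iff\<close>)
      have "insym x (li (S j)) = None" using jj by (simp add: S_def insym_def)
      then show ?thesis using i by (intro lxb_IfIn[where T = 3]) auto
    qed
    then show "rg (S j) ?b \<noteq> 0 \<and> lxb C x (IfIn (Dec ?b) (Seq (Inc ?a) (InM MvR)) (Seq (Inc ?a) (InM MvR))) (S j) 4 (S (Suc j))"
      using j by (simp add: S_def)
  qed (use z assms in \<open>auto simp: S_def\<close>)
  have 1: "lxb C x (InM MvR) s 1 (s\<lparr>li := 1\<rparr>)" using z by (intro lxb_InM) auto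
  have 2: "lxb C x (Inc ?b) (s\<lparr>li := 1\<rparr>) 1 (S 0)"
    using z assms by (intro lxb_Inc) (auto simp: S_def fun_eq_iff)
  define s3 where "s3 = s\<lparr>rg := (rg s)(?b := length x), li := 1\<rparr>"
  have 3: "lxb C x (goi ?a ?b MvL) (S (length x + 1)) (6 * B + 1) s3"
    by (rule lxb_eqI[OF lxb_goi]) (use z assms in \<open>auto simp: S_def s3_def fun_eq_iff pred_funpow\<close>)
  define s4 where "s4 = s3\<lparr>li := 0\<rparr>"
  have 4: "lxb C x (InM MvL) s3 1 s4" by (intro lxb_InM) (auto simp: s3_def s4_def)
  have 5: "lxb C x (mv ?b ?a) s4 (4 * B + 1) (s\<lparr>rg := (rg s)(3 * D := length x)\<rparr>)"
    by (rule lxb_eqI[OF lxb_mv]) (use z assms in \<open>auto simp: s3_def s4_def fun_eq_iff\<close>)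
  show ?thesis unfolding comp.simps
    by (rule lxb_Seq[OF 1 lxb_Seq[OF 2 lxb_Seq[OF W lxb_Seq[OF 3 lxb_Seq[OF 4 5 order_refl] order_refl] order_refl] order_refl]])
      simp
qed

text \<open>In contrast to \<open>lxb_While\<close> the intermediate states are not given by a
  function: of the final state of a compiled command only an invariant is known.\<close>

lemma lxb_While_inv:
  assumes "\<And>j s. j < n \<Longrightarrow> I j s \<Longrightarrow> rg s r \<noteq> 0 \<and> (\<exists>s'. I (Suc j) s' \<and> lxb C x b s T s')"
    "\<And>s. I n s \<Longrightarrow> rg s r = 0" "I 0 s"
  shows "\<exists>s'. I n s' \<and> lxb C x (While r b) s (n * (T + 1) + 1) s'"
proof -
  have "\<exists>s'. I n s' \<and> lxb C x (While r b) s ((n - j) * (T + 1) + 1) s'" if "j \<le> n" "I j s" for j s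
    using that
  proof (induction j arbitrary: s rule: inc_induct)
    case base
    then have "lxb C x (While r b) s 1 s" using assms(2) unfolding lxb_def by (metis lx_WhileF order_refl)
    then show ?case using base by auto
  next
    case (step j)
    obtain s1 where s1: "rg s r \<noteq> 0" "I (Suc j) s1" "lxb C x b s T s1"
      using step assms(1) by blast
    obtain s2 where s2: "I n s2" "lxb C x (While r b) s1 ((n - Suc j) * (T + 1) + 1) s2"
      using step.IH[OF s1(2)] by blast
    obtain t1 t2 where t: "t1 \<le> T" "lx C x b s t1 s1"
      "t2 \<le> (n - Suc j) * (T + 1) + 1" "lx C x (While r b) s1 t2 s2"
      using s1 s2 by (auto simp: lxb_def)
    have "n - j = Suc (n - Suc j)" using step by simp
    then have "t1 + t2 + 1 \<le> (n - j) * (T + 1) + 1" using t by simp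
    then have "lxb C x (While r b) s ((n - j) * (T + 1) + 1) s2"
      unfolding lxb_def using lx_WhileT[OF s1(1) t(2) t(4)] by blast
    then show ?case using s2 by blast
  qed
  from this[of 0 s] assms(3) show ?thesis by simp
qed

lemma okst_var: "okst f vs \<tau> s \<Longrightarrow> k < length vs \<Longrightarrow> rg s (3 * (f + k)) = vs ! k"
  by (simp add: okst_def)

lemma okst_scratch: "okst f vs \<tau> s \<Longrightarrow> 3 * (f + length vs) \<le> r \<Longrightarrow> rg s r = 0"
  by (simp add: okst_def)

lemma frm_snoc: "\<not> frm f (Suc v) r \<longleftrightarrow> \<not> frm f v r \<and> r \<noteq> 3 * (f + v)"
  by (auto simp: frm_def less_Suc_eq)

text \<open>One number bounds time, value, registers and addresses at once. So
  \<open>GE e B < C\<close> excludes overflow, and \<open>GE e B \<le> length \<tau>\<close> keeps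
  the catalytic head from being stopped by the right end of the tape.\<close>

lemma comp_correct:
  assumes xB: "\<And>B. P B \<longleftrightarrow> length x + 2 \<le> B"
  shows "wfe e (length vs) \<Longrightarrow> und e x vs \<tau> \<Longrightarrow> \<forall>v\<in>set vs. v \<le> B \<Longrightarrow> P B \<Longrightarrow> GE e B < C \<Longrightarrow>
      GE e B \<le> length \<tau> \<Longrightarrow> okst f vs \<tau> s \<Longrightarrow>
      lxb C x (comp e f (f + length vs)) s (GE e B) (s\<lparr>rg := (rg s)(3 * (f + length vs) := eval e x vs \<tau>)\<rparr>)"
    and "wfc c (length vs) \<Longrightarrow> undc c x (vs, \<tau>) \<Longrightarrow> \<forall>v\<in>set vs. v \<le> B \<Longrightarrow> P B \<Longrightarrow> GC c B < C \<Longrightarrow>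
      GC c B \<le> length \<tau> \<Longrightarrow> okst f vs \<tau> s \<Longrightarrow>
      \<exists>s'. lxb C x (compc c f (f + length vs)) s (GC c B) s' \<and>
        okst f (fst (exec c x (vs, \<tau>))) (snd (exec c x (vs, \<tau>))) s' \<and>
        (\<forall>r. \<not> frm f (length vs) r \<longrightarrow> rg s' r = rg s r)"
proof (induction e and c arbitrary: vs \<tau> B f s and vs \<tau> B f s)
  case (Var k)
  then have "vs ! k \<le> B" by simp
  then have "lxb C x (comp (Var k) f (f + length vs)) s (10 * B + 10) (s\<lparr>rg := (rg s)(3 * (f + length vs) := vs ! k)\<rparr>)"
    using Var.prems by (intro comp_Var[of k vs B C f \<tau> s]) (simp_all only: wfe.simps GE.simps)
  then show ?case by (simp only: GE.simps eval.simps)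
next
  case (Cn n)
  then have "rg s (3 * (f + length vs)) = 0" using okst_zero by blast
  then have "lxb C x (incs n (3 * (f + length vs))) s (2 * n + 2) (s\<lparr>rg := (rg s)(3 * (f + length vs) := n)\<rparr>)"
    using lxb_incs[of s "3 * (f + length vs)" n C "2 * n + 2" x] Cn.prems by simp
  then show ?case by (simp only: GE.simps eval.simps comp.simps)
next
  case Len
  then have "lxb C x (comp Len f (f + length vs)) s (20 * B + 30) (s\<lparr>rg := (rg s)(3 * (f + length vs) := length x)\<rparr>)"
    using xB by (intro comp_Len[of x B C f vs \<tau> s]) (simp_all only: wfe.simps GE.simps)
  then show ?case by (simp only: GE.simps eval.simps)
next
  case (Inp e)
  define D u s1 where "D = f + length vs" and "u = eval e x vs \<tau>" and "s1 = s\<lparr>rg := (rg s)(3 * D := u)\<rparr>"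
  have 1: "lxb C x (comp e f D) s (GE e B) s1" unfolding s1_def D_def u_def using Inp.prems by (intro Inp.IH) auto
  have u: "u \<le> GE e B" unfolding u_def using Inp.prems xB by (intro eval_exec_bound) auto
  have z: "rg s (3 * D) = 0" "rg s (3 * D + 1) = 0" "rg s (3 * D + 2) = 0" "li s = 0"
    using Inp.prems okst_zero[of f vs \<tau> s D] by (auto simp: okst_def D_def)
  define w where "w = eval (Inp e) x vs \<tau>"
  define s2 where "s2 = s\<lparr>rg := (rg s)(3 * D + 1 := u), li := min u (length x + 1)\<rparr>"
  define s3 where "s3 = s2\<lparr>rg := (rg s2)(3 * D + 2 := w)\<rparr>"
  define s4 where "s4 = s\<lparr>rg := (rg s)(3 * D + 2 := w)\<rparr>"
  have 2: "lxb C x (goi (3 * D) (3 * D + 1) MvR) s1 (6 * GE e B + 1) s2"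
    by (rule lxb_eqI[OF lxb_goi])
      (use u z Inp.prems in \<open>auto simp: s1_def s2_def fun_eq_iff succ_min_funpow\<close>)
  have ins: "insym x (li s2) = insym x u" by (auto simp: s2_def insym_def)
  have 3: "lxb C x (IfIn Skip (Inc (3 * D + 2)) (Seq (Inc (3 * D + 2)) (Inc (3 * D + 2)))) s2 4 s3"
  proof (rule lxb_IfIn[where T = 3])
    assume "insym x (li s2) = None"
    then have "w = 0" using ins by (simp add: w_def u_def)
    then have "s3 = s2" using z by (intro lst_eqI) (auto simp: s3_def s2_def fun_eq_iff)
    then show "lxb C x Skip s2 3 s3" by (simp add: lxb_Skip)
  next
    assume "insym x (li s2) = Some False"
    then have "w = 1" using ins by (simp add: w_def u_def)
    then show "lxb C x (Inc (3 * D + 2)) s2 3 s3" using z Inp.prems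
      by (intro lxb_Inc) (auto simp: s3_def s2_def fun_eq_iff)
  next
    assume "insym x (li s2) = Some True"
    then have "w = 2" using ins by (simp add: w_def u_def)
    then show "lxb C x (Seq (Inc (3 * D + 2)) (Inc (3 * D + 2))) s2 3 s3" using z Inp.prems
      by (intro lxb_Seq[OF lxb_Inc[where T=1, OF _ _ refl] lxb_Inc[where T=1]]) (auto simp: s3_def s2_def fun_eq_iff)
  qed simp
  have 4: "lxb C x (bki (3 * D + 1)) s3 (4 * GE e B + 1) s4"
    by (rule lxb_eqI[OF lxb_bki]) (use u z in \<open>auto simp: s3_def s2_def s4_def fun_eq_iff\<close>)
  have w: "w \<le> 2" by (auto simp: w_def split: option.splits)
  have 5: "lxb C x (mv (3 * D + 2) (3 * D)) s4 9 (s\<lparr>rg := (rg s)(3 * D := w)\<rparr>)"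
    by (rule lxb_eqI[OF lxb_mv]) (use w z Inp.prems in \<open>auto simp: s4_def fun_eq_iff\<close>)
  show ?case unfolding comp.simps D_def[symmetric] w_def[symmetric]
    by (rule lxb_Seq[OF 1 lxb_Seq[OF 2 lxb_Seq[OF 3 lxb_Seq[OF 4 5 order_refl] order_refl] order_refl]]) simp
next
  case (Cat e)
  define D u s1 where "D = f + length vs" and "u = eval e x vs \<tau>" and "s1 = s\<lparr>rg := (rg s)(3 * D := u)\<rparr>"
  have 1: "lxb C x (comp e f D) s (GE e B) s1" unfolding s1_def D_def u_def using Cat.prems by (intro Cat.IH) auto
  have u: "u \<le> GE e B" unfolding u_def using Cat.prems xB by (intro eval_exec_bound) auto
  have z: "rg s (3 * D) = 0" "rg s (3 * D + 1) = 0" "rg s (3 * D + 2) = 0" "lh s = 0" "lc s = \<tau>"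
    using Cat.prems okst_zero[of f vs \<tau> s D] by (auto simp: okst_def D_def)
  define w where "w = eval (Cat e) x vs \<tau>"
  define s2 where "s2 = s\<lparr>rg := (rg s)(3 * D + 1 := u), lh := u\<rparr>"
  define s3 where "s3 = s2\<lparr>rg := (rg s2)(3 * D + 2 := w)\<rparr>"
  define s4 where "s4 = s\<lparr>rg := (rg s)(3 * D + 2 := w)\<rparr>"
  have 2: "lxb C x (goc (3 * D) (3 * D + 1)) s1 (6 * GE e B + 1) s2"
    by (rule lxb_eqI[OF lxb_goc]) (use u z Cat.prems in \<open>auto simp: s1_def s2_def fun_eq_iff\<close>)
  have 3: "lxb C x (IfCat (Inc (3 * D + 2)) Skip) s2 4 s3"
  proof (rule lxb_IfCat[where T = 3])
    assume "\<not> rd (lc s2) (lh s2)"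
    then have "w = 0" using z by (simp add: w_def u_def s2_def)
    then have "s3 = s2" using z by (intro lst_eqI) (auto simp: s3_def s2_def fun_eq_iff)
    then show "lxb C x Skip s2 3 s3" by (simp add: lxb_Skip)
  next
    assume "rd (lc s2) (lh s2)"
    then have "w = 1" using z by (simp add: w_def u_def s2_def)
    then show "lxb C x (Inc (3 * D + 2)) s2 3 s3" using z Cat.prems
      by (intro lxb_Inc) (auto simp: s3_def s2_def fun_eq_iff)
  qed simp
  have 4: "lxb C x (bkc (3 * D + 1)) s3 (4 * GE e B + 1) s4"
    by (rule lxb_eqI[OF lxb_bkc]) (use u z in \<open>auto simp: s3_def s2_def s4_def fun_eq_iff\<close>)
  have w: "w \<le> 2" by (auto simp: w_def of_bool_def)
  have 5: "lxb C x (mv (3 * D + 2) (3 * D)) s4 9 (s\<lparr>rg := (rg s)(3 * D := w)\<rparr>)"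
    by (rule lxb_eqI[OF lxb_mv]) (use w z Cat.prems in \<open>auto simp: s4_def fun_eq_iff\<close>)
  show ?case unfolding comp.simps D_def[symmetric] w_def[symmetric]
    by (rule lxb_Seq[OF 1 lxb_Seq[OF 2 lxb_Seq[OF 3 lxb_Seq[OF 4 5 order_refl] order_refl] order_refl]]) simp
next
  case (Add a b)
  define D u where "D = f + length vs" and "u = eval a x vs \<tau>"
  define w s1 s2 where "w = eval b x (vs @ [u]) \<tau>" and "s1 = s\<lparr>rg := (rg s)(3 * D := u)\<rparr>"
    and "s2 = s1\<lparr>rg := (rg s1)(3 * (D + 1) := w)\<rparr>"
  have u: "u \<le> GE a B" unfolding u_def using Add.prems xB by (intro eval_exec_bound) auto
  have w: "w \<le> GE b (B + GE a B)" unfolding w_def using Add.prems xB u by (intro eval_exec_bound) (auto simp: u_def)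
  have 1: "lxb C x (comp a f D) s (GE a B) s1" unfolding s1_def D_def u_def using Add.prems by (intro Add.IH) auto
  have bb: "\<forall>v\<in>set (vs @ [u]). v \<le> B + GE a B" using Add.prems u by (auto intro: trans_le_add1 trans_le_add2)
  have ok: "okst f (vs @ [u]) \<tau> s1" using Add.prems okst_snoc by (simp add: s1_def D_def)
  have 2: "lxb C x (comp b f (D + 1)) s1 (GE b (B + GE a B)) s2"
    using Add.IH(2)[of "vs @ [u]" \<tau> "B + GE a B" f s1] Add.prems ok u xB bb by (auto simp: s2_def w_def D_def u_def fun_upd_def)
  have z: "rg s (3 * D + 3) = 0" "rg s (3 + 3 * D) = 0" using Add.prems okst_zero[of f vs \<tau> s D] by (auto simp: D_def)
  have 3: "lxb C x (mv (3 * (D + 1)) (3 * D)) s2 (4 * GE b (B + GE a B) + 1) (s\<lparr>rg := (rg s)(3 * D := u + w)\<rparr>)"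
    by (rule lxb_eqI[OF lxb_mv]) (use u w z Add.prems in \<open>auto simp: s1_def s2_def fun_eq_iff\<close>)
  show ?case using lxb_Seq[OF 1 lxb_Seq[OF 2 3 order_refl], of "GE (Add a b) B"]
    by (simp add: D_def u_def w_def fun_upd_def)
next
  case (Sub a b)
  define D u where "D = f + length vs" and "u = eval a x vs \<tau>"
  define w s1 s2 where "w = eval b x (vs @ [u]) \<tau>" and "s1 = s\<lparr>rg := (rg s)(3 * D := u)\<rparr>"
    and "s2 = s1\<lparr>rg := (rg s1)(3 * (D + 1) := w)\<rparr>"
  have u: "u \<le> GE a B" unfolding u_def using Sub.prems xB by (intro eval_exec_bound) auto
  have w: "w \<le> GE b (B + GE a B)" unfolding w_def using Sub.prems xB u by (intro eval_exec_bound) (auto simp: u_def)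
  have 1: "lxb C x (comp a f D) s (GE a B) s1" unfolding s1_def D_def u_def using Sub.prems by (intro Sub.IH) auto
  have bb: "\<forall>v\<in>set (vs @ [u]). v \<le> B + GE a B" using Sub.prems u by (auto intro: trans_le_add1 trans_le_add2)
  have ok: "okst f (vs @ [u]) \<tau> s1" using Sub.prems okst_snoc by (simp add: s1_def D_def)
  have 2: "lxb C x (comp b f (D + 1)) s1 (GE b (B + GE a B)) s2"
    using Sub.IH(2)[of "vs @ [u]" \<tau> "B + GE a B" f s1] Sub.prems ok u xB bb by (auto simp: s2_def w_def D_def u_def fun_upd_def)
  have z: "rg s (3 * D + 3) = 0" "rg s (3 + 3 * D) = 0" using Sub.prems okst_zero[of f vs \<tau> s D] by (auto simp: D_def)
  have 3: "lxb C x (sbt (3 * D) (3 * (D + 1))) s2 (5 * GE b (B + GE a B) + 1) (s\<lparr>rg := (rg s)(3 * D := u - w)\<rparr>)"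
    by (rule lxb_eqI[OF lxb_sbt]) (use u w z Sub.prems in \<open>auto simp: s1_def s2_def fun_eq_iff\<close>)
  show ?case using lxb_Seq[OF 1 lxb_Seq[OF 2 3 order_refl], of "GE (Sub a b) B"]
    by (simp add: D_def u_def w_def fun_upd_def)
next
  case (Ite e a b)
  define D u where "D = f + length vs" and "u = eval e x vs \<tau>"
  define s1 where "s1 = s\<lparr>rg := (rg s)(3 * D := u)\<rparr>"
  have u: "u \<le> GE e B" unfolding u_def using Ite.prems xB by (intro eval_exec_bound) auto
  have 1: "lxb C x (comp e f D) s (GE e B) s1" unfolding s1_def D_def u_def using Ite.prems by (intro Ite.IH) auto
  have z: "rg s (3 * D) = 0" using Ite.prems okst_zero[of f vs \<tau> s D] by (auto simp: D_def)
  define s3 where "s3 = s\<lparr>rg := (rg s)(3 * D := eval (Ite e a b) x vs \<tau>)\<rparr>"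
  have 2: "lxb C x (IfNZ (3 * D) (Seq (clr (3 * D)) (comp a f D)) (comp b f D)) s1 (2 * GE e B + GE a B + GE b B + 3) s3"
  proof (rule lxb_IfNZ[OF _ _ order_refl[THEN le_trans]])
    assume "rg s1 (3 * D) \<noteq> 0"
    then have u0: "u \<noteq> 0" by (simp add: s1_def)
    have c: "lxb C x (clr (3 * D)) s1 (2 * GE e B + 1) s"
      by (rule lxb_eqI[OF lxb_clr]) (use u z in \<open>auto simp: s1_def fun_eq_iff intro!: lst_eqI\<close>)
    have "lxb C x (comp a f D) s (GE a B) s3"
      using Ite.IH(2)[of vs \<tau> B f s] Ite.prems u0 by (auto simp: s3_def D_def u_def fun_upd_def)
    then show "lxb C x (Seq (clr (3 * D)) (comp a f D)) s1 (2 * GE e B + GE a B + GE b B + 2) s3"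
      by (rule lxb_Seq[OF c]) simp
  next
    assume "rg s1 (3 * D) = 0"
    then have u0: "u = 0" by (simp add: s1_def)
    then have "s1 = s" using z by (intro lst_eqI) (auto simp: s1_def fun_eq_iff)
    moreover have "lxb C x (comp b f D) s (GE b B) s3"
      using Ite.IH(3)[of vs \<tau> B f s] Ite.prems u0 by (auto simp: s3_def D_def u_def fun_upd_def)
    ultimately show "lxb C x (comp b f D) s1 (2 * GE e B + GE a B + GE b B + 2) s3"
      by (auto intro: lxb_mono)
  qed simp
  show ?case using lxb_Seq[OF 1 2, of "GE (Ite e a b) B"] by (simp add: D_def s3_def fun_upd_def)
next
  case (Sum a b)
  define D u B' where "D = f + length vs" and "u = eval a x vs \<tau>" and "B' = B + GE a B"
  define w where "w i = eval b x (vs @ [i]) \<tau>" for i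
  define s1 where "s1 = s\<lparr>rg := (rg s)(3 * D := u)\<rparr>"
  have u: "u \<le> GE a B" unfolding u_def using Sum.prems xB by (intro eval_exec_bound) auto
  have w: "w i \<le> GE b B'" if "i < u" for i
    unfolding w_def using Sum.prems xB u that by (intro eval_exec_bound) (auto simp: B'_def)
  have ws: "(\<Sum>i<j. w i) \<le> GE a B * GE b B'" if "j \<le> u" for j
  proof -
    have "(\<Sum>i<j. w i) \<le> of_nat (card {..<j}) * GE b B'"
      using w that by (intro sum_bounded_above) auto
    also have "\<dots> \<le> GE a B * GE b B'" using that u by simp
    finally show ?thesis .
  qed
  have C: "GE a B * GE b B' + GE a B + GE b B' + 2 < C" using Sum.prems(5) by (simp add: B'_def algebra_simps)
  have prod: "GE b B' \<le> GE (Sum a b) B" "GE a B \<le> GE (Sum a b) B" by (simp_all add: B'_def algebra_simps)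
  have 1: "lxb C x (comp a f D) s (GE a B) s1" unfolding s1_def D_def u_def using Sum.prems C prod by (intro Sum.IH) auto
  have z: "rg s (3 * D) = 0" "rg s (3 * D + 1) = 0" "rg s (3 * D + 2) = 0" "rg s (3 * D + 3) = 0" "rg s (3 + 3 * D) = 0"
    using Sum.prems okst_zero[of f vs \<tau> s D] by (auto simp: D_def)
  define S where "S j = s\<lparr>rg := (rg s)(3 * D := j, 3 * D + 1 := u - j, 3 * D + 2 := (\<Sum>i<j. w i))\<rparr>" for j
  have 2: "lxb C x (mv (3 * D) (3 * D + 1)) s1 (4 * GE a B + 1) (S 0)"
    by (rule lxb_eqI[OF lxb_mv]) (use u z C in \<open>auto simp: s1_def S_def fun_eq_iff\<close>)
  let ?body = "Seq (comp b f (D + 1)) (Seq (mv (3 * (D + 1)) (3 * D + 2)) (Seq (Inc (3 * D)) (Dec (3 * D + 1))))"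
  have 3: "lxb C x (While (3 * D + 1) ?body) (S 0) (GE a B * (5 * GE b B' + 10) + 1) (S u)"
  proof (rule lxb_While[where T = "5 * GE b B' + 8"])
    fix j assume j: "j < u"
    have ok: "okst f (vs @ [j]) \<tau> (S j)"
    proof -
      have "okst f (vs @ [j]) \<tau> (s\<lparr>rg := (rg s)(3 * D := j)\<rparr>)"
        using Sum.prems okst_snoc by (simp add: D_def)
      then show ?thesis by (auto simp: okst_def S_def D_def)
    qed
    have bb: "\<forall>v\<in>set (vs @ [j]). v \<le> B'" using Sum.prems u j by (auto simp: B'_def intro: trans_le_add1)
    define t1 where "t1 = (S j)\<lparr>rg := (rg (S j))(3 * (D + 1) := w j)\<rparr>"
    define t2 where "t2 = (S j)\<lparr>rg := (rg (S j))(3 * D + 2 := (\<Sum>i<Suc j. w i))\<rparr>"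
    define t3 where "t3 = t2\<lparr>rg := (rg t2)(3 * D := Suc j)\<rparr>"
    have b1: "lxb C x (comp b f (D + 1)) (S j) (GE b B') t1"
      using Sum.IH(2)[of "vs @ [j]" \<tau> B' f "S j"] Sum.prems ok u j xB C prod bb
      by (auto simp: t1_def w_def D_def u_def B'_def fun_upd_def)
    have b2: "lxb C x (mv (3 * (D + 1)) (3 * D + 2)) t1 (4 * GE b B' + 1) t2"
      by (rule lxb_eqI[OF lxb_mv])
        (use w[OF j] ws[of j] j z C in \<open>auto simp: t1_def t2_def S_def fun_eq_iff\<close>)
    have b3: "lxb C x (Inc (3 * D)) t2 1 t3"
      using j u C by (intro lxb_Inc) (auto simp: t2_def t3_def S_def fun_eq_iff)
    have b4: "lxb C x (Dec (3 * D + 1)) t3 1 (S (Suc j))"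
      using j u C by (intro lxb_Dec) (auto simp: t2_def t3_def S_def fun_eq_iff)
    have "lxb C x ?body (S j) (5 * GE b B' + 8) (S (Suc j))"
      by (rule lxb_Seq[OF b1 lxb_Seq[OF b2 lxb_Seq[OF b3 b4 order_refl] order_refl]]) simp
    then show "rg (S j) (3 * D + 1) \<noteq> 0 \<and> lxb C x ?body (S j) (5 * GE b B' + 8) (S (Suc j))"
      using j by (simp add: S_def)
  next
    have "u * (5 * GE b B' + 8 + 1) \<le> GE a B * (5 * GE b B' + 10)" using u by (intro mult_mono) auto
    then show "u * (5 * GE b B' + 8 + 1) + 1 \<le> GE a B * (5 * GE b B' + 10) + 1" by simp
  qed (simp add: S_def)
  define s4 where "s4 = s\<lparr>rg := (rg s)(3 * D + 2 := (\<Sum>i<u. w i))\<rparr>"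
  have 4: "lxb C x (clr (3 * D)) (S u) (2 * GE a B + 1) s4"
    by (rule lxb_eqI[OF lxb_clr]) (use u z in \<open>auto simp: S_def s4_def fun_eq_iff\<close>)
  have 5: "lxb C x (mv (3 * D + 2) (3 * D)) s4 (4 * (GE a B * GE b B') + 1) (s\<lparr>rg := (rg s)(3 * D := (\<Sum>i<u. w i))\<rparr>)"
    by (rule lxb_eqI[OF lxb_mv]) (use ws[of u] z C in \<open>auto simp: s4_def fun_eq_iff\<close>)
  have "lxb C x (comp (Sum a b) f D) s (GE (Sum a b) B) (s\<lparr>rg := (rg s)(3 * D := (\<Sum>i<u. w i))\<rparr>)"
    unfolding comp.simps
    by (rule lxb_Seq[OF 1 lxb_Seq[OF 2 lxb_Seq[OF 3 lxb_Seq[OF 4 5 order_refl] order_refl] order_refl]])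
      (simp add: B'_def[symmetric] algebra_simps)
  then show ?case by (simp add: D_def u_def w_def fun_upd_def)
next
  case (Let a b)
  define D u where "D = f + length vs" and "u = eval a x vs \<tau>"
  define w s1 s2 where "w = eval b x (vs @ [u]) \<tau>" and "s1 = s\<lparr>rg := (rg s)(3 * D := u)\<rparr>"
    and "s2 = s1\<lparr>rg := (rg s1)(3 * (D + 1) := w)\<rparr>"
  have u: "u \<le> GE a B" unfolding u_def using Let.prems xB by (intro eval_exec_bound) auto
  have w: "w \<le> GE b (B + GE a B)" unfolding w_def using Let.prems xB u by (intro eval_exec_bound) (auto simp: u_def)
  have 1: "lxb C x (comp a f D) s (GE a B) s1" unfolding s1_def D_def u_def using Let.prems by (intro Let.IH) auto
  have bb: "\<forall>v\<in>set (vs @ [u]). v \<le> B + GE a B" using Let.prems u by (auto intro: trans_le_add1 trans_le_add2)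
  have ok: "okst f (vs @ [u]) \<tau> s1" using Let.prems okst_snoc by (simp add: s1_def D_def)
  have 2: "lxb C x (comp b f (D + 1)) s1 (GE b (B + GE a B)) s2"
    using Let.IH(2)[of "vs @ [u]" \<tau> "B + GE a B" f s1] Let.prems ok u xB bb by (auto simp: s2_def w_def D_def u_def fun_upd_def)
  have z: "rg s (3 * D) = 0" "rg s (3 * D + 3) = 0" "rg s (3 + 3 * D) = 0" using Let.prems okst_zero[of f vs \<tau> s D] by (auto simp: D_def)
  define s3 where "s3 = s\<lparr>rg := (rg s)(3 * (D + 1) := w)\<rparr>"
  have 3: "lxb C x (clr (3 * D)) s2 (2 * GE a B + 1) s3"
    by (rule lxb_eqI[OF lxb_clr]) (use u z in \<open>auto simp: s1_def s2_def s3_def fun_eq_iff\<close>)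
  have 4: "lxb C x (mv (3 * (D + 1)) (3 * D)) s3 (4 * GE b (B + GE a B) + 1) (s\<lparr>rg := (rg s)(3 * D := w)\<rparr>)"
    by (rule lxb_eqI[OF lxb_mv]) (use u w z Let.prems in \<open>auto simp: s3_def fun_eq_iff\<close>)
  show ?case using lxb_Seq[OF 1 lxb_Seq[OF 2 lxb_Seq[OF 3 4 order_refl] order_refl], of "GE (Let a b) B"]
    by (simp add: D_def u_def w_def fun_upd_def)
next
  case (Fresh k e)
  have l: "f + length vs - k + length (drop (length vs - k) vs) = f + length vs" using Fresh.prems by simp
  have "lxb C x (comp e (f + length vs - k) (f + length vs)) s (GE e B)
    (s\<lparr>rg := (rg s)(3 * (f + length vs) := eval e x (drop (length vs - k) vs) \<tau>)\<rparr>)"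
    using Fresh.IH[of "drop (length vs - k) vs" \<tau> B "f + length vs - k" s] Fresh.prems okst_drop[of f vs \<tau> s k] l
    by (auto dest: in_set_dropD simp: fun_upd_def)
  then show ?case by (simp add: fun_upd_def)
next
  case (After c e c')
  define D where "D = f + length vs"
  obtain vs' \<tau>' where S: "exec c x (vs, \<tau>) = (vs', \<tau>')" by fastforce
  note len = exec_len'[OF S]
  define u where "u = eval e x vs' \<tau>'"
  obtain s1 where s1: "lxb C x (compc c f D) s (GC c B) s1" "okst f vs' \<tau>' s1"
    "\<And>r. \<not> frm f (length vs) r \<Longrightarrow> rg s1 r = rg s r"
    using After.IH(1)[of vs \<tau> B f s] After.prems S by (auto simp: D_def)
  have vB: "\<forall>v\<in>set vs'. v \<le> B"
    using eval_exec_bound(2)[of c vs B x \<tau>] After.prems S xB by auto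
  have u: "u \<le> GE e B" unfolding u_def using After.prems xB vB len by (intro eval_exec_bound) auto
  define s2 where "s2 = s1\<lparr>rg := (rg s1)(3 * D := u)\<rparr>"
  have 2: "lxb C x (comp e f D) s1 (GE e B) s2"
    using After.IH(2)[of vs' \<tau>' B f s1] After.prems S s1 vB len by (simp add: s2_def D_def u_def fun_upd_def)
  have ok: "okst f (vs' @ [u]) \<tau>' s2" using s1(2) okst_snoc[of f vs' \<tau>' s1 u] len by (simp add: s2_def D_def)
  have bb: "\<forall>v\<in>set (vs' @ [u]). v \<le> B + GE e B" using vB u by (auto intro: trans_le_add1)
  obtain s3 where s3: "lxb C x (compc c' f (D + 1)) s2 (GC c' (B + GE e B)) s3" "okst f (vs @ [u]) \<tau> s3"
    "\<And>r. \<not> frm f (Suc (length vs)) r \<Longrightarrow> rg s3 r = rg s2 r"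
    using After.IH(3)[of "vs' @ [u]" \<tau>' "B + GE e B" f s2] After.prems S vB len u ok xB bb by (auto simp: D_def u_def)
  \<comment> \<open>On the frame the registers agree because the undoing command restores the
    values; elsewhere by the frame conditions of the two commands, up to the result in
    \<open>3 * D\<close>.\<close>
  have "s3 = s\<lparr>rg := (rg s)(3 * D := u)\<rparr>"
  proof (rule lst_eqI)
    show "rg s3 = rg (s\<lparr>rg := (rg s)(3 * D := u)\<rparr>)"
    proof
      fix r
      show "rg s3 r = rg (s\<lparr>rg := (rg s)(3 * D := u)\<rparr>) r"
      proof (cases "frm f (Suc (length vs)) r")
        case True
        then obtain k where k: "k < Suc (length vs)" "r = 3 * (f + k)" by (auto simp: frm_def)
        then show ?thesis using s3(2) After.prems(7) by (auto simp: okst_def nth_append D_def less_Suc_eq)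
      next
        case False
        then show ?thesis using s3(3)[OF False] s1(3)[of r] by (auto simp: frm_snoc s2_def D_def)
      qed
    qed
  qed (use s3(2) After.prems(7) in \<open>auto simp: okst_def\<close>)
  then have "lxb C x (comp (After c e c') f D) s (GE (After c e c') B) (s\<lparr>rg := (rg s)(3 * D := u)\<rparr>)"
    unfolding comp.simps using s3(1) by (intro lxb_Seq[OF s1(1) lxb_Seq[OF 2 _ order_refl]]) auto
  then show ?case by (simp add: D_def u_def S fun_upd_def)
next
  case (Assign k e)
  define D u where "D = f + length vs" and "u = eval e x vs \<tau>"
  have k: "0 < k" "k < length vs" using Assign.prems by auto
  have "vs ! 0 \<in> set vs" "vs ! k \<in> set vs" using k by (auto intro: nth_mem)
  then have v0: "vs ! 0 \<le> B" "vs ! k \<le> B" using Assign.prems by auto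
  have u: "u \<le> GE e B" unfolding u_def using Assign.prems xB by (intro eval_exec_bound) auto
  have "\<forall>i<length vs. rg s (3 * (f + i)) = vs ! i" using Assign.prems(7) by (simp add: okst_def)
  then have "rg s (3 * (f + 0)) = vs ! 0" using k by (metis gr_zeroI less_trans)
  then have z: "rg s (3 * D) = 0" "rg s (3 * D + 1) = 0" "rg s (3 * D + 2) = 0" "rg s (3 * D + 3) = 0" "rg s (3 + 3 * D) = 0"
      "rg s (3 * f) = vs ! 0" "rg s (3 * (f + k)) = vs ! k"
    using Assign.prems okst_zero[of f vs \<tau> s D] k by (auto simp: D_def okst_def)
  define s1 where "s1 = s\<lparr>rg := (rg s)(3 * D := u)\<rparr>"
  have 1: "lxb C x (comp e f D) s (GE e B) s1" unfolding s1_def D_def u_def using Assign.prems by (intro Assign.IH) auto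
  have ne: "3 * f \<noteq> 3 * D" "3 * f \<noteq> 3 * (f + k)" "3 * (f + k) \<noteq> 3 * D" "3 * (f + k) \<noteq> 3 * D + 3" "3 * f \<noteq> 3 * D + 3"
    "3 * f \<noteq> 3 * D + 1" "3 * (f + k) \<noteq> 3 * D + 1"
    using k unfolding D_def by presburger+
  \<comment> \<open>The cap is copied out of variable 0 and put back; afterwards \<open>mnm\<close>
    leaves the minimum of value and cap in the target.\<close>
  define s2 where "s2 = s1\<lparr>rg := (rg s1)(3 * (D + 1) := vs ! 0, 3 * D + 1 := vs ! 0, 3 * f := 0)\<rparr>"
  have 2: "lxb C x (cp (3 * f) (3 * (D + 1)) (3 * D + 1)) s1 (6 * B + 1) s2"
    by (rule lxb_eqI[OF lxb_cp]) (use z ne v0 Assign.prems in \<open>auto simp: s1_def s2_def fun_eq_iff\<close>)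
  define s3 where "s3 = s1\<lparr>rg := (rg s1)(3 * (D + 1) := vs ! 0)\<rparr>"
  have 3: "lxb C x (mv (3 * D + 1) (3 * f)) s2 (4 * B + 1) s3"
    by (rule lxb_eqI[OF lxb_mv]) (use z ne v0 Assign.prems in \<open>auto simp: s1_def s2_def s3_def fun_eq_iff\<close>)
  define s4 where "s4 = s3\<lparr>rg := (rg s3)(3 * (f + k) := 0)\<rparr>"
  have 4: "lxb C x (clr (3 * (f + k))) s3 (2 * B + 1) s4"
    by (rule lxb_eqI[OF lxb_clr]) (use z ne v0 in \<open>auto simp: s1_def s3_def s4_def fun_eq_iff\<close>)
  define s5 where "s5 = s\<lparr>rg := (rg s)(3 * D := u - vs ! 0, 3 * (f + k) := min u (vs ! 0))\<rparr>"
  have 5: "lxb C x (mnm (3 * D) (3 * (D + 1)) (3 * (f + k))) s4 (7 * B + 1) s5"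
    by (rule lxb_eqI[OF lxb_mnm]) (use z ne v0 u Assign.prems in \<open>auto simp: s1_def s3_def s4_def s5_def fun_eq_iff\<close>)
  define s6 where "s6 = s\<lparr>rg := (rg s)(3 * (f + k) := min u (vs ! 0))\<rparr>"
  have 6: "lxb C x (clr (3 * D)) s5 (2 * GE e B + 1) s6"
    by (rule lxb_eqI[OF lxb_clr]) (use z ne v0 u in \<open>auto simp: s5_def s6_def fun_eq_iff\<close>)
  have "lxb C x (compc (Assign k e) f D) s (GC (Assign k e) B) s6"
    unfolding compc.simps
    by (rule lxb_Seq[OF 1 lxb_Seq[OF 2 lxb_Seq[OF 3 lxb_Seq[OF 4 lxb_Seq[OF 5 6 order_refl] order_refl] order_refl] order_refl]]) simp
  moreover have "okst f (vs[k := min u (vs ! 0)]) \<tau> s6"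
    using Assign.prems(7) k by (auto simp: okst_def s6_def nth_list_update)
  moreover have "rg s6 r = rg s r" if "\<not> frm f (length vs) r" for r
    using that k by (auto simp: s6_def frm_def)
  ultimately show ?case by (auto simp: D_def u_def)
next
  case (Write a e)
  define D u where "D = f + length vs" and "u = eval a x vs \<tau>"
  define w s1 s2 where "w = eval e x (vs @ [u]) \<tau>" and "s1 = s\<lparr>rg := (rg s)(3 * D := u)\<rparr>"
    and "s2 = s1\<lparr>rg := (rg s1)(3 * (D + 1) := w)\<rparr>"
  have u: "u \<le> GE a B" unfolding u_def using Write.prems xB by (intro eval_exec_bound) auto
  have w: "w \<le> GE e (B + GE a B)" unfolding w_def using Write.prems xB u by (intro eval_exec_bound) (auto simp: u_def)
  have 1: "lxb C x (comp a f D) s (GE a B) s1" unfolding s1_def D_def u_def using Write.prems by (intro Write.IH) auto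
  have bb: "\<forall>v\<in>set (vs @ [u]). v \<le> B + GE a B" using Write.prems u by (auto intro: trans_le_add1 trans_le_add2)
  have ok: "okst f (vs @ [u]) \<tau> s1" using Write.prems okst_snoc by (simp add: s1_def D_def)
  have 2: "lxb C x (comp e f (D + 1)) s1 (GE e (B + GE a B)) s2"
    using Write.IH(2)[of "vs @ [u]" \<tau> "B + GE a B" f s1] Write.prems ok u xB bb by (auto simp: s2_def w_def D_def u_def fun_upd_def)
  have z: "rg s (3 * D) = 0" "rg s (3 * D + 1) = 0" "rg s (3 * D + 3) = 0" "rg s (3 + 3 * D) = 0" "lh s = 0" "lc s = \<tau>"
    using Write.prems okst_zero[of f vs \<tau> s D] by (auto simp: D_def okst_def)
  define s3 where "s3 = s\<lparr>rg := (rg s)(3 * D + 1 := u, 3 * (D + 1) := w), lh := u\<rparr>"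
  have 3: "lxb C x (goc (3 * D) (3 * D + 1)) s2 (6 * GE a B + 1) s3"
    by (rule lxb_eqI[OF lxb_goc]) (use u z Write.prems in \<open>auto simp: s1_def s2_def s3_def fun_eq_iff\<close>)
  define s4 where "s4 = s3\<lparr>lc := \<tau>[u := (w \<noteq> 0)]\<rparr>"
  have 4: "lxb C x (IfNZ (3 * (D + 1)) (CatW True) (CatW False)) s3 2 s4"
    by (rule lxb_IfNZ[where T=1]) (use z in \<open>auto intro!: lxb_CatW simp: s3_def s4_def\<close>)
  define s5 where "s5 = s\<lparr>rg := (rg s)(3 * (D + 1) := w), lc := \<tau>[u := (w \<noteq> 0)]\<rparr>"
  have 5: "lxb C x (bkc (3 * D + 1)) s4 (4 * GE a B + 1) s5"
    by (rule lxb_eqI[OF lxb_bkc]) (use u z in \<open>auto simp: s3_def s4_def s5_def fun_eq_iff\<close>)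
  define s6 where "s6 = s\<lparr>lc := \<tau>[u := (w \<noteq> 0)]\<rparr>"
  have 6: "lxb C x (clr (3 * (D + 1))) s5 (2 * GE e (B + GE a B) + 1) s6"
    by (rule lxb_eqI[OF lxb_clr]) (use w z in \<open>auto simp: s5_def s6_def fun_eq_iff intro!: lst_eqI\<close>)
  have "lxb C x (compc (Write a e) f D) s (GC (Write a e) B) s6"
    unfolding compc.simps
    by (rule lxb_Seq[OF 1 lxb_Seq[OF 2 lxb_Seq[OF 3 lxb_Seq[OF 4 lxb_Seq[OF 5 6 order_refl] order_refl] order_refl] order_refl]]) simp
  moreover have "okst f vs (\<tau>[u := (w \<noteq> 0)]) s6" using Write.prems(7) by (auto simp: okst_def s6_def)
  ultimately show ?case by (intro exI[of _ s6]) (auto simp: D_def u_def w_def s6_def)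
next
  case (CSeq c1 c2)
  define D where "D = f + length vs"
  obtain vs' \<tau>' where S: "exec c1 x (vs, \<tau>) = (vs', \<tau>')" by fastforce
  note len = exec_len'[OF S]
  obtain s1 where s1: "lxb C x (compc c1 f D) s (GC c1 B) s1" "okst f vs' \<tau>' s1"
    "\<And>r. \<not> frm f (length vs) r \<Longrightarrow> rg s1 r = rg s r"
    using CSeq.IH(1)[of vs \<tau> B f s] CSeq.prems S by (auto simp: D_def)
  have vB: "\<forall>v\<in>set vs'. v \<le> B"
    using eval_exec_bound(2)[of c1 vs B x \<tau>] CSeq.prems S xB by auto
  obtain s2 where s2: "lxb C x (compc c2 f D) s1 (GC c2 B) s2"
    "okst f (fst (exec c2 x (vs', \<tau>'))) (snd (exec c2 x (vs', \<tau>'))) s2"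
    "\<And>r. \<not> frm f (length vs) r \<Longrightarrow> rg s2 r = rg s1 r"
    using CSeq.IH(2)[of vs' \<tau>' B f s1] CSeq.prems S s1 vB len by (auto simp: D_def)
  have "lxb C x (compc (CSeq c1 c2) f D) s (GC (CSeq c1 c2) B) s2"
    unfolding compc.simps by (rule lxb_Seq[OF s1(1) s2(1)]) simp
  then show ?case using s1 s2 by (intro exI[of _ s2]) (auto simp: D_def S)
next
  case (CIf e c1 c2)
  define D u where "D = f + length vs" and "u = eval e x vs \<tau>"
  define s1 where "s1 = s\<lparr>rg := (rg s)(3 * D := u)\<rparr>"
  have u: "u \<le> GE e B" unfolding u_def using CIf.prems xB by (intro eval_exec_bound) auto
  have 1: "lxb C x (comp e f D) s (GE e B) s1" unfolding s1_def D_def u_def using CIf.prems by (intro CIf.IH) auto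
  have z: "rg s (3 * D) = 0" using CIf.prems okst_zero[of f vs \<tau> s D] by (auto simp: D_def)
  obtain s2 where s2: "lxb C x (if u \<noteq> 0 then compc c1 f D else compc c2 f D) s (GC c1 B + GC c2 B) s2"
    "okst f (fst (exec (CIf e c1 c2) x (vs, \<tau>))) (snd (exec (CIf e c1 c2) x (vs, \<tau>))) s2"
    "\<forall>r. \<not> frm f (length vs) r \<longrightarrow> rg s2 r = rg s r"
  proof (cases "u \<noteq> 0")
    case True
    then obtain s2 where "lxb C x (compc c1 f D) s (GC c1 B) s2"
      "okst f (fst (exec c1 x (vs, \<tau>))) (snd (exec c1 x (vs, \<tau>))) s2"
      "\<forall>r. \<not> frm f (length vs) r \<longrightarrow> rg s2 r = rg s r"
      using CIf.IH(2)[of vs \<tau> B f s] CIf.prems by (auto simp: D_def u_def)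
    moreover from this have "lxb C x (compc c1 f D) s (GC c1 B + GC c2 B) s2" by (auto elim: lxb_mono)
    ultimately show ?thesis using that True by (simp add: u_def)
  next
    case False
    then obtain s2 where "lxb C x (compc c2 f D) s (GC c2 B) s2"
      "okst f (fst (exec c2 x (vs, \<tau>))) (snd (exec c2 x (vs, \<tau>))) s2"
      "\<forall>r. \<not> frm f (length vs) r \<longrightarrow> rg s2 r = rg s r"
      using CIf.IH(3)[of vs \<tau> B f s] CIf.prems by (auto simp: D_def u_def)
    moreover from this have "lxb C x (compc c2 f D) s (GC c1 B + GC c2 B) s2" by (auto elim: lxb_mono)
    ultimately show ?thesis using that False by (simp add: u_def)
  qed
  have 2: "lxb C x (IfNZ (3 * D) (Seq (clr (3 * D)) (compc c1 f D)) (compc c2 f D)) s1 (2 * GE e B + GC c1 B + GC c2 B + 3) s2"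
  proof (rule lxb_IfNZ[OF _ _ order_refl[THEN le_trans]])
    assume "rg s1 (3 * D) \<noteq> 0"
    then have u0: "u \<noteq> 0" by (simp add: s1_def)
    have c: "lxb C x (clr (3 * D)) s1 (2 * GE e B + 1) s"
      by (rule lxb_eqI[OF lxb_clr]) (use u z in \<open>auto simp: s1_def fun_eq_iff intro!: lst_eqI\<close>)
    show "lxb C x (Seq (clr (3 * D)) (compc c1 f D)) s1 (2 * GE e B + GC c1 B + GC c2 B + 2) s2"
      by (rule lxb_Seq[OF c]) (use s2 u0 in auto)
  next
    assume "rg s1 (3 * D) = 0"
    then have u0: "u = 0" by (simp add: s1_def)
    then have "s1 = s" using z by (intro lst_eqI) (auto simp: s1_def fun_eq_iff)
    then show "lxb C x (compc c2 f D) s1 (2 * GE e B + GC c1 B + GC c2 B + 2) s2"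
      using s2 u0 by (auto intro: lxb_mono)
  qed simp
  have "lxb C x (compc (CIf e c1 c2) f D) s (GC (CIf e c1 c2) B) s2"
    unfolding compc.simps by (rule lxb_Seq[OF 1 2]) simp
  then show ?case using s2 by (intro exI[of _ s2]) (auto simp: D_def)
next
  case (Loop e c)
  define D u where "D = f + length vs" and "u = eval e x vs \<tau>"
  define s1 where "s1 = s\<lparr>rg := (rg s)(3 * D := u)\<rparr>"
  have u: "u \<le> GE e B" unfolding u_def using Loop.prems xB by (intro eval_exec_bound) auto
  have C: "GE e B + GC c B + B + 2 < C" using Loop.prems(5) by (simp add: algebra_simps)
  have le: "GE e B \<le> GC (Loop e c) B" "GC c B \<le> GC (Loop e c) B" by (simp_all add: algebra_simps)
  have 1: "lxb C x (comp e f D) s (GE e B) s1" unfolding s1_def D_def u_def using Loop.prems C le by (intro Loop.IH) auto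
  have z: "rg s (3 * D) = 0" "rg s (3 * D + 1) = 0" using Loop.prems okst_zero[of f vs \<tau> s D] by (auto simp: D_def)
  define s2 where "s2 = s\<lparr>rg := (rg s)(3 * D + 1 := u)\<rparr>"
  have 2: "lxb C x (mv (3 * D) (3 * D + 1)) s1 (4 * GE e B + 1) s2"
    by (rule lxb_eqI[OF lxb_mv]) (use u z C in \<open>auto simp: s1_def s2_def fun_eq_iff\<close>)
  define Z where "Z j = (loop1 (exec c x) ^^ j) (vs, \<tau>)" for j
  \<comment> \<open>The counter lives in \<open>3 * D + 1\<close>, a scratch register which
    \<open>okst\<close> wants to be 0 for the outer frame. Hence the invariant speaks of the state
    with the counter blanked out.\<close>
  define I where "I j t \<longleftrightarrow> rg t (3 * D + 1) = u - j \<and>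
     okst f (fst (Z j)) (snd (Z j)) (t\<lparr>rg := (rg t)(3 * D + 1 := 0)\<rparr>) \<and>
     (\<forall>r. \<not> frm f (length vs) r \<and> r \<noteq> 3 * D + 1 \<longrightarrow> rg t r = rg s r)" for j t
  have lenZ: "length (fst (Z j)) = length vs" "length (snd (Z j)) = length \<tau>" for j
    using loop1_len[of "exec c x" j vs \<tau>] exec_len by (auto simp: Z_def)
  have ZB: "\<forall>v\<in>set (fst (Z j)). v \<le> B" for j
  proof (induction j)
    case 0
    then show ?case using Loop.prems by (simp add: Z_def)
  next
    case (Suc j)
    obtain us \<sigma> where S: "Z j = (us, \<sigma>)" by fastforce
    have "\<forall>v\<in>set (fst (exec c x (us @ [0], \<sigma>))). v \<le> B"
      using eval_exec_bound(2)[of c "us @ [0]" B x \<sigma>] Suc S Loop.prems lenZ[of j] xB by auto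
    then show ?case using S by (auto simp: Z_def loop1_def split: prod.splits dest: in_set_takeD)
  qed
  let ?body = "Seq (compc c f (D + 1)) (Seq (clr (3 * D)) (Dec (3 * D + 1)))"
  have "\<exists>s'. I u s' \<and> lxb C x (While (3 * D + 1) ?body) s2 (u * ((GC c B + 2 * B + 4) + 1) + 1) s'"
  proof (rule lxb_While_inv)
    fix j t assume j: "j < u" and I: "I j t"
    obtain us \<sigma> where S: "Z j = (us, \<sigma>)" by fastforce
    have lus: "length us = length vs" "length \<sigma> = length \<tau>" using lenZ[of j] S by auto
    have o: "okst f us \<sigma> (t\<lparr>rg := (rg t)(3 * D + 1 := 0)\<rparr>)" using I by (simp add: I_def S)
    have zr: "rg t r = 0" if r: "3 * D \<le> r" "r \<noteq> 3 * D + 1" for r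
    proof -
      have "3 * (f + length us) \<le> r" using r(1) lus(1) by (simp only: D_def)
      then have "rg (t\<lparr>rg := (rg t)(3 * D + 1 := 0)\<rparr>) r = 0" by (rule okst_scratch[OF o])
      then show ?thesis using r(2) by simp
    qed
    have "rg t (3 * (f + k)) = us ! k" if k: "k < length vs" for k
    proof -
      have "rg (t\<lparr>rg := (rg t)(3 * D + 1 := 0)\<rparr>) (3 * (f + k)) = us ! k"
        using k lus(1) by (intro okst_var[OF o]) simp
      moreover have "3 * (f + k) \<noteq> 3 * D + 1" by presburger
      ultimately show ?thesis by simp
    qed
    then have ok: "okst f (us @ [0]) \<sigma> t"
      using o lus zr unfolding okst_def by (auto simp: nth_append D_def less_Suc_eq)
    have un: "undc c x (us @ [0], \<sigma>)" using Loop.prems(2) j S by (auto simp: u_def Z_def)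
    obtain ws \<sigma>' where E: "exec c x (us @ [0], \<sigma>) = (ws, \<sigma>')" by fastforce
    note lws = exec_len'[OF E]
    have wsB: "\<forall>v\<in>set ws. v \<le> B"
      using eval_exec_bound(2)[of c "us @ [0]" B x \<sigma>] ZB[of j] S Loop.prems lus xB E by auto
    obtain t1 where t1: "lxb C x (compc c f (D + 1)) t (GC c B) t1" "okst f ws \<sigma>' t1"
      "\<And>r. \<not> frm f (Suc (length vs)) r \<Longrightarrow> rg t1 r = rg t r"
      using Loop.IH(2)[of "us @ [0]" \<sigma> B f t] Loop.prems ok un lus C le ZB[of j] S E by (auto simp: D_def)
    have lwv: "length ws = Suc (length vs)" using lws lus by simp
    have tD: "rg t1 (3 * D) = ws ! length vs" "ws ! length vs \<le> B"
      using t1(2) lwv wsB by (auto simp: okst_def D_def)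
    define t2 where "t2 = t1\<lparr>rg := (rg t1)(3 * D := 0)\<rparr>"
    define t3 where "t3 = t2\<lparr>rg := (rg t2)(3 * D + 1 := u - Suc j)\<rparr>"
    have nf: "\<not> frm f (Suc (length vs)) (3 * D + 1)" unfolding frm_def by presburger
    have tb: "rg t1 (3 * D + 1) = u - j" using t1(3)[OF nf] I by (simp add: I_def)
    have b2: "lxb C x (clr (3 * D)) t1 (2 * B + 1) t2"
      by (rule lxb_eqI[OF lxb_clr]) (use tD in \<open>auto simp: t2_def\<close>)
    have b3: "lxb C x (Dec (3 * D + 1)) t2 1 t3"
      by (rule lxb_Dec) (use tb j in \<open>auto simp: t2_def t3_def fun_eq_iff\<close>)
    have b: "lxb C x ?body t (GC c B + 2 * B + 4) t3"
      by (rule lxb_Seq[OF t1(1) lxb_Seq[OF b2 b3 order_refl]]) simp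
    have Zs: "Z (Suc j) = (take (length vs) ws, \<sigma>')"
      using S E lus by (simp add: Z_def loop1_def)
    have ne: "3 * (f + k) \<noteq> 3 * D + 1" "k < length vs \<Longrightarrow> 3 * (f + k) \<noteq> 3 * D" for k unfolding D_def by presburger+
    have "okst f (take (length vs) ws) \<sigma>' (t3\<lparr>rg := (rg t3)(3 * D + 1 := 0)\<rparr>)"
    proof -
      have "rg t1 r = 0" if "3 * D \<le> r" "r \<noteq> 3 * D" "r \<noteq> 3 * D + 1" for r
      proof (cases "frm f (Suc (length vs)) r")
        case True
        then have False using that unfolding frm_def D_def by auto
        then show ?thesis ..
      next
        case False
        then show ?thesis using t1(3)[OF False] zr that by simp
      qed
      then show ?thesis using t1(2) lwv ne by (auto simp: okst_def t3_def t2_def D_def[symmetric])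
    qed
    moreover have "rg t3 r = rg s r" if "\<not> frm f (length vs) r" "r \<noteq> 3 * D + 1" for r
      using that t1(3)[of r] I z by (cases "r = 3 * D") (auto simp: t3_def t2_def frm_snoc I_def D_def)
    ultimately have "I (Suc j) t3" using lwv Zs by (simp add: I_def t3_def)
    then show "rg t (3 * D + 1) \<noteq> 0 \<and> (\<exists>s'. I (Suc j) s' \<and> lxb C x ?body t (GC c B + 2 * B + 4) s')"
      using b I j by (auto simp: I_def)
  next
    have "s2\<lparr>rg := (rg s2)(3 * D + 1 := 0)\<rparr> = s" using z by (intro lst_eqI) (auto simp: s2_def fun_eq_iff)
    then show "I 0 s2" using Loop.prems(7) by (simp add: I_def Z_def) (simp add: s2_def)
  qed (simp add: I_def)
  then obtain s3 where s3: "I u s3" "lxb C x (While (3 * D + 1) ?body) s2 (u * ((GC c B + 2 * B + 4) + 1) + 1) s3" by blast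
  have "u * ((GC c B + 2 * B + 4) + 1) \<le> GE e B * (GC c B + 2 * B + 5)" using u by (intro mult_mono) auto
  then have 3: "lxb C x (While (3 * D + 1) ?body) s2 (GE e B * (GC c B + 2 * B + 5) + 1) s3"
    using s3(2) by (auto intro: lxb_mono)
  have "lxb C x (compc (Loop e c) f D) s (GC (Loop e c) B) s3"
    unfolding compc.simps by (rule lxb_Seq[OF 1 lxb_Seq[OF 2 3 order_refl]]) (simp add: algebra_simps)
  moreover have "s3\<lparr>rg := (rg s3)(3 * D + 1 := 0)\<rparr> = s3"
    using s3(1) by (intro lst_eqI) (auto simp: I_def fun_eq_iff)
  then have "okst f (fst (Z u)) (snd (Z u)) s3" using s3(1) by (simp add: I_def)
  moreover have "rg s3 r = rg s r" if "\<not> frm f (length vs) r" for r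
    using s3(1) that z by (cases "r = 3 * D + 1") (auto simp: I_def)
  ultimately show ?case by (intro exI[of _ s3]) (auto simp: D_def Z_def u_def)
qed


section \<open>Polynomial bounds\<close>

definition polyf :: "(nat \<Rightarrow> nat) \<Rightarrow> bool" where
  "polyf F \<longleftrightarrow> (\<exists>d. \<forall>N\<ge>2. F N \<le> N ^ d)"

lemma polyf_const: "polyf (\<lambda>N. c)"
proof -
  have "c \<le> N ^ c" if "2 \<le> N" for N :: nat
    using that less_exp[of c] power_mono[of 2 N c] by linarith
  then show ?thesis unfolding polyf_def by blast
qed

lemma polyf_le: "polyf F \<Longrightarrow> (\<And>N. N \<ge> 2 \<Longrightarrow> F' N \<le> F N) \<Longrightarrow> polyf F'"
  unfolding polyf_def by (meson le_trans)

lemma polyf_mult: assumes "polyf F" "polyf F'" shows "polyf (\<lambda>N. F N * F' N)"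
proof -
  obtain d d' where "\<And>N. N \<ge> 2 \<Longrightarrow> F N \<le> N ^ d" "\<And>N. N \<ge> 2 \<Longrightarrow> F' N \<le> N ^ d'"
    using assms by (auto simp: polyf_def)
  then have "F N * F' N \<le> N ^ (d + d')" if "N \<ge> 2" for N
    using that unfolding power_add by (intro mult_le_mono) auto
  then show ?thesis by (auto simp: polyf_def)
qed

lemma polyf_add: assumes "polyf F" "polyf F'" shows "polyf (\<lambda>N. F N + F' N)"
proof -
  have "polyf (\<lambda>N. (F N + 1) * (F' N + 1))" if s: "\<And>F. polyf F \<Longrightarrow> polyf (\<lambda>N. F N + 1)"
    using s[OF assms(1)] s[OF assms(2)] by (rule polyf_mult)
  moreover have "polyf (\<lambda>N. F N + 1)" if p: "polyf F" for F
  proof -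
    obtain d where d: "\<forall>N\<ge>2. F N \<le> N ^ d" using p unfolding polyf_def by blast
    have "F N + 1 \<le> N ^ (d + 1)" if "N \<ge> 2" for N
    proof -
      have "F N + 1 \<le> N ^ d + N ^ d" using d that by (intro add_le_mono) auto
      also have "\<dots> \<le> N * N ^ d" using that by (simp add: mult_2[symmetric])
      finally show ?thesis by simp
    qed
    then show ?thesis unfolding polyf_def by blast
  qed
  ultimately have "polyf (\<lambda>N. (F N + 1) * (F' N + 1))" by blast
  then show ?thesis by (rule polyf_le) (simp add: algebra_simps)
qed

text \<open>Bounds of subterms are taken at larger arguments such as \<open>B + GE a B\<close>.
  Quantifying over an arbitrary polynomial \<open>b\<close> puts this composition into the induction
  hypothesis.\<close>

lemma polyf_GE_GC:
  shows "polyf b \<Longrightarrow> polyf (\<lambda>N. GE e (b N))" and "polyf b \<Longrightarrow> polyf (\<lambda>N. GC c (b N))"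
proof (induction e and c arbitrary: b and b)
  case (Var k)
  show ?case unfolding GE.simps by (intro polyf_add polyf_mult polyf_const Var)
next
  case (Cn n)
  show ?case unfolding GE.simps by (intro polyf_add polyf_mult polyf_const Cn)
next
  case Len
  show ?case unfolding GE.simps by (intro polyf_add polyf_mult polyf_const Len)
next
  case (Inp e)
  show ?case unfolding GE.simps by (intro polyf_add polyf_mult polyf_const Inp.IH Inp.prems)
next
  case (Cat e)
  show ?case unfolding GE.simps by (intro polyf_add polyf_mult polyf_const Cat.IH Cat.prems)
next
  case (Add a1 a2)
  show ?case unfolding GE.simps by (intro polyf_add polyf_mult polyf_const Add.IH Add.prems)
next
  case (Sub a1 a2)
  show ?case unfolding GE.simps by (intro polyf_add polyf_mult polyf_const Sub.IH Sub.prems)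
next
  case (Ite e a1 a2)
  show ?case unfolding GE.simps by (intro polyf_add polyf_mult polyf_const Ite.IH Ite.prems)
next
  case (Sum a1 a2)
  show ?case unfolding GE.simps by (intro polyf_add polyf_mult polyf_const Sum.IH Sum.prems)
next
  case (Let a1 a2)
  show ?case unfolding GE.simps by (intro polyf_add polyf_mult polyf_const Let.IH Let.prems)
next
  case (Fresh k e)
  show ?case unfolding GE.simps by (intro polyf_add polyf_mult polyf_const Fresh.IH Fresh.prems)
next
  case (After c e c')
  show ?case unfolding GE.simps by (intro polyf_add polyf_mult polyf_const After.IH After.prems)
next
  case (Assign k e)
  show ?case unfolding GC.simps by (intro polyf_add polyf_mult polyf_const Assign.IH Assign.prems)
next
  case (Write a1 a2)
  show ?case unfolding GC.simps by (intro polyf_add polyf_mult polyf_const Write.IH Write.prems)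
next
  case (CSeq a1 a2)
  show ?case unfolding GC.simps by (intro polyf_add polyf_mult polyf_const CSeq.IH CSeq.prems)
next
  case (CIf e a1 a2)
  show ?case unfolding GC.simps by (intro polyf_add polyf_mult polyf_const CIf.IH CIf.prems)
next
  case (Loop e c)
  show ?case unfolding GC.simps by (intro polyf_add polyf_mult polyf_const Loop.IH Loop.prems)
qed


section \<open>Logarithmic work space\<close>

definition lg :: "nat \<Rightarrow> nat" where
  "lg n = nat \<lceil>log 2 (real (max n 2))\<rceil>"

lemma le_pow_lg: "max n 2 \<le> 2 ^ lg n"
proof -
  have "log 2 (real (max n 2)) \<le> real (lg n)" unfolding lg_def by linarith
  then have "2 powr log 2 (real (max n 2)) \<le> 2 powr real (lg n)" by (intro powr_mono) auto
  then have "real (max n 2) \<le> 2 ^ lg n" by (simp add: powr_realpow)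
  then show ?thesis by (metis numeral_power_le_of_nat_cancel_iff of_nat_le_iff of_nat_numeral of_nat_power)
qed

lemma lg_least: assumes "2 ^ j \<ge> max n 2" shows "lg n \<le> j"
proof -
  have "real (max n 2) \<le> real (2 ^ j)" using assms by (rule of_nat_mono)
  then have "log 2 (real (max n 2)) \<le> log 2 (2 ^ j)" by (subst log_le_cancel_iff) auto
  then show ?thesis by (simp add: lg_def log_nat_power ceiling_le_iff)
qed

lemma lg_pos: "0 < lg n"
  using le_pow_lg[of n] by (cases "lg n") auto

lemma lg_le: "lg n \<le> max n 2"
proof (rule lg_least)
  show "max n 2 \<le> 2 ^ max n 2" using less_exp[of "max n 2"] by linarith
qed

text \<open>The interface to machines: it suffices to write one fixed expression that decides L on
  every long enough tape and undoes its side effects. Being fixed, it needs a constant number of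
  registers and has a bound of constant degree, so registers of logarithmic length suffice.\<close>

theorem exp_in_CLP:
  assumes wf: "wfe e 0"
    and ok: "\<And>x \<tau>. max (length x) 2 ^ D \<le> length \<tau> \<Longrightarrow> und e x [] \<tau> \<and> (eval e x [] \<tau> \<noteq> 0 \<longleftrightarrow> x \<in> L)"
  shows "L \<in> CLP"
proof -
  have "polyf (\<lambda>N. GE e (N ^ 2))"
    by (rule polyf_GE_GC) (auto simp: polyf_def)
  then obtain d where d: "\<forall>N\<ge>2. GE e (N ^ 2) \<le> N ^ d" by (auto simp: polyf_def)
  \<comment> \<open>There are \<kappa> lg n groups of g cells, so k = g \<kappa> makes the work
    space exactly g W. As \<kappa> exceeds d and D, registers of W bits hold all values and the tape
    is long enough; the slack pays for the overhead of the simulation.\<close>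
  define g \<kappa> where "g = nregs (comp e 0 0) + 3" and "\<kappa> = 2 * d + D + 20"
  define k where "k = g * \<kappa>"
  define M where "M = tm_of (Seq (comp e 0 0) (IfNZ 0 Acc Rej)) g"
  have k: "\<kappa> \<le> k" by (simp add: k_def g_def)
  have "halted M c \<and> (st c = qacc M \<longleftrightarrow> x \<in> L) \<and> ct c = \<tau>"
    if len: "length \<tau> = polyb k (length x)" and c: "c = run M x [] (logb k (length x)) \<tau> (polyb k (length x))" for x \<tau> c
  proof -
    define N W where "N = max (length x) 2" and "W = \<kappa> * lg (length x)"
    have N: "2 \<le> N" by (simp add: N_def)
    have NN: "N ^ i \<le> N ^ j" if "i \<le> j" for i j using N that by (intro power_increasing) auto
    have G: "GE e (N ^ 2) \<le> N ^ d" using d N by blast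
    have w: "logb k (length x) = g * W" by (simp add: logb_def W_def k_def lg_def)
    have l: "length \<tau> = N ^ k" using len by (simp add: polyb_def N_def)
    have "N ^ D \<le> length \<tau>" using NN[of D k] k l by (simp add: \<kappa>_def)
    note okx = ok[OF this[unfolded N_def]]
    have "N ^ \<kappa> \<le> (2 ^ lg (length x)) ^ \<kappa>" using le_pow_lg by (intro power_mono) (auto simp: N_def)
    then have "N ^ \<kappa> \<le> 2 ^ W" by (simp add: W_def power_mult[symmetric] mult.commute)
    moreover have "N ^ d < N ^ \<kappa>" using N by (intro power_strict_increasing) (auto simp: \<kappa>_def)
    ultimately have C: "GE e (N ^ 2) < 2 ^ W" using G by linarith
    have B: "length x + 2 \<le> N ^ 2"
    proof -
      have "length x + 2 \<le> 2 * N" by (simp add: N_def)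
      also have "\<dots> \<le> N ^ 2" using N by (simp add: power2_eq_square)
      finally show ?thesis .
    qed
    let ?s = "\<lparr>rg = (\<lambda>_. 0), li = 0, lc = \<tau>, lh = 0\<rparr>"
    have "lxb (2 ^ W) x (comp e 0 (0 + length ([] :: nat list))) ?s (GE e (N ^ 2))
      (?s\<lparr>rg := (rg ?s)(3 * (0 + length ([] :: nat list)) := eval e x [] \<tau>)\<rparr>)"
      by (rule comp_correct(1)[where P = "\<lambda>B. length x + 2 \<le> B" and \<tau> = \<tau>])
        (use wf okx B C G NN[of d k] k l in \<open>auto simp: okst_def \<kappa>_def\<close>)
    then obtain t where t: "t \<le> N ^ d"
      "lx (2 ^ W) x (comp e 0 0) ?s t (?s\<lparr>rg := (\<lambda>_. 0)(0 := eval e x [] \<tau>)\<rparr>)"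
      using G by (auto simp: lxb_def intro: le_trans)
    have T: "(t + 4) * (2 * (g * W) + 1) + 2 \<le> N ^ k"
    proof -
      have gW: "g * W \<le> k * N" using lg_le[of "length x"] by (simp add: W_def k_def N_def mult.assoc)
      have k1: "1 \<le> k" using k by (simp add: \<kappa>_def)
      have "t + 4 \<le> N ^ d + 4 * N ^ d" using t N by (intro add_le_mono) auto
      then have a: "t + 4 \<le> 5 * N ^ d" by simp
      have b: "2 * (g * W) + 1 \<le> 3 * (k * N)" using gW k1 N mult_pos_pos[of k N] by linarith
      \<comment> \<open>What is left of the exponent k after N^d for the program, one N for the
        logarithm and N^6 for the constants. The factor k coming from the work space is absorbed by
        N^j, as k \<le> 2 j.\<close>
      define j where "j = k - d - 8"
      have j: "k = j + d + 8" "k \<le> 2 * j" using k by (auto simp: j_def \<kappa>_def)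
      have "j \<le> 2 ^ j" using less_exp[of j] by linarith
      then have k2: "k \<le> 2 * 2 ^ j" using j by linarith
      have jN: "(2::nat) ^ j \<le> N ^ j" using N by (intro power_mono) auto
      have "(t + 4) * (2 * (g * W) + 1) + 2 \<le> (5 * N ^ d) * (3 * (k * N)) + 2 * (N ^ d * (k * N))"
        using a b N k1 by (intro add_le_mono mult_le_mono) auto
      also have "\<dots> = 17 * (N ^ d * N * k)" by (simp add: algebra_simps)
      also have "\<dots> \<le> 2 ^ 5 * (N ^ d * N * (2 * N ^ j))"
        using k2 jN by (intro mult_le_mono) auto
      also have "\<dots> = 2 ^ 6 * (N ^ d * N * N ^ j)" by simp
      also have "\<dots> \<le> N ^ 6 * (N ^ d * N * N ^ j)" using N by (intro mult_le_mono power_mono) auto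
      also have "\<dots> = N ^ (6 + (d + 1 + j))" by (simp only: power_add power_one_right)
      also have "\<dots> \<le> N ^ k" using j by (intro NN) simp
      finally show ?thesis .
    qed
    have "0 < W" using lg_pos by (simp add: W_def \<kappa>_def)
    from counter_program_machine[OF t(2), of g "N ^ k"] this T
    have "halted M (run M x [] (g * W) \<tau> (N ^ k))"
      "st (run M x [] (g * W) \<tau> (N ^ k)) = qacc M \<longleftrightarrow> eval e x [] \<tau> \<noteq> 0" "ct (run M x [] (g * W) \<tau> (N ^ k)) = \<tau>"
      by (simp_all add: M_def g_def)
    moreover have "c = run M x [] (g * W) \<tau> (N ^ k)" using c w by (simp add: polyb_def N_def)
    ultimately show ?thesis using okx by simp
  qed
  moreover have "wf_machine M" unfolding M_def by (rule wf_tm_of) (simp add: g_def)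
  ultimately show ?thesis unfolding CLP_def Let_def by blast
qed

section \<open>Reversible tours of the configuration forest\<close>

text \<open>Bounded search: the least e below n with P e, or n if there is none. It is written as a
  count because the expression language has sums but no search.\<close>

definition fnd :: "nat \<Rightarrow> (nat \<Rightarrow> bool) \<Rightarrow> nat" where
  "fnd n P = (\<Sum>e<n. of_bool (\<forall>e'\<le>e. \<not> P e'))"

lemma fnd_eq:
  assumes "e < n" "P e" "\<And>e'. e' < e \<Longrightarrow> \<not> P e'"
  shows "fnd n P = e"
proof -
  have "fnd n P = card ({..<n} \<inter> {i. \<forall>e'\<le>i. \<not> P e'})" by (simp add: fnd_def)
  also have "{..<n} \<inter> {i. \<forall>e'\<le>i. \<not> P e'} = {..<e}"
  proof
    show "{..<n} \<inter> {i. \<forall>e'\<le>i. \<not> P e'} \<subseteq> {..<e}" using assms(2) leI by blast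
    show "{..<e} \<subseteq> {..<n} \<inter> {i. \<forall>e'\<le>i. \<not> P e'}" using assms(1,3) by auto
  qed
  finally show ?thesis by simp
qed

lemma fnd_none: "(\<And>e. e < n \<Longrightarrow> \<not> P e) \<Longrightarrow> fnd n P = n"
  by (simp add: fnd_def)

lemma fnd_cases:
  obtains (none) "fnd n P = n" "\<And>e. e < n \<Longrightarrow> \<not> P e"
  | (some) "fnd n P < n" "P (fnd n P)" "\<And>e. e < fnd n P \<Longrightarrow> \<not> P e"
proof (cases "\<exists>e<n. P e")
  case True
  define e where "e = (LEAST e. P e)"
  have e: "P e" "\<And>e'. e' < e \<Longrightarrow> \<not> P e'" "e < n"
    unfolding e_def using True LeastI[of P] not_less_Least[of _ P] Least_le[of P] le_less_trans by blast+
  then have "fnd n P = e" by (intro fnd_eq) auto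
  then show ?thesis using some e by simp
next
  case False
  then show ?thesis using none fnd_none by blast
qed

lemma fnd_cong: "n = n' \<Longrightarrow> (\<And>e. e < n' \<Longrightarrow> P e = Q e) \<Longrightarrow> fnd n P = fnd n' Q"
  unfolding fnd_def by (intro sum.cong) (auto intro!: arg_cong[where f = of_bool])

text \<open>The greatest e below a with P e is a - 1 - fnd a (P reversed).\<close>

lemma fnd_rev_eq:
  assumes "e < a" "P e" "\<And>e'. e < e' \<Longrightarrow> e' < a \<Longrightarrow> \<not> P e'"
  shows "fnd a (\<lambda>j. P (a - 1 - j)) < a \<and> a - 1 - fnd a (\<lambda>j. P (a - 1 - j)) = e"
proof -
  have "fnd a (\<lambda>j. P (a - 1 - j)) = a - 1 - e"
    by (rule fnd_eq) (use assms in \<open>auto\<close>)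
  then show ?thesis using assms by auto
qed

lemma fnd_rev_none:
  assumes "\<And>e'. e' < a \<Longrightarrow> \<not> P e'"
  shows "fnd a (\<lambda>j. P (a - 1 - j)) = a"
  by (rule fnd_none) (use assms in auto)

lemma fnd_rev_cases:
  obtains (none) "fnd a (\<lambda>j. P (a - 1 - j)) = a" "\<And>e. e < a \<Longrightarrow> \<not> P e"
  | (some) e where "fnd a (\<lambda>j. P (a - 1 - j)) < a" "a - 1 - fnd a (\<lambda>j. P (a - 1 - j)) = e" "e < a" "P e"
      "\<And>e'. e < e' \<Longrightarrow> e' < a \<Longrightarrow> \<not> P e'"
proof (cases "\<exists>e<a. P e")
  case True
  define e where "e = Max {e. e < a \<and> P e}"
  have f: "finite {e. e < a \<and> P e}" by simp
  have e: "e < a" "P e" using Max_in[OF f] True by (auto simp: e_def)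
  have "\<not> P e'" if "e < e'" "e' < a" for e'
  proof
    assume "P e'"
    then have "e' \<le> e" unfolding e_def using that by (intro Max_ge[OF f]) simp
    then show False using that by simp
  qed
  then show ?thesis using some fnd_rev_eq[of e a P] e by blast
next
  case False
  then show ?thesis using none fnd_rev_none by blast
qed

type_synonym node = "nat \<times> bool list"
type_synonym tour = "nat \<times> bool \<times> bool list"

text \<open>A node is a small state together with the whole tape, and its parent is the next
  configuration: time runs towards the roots, which lie at level H. The tour never descends below
  level \<open>tm\<close>; cut off there, it does not depend on what governs the earlier steps, in
  the application their seeds.\<close>

locale forest =
  fixes S H Lt tm :: nat and pos :: "nat \<Rightarrow> nat" and nx :: "nat \<Rightarrow> bool \<Rightarrow> nat"
    and wr :: "nat \<Rightarrow> bool \<Rightarrow> bool" and lvl :: "nat \<Rightarrow> nat"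
  assumes nx_less: "s < S \<Longrightarrow> lvl s < H \<Longrightarrow> nx s b < S"
    and lvl_nx: "s < S \<Longrightarrow> lvl s < H \<Longrightarrow> lvl (nx s b) = Suc (lvl s)"
    and pos_less: "s < S \<Longrightarrow> pos s < Lt"
begin

definition par :: "node \<Rightarrow> node" where
  "par = (\<lambda>(s, z). (nx s (z ! pos s), z[pos s := wr s (z ! pos s)]))"

text \<open>The label 2 s + b of a child records its small state and the bit it had under its head.\<close>

definition valid :: "nat \<Rightarrow> bool list \<Rightarrow> nat \<Rightarrow> bool" where
  "valid s' z e \<longleftrightarrow> tm \<le> lvl (e div 2) \<and> lvl (e div 2) < H \<and> nx (e div 2) (odd e) = s'
     \<and> wr (e div 2) (odd e) = z ! pos (e div 2)"

definition child :: "bool list \<Rightarrow> nat \<Rightarrow> node" where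
  "child z e = (e div 2, z[pos (e div 2) := odd e])"

definition lab :: "nat \<Rightarrow> bool list \<Rightarrow> nat" where
  "lab s z = 2 * s + of_bool (z ! pos s)"

definition nxt :: "tour \<Rightarrow> tour" where
  "nxt = (\<lambda>(s, d, z). if \<not> d
     then (let e = fnd (2 * S) (\<lambda>e. valid s z e) in
       if e < 2 * S then (fst (child z e), False, snd (child z e)) else (s, True, z))
     else if H \<le> lvl s then (s, False, z)
     else (let s' = fst (par (s, z)); z' = snd (par (s, z));
         e = fnd (2 * S) (\<lambda>e. lab s z < e \<and> valid s' z' e) in
       if e < 2 * S then (fst (child z' e), False, snd (child z' e)) else (s', True, z')))"

definition prv :: "tour \<Rightarrow> tour" where
  "prv = (\<lambda>(s, d, z). if d
     then (let j = fnd (2 * S) (\<lambda>j. valid s z (2 * S - 1 - j)); e = 2 * S - 1 - j in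
       if j < 2 * S then (fst (child z e), True, snd (child z e)) else (s, False, z))
     else if H \<le> lvl s then (s, True, z)
     else (let s' = fst (par (s, z)); z' = snd (par (s, z)); a = lab s z;
         j = fnd a (\<lambda>j. valid s' z' (a - 1 - j)); e = a - 1 - j in
       if j < a then (fst (child z' e), True, snd (child z' e)) else (s', False, z')))"

definition nok :: "node \<Rightarrow> bool" where
  "nok u \<longleftrightarrow> fst u < S \<and> tm \<le> lvl (fst u) \<and> lvl (fst u) \<le> H \<and> length (snd u) = Lt"

definition tok :: "tour \<Rightarrow> bool" where
  "tok = (\<lambda>(s, d, z). nok (s, z))"

lemma nok_par: "nok (s, z) \<Longrightarrow> lvl s < H \<Longrightarrow> nok (par (s, z)) \<and> lvl (fst (par (s, z))) = Suc (lvl s)"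
  by (auto simp: nok_def par_def nx_less lvl_nx)

lemma lab_less: "s < S \<Longrightarrow> lab s z < 2 * S"
  by (simp add: lab_def of_bool_def)

lemma lab_div [simp]: "lab s z div 2 = s" and lab_odd [simp]: "odd (lab s z) = (z ! pos s)"
  by (auto simp: lab_def)

text \<open>A step alters only the cell under its head, so the old state and the old bit suffice to
  rebuild the child from its parent.\<close>

lemma valid_lab:
  assumes "nok (s, z)" "lvl s < H"
  shows "valid (fst (par (s, z))) (snd (par (s, z))) (lab s z)"
    and "child (snd (par (s, z))) (lab s z) = (s, z)"
  using assms pos_less[of s] by (auto simp: valid_def par_def child_def nok_def simp del: even_mult_iff)

lemma child_ok:
  assumes "nok (s, z)" "valid s z e" "e < 2 * S"
  shows "nok (child z e)" "par (child z e) = (s, z)" "lab (fst (child z e)) (snd (child z e)) = e"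
    "lvl (fst (child z e)) < H" "Suc (lvl (fst (child z e))) = lvl s"
proof -
  have e: "e div 2 < S" using assms by auto
  have p: "pos (e div 2) < length z" using pos_less[OF e] assms by (simp add: nok_def)
  show "nok (child z e)" using assms e by (auto simp: nok_def child_def valid_def)
  show "par (child z e) = (s, z)" using assms p by (auto simp: par_def child_def valid_def)
  show "lab (fst (child z e)) (snd (child z e)) = e" using p by (auto simp: lab_def child_def of_bool_def)
  show "lvl (fst (child z e)) < H" using assms by (simp add: child_def valid_def)
  show "Suc (lvl (fst (child z e))) = lvl s" using assms e lvl_nx[OF e, of "odd e"] by (auto simp: child_def valid_def)
qed

lemma child_inj: "nok (s, z) \<Longrightarrow> valid s z e \<Longrightarrow> e < 2 * S \<Longrightarrow> child z e = (s1, z1) \<Longrightarrow>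
    nok (s1, z1) \<and> par (s1, z1) = (s, z) \<and> lab s1 z1 = e \<and> lvl s1 < H"
  using child_ok[of s z e] by auto

text \<open>\<open>nxt\<close> picks the first valid label above the current one and
  \<open>prv\<close> the last valid label below; no valid label lies between the two, so each undoes
  the other.\<close>

lemma prv_nxt: assumes "tok t" shows "prv (nxt t) = t \<and> tok (nxt t)"
proof -
  obtain s d z where t: "t = (s, d, z)" by (cases t) auto
  have ok: "nok (s, z)" using assms by (simp add: t tok_def)
  show ?thesis
  proof (cases d)
    case d: False
    show ?thesis
    proof (cases rule: fnd_cases[of "2 * S" "valid s z"])
      case none
      then have n: "nxt t = (s, True, z)" by (simp add: nxt_def t d)
      have "fnd (2 * S) (\<lambda>j. valid s z (2 * S - 1 - j)) = 2 * S" using none(2) by (intro fnd_rev_none[of "2 * S" "valid s z"])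
      then show ?thesis using ok unfolding n by (simp add: prv_def t d tok_def)
    next
      case some
      define e where "e = fnd (2 * S) (valid s z)"
      obtain s1 z1 where c: "child z e = (s1, z1)" by (cases "child z e")
      have n: "nxt t = (s1, False, z1)" using some c by (simp add: nxt_def t d e_def[symmetric] Let_def)
      have c1: "nok (s1, z1)" "par (s1, z1) = (s, z)" "lab s1 z1 = e" "lvl s1 < H"
        using child_inj[OF ok _ _ c] some by (auto simp: e_def)
      have "fnd e (\<lambda>j. valid s z (e - 1 - j)) = e"
        using some(3) by (intro fnd_rev_none[of e "valid s z"]) (simp add: e_def)
      then show ?thesis using c1 unfolding n by (simp add: prv_def t d tok_def Let_def)
    qed
  next
    case d: True
    show ?thesis
    proof (cases "H \<le> lvl s")
      case True
      then show ?thesis using ok by (simp add: nxt_def prv_def t d tok_def)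
    next
      case False
      then have l: "lvl s < H" by simp
      obtain s' z' where p: "par (s, z) = (s', z')" by (cases "par (s, z)")
      have ok': "nok (s', z')" using nok_par[OF ok l] p by simp
      have v: "valid s' z' (lab s z)" "child z' (lab s z) = (s, z)" using valid_lab[OF ok l] p by auto
      have ls: "lab s z < 2 * S" using ok by (simp add: nok_def lab_less)
      show ?thesis
      proof (cases rule: fnd_cases[of "2 * S" "\<lambda>e. lab s z < e \<and> valid s' z' e"])
        case none
        then have n: "nxt t = (s', True, z')" using l by (simp add: nxt_def t d p)
        have "fnd (2 * S) (\<lambda>j. valid s' z' (2 * S - 1 - j)) < 2 * S \<and>
          2 * S - 1 - fnd (2 * S) (\<lambda>j. valid s' z' (2 * S - 1 - j)) = lab s z"
          using none(2) v ls by (intro fnd_rev_eq[of "lab s z" "2 * S" "valid s' z'"]) auto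
        then show ?thesis using ok' v unfolding n by (simp add: prv_def t d tok_def Let_def)
      next
        case some
        define e where "e = fnd (2 * S) (\<lambda>e. lab s z < e \<and> valid s' z' e)"
        obtain s1 z1 where c: "child z' e = (s1, z1)" by (cases "child z' e")
        have n: "nxt t = (s1, False, z1)" using some c l by (simp add: nxt_def t d p e_def[symmetric] Let_def)
        have c1: "nok (s1, z1)" "par (s1, z1) = (s', z')" "lab s1 z1 = e" "lvl s1 < H"
          using child_inj[OF ok' _ _ c] some by (auto simp: e_def)
        have "fnd e (\<lambda>j. valid s' z' (e - 1 - j)) < e \<and> e - 1 - fnd e (\<lambda>j. valid s' z' (e - 1 - j)) = lab s z"
          using some v by (intro fnd_rev_eq[of "lab s z" e "valid s' z'"]) (auto simp: e_def)
        then show ?thesis using c1 v unfolding n by (simp add: prv_def t d tok_def Let_def)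
      qed
    qed
  qed
qed

lemma nxt_prv: assumes "tok t" shows "nxt (prv t) = t \<and> tok (prv t)"
proof -
  obtain s d z where t: "t = (s, d, z)" by (cases t) auto
  have ok: "nok (s, z)" using assms by (simp add: t tok_def)
  show ?thesis
  proof (cases d)
    case d: True
    show ?thesis
    proof (cases rule: fnd_rev_cases[of "2 * S" "valid s z"])
      case none
      then have n: "prv t = (s, False, z)" by (simp add: prv_def t d)
      have "fnd (2 * S) (valid s z) = 2 * S" by (rule fnd_none) (use none in auto)
      then show ?thesis using ok unfolding n by (simp add: nxt_def t d tok_def)
    next
      case (some e)
      obtain s1 z1 where c: "child z e = (s1, z1)" by (cases "child z e")
      have n: "prv t = (s1, True, z1)" using some(1,2) c by (simp add: prv_def t d Let_def)
      have c1: "nok (s1, z1)" "par (s1, z1) = (s, z)" "lab s1 z1 = e" "lvl s1 < H"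
        using child_inj[OF ok _ _ c] some by auto
      have "fnd (2 * S) (\<lambda>e'. e < e' \<and> valid s z e') = 2 * S" by (rule fnd_none) (use some in auto)
      then show ?thesis using c1 unfolding n by (simp add: nxt_def t d tok_def Let_def)
    qed
  next
    case d: False
    show ?thesis
    proof (cases "H \<le> lvl s")
      case True
      then show ?thesis using ok by (simp add: nxt_def prv_def t d tok_def)
    next
      case False
      then have l: "lvl s < H" by simp
      obtain s' z' where p: "par (s, z) = (s', z')" by (cases "par (s, z)")
      have ok': "nok (s', z')" using nok_par[OF ok l] p by simp
      define a where "a = lab s z"
      have v: "valid s' z' a" "child z' a = (s, z)" using valid_lab[OF ok l] p by (auto simp: a_def)
      have ls: "a < 2 * S" using ok by (simp add: nok_def lab_less a_def)
      show ?thesis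
      proof (cases rule: fnd_rev_cases[of a "valid s' z'"])
        case none
        then have n: "prv t = (s', False, z')" using l by (simp add: prv_def t d p a_def[symmetric])
        have "fnd (2 * S) (valid s' z') = a" by (rule fnd_eq) (use none v ls in auto)
        then show ?thesis using ok' v ls unfolding n by (simp add: nxt_def t d tok_def Let_def)
      next
        case (some e)
        obtain s1 z1 where c: "child z' e = (s1, z1)" by (cases "child z' e")
        have n: "prv t = (s1, True, z1)" using some(1,2) c l by (simp add: prv_def t d p a_def[symmetric] Let_def)
        have c1: "nok (s1, z1)" "par (s1, z1) = (s', z')" "lab s1 z1 = e" "lvl s1 < H"
          using child_inj[OF ok' _ _ c] some ls by auto
        have "fnd (2 * S) (\<lambda>e'. e < e' \<and> valid s' z' e') = a" by (rule fnd_eq) (use some v ls in auto)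
        then show ?thesis using c1 v ls unfolding n by (simp add: nxt_def t d tok_def Let_def)
      qed
    qed
  qed
qed

lemma tok_nxt_pow: "tok t \<Longrightarrow> tok ((nxt ^^ n) t)"
  by (induction n) (auto simp: prv_nxt)

lemma tok_prv_pow: "tok t \<Longrightarrow> tok ((prv ^^ n) t)"
  by (induction n) (auto simp: nxt_prv)

lemma prv_nxt_pow: "tok t \<Longrightarrow> j \<le> n \<Longrightarrow> (prv ^^ j) ((nxt ^^ n) t) = (nxt ^^ (n - j)) t"
proof (induction j)
  case (Suc j)
  have "n - j = Suc (n - Suc j)" using Suc.prems by simp
  then have "(prv ^^ Suc j) ((nxt ^^ n) t) = prv (nxt ((nxt ^^ (n - Suc j)) t))"
    using Suc by simp
  then show ?case using prv_nxt tok_nxt_pow Suc.prems by simp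
qed simp

section \<open>The tour stays in one tree and covers it\<close>

definition root :: "node \<Rightarrow> node" where
  "root u = (par ^^ (H - lvl (fst u))) u"

lemma root_par: "nok u \<Longrightarrow> lvl (fst u) < H \<Longrightarrow> root (par u) = root u"
proof -
  assume a: "nok u" "lvl (fst u) < H"
  have "lvl (fst (par u)) = Suc (lvl (fst u))" using nok_par[of "fst u" "snd u"] a by simp
  moreover have "H - lvl (fst u) = Suc (H - Suc (lvl (fst u)))" using a by simp
  ultimately show ?thesis by (simp add: root_def funpow_Suc_right del: funpow.simps)
qed

lemma root_top: "H \<le> lvl (fst u) \<Longrightarrow> root u = u"
  by (simp add: root_def)

definition tnode :: "tour \<Rightarrow> node" where
  "tnode = (\<lambda>(s, d, z). (s, z))"

lemma root_child: "nok (s, z) \<Longrightarrow> valid s z e \<Longrightarrow> e < 2 * S \<Longrightarrow> root (child z e) = root (s, z)"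
  using child_ok[of s z e] root_par[of "child z e"] by simp

lemma root_nxt: assumes "tok t" shows "root (tnode (nxt t)) = root (tnode t)"
proof -
  obtain s d z where t: "t = (s, d, z)" by (cases t) auto
  have ok: "nok (s, z)" using assms by (simp add: t tok_def)
  show ?thesis
  proof (cases "\<not> d \<or> H \<le> lvl s")
    case True
    then show ?thesis
      using root_child[OF ok] by (cases rule: fnd_cases[of "2 * S" "valid s z"]) (auto simp: nxt_def t tnode_def Let_def)
  next
    case False
    then have l: "lvl s < H" and d by auto
    obtain s' z' where p: "par (s, z) = (s', z')" by (cases "par (s, z)")
    have ok': "nok (s', z')" using nok_par[OF ok l] p by simp
    have "root (s', z') = root (s, z)" using root_par[OF ok] l p by simp
    then show ?thesis using root_child[OF ok'] \<open>d\<close> l p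
      by (cases rule: fnd_cases[of "2 * S" "\<lambda>e. lab s z < e \<and> valid s' z' e"]) (auto simp: nxt_def t tnode_def Let_def)
  qed
qed

lemma root_nxt_pow: "tok t \<Longrightarrow> root (tnode ((nxt ^^ n) t)) = root (tnode t)"
  by (induction n) (auto simp: root_nxt tok_nxt_pow)

definition desc :: "node \<Rightarrow> node \<Rightarrow> bool" where
  "desc u w \<longleftrightarrow> nok w \<and> lvl (fst w) \<le> lvl (fst u) \<and> (par ^^ (lvl (fst u) - lvl (fst w))) w = u"

lemma desc_cases:
  assumes "desc (s, z) w" "nok (s, z)"
  obtains (self) "w = (s, z)" | (below) e where "e < 2 * S" "valid s z e" "desc (child z e) w"
proof (cases "lvl (fst w) = lvl s")
  case True
  then have "w = (s, z)" using assms by (simp add: desc_def)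
  then show ?thesis by (rule that(1))
next
  case False
  then have lt: "lvl (fst w) < lvl s" using assms by (simp add: desc_def)
  define k where "k = lvl s - lvl (fst w) - 1"
  have k: "lvl s - lvl (fst w) = Suc k" using lt by (simp add: k_def)
  have lvlk: "nok ((par ^^ j) w) \<and> lvl (fst ((par ^^ j) w)) = lvl (fst w) + j" if "j \<le> k" for j
    using that
  proof (induction j)
    case 0
    then show ?case using assms by (simp add: desc_def)
  next
    case (Suc j)
    then have "lvl (fst ((par ^^ j) w)) < H" using k assms(2) lt by (auto simp: nok_def)
    then show ?case using Suc nok_par[of "fst ((par ^^ j) w)" "snd ((par ^^ j) w)"] by simp
  qed
  obtain s1 z1 where c: "(par ^^ k) w = (s1, z1)" by (cases "(par ^^ k) w")
  have ok1: "nok (s1, z1)" "lvl s1 = lvl s - 1" using lvlk[of k] c k by auto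
  have l1: "lvl s1 < H" using ok1 lt assms(2) by (auto simp: nok_def)
  have p: "par (s1, z1) = (s, z)" using assms k c by (simp add: desc_def)
  have v: "valid s z (lab s1 z1)" "child z (lab s1 z1) = (s1, z1)" using valid_lab[OF ok1(1) l1] p by auto
  have "desc (s1, z1) w" 
  proof -
    have "lvl s1 - lvl (fst w) = k" using ok1 k by simp
    then show ?thesis using c ok1 lt assms(1) by (simp add: desc_def)
  qed
  then show ?thesis using ok1(1) v by (intro that(2)[of "lab s1 z1"]) (simp_all add: nok_def lab_less)
qed

lemma tour_covers:
  assumes "nok (s, z)"
  shows "\<exists>n. (nxt ^^ n) (s, False, z) = (s, True, z) \<and>
    (\<forall>s' z'. desc (s, z) (s', z') \<longrightarrow> (\<exists>j\<le>n. (nxt ^^ j) (s, False, z) = (s', False, z')))"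
  using assms
proof (induction "lvl s" arbitrary: s z rule: less_induct)
  case less
  note ok = less.prems
  \<comment> \<open>The tour state in which the children of \<open>(s, z)\<close> with labels from
    \<open>a\<close> on are still to be visited.\<close>
  define X where "X a = (let e = fnd (2 * S) (\<lambda>e. a \<le> e \<and> valid s z e) in
    if e < 2 * S then (fst (child z e), False, snd (child z e)) else (s, True, z))" for a
  have X: "\<exists>n. (nxt ^^ n) (X a) = (s, True, z) \<and> (\<forall>e s' z'. a \<le> e \<and> e < 2 * S \<and> valid s z e \<and> desc (child z e) (s', z') \<longrightarrow>
      (\<exists>j\<le>n. (nxt ^^ j) (X a) = (s', False, z')))" for a
  proof (induction "2 * S - a" arbitrary: a rule: less_induct)
    case inner: less
    show ?case
    proof (cases rule: fnd_cases[of "2 * S" "\<lambda>e. a \<le> e \<and> valid s z e"])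
      case none
      then have "X a = (s, True, z)" by (simp add: X_def)
      then show ?thesis using none by (intro exI[of _ 0]) auto
    next
      case some
      define e where "e = fnd (2 * S) (\<lambda>e. a \<le> e \<and> valid s z e)"
      have e: "e < 2 * S" "a \<le> e" "valid s z e" "\<And>e'. e' < e \<Longrightarrow> \<not> (a \<le> e' \<and> valid s z e')"
        using some by (auto simp: e_def)
      obtain s1 z1 where c: "child z e = (s1, z1)" by (cases "child z e")
      have Xa: "X a = (s1, False, z1)" using e c by (simp add: X_def e_def[symmetric] Let_def)
      have c1: "nok (s1, z1)" "par (s1, z1) = (s, z)" "lab s1 z1 = e" "lvl s1 < H" "Suc (lvl s1) = lvl s"
        using child_ok[OF ok e(3,1)] c by auto
      obtain n1 where n1: "(nxt ^^ n1) (s1, False, z1) = (s1, True, z1)"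
        "\<And>s' z'. desc (s1, z1) (s', z') \<Longrightarrow> \<exists>j\<le>n1. (nxt ^^ j) (s1, False, z1) = (s', False, z')"
        using less.hyps[of s1 z1] c1 by auto
      have st: "nxt (s1, True, z1) = X (Suc e)"
        using c1 by (simp add: nxt_def X_def Suc_le_eq)
      have lt: "2 * S - Suc e < 2 * S - a" using e by simp
      obtain n2 where n2: "(nxt ^^ n2) (X (Suc e)) = (s, True, z)"
        "\<And>e' s' z'. Suc e \<le> e' \<Longrightarrow> e' < 2 * S \<Longrightarrow> valid s z e' \<Longrightarrow> desc (child z e') (s', z') \<Longrightarrow>
          \<exists>j\<le>n2. (nxt ^^ j) (X (Suc e)) = (s', False, z')"
        using inner.hyps[OF lt] by blast
      have go: "(nxt ^^ (j + Suc n1)) (X a) = (nxt ^^ j) (X (Suc e))" for j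
        using n1(1) st Xa by (simp only: funpow_add o_apply funpow.simps)
      show ?thesis
      proof (rule exI[of _ "n2 + Suc n1"], intro conjI allI impI)
        show "(nxt ^^ (n2 + Suc n1)) (X a) = (s, True, z)" using go n2 by simp
        fix e' s' z' assume e': "a \<le> e' \<and> e' < 2 * S \<and> valid s z e' \<and> desc (child z e') (s', z')"
        show "\<exists>j\<le>n2 + Suc n1. (nxt ^^ j) (X a) = (s', False, z')"
        proof (cases "e' = e")
          case True
          then obtain j where "j \<le> n1" "(nxt ^^ j) (X a) = (s', False, z')" using n1(2)[of s' z'] e' c Xa by auto
          then show ?thesis by (intro exI[of _ j]) auto
        next
          case False
          then have "Suc e \<le> e'" using e(4)[of e'] e' by (meson Suc_leI linorder_neqE_nat)
          then obtain j where "j \<le> n2" "(nxt ^^ j) (X (Suc e)) = (s', False, z')" using n2(2) e' by blast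
          then show ?thesis using go[of j] by (intro exI[of _ "j + Suc n1"]) auto
        qed
      qed
    qed
  qed
  have n0: "nxt (s, False, z) = X 0" by (simp add: nxt_def X_def)
  obtain n where n: "(nxt ^^ n) (X 0) = (s, True, z)" "\<And>e s' z'. e < 2 * S \<Longrightarrow> valid s z e \<Longrightarrow> desc (child z e) (s', z') \<Longrightarrow>
      \<exists>j\<le>n. (nxt ^^ j) (X 0) = (s', False, z')" using X[of 0] by blast
  have go: "(nxt ^^ Suc j) (s, False, z) = (nxt ^^ j) (X 0)" for j
    using n0 by (simp add: funpow_Suc_right del: funpow.simps)
  show ?case
  proof (rule exI[of _ "Suc n"], intro conjI allI impI)
    show "(nxt ^^ Suc n) (s, False, z) = (s, True, z)" using go n by simp
    fix s' z' assume "desc (s, z) (s', z')"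
    from this ok show "\<exists>j\<le>Suc n. (nxt ^^ j) (s, False, z) = (s', False, z')"
    proof (cases rule: desc_cases)
      case self
      then show ?thesis by (intro exI[of _ 0]) auto
    next
      case (below e)
      then obtain j where "j \<le> n" "(nxt ^^ j) (X 0) = (s', False, z')" using n(2) by blast
      then show ?thesis using go[of j] by (intro exI[of _ "Suc j"]) auto
    qed
  qed
qed

definition short :: "nat \<Rightarrow> node \<Rightarrow> bool" where
  "short Y u \<longleftrightarrow> (\<exists>j<Y. case (nxt ^^ j) (fst u, False, snd u) of (s, d, z) \<Rightarrow> H \<le> lvl s \<and> d)"

text \<open>Within its tree, a state finished at level H can only be the root itself, and the next
  step restarts the tour. So the tour has a period of at most Y, and every node ever visited is
  visited within the first period.\<close>

lemma short_covers:
  assumes ok: "nok (s, z)" "H \<le> lvl s" and sh: "short Y (s, z)" and w: "nok (s', z')" "root (s', z') = (s, z)"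
  shows "\<exists>j<Y. (nxt ^^ j) (s, False, z) = (s', False, z')"
proof -
  let ?t = "(s, False, z)"
  have tk: "tok ?t" using ok by (simp add: tok_def)
  obtain j0 s0 z0 where j0: "j0 < Y" "(nxt ^^ j0) ?t = (s0, True, z0)" "H \<le> lvl s0"
    using sh unfolding short_def by (fastforce split: prod.splits)
  have "root (s0, z0) = root (s, z)" using root_nxt_pow[OF tk, of j0] j0 by (simp add: tnode_def)
  then have "(s0, z0) = (s, z)" using root_top[of "(s0, z0)"] root_top[of "(s, z)"] j0 ok by simp
  then have per: "(nxt ^^ Suc j0) ?t = ?t" using j0 ok by (simp add: nxt_def)
  have "desc (s, z) (s', z')"
    using w ok by (auto simp: desc_def root_def nok_def)
  then obtain j where j: "(nxt ^^ j) ?t = (s', False, z')" using tour_covers[OF ok(1)] by blast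
  have "(nxt ^^ (j mod Suc j0)) ?t = (nxt ^^ j) ?t" using per by (rule funpow_mod_eq)
  moreover have "j mod Suc j0 < Y" using j0 mod_less_divisor[of "Suc j0" j] by linarith
  ultimately show ?thesis using j by metis
qed

text \<open>Walking backwards, y is the number of steps to the start. An earlier passage through a
  freshly entered root would be preceded by the finished root, and then the tour would have closed
  before step Y.\<close>

lemma long_decode:
  assumes ok: "nok (s, z)" "H \<le> lvl s" and lng: "\<not> short Y (s, z)" and y: "y < Y"
  shows "fnd Y (\<lambda>j. case (prv ^^ j) ((nxt ^^ y) (s, False, z)) of (s, d, z) \<Rightarrow> H \<le> lvl s \<and> \<not> d) = y"
proof (rule fnd_eq[OF y])
  let ?t = "(s, False, z)"
  have tk: "tok ?t" using ok by (simp add: tok_def)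
  show "case (prv ^^ y) ((nxt ^^ y) ?t) of (s, d, z) \<Rightarrow> H \<le> lvl s \<and> \<not> d"
    using prv_nxt_pow[OF tk, of y y] ok by simp
  fix j assume j: "j < y"
  show "\<not> (case (prv ^^ j) ((nxt ^^ y) ?t) of (s, d, z) \<Rightarrow> H \<le> lvl s \<and> \<not> d)"
  proof
    assume a: "case (prv ^^ j) ((nxt ^^ y) ?t) of (s, d, z) \<Rightarrow> H \<le> lvl s \<and> \<not> d"
    obtain s1 d1 z1 where e: "(nxt ^^ (y - j)) ?t = (s1, d1, z1)" by (cases "(nxt ^^ (y - j)) ?t") auto
    have s1: "H \<le> lvl s1" "\<not> d1" using a e prv_nxt_pow[OF tk, of j y] j by auto
    have "(prv ^^ 1) ((nxt ^^ (y - j)) ?t) = (nxt ^^ (y - j - 1)) ?t" using j by (intro prv_nxt_pow[OF tk]) auto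
    then have "(nxt ^^ (y - j - 1)) ?t = (s1, True, z1)" using e s1 by (simp add: prv_def)
    then have "short Y (s, z)" using s1 y j by (auto simp: short_def intro!: exI[of _ "y - j - 1"])
    then show False using lng by simp
  qed
qed

text \<open>Seeds and stored numbers are kept in cells that no head reaches; this is why they
  survive the tour.\<close>

lemma nxt_unchanged:
  assumes "tok t" "\<And>s. s < S \<Longrightarrow> pos s \<noteq> p"
  shows "snd (tnode (nxt t)) ! p = snd (tnode t) ! p"
proof -
  obtain s d z where t: "t = (s, d, z)" by (cases t) auto
  have s: "s < S" using assms by (simp add: t tok_def nok_def)
  have "pos s \<noteq> p" using assms s by blast
  moreover have "pos (e div 2) \<noteq> p" if "e < 2 * S" for e using assms(2)[of "e div 2"] that by auto
  ultimately show ?thesis by (auto simp: nxt_def t tnode_def Let_def child_def par_def)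
qed

lemma nxt_pow_unchanged:
  assumes "tok t" "\<And>s. s < S \<Longrightarrow> pos s \<noteq> p"
  shows "snd (tnode ((nxt ^^ n) t)) ! p = snd (tnode t) ! p"
proof (induction n)
  case (Suc n)
  then show ?case using nxt_unchanged[OF tok_nxt_pow[OF assms(1)] assms(2), of n] by simp
qed simp

end

section \<open>Pairwise independent sampling of coins\<close>

definition ip :: "nat \<Rightarrow> nat \<Rightarrow> nat \<Rightarrow> bool" where
  "ip l a i = odd (\<Sum>p<l. (a div 2 ^ p mod 2) * (i div 2 ^ p mod 2))"

definition sg :: "bool \<Rightarrow> int" where
  "sg b = (if b then - 1 else 1)"

lemma ip_Suc: "ip (Suc l) a i \<longleftrightarrow> (odd a \<and> odd i) \<noteq> ip l (a div 2) (i div 2)"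
proof -
  have "(\<Sum>p<Suc l. (a div 2 ^ p mod 2) * (i div 2 ^ p mod 2)) =
    (a mod 2) * (i mod 2) + (\<Sum>p<l. (a div 2 div 2 ^ p mod 2) * (i div 2 div 2 ^ p mod 2))"
    by (subst sum.lessThan_Suc_shift) (simp add: div_mult2_eq)
  then show ?thesis by (auto simp: ip_def)
qed

lemma sum_two: "(\<Sum>a<2 * n. f a) = (\<Sum>a<n. f (2 * a) + f (Suc (2 * a)))" for f :: "nat \<Rightarrow> int"
  by (induction n) auto

text \<open>Orthogonality of the Walsh functions. Splitting off the lowest bit of a, its two values
  contribute the same sign if i and j have equal parity and cancel otherwise.\<close>

lemma sg_orthogonal:
  assumes "i < 2 ^ l" "j < 2 ^ l"
  shows "(\<Sum>a<2 ^ l. sg (ip l a i) * sg (ip l a j)) = (if i = j then 2 ^ l else 0)"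
  using assms
proof (induction l arbitrary: i j)
  case 0
  then show ?case by (simp add: sg_def)
next
  case (Suc l)
  have lt: "i div 2 < 2 ^ l" "j div 2 < 2 ^ l" using Suc.prems by auto
  have "(\<Sum>a<2 ^ Suc l. sg (ip (Suc l) a i) * sg (ip (Suc l) a j)) =
    (\<Sum>a<2 ^ l. (if odd i = odd j then 2 else 0) * (sg (ip l a (i div 2)) * sg (ip l a (j div 2))))"
    unfolding power_Suc sum_two by (intro sum.cong) (auto simp: ip_Suc sg_def)
  also have "\<dots> = (if odd i = odd j then 2 else 0) * (if i div 2 = j div 2 then 2 ^ l else 0)"
    unfolding sum_distrib_left[symmetric] Suc.IH[OF lt] ..
  also have "\<dots> = (if i = j then 2 ^ Suc l else 0)"
    by (auto dest: odd_two_times_div_two_succ)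
  finally show ?case .
qed

text \<open>The deviation \<open>G a\<close> is a combination of the orthogonal sign functions with
  coefficients in {-1, 0, 1}, so its squares sum to at most m 2^l over all seeds, while each seed
  counted contributes at least 4 m^2 / E^2. Single coins need not be balanced: sample 0 always
  tosses 0.\<close>

lemma chebyshev_count:
  assumes A: "A0 \<subseteq> {..<m}" "A1 \<subseteq> {..<m}" and m: "m \<le> 2 ^ l"
  shows "card {a. a < 2 ^ l \<and> 2 * E * card {i. i < m \<and> (if ip l a i then i \<in> A1 else i \<in> A0)} + 2 * m
      < E * (card A0 + card A1)} * (4 * m) \<le> 2 ^ l * E\<^sup>2"
proof (cases "m = 0")
  case False
  define g :: "nat \<Rightarrow> int" where "g i = of_bool (i \<in> A0) - of_bool (i \<in> A1)" for i
  define G where "G a = (\<Sum>i<m. g i * sg (ip l a i))" for a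
  let ?X = "\<lambda>a. card {i. i < m \<and> (if ip l a i then i \<in> A1 else i \<in> A0)}"
  let ?B = "{a. a < 2 ^ l \<and> 2 * E * ?X a + 2 * m < E * (card A0 + card A1)}"
  have cA: "int (card B) = (\<Sum>i<m. of_bool (i \<in> B))" if "B \<subseteq> {..<m}" for B
  proof -
    have "{..<m} \<inter> {i. i \<in> B} = B" using that by auto
    then show ?thesis by (simp add: sum.If_cases of_bool_def)
  qed
  have GX: "2 * int (?X a) - int (card A0) - int (card A1) = G a" for a
  proof -
    have X: "int (?X a) = (\<Sum>i<m. of_bool (if ip l a i then i \<in> A1 else i \<in> A0))"
      by (subst cA) (auto intro!: sum.cong simp del: sum_of_bool_eq)
    have "2 * int (?X a) - int (card A0) - int (card A1) =
      (\<Sum>i<m. 2 * of_bool (if ip l a i then i \<in> A1 else i \<in> A0) - of_bool (i \<in> A0) - of_bool (i \<in> A1))"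
      unfolding X cA[OF A(1)] cA[OF A(2)] by (simp add: sum_subtractf sum_distrib_left)
    also have "\<dots> = G a" unfolding G_def by (intro sum.cong) (auto simp: g_def sg_def)
    finally show ?thesis .
  qed
  have big: "4 * (int m)\<^sup>2 \<le> (int E)\<^sup>2 * (G a)\<^sup>2" if "a \<in> ?B" for a
  proof -
    have "int (2 * E * ?X a + 2 * m) < int (E * (card A0 + card A1))" using that by (simp only: mem_Collect_eq of_nat_less_iff)
    then have "int E * G a < - 2 * int m" unfolding GX[symmetric] by (simp add: algebra_simps)
    then have "2 * int m \<le> \<bar>int E * G a\<bar>" by linarith
    then have "(2 * int m)\<^sup>2 \<le> (int E * G a)\<^sup>2" by (metis abs_le_square_iff abs_of_nat abs_mult abs_numeral of_nat_numeral of_nat_mult)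
    then show ?thesis by (simp add: power_mult_distrib)
  qed
  have "(\<Sum>a<2 ^ l. (G a)\<^sup>2) = (\<Sum>a<2 ^ l. \<Sum>i<m. \<Sum>j<m. (g i * g j) * (sg (ip l a i) * sg (ip l a j)))"
    by (simp add: G_def power2_eq_square sum_product algebra_simps)
  also have "\<dots> = (\<Sum>i<m. \<Sum>j<m. \<Sum>a<2 ^ l. (g i * g j) * (sg (ip l a i) * sg (ip l a j)))"
    by (subst sum.swap, rule sum.cong[OF refl], rule sum.swap)
  also have "\<dots> = (\<Sum>i<m. \<Sum>j<m. (g i * g j) * (if i = j then 2 ^ l else 0))"
  proof (intro sum.cong refl)
    fix i j assume "i \<in> {..<m}" "j \<in> {..<m}"
    then have "i < 2 ^ l" "j < 2 ^ l" using m by auto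
    then show "(\<Sum>a<2 ^ l. (g i * g j) * (sg (ip l a i) * sg (ip l a j))) = (g i * g j) * (if i = j then 2 ^ l else 0)"
      unfolding sum_distrib_left[symmetric] by (simp add: sg_orthogonal)
  qed
  also have "\<dots> = (\<Sum>i<m. (g i)\<^sup>2 * 2 ^ l)"
    by (intro sum.cong refl) (simp add: power2_eq_square if_distrib cong: if_cong)
  also have "\<dots> \<le> (\<Sum>i<m. 2 ^ l)" by (intro sum_mono) (auto simp: g_def of_bool_def)
  finally have tot: "(\<Sum>a<2 ^ l. (G a)\<^sup>2) \<le> int m * 2 ^ l" by simp
  have "int (card ?B) * (4 * (int m)\<^sup>2) = (\<Sum>a\<in>?B. 4 * (int m)\<^sup>2)" by simp
  also have "\<dots> \<le> (\<Sum>a\<in>?B. (int E)\<^sup>2 * (G a)\<^sup>2)" using big by (intro sum_mono) blast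
  also have "\<dots> \<le> (\<Sum>a<2 ^ l. (int E)\<^sup>2 * (G a)\<^sup>2)" by (intro sum_mono2) auto
  also have "\<dots> = (int E)\<^sup>2 * (\<Sum>a<2 ^ l. (G a)\<^sup>2)" by (simp add: sum_distrib_left)
  also have "\<dots> \<le> (int E)\<^sup>2 * (int m * 2 ^ l)" using tot by (intro mult_left_mono) auto
  finally have "int m * (int (card ?B) * (4 * int m)) \<le> int m * (2 ^ l * (int E)\<^sup>2)"
    by (simp add: power2_eq_square algebra_simps)
  then have "int (card ?B) * (4 * int m) \<le> 2 ^ l * (int E)\<^sup>2" using False by (simp add: mult_le_cancel_left)
  then have "int (card ?B * (4 * m)) \<le> int (2 ^ l * E\<^sup>2)" by simp
  then show ?thesis by (simp only: of_nat_le_iff)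
qed simp

text \<open>The small state i S0 + k of the forest means that sample i is in the packed
  configuration k. \<open>ktop\<close> and \<open>kbot\<close> are two extra states one level above
  the last configurations, for runs that end as guessed and for those that do not.\<close>

locale sampler =
  fixes S0 m T Lt E l :: nat and pos0 :: "nat \<Rightarrow> nat" and nx0 :: "nat \<Rightarrow> bool \<Rightarrow> bool \<Rightarrow> nat"
    and wr0 :: "nat \<Rightarrow> bool \<Rightarrow> bool \<Rightarrow> bool" and lvl0 :: "nat \<Rightarrow> nat" and acc :: "nat \<Rightarrow> bool" and ktop kbot :: nat
  assumes nx0_less: "k < S0 \<Longrightarrow> lvl0 k < T \<Longrightarrow> nx0 k b r < S0"
    and lvl0_nx0: "k < S0 \<Longrightarrow> lvl0 k < T \<Longrightarrow> lvl0 (nx0 k b r) = Suc (lvl0 k)"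
    and pos0_less: "k < S0 \<Longrightarrow> pos0 k < Lt"
    and ktop: "ktop < S0" "lvl0 ktop = Suc T" and kbot: "kbot < S0" "lvl0 kbot = Suc T" "ktop \<noteq> kbot"
    and m: "0 < m" "m \<le> 2 ^ l" and E: "0 < E"
begin

definition pos :: "nat \<Rightarrow> nat" where "pos s = pos0 (s mod S0)"
definition lvl :: "nat \<Rightarrow> nat" where "lvl s = lvl0 (s mod S0)"
text \<open>In the last step the sample index is dropped, so that the successful runs of all samples
  ending with the same tape share one root.\<close>

definition nxs :: "(nat \<Rightarrow> nat) \<Rightarrow> nat \<Rightarrow> bool \<Rightarrow> nat" where
  "nxs a s b = (if lvl s < T then (s div S0) * S0 + nx0 (s mod S0) b (ip l (a (lvl s)) (s div S0))
     else if acc (s mod S0) then ktop else kbot)"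
definition wrs :: "(nat \<Rightarrow> nat) \<Rightarrow> nat \<Rightarrow> bool \<Rightarrow> bool" where
  "wrs a s b = (if lvl s < T then wr0 (s mod S0) b (ip l (a (lvl s)) (s div S0)) else b)"

lemma S0_pos: "0 < S0" using ktop by simp

lemma snode: assumes "k < S0" "i < m"
  shows "(i * S0 + k) mod S0 = k" "(i * S0 + k) div S0 = i" "i * S0 + k < m * S0"
proof -
  show "(i * S0 + k) mod S0 = k" "(i * S0 + k) div S0 = i" using assms by auto
  have "i * S0 + k < Suc i * S0" using assms by simp
  also have "\<dots> \<le> m * S0" using assms by (intro mult_le_mono1) simp
  finally show "i * S0 + k < m * S0" .
qed

lemma snode_top: "k < S0 \<Longrightarrow> k < m * S0"
  using snode(3)[of k 0] m by simp

sublocale F: forest "m * S0" "Suc T" Lt tm pos "nxs a" "wrs a" lvl for tm a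
proof
  fix s b assume s: "s < m * S0" "lvl s < Suc T"
  have k: "s mod S0 < S0" "s div S0 < m" using s S0_pos by (auto simp: less_mult_imp_div_less)
  show "nxs a s b < m * S0"
    using s k snode(3)[of "nx0 (s mod S0) b (ip l (a (lvl s)) (s div S0))" "s div S0"] nx0_less[of "s mod S0"]
      snode_top ktop kbot by (auto simp: nxs_def lvl_def)
  show "lvl (nxs a s b) = Suc (lvl s)"
    using s k nx0_less[of "s mod S0"] lvl0_nx0[of "s mod S0"] ktop kbot by (auto simp: nxs_def lvl_def)
next
  fix s assume "s < m * S0"
  then show "pos s < Lt" using S0_pos by (simp add: pos_def pos0_less)
qed

definition rt :: "(nat \<Rightarrow> nat) \<Rightarrow> node \<Rightarrow> node" where
  "rt a = forest.root (Suc T) pos (nxs a) (wrs a) lvl"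

definition isin :: "(nat \<Rightarrow> nat) \<Rightarrow> bool list \<Rightarrow> nat \<Rightarrow> bool list \<Rightarrow> bool" where
  "isin a \<tau> s z \<longleftrightarrow> rt a (s, z) = (ktop, \<tau>)"

definition stp :: "nat \<Rightarrow> bool list \<Rightarrow> bool \<Rightarrow> node" where
  "stp k z r = (nx0 k (z ! pos0 k) r, z[pos0 k := wr0 k (z ! pos0 k) r])"

definition cntin :: "(nat \<Rightarrow> nat) \<Rightarrow> bool list \<Rightarrow> node \<Rightarrow> nat" where
  "cntin a \<tau> u = card {i. i < m \<and> isin a \<tau> (i * S0 + fst u) (snd u)}"

definition hits :: "(nat \<Rightarrow> nat) \<Rightarrow> bool list \<Rightarrow> nat \<Rightarrow> bool list \<Rightarrow> nat \<Rightarrow> nat" where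
  "hits a \<tau> k z a' = card {i. i < m \<and> isin a \<tau> (i * S0 + fst (stp k z (ip l a' i))) (snd (stp k z (ip l a' i)))}"

text \<open>The seed a' misrepresents the average of the two successors of (k, z).\<close>

definition badat :: "(nat \<Rightarrow> nat) \<Rightarrow> bool list \<Rightarrow> nat \<Rightarrow> bool list \<Rightarrow> nat \<Rightarrow> bool" where
  "badat a \<tau> k z a' \<longleftrightarrow> 2 * E * hits a \<tau> k z a' + 2 * m
     < E * (cntin a \<tau> (stp k z False) + cntin a \<tau> (stp k z True))"

text \<open>Only the counts at level t + 1 enter, so the verdict depends on \<open>a\<close> only
  through the seeds of times after t; the seed on trial is the separate argument.\<close>

definition bad :: "(nat \<Rightarrow> nat) \<Rightarrow> bool list \<Rightarrow> nat \<Rightarrow> nat \<Rightarrow> bool" where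
  "bad a \<tau> t a' \<longleftrightarrow> (\<exists>k z. k < S0 \<and> lvl0 k = t \<and> length z = Lt \<and> badat a \<tau> k z a')"

lemma stp_ok: "k < S0 \<Longrightarrow> lvl0 k < T \<Longrightarrow> fst (stp k z r) < S0 \<and> lvl0 (fst (stp k z r)) = Suc (lvl0 k) \<and> length (snd (stp k z r)) = length z"
  by (simp add: stp_def nx0_less lvl0_nx0)

lemma node_ok:
  assumes "k < S0" "i < m" "lvl0 k \<le> Suc T" "length z = Lt"
  shows "F.nok 0 (i * S0 + k, z)"
  using assms by (auto simp: F.nok_def lvl_def snode)

lemma rt_step:
  assumes "k < S0" "i < m" "lvl0 k < T" "length z = Lt"
  shows "rt a (i * S0 + k, z) = rt a (i * S0 + fst (stp k z (ip l (a (lvl0 k)) i)), snd (stp k z (ip l (a (lvl0 k)) i)))"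
proof -
  have "F.par a (i * S0 + k, z) = (i * S0 + fst (stp k z (ip l (a (lvl0 k)) i)), snd (stp k z (ip l (a (lvl0 k)) i)))"
    using assms by (simp add: F.par_def pos_def nxs_def wrs_def lvl_def snode stp_def)
  then show ?thesis using F.root_par[OF node_ok[of k i z], of a] assms by (simp add: rt_def lvl_def snode)
qed

lemma isin_step:
  assumes "k < S0" "i < m" "lvl0 k < T" "length z = Lt"
  shows "isin a \<tau> (i * S0 + k) z \<longleftrightarrow>
    isin a \<tau> (i * S0 + fst (stp k z (ip l (a (lvl0 k)) i))) (snd (stp k z (ip l (a (lvl0 k)) i)))"
  using rt_step[OF assms] by (simp add: isin_def)

lemma isin_last:
  assumes "k < S0" "i < m" "lvl0 k = T" "length z = Lt"
  shows "isin a \<tau> (i * S0 + k) z \<longleftrightarrow> acc k \<and> z = \<tau>"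
proof -
  have p: "F.par a (i * S0 + k, z) = (if acc k then ktop else kbot, z)"
    using assms by (simp add: F.par_def pos_def nxs_def wrs_def lvl_def snode)
  have "rt a (i * S0 + k, z) = rt a (if acc k then ktop else kbot, z)"
    using F.root_par[OF node_ok[of k i z], of a] assms p by (simp add: rt_def lvl_def snode)
  also have "\<dots> = (if acc k then ktop else kbot, z)"
    unfolding rt_def using ktop kbot by (intro F.root_top) (auto simp: lvl_def)
  finally show ?thesis using kbot by (auto simp: isin_def)
qed

primrec pr :: "bool list \<Rightarrow> nat \<Rightarrow> node \<Rightarrow> real" where
  "pr \<tau> 0 u = of_bool (acc (fst u) \<and> snd u = \<tau>)"
| "pr \<tau> (Suc n) u = (pr \<tau> n (stp (fst u) (snd u) False) + pr \<tau> n (stp (fst u) (snd u) True)) / 2"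

lemma good_seeds_count:
  assumes "\<And>t. t < T \<Longrightarrow> \<not> bad a \<tau> t (a t)"
    and "k < S0" "lvl0 k + n = T" "length z = Lt"
  shows "real E * real (cntin a \<tau> (k, z)) \<ge> real E * real m * pr \<tau> n (k, z) - real m * real n"
  using assms(2-)
proof (induction n arbitrary: k z)
  case 0
  have "{i. i < m \<and> isin a \<tau> (i * S0 + k) z} = {i. i < m \<and> acc k \<and> z = \<tau>}"
    using isin_last 0 by (intro Collect_cong) auto
  then show ?case by (simp add: cntin_def)
next
  case (Suc n)
  define t where "t = lvl0 k"
  have t: "t < T" using Suc.prems by (simp add: t_def)
  have "\<not> badat a \<tau> k z (a t)" using assms(1)[OF t] Suc.prems by (auto simp: bad_def t_def)
  moreover have "hits a \<tau> k z (a t) = cntin a \<tau> (k, z)"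
    unfolding hits_def cntin_def using isin_step[of k _ z a \<tau>] Suc.prems t
    by (intro arg_cong[where f = card] Collect_cong) (auto simp: t_def)
  ultimately have "E * (cntin a \<tau> (stp k z False) + cntin a \<tau> (stp k z True)) \<le> 2 * E * cntin a \<tau> (k, z) + 2 * m"
    by (simp add: badat_def)
  then have 1: "real E * real (cntin a \<tau> (stp k z False)) + real E * real (cntin a \<tau> (stp k z True))
      \<le> 2 * (real E * real (cntin a \<tau> (k, z))) + 2 * real m"
    by (simp add: of_nat_le_iff[where 'a = real, symmetric] algebra_simps)
  have 2: "real E * real (cntin a \<tau> (stp k z r)) \<ge> real E * real m * pr \<tau> n (stp k z r) - real m * real n" for r
    using Suc.IH[of "fst (stp k z r)" "snd (stp k z r)"] stp_ok[of k z r] Suc.prems t by (simp add: t_def)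
  from 1 2[of False] 2[of True] show ?case by (simp add: algebra_simps)
qed

text \<open>A union bound that does not run over all tapes: a seed can be bad only next to a heavy
  node, and a short tour leaves room for few heavy nodes. The three factors are E Y/m heavy nodes, 2
  S0 predecessors of each, and a fraction E^2/(4 m) of seeds bad at one node.\<close>

lemma bad_card:
  assumes t: "t < T" and tau: "length \<tau> = Lt" and sh: "F.short (Suc t) a Y (ktop, \<tau>)"
  shows "card {a'. a' < 2 ^ l \<and> bad a \<tau> t a'} * (2 * m * m) \<le> S0 * E ^ 3 * Y * 2 ^ l"
proof -
  \<comment> \<open>Heavy nodes: at least m/E samples lead from them to the root. Their counts sum
    to at most Y, since different pairs of a heavy node and a sample are different nodes of the
    tour.\<close>
  define HV where "HV = {u. fst u < S0 \<and> lvl0 (fst u) = Suc t \<and> length (snd u) = Lt \<and> m \<le> E * cntin a \<tau> u}"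
  define U where "U = {u. fst u < S0 \<and> lvl0 (fst u) = t \<and> length (snd u) = Lt \<and> (\<exists>a'. badat a \<tau> (fst u) (snd u) a')}"
  have fin: "finite {u :: node. fst u < S0 \<and> length (snd u) = Lt}"
  proof -
    have "{u :: node. fst u < S0 \<and> length (snd u) = Lt} = {..<S0} \<times> {z. length z = Lt}" by auto
    moreover have "finite {z :: bool list. length z = Lt}" using finite_lists_length_eq[of "UNIV :: bool set" Lt] by simp
    ultimately show ?thesis by simp
  qed
  have fHV: "finite HV" and fU: "finite U" by (auto simp: HV_def U_def intro!: finite_subset[OF _ fin])
  let ?f = "\<lambda>(u, i). (i * S0 + fst u, snd u) :: node"
  let ?D = "SIGMA u:HV. {i. i < m \<and> isin a \<tau> (i * S0 + fst u) (snd u)}"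
  have inj: "inj_on ?f ?D"
  proof (rule inj_onI)
    fix x y assume xy: "x \<in> ?D" "y \<in> ?D" "?f x = ?f y"
    obtain k z i k' z' i' where [simp]: "x = ((k, z), i)" "y = ((k', z'), i')" by (metis prod.exhaust)
    have lt: "k < S0" "k' < S0" "i < m" "i' < m" using xy by (auto simp: HV_def)
    have e: "i * S0 + k = i' * S0 + k'" "z = z'" using xy by auto
    have "k = k'" "i = i'" using snode(1,2)[OF lt(1,3)] snode(1,2)[OF lt(2,4)] e(1) by metis+
    then show "x = y" using e by simp
  qed
  have img: "?f ` ?D \<subseteq> (\<lambda>j. F.tnode ((F.nxt (Suc t) a ^^ j) (ktop, False, \<tau>))) ` {..<Y}"
  proof
    fix w assume "w \<in> ?f ` ?D"
    then obtain k z i where w: "w = (i * S0 + k, z)" "(k, z) \<in> HV" "i < m" "isin a \<tau> (i * S0 + k) z" by auto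
    have k: "k < S0" "lvl0 k = Suc t" "length z = Lt" using w by (auto simp: HV_def)
    have "F.nok (Suc t) (i * S0 + k, z)" using k w t by (auto simp: F.nok_def lvl_def snode)
    moreover have "F.nok (Suc t) (ktop, \<tau>)" using ktop tau t snode_top by (auto simp: F.nok_def lvl_def)
    moreover have "F.root a (i * S0 + k, z) = (ktop, \<tau>)" using w by (simp add: isin_def rt_def)
    ultimately have "\<exists>j<Y. (F.nxt (Suc t) a ^^ j) (ktop, False, \<tau>) = (i * S0 + k, False, z)"
      using F.short_covers[of "Suc t" ktop \<tau> a Y "i * S0 + k" z] sh ktop by (simp add: lvl_def)
    then show "w \<in> (\<lambda>j. F.tnode ((F.nxt (Suc t) a ^^ j) (ktop, False, \<tau>))) ` {..<Y}"
      using w by (auto simp: F.tnode_def image_iff intro!: bexI)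
  qed
  have "(\<Sum>u\<in>HV. cntin a \<tau> u) = card ?D" using fHV by (simp add: cntin_def)
  also have "\<dots> = card (?f ` ?D)" using inj by (simp add: card_image)
  also have "\<dots> \<le> card ((\<lambda>j. F.tnode ((F.nxt (Suc t) a ^^ j) (ktop, False, \<tau>))) ` {..<Y})"
    by (intro card_mono img) simp
  also have "\<dots> \<le> Y" using card_image_le[of "{..<Y}"] by (metis card_lessThan finite_lessThan)
  finally have sumY: "(\<Sum>u\<in>HV. cntin a \<tau> u) \<le> Y" .
  have "m * card HV = (\<Sum>u\<in>HV. m)" by simp
  also have "\<dots> \<le> (\<Sum>u\<in>HV. E * cntin a \<tau> u)" by (intro sum_mono) (auto simp: HV_def)
  also have "\<dots> \<le> E * Y" using sumY by (simp add: sum_distrib_left[symmetric])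
  finally have mHV: "m * card HV \<le> E * Y" .
  \<comment> \<open>A predecessor is recovered from its successor by its small state and the bit
    that was overwritten.\<close>
  let ?g = "\<lambda>(u, k, b). (k, (snd u)[pos0 k := b]) :: node"
  have "U \<subseteq> ?g ` (HV \<times> {..<S0} \<times> UNIV)"
  proof
    fix u assume u: "u \<in> U"
    obtain k z where [simp]: "u = (k, z)" by (cases u)
    have k: "k < S0" "lvl0 k = t" "length z = Lt" using u by (auto simp: U_def)
    obtain a' where "badat a \<tau> k z a'" using u by (auto simp: U_def)
    then have b: "2 * m < E * cntin a \<tau> (stp k z False) + E * cntin a \<tau> (stp k z True)"
      by (simp add: badat_def algebra_simps)
    then have "m \<le> E * cntin a \<tau> (stp k z False) \<or> m \<le> E * cntin a \<tau> (stp k z True)" by linarith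
    then obtain r where r: "m \<le> E * cntin a \<tau> (stp k z r)" by blast
    have "stp k z r \<in> HV" using r stp_ok[of k z r] k t by (auto simp: HV_def)
    moreover have "u = ?g (stp k z r, k, z ! pos0 k)" by (simp add: stp_def)
    ultimately show "u \<in> ?g ` (HV \<times> {..<S0} \<times> UNIV)" using k by blast
  qed
  then have "card U \<le> card (?g ` (HV \<times> {..<S0} \<times> (UNIV :: bool set)))" using fHV by (intro card_mono) auto
  also have "\<dots> \<le> card (HV \<times> {..<S0} \<times> (UNIV :: bool set))" using fHV by (intro card_image_le) auto
  finally have cU: "card U \<le> card HV * (S0 * 2)" by (simp add: card_cartesian_product)
  have each: "card {a'. a' < 2 ^ l \<and> badat a \<tau> k z a'} * (4 * m) \<le> 2 ^ l * E\<^sup>2" for k z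
  proof -
    define A where "A r = {i. i < m \<and> isin a \<tau> (i * S0 + fst (stp k z r)) (snd (stp k z r))}" for r
    have h: "hits a \<tau> k z a' = card {i. i < m \<and> (if ip l a' i then i \<in> A True else i \<in> A False)}" for a'
      unfolding hits_def A_def by (intro arg_cong[where f = card] Collect_cong) auto
    have c: "cntin a \<tau> (stp k z r) = card (A r)" for r by (simp add: cntin_def A_def)
    have AA: "A r \<subseteq> {..<m}" for r by (auto simp: A_def)
    show ?thesis unfolding badat_def h c by (rule chebyshev_count[OF AA AA m(2)])
  qed
  have "{a'. a' < 2 ^ l \<and> bad a \<tau> t a'} \<subseteq> (\<Union>u\<in>U. {a'. a' < 2 ^ l \<and> badat a \<tau> (fst u) (snd u) a'})"
    by (fastforce simp: bad_def U_def)
  then have "card {a'. a' < 2 ^ l \<and> bad a \<tau> t a'} \<le> card (\<Union>u\<in>U. {a'. a' < 2 ^ l \<and> badat a \<tau> (fst u) (snd u) a'})"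
    using fU by (intro card_mono) auto
  also have "\<dots> \<le> (\<Sum>u\<in>U. card {a'. a' < 2 ^ l \<and> badat a \<tau> (fst u) (snd u) a'})" using fU by (rule card_UN_le)
  finally have "card {a'. a' < 2 ^ l \<and> bad a \<tau> t a'} * (4 * m) \<le>
    (\<Sum>u\<in>U. card {a'. a' < 2 ^ l \<and> badat a \<tau> (fst u) (snd u) a'} * (4 * m))"
    by (simp add: sum_distrib_right[symmetric])
  also have "\<dots> \<le> (\<Sum>u\<in>U. 2 ^ l * E\<^sup>2)" using each by (intro sum_mono) auto
  also have "\<dots> = card U * (2 ^ l * E\<^sup>2)" by simp
  also have "\<dots> \<le> card HV * (S0 * 2) * (2 ^ l * E\<^sup>2)" using cU by (intro mult_le_mono1)
  finally have "card {a'. a' < 2 ^ l \<and> bad a \<tau> t a'} * (4 * m) * m \<le> card HV * (S0 * 2) * (2 ^ l * E\<^sup>2) * m"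
    by (intro mult_le_mono1)
  also have "\<dots> = (m * card HV) * (S0 * 2 * (2 ^ l * E\<^sup>2))" by (simp add: algebra_simps)
  also have "\<dots> \<le> E * Y * (S0 * 2 * (2 ^ l * E\<^sup>2))" using mHV by (intro mult_le_mono1)
  finally have "2 * (card {a'. a' < 2 ^ l \<and> bad a \<tau> t a'} * (2 * m * m)) \<le> 2 * (S0 * E ^ 3 * Y * 2 ^ l)"
    by (simp add: power2_eq_square power3_eq_cube algebra_simps)
  then show ?thesis by (simp add: ac_simps)
qed

end

section \<open>The given machine on packed configurations\<close>

definition bitsval :: "bool list \<Rightarrow> nat" where
  "bitsval bs = (\<Sum>p<length bs. of_bool (bs ! p) * 2 ^ p)"

lemma bitsval_Nil [simp]: "bitsval [] = 0"
  by (simp add: bitsval_def)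

lemma bitsval_Cons: "bitsval (b # bs) = of_bool b + 2 * bitsval bs"
  unfolding bitsval_def length_Cons by (subst sum.lessThan_Suc_shift) (simp add: sum_distrib_left algebra_simps del: sum_of_bool_mult_eq sum_mult_of_bool_eq)

lemma bitsval_less: "bitsval bs < 2 ^ length bs"
  by (induction bs) (auto simp: bitsval_Cons of_bool_def)

lemma bitsval_bit: "bitsval bs div 2 ^ h mod 2 = of_bool (rd bs h)"
proof (induction bs arbitrary: h)
  case Nil
  then show ?case by (simp add: rd_def)
next
  case (Cons b bs)
  show ?case
  proof (cases h)
    case 0
    then show ?thesis by (auto simp: bitsval_Cons rd_def)
  next
    case (Suc h')
    have "(of_bool b + 2 * bitsval bs) div 2 = bitsval bs" by (auto simp: of_bool_def)
    then show ?thesis using Cons[of h'] Suc by (simp add: bitsval_Cons rd_def div_mult2_eq)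
  qed
qed

lemma bitsval_ge: "h < length bs \<Longrightarrow> bs ! h \<Longrightarrow> 2 ^ h \<le> bitsval bs"
  unfolding bitsval_def by (intro order_trans[OF _ member_le_sum[of h]]) auto

lemma bitsval_update:
  assumes "h < length bs"
  shows "bitsval (bs[h := b]) = bitsval bs - of_bool (bs ! h) * 2 ^ h + of_bool b * 2 ^ h"
proof -
  have "bitsval (bs[h := b]) + of_bool (bs ! h) * 2 ^ h = bitsval bs + of_bool b * 2 ^ h"
    using assms
  proof (induction bs arbitrary: h)
    case (Cons a bs)
    then show ?case by (cases h) (force simp: bitsval_Cons)+
  qed simp
  moreover have "of_bool (bs ! h) * 2 ^ h \<le> bitsval bs" using bitsval_ge[OF assms] by (auto simp: of_bool_def)
  ultimately show ?thesis by linarith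
qed

fun dcode :: "dir \<Rightarrow> nat" where "dcode MvL = 0" | "dcode MvN = 1" | "dcode MvR = 2"

definition mvnum :: "nat \<Rightarrow> nat \<Rightarrow> nat \<Rightarrow> nat" where
  "mvnum d h mx = (if d = 0 then h - 1 else if d = 1 then h else min (h + 1) mx)"

lemma mvnum_move: "mvnum (dcode d) h (len - 1) = move d h len"
  by (cases d) (simp_all add: mvnum_def)

definition incode :: "bool list \<Rightarrow> nat \<Rightarrow> nat" where
  "incode x i = (case insym x i of None \<Rightarrow> 0 | Some b \<Rightarrow> if b then 2 else 1)"

text \<open>An index packs 4 st + 2 g + r (state, guess, current random bit), the input symbol, the work bit
and the catalytic bit.\<close>

definition dlt :: "cmachine \<Rightarrow> nat \<Rightarrow> nat \<times> dir \<times> bool \<times> dir \<times> bool \<times> dir \<times> bool" where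
  "dlt M i = (let q = i div 48; wb = odd (i div 2); cb = odd i in
     if q = qacc M \<or> q = qrej M then (q, MvN, wb, MvN, cb, MvN, False)
     else delta M q (if i div 4 mod 3 = 0 then None else Some (i div 4 mod 3 = 2)) wb cb (odd (i div 12)))"

definition tb :: "cmachine \<Rightarrow> (nat \<Rightarrow> nat) \<Rightarrow> nat \<Rightarrow> nat" where
  "tb M F i = (if i < 48 * nst M then F i else 0)"

definition t_st where "t_st M = tb M (\<lambda>i. case dlt M i of (q, di, ww, dw, cw, dc, adv) \<Rightarrow> 4 * q + i div 24 mod 2 * 2)"
definition t_di where "t_di M = tb M (\<lambda>i. case dlt M i of (q, di, ww, dw, cw, dc, adv) \<Rightarrow> dcode di)"
definition t_ww where "t_ww M = tb M (\<lambda>i. case dlt M i of (q, di, ww, dw, cw, dc, adv) \<Rightarrow> of_bool ww)"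
definition t_dw where "t_dw M = tb M (\<lambda>i. case dlt M i of (q, di, ww, dw, cw, dc, adv) \<Rightarrow> dcode dw)"
definition t_cw where "t_cw M = tb M (\<lambda>i. case dlt M i of (q, di, ww, dw, cw, dc, adv) \<Rightarrow> of_bool cw)"
definition t_dc where "t_dc M = tb M (\<lambda>i. case dlt M i of (q, di, ww, dw, cw, dc, adv) \<Rightarrow> dcode dc)"
definition t_ad where "t_ad M = tb M (\<lambda>i. case dlt M i of (q, di, ww, dw, cw, dc, adv) \<Rightarrow> of_bool adv)"

lemmas t_defs = t_st_def t_di_def t_ww_def t_dw_def t_cw_def t_dc_def t_ad_def

text \<open>Digits in base R: \<open>f\<close> holds state, guess and current coin, then come input
  head, work tape, work head, catalytic head and time. The work head is stored as 2 to the power of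
  its position, so that reading a work bit is one division. The time is the leading digit.\<close>

definition pk :: "nat \<Rightarrow> nat \<Rightarrow> nat \<Rightarrow> nat \<Rightarrow> nat \<Rightarrow> nat \<Rightarrow> nat \<Rightarrow> nat" where
  "pk R f i w h c t = f + R * (i + R * (w + R * (h + R * (c + R * t))))"

lemma pk_cmp:
  assumes "f < R" "i < R" "w < R" "h < R" "c < R"
  shows "pk R f i w h c t mod R = f" "pk R f i w h c t div R mod R = i" "pk R f i w h c t div R ^ 2 mod R = w"
    "pk R f i w h c t div R ^ 3 mod R = h" "pk R f i w h c t div R ^ 4 mod R = c" "pk R f i w h c t div R ^ 5 = t"
  using assms by (auto simp: pk_def power2_eq_square numeral_eq_Suc div_mult2_eq)

lemma pk_less:
  assumes "f < R" "i < R" "w < R" "h < R" "c < R" "t < R"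
  shows "pk R f i w h c t < R ^ 6"
proof -
  have s: "a + R * b < R * B" if "a < R" "b < B" for a b B
  proof -
    have "a + R * b < R * Suc b" using that by simp
    also have "\<dots> \<le> R * B" using that by (intro mult_le_mono2) simp
    finally show ?thesis .
  qed
  show ?thesis unfolding pk_def
    by (simp add: numeral_eq_Suc) (intro s assms)
qed

text \<open>The exponent makes R = P^rho exceed every digit: P^(k + 1) covers tape contents and
  times, P^2 the input head, and P^(4 nst) \<ge> 2^(4 nst) the states.\<close>

locale mach =
  fixes M :: cmachine and k rho :: nat and x :: "bool list"
  assumes wf: "wf_machine M" and rho: "rho = k + 4 * nst M + 3"
begin

definition "n = length x"
definition "N = max n 2"
definition "T = N ^ k"
definition "w = k * lg n"
definition "P = (2::nat) ^ lg n"
definition "R = P ^ rho"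
definition "S0 = R ^ 6"

lemma P2: "2 \<le> P" using lg_pos[of n] self_le_power[of 2 "lg n"] by (simp add: P_def)
lemma NP: "N \<le> P" using le_pow_lg[of n] by (simp add: N_def P_def)
lemma N2: "2 \<le> N" by (simp add: N_def)
lemma T_pos: "0 < T" using N2 by (simp add: T_def)
lemma w_pow: "2 ^ w = P ^ k" by (simp add: w_def P_def power_mult[symmetric] mult.commute)

lemma Rs: "4 * nst M < R" "n + 1 < R" "2 ^ w < R" "T + 1 < R" "2 \<le> R"
proof -
  have Pi: "P ^ i \<le> P ^ j" if "i \<le> j" for i j using P2 that by (intro power_increasing) auto
  have TP: "T \<le> P ^ k" unfolding T_def using NP by (intro power_mono) auto
  have k1: "P ^ k + P ^ k \<le> P ^ (k + 1)" using P2 by (simp add: mult_2[symmetric])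
  have k2: "P ^ (k + 1) \<le> R" unfolding R_def by (intro Pi) (simp add: rho)
  have Pk: "1 \<le> P ^ k" using P2 by simp
  have "P ^ 1 \<le> R" unfolding R_def by (intro Pi) (simp add: rho)
  then show "2 \<le> R" using P2 by simp
  show "2 ^ w < R" using k1 k2 Pk unfolding w_pow by linarith
  have "P ^ (k + 1) < P ^ rho" using P2 by (intro power_strict_increasing) (auto simp: rho)
  then show "T + 1 < R" using TP k1 Pk unfolding R_def by linarith
  have "4 * nst M < 2 ^ (4 * nst M)" by (rule less_exp)
  also have "\<dots> \<le> P ^ (4 * nst M)" using P2 by (intro power_mono) auto
  also have "\<dots> \<le> R" unfolding R_def by (intro Pi) (simp add: rho)
  finally show "4 * nst M < R" .
  have "n + 1 \<le> P + P" using NP P2 by (simp add: N_def)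
  also have "\<dots> \<le> P ^ 2" using P2 by (simp add: power2_eq_square mult_2[symmetric])
  also have "P ^ 2 < P ^ rho" using P2 by (intro power_strict_increasing) (auto simp: rho)
  finally show "n + 1 < R" by (simp add: R_def)
qed

definition cm :: "nat \<Rightarrow> nat \<Rightarrow> nat" where "cm j y = y div R ^ j mod R"
definition lv :: "nat \<Rightarrow> nat" where "lv y = y div R ^ 5"

definition ix :: "nat \<Rightarrow> bool \<Rightarrow> nat" where
  "ix y b = cm 0 y * 12 + incode x (cm 1 y) * 4 + (cm 2 y div cm 3 y mod 2) * 2 + of_bool b"

text \<open>Every number below \<open>S0\<close> counts as a node, also those that pack no
  configuration. The guard on digit 0 and the reduction modulo \<open>2 ^ w\<close> keep such
  numbers below \<open>S0\<close>. The coin \<open>r\<close> replaces the current one only if the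
  random head advances.\<close>

definition nx0 :: "nat \<Rightarrow> bool \<Rightarrow> bool \<Rightarrow> nat" where
  "nx0 y b r = pk R
     (if cm 0 y < 4 * nst M then t_st M (ix y b) + (if t_ad M (ix y b) = 1 then of_bool r else cm 0 y mod 2) else 0)
     (mvnum (t_di M (ix y b)) (cm 1 y) (n + 1))
     ((cm 2 y - (cm 2 y div cm 3 y mod 2) * cm 3 y + t_ww M (ix y b) * cm 3 y) mod 2 ^ w)
     (if t_dw M (ix y b) = 0 then max (cm 3 y div 2) 1 else if t_dw M (ix y b) = 1 then cm 3 y
        else min (2 * cm 3 y) (max (2 ^ w div 2) 1))
     (mvnum (t_dc M (ix y b)) (cm 4 y) (T - 1))
     (lv y + 1)"

definition wr0 :: "nat \<Rightarrow> bool \<Rightarrow> bool \<Rightarrow> bool" where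
  "wr0 y b r \<longleftrightarrow> t_cw M (ix y b) = 1"

definition ps :: "nat \<Rightarrow> nat" where "ps y = (if cm 4 y < T then cm 4 y else 0)"

text \<open>Digit 0 is 4 st + 2 g + r, so this compares the answer of the machine with the guess
  g.\<close>

definition acc :: "nat \<Rightarrow> bool" where
  "acc y \<longleftrightarrow> (cm 0 y div 4 = qacc M \<longleftrightarrow> odd (cm 0 y div 2))"

definition "ktop = R ^ 5 * (T + 1)"
definition "kbot = R ^ 5 * (T + 1) + 1"

definition startk :: "bool \<Rightarrow> bool \<Rightarrow> nat" where
  "startk g b = pk R (4 * q0 M + 2 * of_bool g + of_bool b) 0 0 1 0 0"

lemma dlt_less: "i < 48 * nst M \<Longrightarrow> fst (dlt M i) < nst M"
proof -
  assume "i < 48 * nst M"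
  then have "i div 48 < nst M" by (simp add: less_mult_imp_div_less mult.commute)
  then show ?thesis using wf by (auto simp: dlt_def Let_def wf_machine_def)
qed

lemma ix_less: "cm 0 y < 4 * nst M \<Longrightarrow> ix y b < 48 * nst M"
proof -
  assume a: "cm 0 y < 4 * nst M"
  have "incode x (cm 1 y) \<le> 2" by (simp add: incode_def split: option.splits)
  moreover have "cm 2 y div cm 3 y mod 2 \<le> 1" by simp
  ultimately have "ix y b \<le> cm 0 y * 12 + 11" unfolding ix_def by (simp add: of_bool_def)
  then show ?thesis using a by linarith
qed

lemma nx0_ok:
  assumes "y < S0" "lv y < T"
  shows "nx0 y b r < S0" "lv (nx0 y b r) = Suc (lv y)"
proof -
  have c: "cm j y < R" for j using Rs by (simp add: cm_def)
  have mv: "mvnum d h mx < R" if "h < R" "mx < R" for d h mx using that by (auto simp: mvnum_def)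
  let ?f = "if cm 0 y < 4 * nst M then t_st M (ix y b) + (if t_ad M (ix y b) = 1 then of_bool r else cm 0 y mod 2) else 0"
  have 0: "?f < R"
  proof (cases "cm 0 y < 4 * nst M")
    case True
    have i: "ix y b < 48 * nst M" using ix_less True by blast
    obtain q e where d: "dlt M (ix y b) = (q, e)" by (cases "dlt M (ix y b)") auto
    have "q < nst M" using dlt_less[OF i] d by simp
    moreover have "t_st M (ix y b) = 4 * q + ix y b div 24 mod 2 * 2" using d i by (auto simp: t_st_def tb_def split: prod.splits)
    moreover have "(if t_ad M (ix y b) = 1 then of_bool r else cm 0 y mod 2) \<le> (1::nat)" by (auto simp: of_bool_def)
    moreover have "ix y b div 24 mod 2 \<le> 1" by simp
    ultimately have "t_st M (ix y b) + (if t_ad M (ix y b) = 1 then of_bool r else cm 0 y mod 2) < R"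
      using Rs(1) by linarith
    then show ?thesis using True by simp
  qed (use Rs in simp)
  have 2: "a mod 2 ^ w < R" for a
  proof -
    have "a mod 2 ^ w < 2 ^ w" by simp
    then show ?thesis using Rs(3) by linarith
  qed
  have 3: "(if t_dw M (ix y b) = 0 then max (cm 3 y div 2) 1 else if t_dw M (ix y b) = 1 then cm 3 y
        else min (2 * cm 3 y) (max (2 ^ w div 2) 1)) < R"
  proof -
    have "max (cm 3 y div 2) 1 < R" using c[of 3] Rs(5) div_le_dividend[of "cm 3 y" 2] by linarith
    moreover have "max (2 ^ w div 2) 1 < R" using Rs(3,5) div_le_dividend[of "2 ^ w" 2] by linarith
    then have "min (2 * cm 3 y) (max (2 ^ w div 2) 1) < R" by linarith
    ultimately show ?thesis using c[of 3] by (simp only: split: if_split) blast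
  qed
  have 4: "T - 1 < R" and 5: "lv y + 1 < R" using Rs(4) assms(2) by linarith+
  show "nx0 y b r < S0" unfolding nx0_def S0_def by (rule pk_less[OF 0 mv[OF c Rs(2)] 2 3 mv[OF c 4] 5])
  have "lv (nx0 y b r) = lv y + 1"
    unfolding nx0_def lv_def[of "pk R a1 a2 a3 a4 a5 a6" for a1 a2 a3 a4 a5 a6]
    by (rule pk_cmp(6)[OF 0 mv[OF c Rs(2)] 2 3 mv[OF c 4]])
  then show "lv (nx0 y b r) = Suc (lv y)" by simp
qed

lemma ps_less: "ps y < T" using T_pos by (simp add: ps_def)

lemma tops: "ktop < S0" "lv ktop = Suc T" "kbot < S0" "lv kbot = Suc T" "ktop \<noteq> kbot"
proof -
  have R: "1 < R ^ 5" using Rs by (intro one_less_power) auto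
  have "R ^ 5 * (T + 1) + 1 < R ^ 5 * (T + 1) + R ^ 5" using R by simp
  also have "\<dots> = R ^ 5 * (T + 2)" by simp
  also have "\<dots> \<le> R ^ 5 * R" using Rs by (intro mult_le_mono2) simp
  finally show "kbot < S0" by (simp add: kbot_def S0_def numeral_eq_Suc mult.commute)
  then show "ktop < S0" by (simp add: kbot_def ktop_def)
  show "lv ktop = Suc T" "ktop \<noteq> kbot" using R Rs by (auto simp: ktop_def kbot_def lv_def)
  have "(1 + (T + 1) * R ^ 5) div R ^ 5 = Suc T" using R Rs(5) by (subst div_mult_self1) auto
  then show "lv kbot = Suc T" by (simp add: kbot_def lv_def algebra_simps)
qed

section \<open>Packed configurations follow the machine\<close>

definition vc :: "config \<Rightarrow> bool" where
  "vc c \<longleftrightarrow> st c < nst M \<and> ih c \<le> n + 1 \<and> length (wt c) = w \<and> wh c < max w 1 \<and> length (ct c) = T \<and> ch c < T"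

definition encc :: "bool \<Rightarrow> bool \<Rightarrow> nat \<Rightarrow> config \<Rightarrow> nat" where
  "encc g b t c = pk R (4 * st c + 2 * of_bool g + of_bool b) (ih c) (bitsval (wt c)) (2 ^ wh c) (ch c) t"

lemma wh_pow: "wh c < max w 1 \<Longrightarrow> 2 ^ wh c \<le> (2::nat) ^ w"
  by (intro power_increasing) auto

lemma encc_cm:
  assumes "vc c"
  shows "cm 0 (encc g b t c) = 4 * st c + 2 * of_bool g + of_bool b" "cm 1 (encc g b t c) = ih c"
    "cm 2 (encc g b t c) = bitsval (wt c)" "cm 3 (encc g b t c) = 2 ^ wh c" "cm 4 (encc g b t c) = ch c"
    "lv (encc g b t c) = t"
proof -
  have "bitsval (wt c) < 2 ^ w" using bitsval_less[of "wt c"] assms by (simp add: vc_def)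
  moreover have "4 * st c + 2 * of_bool g + of_bool b < R" using assms Rs by (auto simp: vc_def of_bool_def)
  moreover have "2 ^ wh c < R"
  proof -
    have "2 ^ wh c \<le> (2::nat) ^ w" using wh_pow[of c] assms by (simp add: vc_def)
    then show ?thesis using Rs(3) by linarith
  qed
  moreover have "ih c < R" "ch c < R" using assms Rs by (auto simp: vc_def)
  ultimately show "cm 0 (encc g b t c) = 4 * st c + 2 * of_bool g + of_bool b" "cm 1 (encc g b t c) = ih c"
    "cm 2 (encc g b t c) = bitsval (wt c)" "cm 3 (encc g b t c) = 2 ^ wh c" "cm 4 (encc g b t c) = ch c"
    "lv (encc g b t c) = t"
    using pk_cmp[of "4 * st c + 2 * of_bool g + of_bool b" R "ih c" "bitsval (wt c)" "2 ^ wh c" "ch c" t] Rs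
    by (auto simp: cm_def encc_def lv_def)
qed


lemma ix_dec:
  fixes f a u v :: nat
  assumes "a \<le> 2" "u \<le> 1" "v \<le> 1"
  defines "i \<equiv> f * 12 + a * 4 + u * 2 + v"
  shows "i div 48 = f div 4" "i div 24 mod 2 = f div 2 mod 2" "i div 12 = f" "i div 4 mod 3 = a"
    "odd (i div 2) \<longleftrightarrow> u = 1" "odd i \<longleftrightarrow> v = 1"
proof -
  have "i = (a * 4 + u * 2 + v) + f * 12" by (simp add: i_def)
  moreover have "a * 4 + u * 2 + v < 12" using assms by simp
  ultimately show d: "i div 12 = f" by simp
  have "i div 48 = i div 12 div 4" "i div 24 = i div 12 div 2" by (simp_all add: div_mult2_eq[symmetric])
  then show "i div 48 = f div 4" "i div 24 mod 2 = f div 2 mod 2" using d by auto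
  have "i = (u * 2 + v) + (f * 3 + a) * 4" by (simp add: i_def)
  moreover have "u * 2 + v < 4" using assms by simp
  ultimately have "i div 4 = f * 3 + a" by simp
  then show "i div 4 mod 3 = a" using assms by simp
  have "i = v + (f * 6 + a * 2 + u) * 2" by (simp add: i_def)
  then have "i div 2 = f * 6 + a * 2 + u" using assms by simp
  then show "odd (i div 2) \<longleftrightarrow> u = 1" using assms(2) by (auto simp: le_Suc_eq)
  show "odd i \<longleftrightarrow> v = 1" using assms(3) by (auto simp: i_def le_Suc_eq)
qed

lemma f_dec:
  fixes q u v :: nat
  assumes "u \<le> 1" "v \<le> 1"
  shows "(4 * q + 2 * u + v) div 4 = q" "(4 * q + 2 * u + v) div 2 mod 2 = u" "(4 * q + 2 * u + v) mod 2 = v"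
    "odd (4 * q + 2 * u + v) \<longleftrightarrow> v = 1"
proof -
  show "(4 * q + 2 * u + v) div 4 = q" using assms by simp
  have "(4 * q + 2 * u + v) div 2 = 2 * q + u" using assms by simp
  then show "(4 * q + 2 * u + v) div 2 mod 2 = u" using assms by simp
  have "4 * q + 2 * u + v = v + 2 * (2 * q + u)" by simp
  then show "(4 * q + 2 * u + v) mod 2 = v" using assms mod_mult_self2[of v 2 "2 * q + u"] by (simp add: ac_simps)
  show "odd (4 * q + 2 * u + v) \<longleftrightarrow> v = 1" using assms(2) by (auto simp: le_Suc_eq)
qed

text \<open>The coin consumed is the one already stored in the packed state. The fresh coin
  \<open>r'\<close> becomes current only when the random head moves, so a bit that is read several
  times keeps its value.\<close>

lemma enc_step:
  fixes g r' :: bool and t :: nat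
  assumes vc: "vc c" and b: "rd r (rh c) = b"
  defines "c' \<equiv> step M x r c" and "y \<equiv> encc g b t c" and "v \<equiv> ct c ! ch c"
  shows "vc c'" "nx0 y v r' = encc g (if rh c' = rh c then b else r') (Suc t) c'"
    "ct c' = (ct c)[ch c := wr0 y v r']" "rh c' = rh c \<or> rh c' = Suc (rh c)"
proof -
  have V: "st c < nst M" "ih c \<le> n + 1" "length (wt c) = w" "wh c < max w 1" "length (ct c) = T" "ch c < T"
    using vc by (auto simp: vc_def)
  note cm = encc_cm[OF vc, of g b t, folded y_def]
  define f where "f = 4 * st c + 2 * of_bool g + of_bool b"
  have fd: "f div 4 = st c" "f div 2 mod 2 = of_bool g" "odd f \<longleftrightarrow> b" "f mod 2 = of_bool b" "f < 4 * nst M"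
    using V f_dec[of "of_bool g" "of_bool b" "st c"] by (auto simp: f_def of_bool_def)
  have wb: "bitsval (wt c) div 2 ^ wh c mod 2 = of_bool (rd (wt c) (wh c))" by (rule bitsval_bit)
  define i where "i = ix y v"
  have i: "i = f * 12 + incode x (ih c) * 4 + of_bool (rd (wt c) (wh c)) * 2 + of_bool v"
    unfolding i_def ix_def cm wb f_def ..
  have inc: "incode x (ih c) \<le> 2" by (simp add: incode_def split: option.splits)
  have dec: "i div 48 = st c" "i div 24 mod 2 = of_bool g" "i div 12 = f" "i div 4 mod 3 = incode x (ih c)"
    "odd (i div 2) \<longleftrightarrow> rd (wt c) (wh c)" "odd i \<longleftrightarrow> v"
    using ix_dec[OF inc, of "of_bool (rd (wt c) (wh c))" "of_bool v" f] fd unfolding i by simp_all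
  have i48: "i < 48 * nst M" unfolding i_def using cm(1) fd(5) by (intro ix_less) (simp add: f_def)
  have ins: "(if incode x (ih c) = 0 then None else Some (incode x (ih c) = 2)) = insym x (ih c)"
    by (auto simp: incode_def split: option.splits)
  obtain q' di ww dw cw dc adv where d: "dlt M i = (q', di, ww, dw, cw, dc, adv)"
    by (cases "dlt M i") auto
  have v: "v = rd (ct c) (ch c)" using V by (simp add: v_def rd_def)
  have step: "c' = \<lparr> st = q', ih = move di (ih c) (n + 2), wt = (wt c)[wh c := ww], wh = move dw (wh c) w,
      ct = (ct c)[ch c := cw], ch = move dc (ch c) T, rh = (if adv then rh c + 1 else rh c) \<rparr>"
  proof (cases "halted M c")
    case True
    then have "dlt M i = (st c, MvN, rd (wt c) (wh c), MvN, v, MvN, False)"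
      by (auto simp: dlt_def dec halted_def Let_def)
    then show ?thesis using d True v by (auto simp: c'_def step_def)
  next
    case False
    then have "dlt M i = delta M (st c) (insym x (ih c)) (rd (wt c) (wh c)) (rd (ct c) (ch c)) b"
      unfolding dlt_def Let_def dec fd ins v[symmetric] by (simp add: halted_def)
    then have d': "delta M (st c) (insym x (ih c)) (rd (wt c) (wh c)) (rd (ct c) (ch c)) b = (q', di, ww, dw, cw, dc, adv)"
      using d by simp
    show ?thesis unfolding c'_def step_def using False d' V b
      by (simp add: Let_def insym_def[symmetric] n_def del: One_nat_def)
  qed
  have q': "q' < nst M" using dlt_less[OF i48] d by simp
  have mv: "move d h m < m" if "h < m" for d h m using that by (cases d) auto
  have w1: "move dw (wh c) w < max w 1" using V(4) by (cases dw) auto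
  have i1: "move di (ih c) (n + 2) \<le> n + 1" using mv[of "ih c" "n + 2" di] V by linarith
  show vc': "vc c'" using q' V mv[of "ch c" T dc] w1 i1 by (simp add: vc_def step)
  have tabs: "t_st M i = 4 * q' + 2 * of_bool g" "t_di M i = dcode di" "t_ww M i = of_bool ww" "t_dw M i = dcode dw"
    "t_cw M i = of_bool cw" "t_dc M i = dcode dc" "t_ad M i = of_bool adv"
    using i48 d dec(2) by (simp_all add: t_defs tb_def)
  have wt': "(bitsval (wt c) - of_bool (rd (wt c) (wh c)) * 2 ^ wh c + of_bool ww * 2 ^ wh c) mod 2 ^ w = bitsval ((wt c)[wh c := ww])"
  proof (cases "w = 0")
    case True
    then show ?thesis using V by simp
  next
    case False
    then have h: "wh c < length (wt c)" using V by simp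
    have "bitsval ((wt c)[wh c := ww]) < 2 ^ w" using bitsval_less[of "(wt c)[wh c := ww]"] V by simp
    then show ?thesis using bitsval_update[OF h, of ww] h by (simp add: rd_def)
  qed
  \<comment> \<open>\<open>2 ^ w div 2\<close> belongs to the last work cell, where a move to the
    right is stopped; the maximum with 1 takes care of w = 0 and, for moves to the left, of the
    first cell.\<close>
  have hw': "(if dcode dw = 0 then max (2 ^ wh c div 2) 1 else if dcode dw = 1 then 2 ^ wh c
        else min (2 * 2 ^ wh c) (max (2 ^ w div 2) 1)) = (2::nat) ^ move dw (wh c) w"
  proof (cases dw)
    case MvL
    then show ?thesis by (cases "wh c") auto
  next
    case MvN
    then show ?thesis by simp
  next
    case MvR
    show ?thesis
    proof (cases w)
      case 0
      then show ?thesis using MvR V by simp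
    next
      case (Suc w')
      have "min (2 * 2 ^ wh c) (2 ^ w') = (2::nat) ^ min (Suc (wh c)) w'"
        using power_increasing_iff[of "2::nat" "Suc (wh c)" w'] by (simp add: min_def)
      then show ?thesis using MvR Suc by simp
    qed
  qed
  have "nx0 y v r' = pk R (4 * q' + 2 * of_bool g + (if adv then of_bool r' else of_bool b)) (move di (ih c) (n + 2))
     (bitsval ((wt c)[wh c := ww])) (2 ^ move dw (wh c) w) (move dc (ch c) T) (Suc t)"
    unfolding nx0_def cm i_def[symmetric] tabs wb wt' hw' mvnum_move[symmetric] using fd
    by (simp add: f_def of_bool_def)
  then show "nx0 y v r' = encc g (if rh c' = rh c then b else r') (Suc t) c'"
    by (auto simp: encc_def step)
  show "ct c' = (ct c)[ch c := wr0 y v r']" by (simp add: step wr0_def i_def[symmetric] tabs)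
  show "rh c' = rh c \<or> rh c' = Suc (rh c)" by (simp add: step)
qed

end

section \<open>A block of the tape and the acceptance probability\<close>

locale block = mach +
  fixes off Lt m E l :: nat
  assumes offT: "off + T \<le> Lt" and mm: "0 < m" "m \<le> 2 ^ l" and EE: "0 < E"
begin

sublocale smp: sampler S0 m T Lt E l "\<lambda>y. off + ps y" nx0 wr0 lv acc ktop kbot
proof -
  have "off + ps y < Lt" for y using ps_less[of y] offT by linarith
  then show "sampler S0 m T Lt E l (\<lambda>y. off + ps y) nx0 lv ktop kbot"
    using nx0_ok tops mm EE by unfold_locales auto
qed

definition emb :: "bool list \<Rightarrow> bool list \<Rightarrow> bool list" where
  "emb \<tau> z = take off \<tau> @ z @ drop (off + T) \<tau>"

definition blk :: "bool list \<Rightarrow> bool list" where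
  "blk \<tau> = take T (drop off \<tau>)"

lemma emb_blk: "length \<tau> = Lt \<Longrightarrow> emb \<tau> (blk \<tau>) = \<tau>"
  unfolding emb_def blk_def append_assoc[symmetric] take_add[symmetric] by simp

lemma blk_len: "length \<tau> = Lt \<Longrightarrow> length (blk \<tau>) = T"
  using offT by (simp add: blk_def)

lemma emb_inj: "length \<tau> = Lt \<Longrightarrow> length z = T \<Longrightarrow> length z' = T \<Longrightarrow> emb \<tau> z = emb \<tau> z' \<longleftrightarrow> z = z'"
  by (simp add: emb_def)

lemma emb_nth: "length \<tau> = Lt \<Longrightarrow> length z = T \<Longrightarrow> j < T \<Longrightarrow> emb \<tau> z ! (off + j) = z ! j"
  using offT by (simp add: emb_def nth_append)

lemma emb_upd: "length \<tau> = Lt \<Longrightarrow> length z = T \<Longrightarrow> j < T \<Longrightarrow> (emb \<tau> z)[off + j := b] = emb \<tau> (z[j := b])"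
  using offT by (simp add: emb_def list_update_append)

lemma stp_enc:
  assumes "vc c" "rd r (rh c) = b" "length \<tau> = Lt"
  shows "smp.stp (encc g b t c) (emb \<tau> (ct c)) r' =
    (encc g (if rh (step M x r c) = rh c then b else r') (Suc t) (step M x r c), emb \<tau> (ct (step M x r c)))"
proof -
  have c: "ch c < T" "length (ct c) = T" using assms by (auto simp: vc_def)
  then have "ps (encc g b t c) = ch c" using encc_cm[OF assms(1)] by (simp add: ps_def)
  then show ?thesis using enc_step(2,3)[OF assms(1,2), where g=g and t=t and r'=r'] emb_nth[of \<tau> "ct c" "ch c"] emb_upd[of \<tau> "ct c" "ch c"] c assms(3)
    by (simp add: smp.stp_def)
qed

lemma step_cong_rd: "rd r (rh c) = rd r' (rh c) \<Longrightarrow> step M x r c = step M x r' c"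
  by (simp add: step_def)

lemma card_split: "card {s :: bool list. length s = Suc j \<and> Q s} =
   card {s. length s = j \<and> Q (False # s)} + card {s. length s = j \<and> Q (True # s)}"
proof -
  have f: "finite {s :: bool list. length s = i \<and> Q' s}" for i Q'
    using finite_subset[OF _ finite_lists_length_eq[of "UNIV :: bool set" i]] by fastforce
  have "{s. length s = Suc j \<and> Q s} = (Cons False) ` {s. length s = j \<and> Q (False # s)} \<union> (Cons True) ` {s. length s = j \<and> Q (True # s)}"
  proof (rule set_eqI)
    fix s
    show "s \<in> {s. length s = Suc j \<and> Q s} \<longleftrightarrow>
      s \<in> (Cons False) ` {s. length s = j \<and> Q (False # s)} \<union> (Cons True) ` {s. length s = j \<and> Q (True # s)}"
    proof (cases s)
      case (Cons b s')
      then show ?thesis by (cases b) auto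
    qed auto
  qed
  then have "card {s. length s = Suc j \<and> Q s} = card ((Cons False) ` {s. length s = j \<and> Q (False # s)}) + card ((Cons True) ` {s. length s = j \<and> Q (True # s)})"
    by (simp only:) (rule card_Un_disjoint, use f in auto)
  then show ?thesis by (simp add: card_image)
qed

lemma card_bool_lists: "card {s :: bool list. length s = j} = 2 ^ j"
  using card_lists_length_eq[of "UNIV :: bool set" j] by simp

text \<open>Drawing a fresh bit at every step, and keeping it only when the random head advances, has
the same distribution as reading the bits of a uniform random string.\<close>

lemma pr_count:
  assumes "vc c" "length \<tau> = Lt" "rh c + n' < L" "length pre = Suc (rh c)" "last pre = b" "t + n' = T"
  shows "smp.pr \<tau> n' (encc g b t c, emb \<tau> (ct c)) * 2 ^ (L - Suc (rh c)) =
    real (card {s. length s = L - Suc (rh c) \<and> (let f = (step M x (pre @ s) ^^ n') c in (st f = qacc M \<longleftrightarrow> g) \<and> ct f = blk \<tau>)})"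
  using assms
proof (induction n' arbitrary: c b pre t)
  case 0
  have "acc (encc g b t c) \<longleftrightarrow> (st c = qacc M \<longleftrightarrow> g)"
    using encc_cm[OF 0(1)] by (auto simp: acc_def of_bool_def)
  moreover have "emb \<tau> (ct c) = \<tau> \<longleftrightarrow> ct c = blk \<tau>"
    using emb_inj[of \<tau> "ct c" "blk \<tau>"] emb_blk blk_len 0 by (auto simp: vc_def)
  ultimately show ?case by (simp add: card_bool_lists)
next
  case (Suc n')
  define j where "j = L - Suc (rh c)"
  have pne: "pre \<noteq> []" using Suc.prems by auto
  have rdp: "rd (pre @ s) (rh c) = b" for s
    using Suc.prems pne by (simp add: rd_def nth_append last_conv_nth)
  define c' where "c' = step M x (pre @ []) c"
  have st: "step M x (pre @ s) c = c'" for s unfolding c'_def by (rule step_cong_rd) (simp only: rdp)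
  note es = enc_step[OF Suc.prems(1) rdp[of "[]"], folded c'_def]
  have stp: "smp.stp (encc g b t c) (emb \<tau> (ct c)) r' = (encc g (if rh c' = rh c then b else r') (Suc t) c', emb \<tau> (ct c'))" for r'
    using stp_enc[OF Suc.prems(1) rdp[of "[]"] Suc.prems(2), of g t r'] by (simp only: c'_def)
  have fp: "(step M x (pre @ s) ^^ Suc n') c = (step M x (pre @ s) ^^ n') c'" for s
    by (simp only: funpow_Suc_right o_apply st)
  show ?case
  proof (cases "rh c' = rh c")
    case True
    have "smp.pr \<tau> n' (encc g b (Suc t) c', emb \<tau> (ct c')) * 2 ^ (L - Suc (rh c')) =
      real (card {s. length s = L - Suc (rh c') \<and> (let f = (step M x (pre @ s) ^^ n') c' in (st f = qacc M \<longleftrightarrow> g) \<and> ct f = blk \<tau>)})"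
      using Suc.prems True es(1) by (intro Suc.IH) auto
    then show ?thesis unfolding fp using stp True by simp
  next
    case False
    then have rh: "rh c' = Suc (rh c)" using es(4) by blast
    have j1: "L - Suc (rh c) = Suc (L - Suc (rh c'))" using Suc.prems rh by simp
    have IH: "smp.pr \<tau> n' (encc g b' (Suc t) c', emb \<tau> (ct c')) * 2 ^ (L - Suc (rh c')) =
      real (card {s. length s = L - Suc (rh c') \<and> (let f = (step M x ((pre @ [b']) @ s) ^^ n') c' in (st f = qacc M \<longleftrightarrow> g) \<and> ct f = blk \<tau>)})" for b'
      using Suc.prems rh es(1) by (intro Suc.IH) auto
    show ?thesis unfolding fp j1 card_split using IH[of False] IH[of True] stp False by (simp add: distrib_right)
  qed
qed

lemma init_enc: "vc (init M w z)" if "length z = T"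
  using wf T_pos that by (auto simp: vc_def init_def wf_machine_def)

lemma start_enc: "encc g b 0 (init M w z) = startk g b"
proof -
  have "bitsval (replicate w False) = 0" by (simp add: bitsval_def)
  then show ?thesis by (simp add: encc_def init_def startk_def)
qed

text \<open>The first coin belongs to the start state. The probability over full strings is the mean
  over its two values, so one of them is at least as good. Agreement with the guess costs nothing,
  since the answer is always g.\<close>

lemma some_start_likely:
  assumes \<tau>: "length \<tau> = Lt" and TL: "T < L"
    and p: "real (card {r. length r = L \<and> ct (run M x r w (blk \<tau>) T) = blk \<tau>}) \<ge> (1 - \<delta>) * 2 ^ L"
    and g: "\<And>r. length r = L \<Longrightarrow> st (run M x r w (blk \<tau>) T) = qacc M \<longleftrightarrow> g"
  shows "\<exists>b. smp.pr \<tau> T (startk g b, \<tau>) \<ge> 1 - \<delta>"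
proof (rule ccontr)
  assume "\<not> ?thesis"
  then have less: "smp.pr \<tau> T (startk g b, \<tau>) < 1 - \<delta>" for b by (simp add: not_le)
  let ?i = "init M w (blk \<tau>)"
  have vi: "vc ?i" using init_enc blk_len \<tau> by blast
  have [simp]: "rh ?i = 0" "ct ?i = blk \<tau>" by (simp_all add: init_def)
  define Q where "Q r \<longleftrightarrow> ct (run M x r w (blk \<tau>) T) = blk \<tau>" for r
  have L: "L = Suc (L - 1)" using TL by simp
  have c: "smp.pr \<tau> T (startk g b, \<tau>) * 2 ^ (L - 1) = real (card {s. length s = L - 1 \<and> Q (b # s)})" for b
  proof -
    have "smp.pr \<tau> T (startk g b, \<tau>) * 2 ^ (L - 1) =
      real (card {s. length s = L - Suc (rh ?i) \<and> (let f = (step M x ([b] @ s) ^^ T) ?i in (st f = qacc M \<longleftrightarrow> g) \<and> ct f = blk \<tau>)})"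
      using pr_count[OF vi \<tau>, of T L "[b]" b 0 g] TL start_enc emb_blk[OF \<tau>] by simp
    also have "{s. length s = L - Suc (rh ?i) \<and> (let f = (step M x ([b] @ s) ^^ T) ?i in (st f = qacc M \<longleftrightarrow> g) \<and> ct f = blk \<tau>)}
       = {s. length s = L - 1 \<and> Q (b # s)}"
    proof (rule Collect_cong)
      fix s
      show "(length s = L - Suc (rh ?i) \<and> (let f = (step M x ([b] @ s) ^^ T) ?i in (st f = qacc M \<longleftrightarrow> g) \<and> ct f = blk \<tau>)) \<longleftrightarrow>
        (length s = L - 1 \<and> Q (b # s))"
        using g[of "b # s"] TL by (auto simp: Q_def run_def)
    qed
    finally show ?thesis .
  qed
  have "card {r. length r = L \<and> Q r} = card {s. length s = L - 1 \<and> Q (False # s)} + card {s. length s = L - 1 \<and> Q (True # s)}"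
    using card_split[of "L - 1" Q] L by simp
  then have "real (card {r. length r = L \<and> Q r}) = smp.pr \<tau> T (startk g False, \<tau>) * 2 ^ (L - 1) + smp.pr \<tau> T (startk g True, \<tau>) * 2 ^ (L - 1)"
    using c by simp
  also have "\<dots> < (1 - \<delta>) * 2 ^ (L - 1) + (1 - \<delta>) * 2 ^ (L - 1)" using less by (intro add_strict_mono mult_strict_right_mono) auto
  also have "\<dots> = (1 - \<delta>) * 2 ^ L" by (subst (3) L) simp
  finally show False using p by (simp add: Q_def)
qed

end

section \<open>Programming the arithmetic\<close>

definition call :: "nat \<Rightarrow> exp \<Rightarrow> exp list \<Rightarrow> exp" where
  "call k f es = foldr exp.Let es (Fresh k f)"

lemma call_simps [simp]: "call k f [] = Fresh k f" "call k f (e # es) = exp.Let e (call k f es)"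
  by (simp_all add: call_def)

definition "mulB = Sum (Var 0) (Var 1)"
definition "mul a b = call 2 mulB [a, b]"
definition "ltB = Ite (Sub (Var 1) (Var 0)) (Cn 1) (Cn 0)"
definition "lt a b = call 2 ltB [a, b]"
definition "eqB = Ite (Sub (Var 0) (Var 1)) (Cn 0) (Ite (Sub (Var 1) (Var 0)) (Cn 0) (Cn 1))"
definition "eq a b = call 2 eqB [a, b]"
definition "nt a = Ite a (Cn 0) (Cn 1)"
definition "an a b = Ite a (Ite b (Cn 1) (Cn 0)) (Cn 0)"
definition "dvB = Ite (Var 1) (Sum (Var 0) (Ite (Sub (mul (Add (Var 2) (Cn 1)) (Var 1)) (Var 0)) (Cn 0) (Cn 1))) (Cn 0)"
definition "dv a b = call 2 dvB [a, b]"
definition "mdB = Sub (Var 0) (mul (Var 1) (dv (Var 0) (Var 1)))"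
definition "md a b = call 2 mdB [a, b]"
definition "mxB = Add (Var 0) (Sub (Var 1) (Var 0))"
definition "mx a b = call 2 mxB [a, b]"
definition "mnB = Sub (Var 0) (Sub (Var 0) (Var 1))"
definition "mn a b = call 2 mnB [a, b]"
definition "bt2 a = md a (Cn 2)"
text \<open>Doubling in a loop; the cap of the assignment makes it a power truncated at
  \<open>lm\<close>, and resetting the accumulator to 1 undoes it.\<close>

definition "p2B = After (Loop (Var 1) (Assign 2 (Add (Var 2) (Var 2)))) (Var 2) (Assign 2 (Cn 1))"
definition "p2 lm j = call 3 p2B [lm, j, Cn 1]"

text \<open>In a frame of length v, the predicate P sees the candidate as variable v + 1.\<close>

definition "fndE v n P = Sum n (Ite (Sum (Add (Var v) (Cn 1)) P) (Cn 0) (Cn 1))"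

lemma mul_ev [simp]: "eval (mul a b) x vs \<tau> = eval a x vs \<tau> * eval b x (vs @ [eval a x vs \<tau>]) \<tau>"
  "und (mul a b) x vs \<tau> \<longleftrightarrow> und a x vs \<tau> \<and> und b x (vs @ [eval a x vs \<tau>]) \<tau>"
  "wfe (mul a b) v \<longleftrightarrow> wfe a v \<and> wfe b (Suc v)"
  by (simp_all add: mul_def mulB_def)

lemma lt_ev [simp]: "eval (lt a b) x vs \<tau> = of_bool (eval a x vs \<tau> < eval b x (vs @ [eval a x vs \<tau>]) \<tau>)"
  "und (lt a b) x vs \<tau> \<longleftrightarrow> und a x vs \<tau> \<and> und b x (vs @ [eval a x vs \<tau>]) \<tau>"
  "wfe (lt a b) v \<longleftrightarrow> wfe a v \<and> wfe b (Suc v)"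
  by (simp_all add: lt_def ltB_def)

lemma eq_ev [simp]: "eval (eq a b) x vs \<tau> = of_bool (eval a x vs \<tau> = eval b x (vs @ [eval a x vs \<tau>]) \<tau>)"
  "und (eq a b) x vs \<tau> \<longleftrightarrow> und a x vs \<tau> \<and> und b x (vs @ [eval a x vs \<tau>]) \<tau>"
  "wfe (eq a b) v \<longleftrightarrow> wfe a v \<and> wfe b (Suc v)"
  by (auto simp: eq_def eqB_def)

lemma nt_ev [simp]: "eval (nt a) x vs \<tau> = of_bool (eval a x vs \<tau> = 0)" "und (nt a) x vs \<tau> = und a x vs \<tau>"
  "wfe (nt a) v = wfe a v"
  by (simp_all add: nt_def)

lemma an_ev [simp]: "eval (an a b) x vs \<tau> = of_bool (eval a x vs \<tau> \<noteq> 0 \<and> eval b x vs \<tau> \<noteq> 0)"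
  "und (an a b) x vs \<tau> \<longleftrightarrow> und a x vs \<tau> \<and> (eval a x vs \<tau> \<noteq> 0 \<longrightarrow> und b x vs \<tau>)"
  "wfe (an a b) v \<longleftrightarrow> wfe a v \<and> wfe b v"
  by (auto simp: an_def)

lemma div_count: "0 < b \<Longrightarrow> card {i. i < a \<and> Suc i * b \<le> a} = a div (b::nat)"
proof -
  assume b: "0 < b"
  have "{i. i < a \<and> Suc i * b \<le> a} = {..<a div b}"
  proof (rule set_eqI)
    fix i
    have "Suc i * b \<le> a \<longleftrightarrow> Suc i \<le> a div b" using b by (simp add: less_eq_div_iff_mult_less_eq)
    then have "Suc i * b \<le> a \<longleftrightarrow> i < a div b" by (simp only: Suc_le_eq)
    moreover have "i < a div b \<Longrightarrow> i < a" by (metis div_le_dividend less_le_trans)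
    ultimately show "i \<in> {i. i < a \<and> Suc i * b \<le> a} \<longleftrightarrow> i \<in> {..<a div b}" by blast
  qed
  then show ?thesis by simp
qed

lemma dvB_ev: "eval dvB x [a, b] \<tau> = a div b" "und dvB x [a, b] \<tau>" "wfe dvB 2"
proof -
  show "eval dvB x [a, b] \<tau> = a div b"
  proof (cases "b = 0")
    case False
    have "(\<Sum>i<a. if a < b + i * b then 0 else Suc 0) = card {i. i < a \<and> Suc i * b \<le> a}"
      by (subst sum.If_cases) (auto intro!: arg_cong[where f = card] simp: not_less)
    also have "\<dots> = a div b" using div_count False by simp
    finally show ?thesis using False by (simp add: dvB_def not_le cong: if_cong)
  qed (simp add: dvB_def)
qed (simp_all add: dvB_def)

lemma dv_ev [simp]: "eval (dv a b) x vs \<tau> = eval a x vs \<tau> div eval b x (vs @ [eval a x vs \<tau>]) \<tau>"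
  "und (dv a b) x vs \<tau> \<longleftrightarrow> und a x vs \<tau> \<and> und b x (vs @ [eval a x vs \<tau>]) \<tau>"
  "wfe (dv a b) v \<longleftrightarrow> wfe a v \<and> wfe b (Suc v)"
  by (simp_all add: dv_def dvB_ev)

lemma md_ev [simp]: "eval (md a b) x vs \<tau> = eval a x vs \<tau> mod eval b x (vs @ [eval a x vs \<tau>]) \<tau>"
  "und (md a b) x vs \<tau> \<longleftrightarrow> und a x vs \<tau> \<and> und b x (vs @ [eval a x vs \<tau>]) \<tau>"
  "wfe (md a b) v \<longleftrightarrow> wfe a v \<and> wfe b (Suc v)"
  by (simp_all add: md_def mdB_def minus_mult_div_eq_mod)

lemma mx_ev [simp]: "eval (mx a b) x vs \<tau> = max (eval a x vs \<tau>) (eval b x (vs @ [eval a x vs \<tau>]) \<tau>)"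
  "und (mx a b) x vs \<tau> \<longleftrightarrow> und a x vs \<tau> \<and> und b x (vs @ [eval a x vs \<tau>]) \<tau>"
  "wfe (mx a b) v \<longleftrightarrow> wfe a v \<and> wfe b (Suc v)"
  by (simp_all add: mx_def mxB_def)

lemma mn_ev [simp]: "eval (mn a b) x vs \<tau> = min (eval a x vs \<tau>) (eval b x (vs @ [eval a x vs \<tau>]) \<tau>)"
  "und (mn a b) x vs \<tau> \<longleftrightarrow> und a x vs \<tau> \<and> und b x (vs @ [eval a x vs \<tau>]) \<tau>"
  "wfe (mn a b) v \<longleftrightarrow> wfe a v \<and> wfe b (Suc v)"
  by (simp_all add: mn_def mnB_def)

lemma bt2_ev [simp]: "eval (bt2 a) x vs \<tau> = of_bool (odd (eval a x vs \<tau>))"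
  "und (bt2 a) x vs \<tau> = und a x vs \<tau>" "wfe (bt2 a) v = wfe a v"
  by (simp_all add: bt2_def mod_2_eq_odd)

lemma p2_loop: "1 \<le> lm \<Longrightarrow>
  (loop1 (exec (Assign 2 (Add (Var 2) (Var 2))) x) ^^ i) ([lm, j, 1], \<tau>) = ([lm, j, min (2 ^ i) lm], \<tau>)"
  by (induction i) (auto simp: loop1_def)

lemma p2B_ev: "1 \<le> lm \<Longrightarrow> eval p2B x [lm, j, 1] \<tau> = min (2 ^ j) lm" "1 \<le> lm \<Longrightarrow> und p2B x [lm, j, 1] \<tau>" "wfe p2B 3"
proof -
  assume l: "1 \<le> lm"
  show "eval p2B x [lm, j, 1] \<tau> = min (2 ^ j) lm" using p2_loop[OF l, where x=x and i=j and j=j and \<tau>=\<tau>] by (simp add: p2B_def)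
  show "und p2B x [lm, j, 1] \<tau>" using p2_loop[OF l, where x=x and j=j and \<tau>=\<tau>] l by (simp add: p2B_def)
qed (simp add: p2B_def)

lemma p2_ev [simp]:
  "1 \<le> eval a x vs \<tau> \<Longrightarrow> eval (p2 a b) x vs \<tau> = min (2 ^ eval b x (vs @ [eval a x vs \<tau>]) \<tau>) (eval a x vs \<tau>)"
  "1 \<le> eval a x vs \<tau> \<Longrightarrow> und (p2 a b) x vs \<tau> \<longleftrightarrow> und a x vs \<tau> \<and> und b x (vs @ [eval a x vs \<tau>]) \<tau>"
  "wfe (p2 a b) v \<longleftrightarrow> wfe a v \<and> wfe b (Suc v)"
  using p2B_ev by (simp_all add: p2_def)

lemma fnd_ev:
  assumes "v = length vs" "\<And>e1 e. e < eval n x vs \<tau> \<Longrightarrow> e \<le> e1 \<Longrightarrow> e1 < eval n x vs \<tau> \<Longrightarrow> eval p x (vs @ [e1, e]) \<tau> \<noteq> 0 \<longleftrightarrow> Q e"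
  shows "eval (fndE v n p) x vs \<tau> = fnd (eval n x vs \<tau>) Q"
proof -
  have h: "(if (\<Sum>j<Suc i. eval p x (vs @ [i, j]) \<tau>) \<noteq> 0 then 0 else 1) = (of_bool (\<forall>e'\<le>i. \<not> Q e') :: nat)"
    if i: "i < eval n x vs \<tau>" for i
  proof -
    have "(\<Sum>j<Suc i. eval p x (vs @ [i, j]) \<tau>) = 0 \<longleftrightarrow> (\<forall>j\<le>i. eval p x (vs @ [i, j]) \<tau> = 0)"
      by (simp add: sum_eq_0_iff less_Suc_eq_le Ball_def del: sum.lessThan_Suc)
    also have "\<dots> \<longleftrightarrow> (\<forall>j\<le>i. \<not> Q j)" using assms(2)[of _ i] i by (meson le_less_trans)
    finally show ?thesis by simp
  qed
  show ?thesis unfolding fndE_def fnd_def eval.simps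
  proof (intro sum.cong refl)
    fix i assume "i \<in> {..<eval n x vs \<tau>}"
    then show "(if (\<Sum>j<(vs @ [i]) ! v + 1. eval p x ((vs @ [i]) @ [j]) \<tau>) \<noteq> 0 then 0 else 1) = (of_bool (\<forall>e'\<le>i. \<not> Q e') :: nat)"
      using h[of i] assms(1) by (simp add: nth_append del: sum.lessThan_Suc)
  qed
qed

lemma fnd_und:
  assumes "v = length vs" "und n x vs \<tau>" "\<And>e1 e. e < eval n x vs \<tau> \<Longrightarrow> e \<le> e1 \<Longrightarrow> e1 < eval n x vs \<tau> \<Longrightarrow> und p x (vs @ [e1, e]) \<tau>"
  shows "und (fndE v n p) x vs \<tau>"
  using assms by (auto simp: fndE_def nth_append less_Suc_eq_le)

lemma fnd_wf [simp]: "wfe (fndE v n p) v \<longleftrightarrow> wfe n v \<and> wfe p (Suc (Suc v))"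
  by (auto simp: fndE_def)

primrec tab :: "(nat \<Rightarrow> nat) \<Rightarrow> nat \<Rightarrow> exp" where
  "tab F 0 = Cn 0"
| "tab F (Suc j) = Ite (eq (Var 0) (Cn j)) (Cn (F j)) (tab F j)"

lemma tab_ev [simp]: "eval (tab F j) x [i] \<tau> = (if i < j then F i else 0)" "und (tab F j) x [i] \<tau>" "wfe (tab F j) (Suc 0)"
  by (induction j) auto

primrec pwE :: "exp \<Rightarrow> nat \<Rightarrow> exp" where
  "pwE e 0 = Cn 1"
| "pwE e (Suc j) = mul e (pwE e j)"

definition "cN = Ite (Sub Len (Cn 2)) Len (Cn 2)"
text \<open>The logarithm counted as the number of j with 2^j below N. Truncating the powers at N
  does not affect this comparison, and in \<open>cP\<close> the truncation at 2 N is harmless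
  because 2^(lg n) \<le> 2 N.\<close>

definition "cLB = Sum cN (lt (p2 cN (Var 0)) cN)"
definition "cL = Fresh 0 cLB"
definition "cP = p2 (Add cN cN) cL"

lemma cN_ev [simp]: "eval cN x vs \<tau> = max (length x) 2" "und cN x vs \<tau>" "wfe cN v"
  by (auto simp: cN_def)

lemma lg_count: "(\<Sum>j<max n 2. of_bool (min (2 ^ j) (max n 2) < max n 2)) = lg n"
proof -
  have "{..<max n 2} \<inter> {j. min (2 ^ j) (max n 2) < max n 2} = {..<lg n}"
  proof (rule set_eqI)
    fix j
    have "2 ^ j < max n 2 \<longleftrightarrow> j < lg n"
    proof
      assume a: "2 ^ j < max n 2"
      show "j < lg n"
      proof (rule ccontr)
        assume "\<not> j < lg n"
        then have "(2::nat) ^ lg n \<le> 2 ^ j" by (intro power_increasing) auto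
        then show False using a le_pow_lg[of n] by linarith
      qed
    next
      assume a: "j < lg n"
      show "2 ^ j < max n 2"
      proof (rule ccontr)
        assume "\<not> 2 ^ j < max n 2"
        then have "lg n \<le> j" by (intro lg_least) linarith
        then show False using a by simp
      qed
    qed
    moreover have "j < lg n \<Longrightarrow> j < max n 2" using lg_le[of n] by linarith
    moreover have "min (2 ^ j) (max n 2) < max n 2 \<longleftrightarrow> 2 ^ j < max n 2" by linarith
    ultimately show "j \<in> {..<max n 2} \<inter> {j. min (2 ^ j) (max n 2) < max n 2} \<longleftrightarrow> j \<in> {..<lg n}" by auto
  qed
  then show ?thesis by (simp add: sum_of_bool_eq)
qed

lemma cL_ev [simp]: "eval cL x vs \<tau> = lg (length x)" "und cL x vs \<tau>" "wfe cL v"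
proof -
  have "1 \<le> max (length x) 2" by simp
  then show "eval cL x vs \<tau> = lg (length x)" "und cL x vs \<tau>" "wfe cL v"
    using lg_count[of "length x"] by (simp_all add: cL_def cLB_def)
qed

lemma pow_lg_le: "2 ^ lg n \<le> max n 2 + max n 2"
proof -
  obtain j where j: "lg n = Suc j" using lg_pos[of n] by (cases "lg n") auto
  have "2 ^ j < max n 2"
  proof (rule ccontr)
    assume "\<not> 2 ^ j < max n 2"
    then have "lg n \<le> j" by (intro lg_least) linarith
    then show False using j by simp
  qed
  then show ?thesis using j by simp
qed

lemma cP_ev [simp]: "eval cP x vs \<tau> = 2 ^ lg (length x)" "und cP x vs \<tau>" "wfe cP v"
proof -
  have "1 \<le> max (length x) 2" by simp
  then show "eval cP x vs \<tau> = 2 ^ lg (length x)" "und cP x vs \<tau>" "wfe cP v"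
    using pow_lg_le[of "length x"] by (simp_all add: cP_def min_absorb1)
qed

lemma pwE_ev:
  assumes "\<And>vs. eval e x vs \<tau> = c" "\<And>vs. und e x vs \<tau>"
  shows "eval (pwE e j) x vs \<tau> = c ^ j" "und (pwE e j) x vs \<tau>"
  using assms by (induction j arbitrary: vs) auto

lemma pwE_wf: "(\<And>v. wfe e v) \<Longrightarrow> wfe (pwE e j) v"
  by (induction j arbitrary: v) auto

lemma pwP_ev [simp]: "eval (pwE cP j) x vs \<tau> = (2 ^ lg (length x)) ^ j" "und (pwE cP j) x vs \<tau>" "wfe (pwE cP j) v"
  by (rule pwE_ev pwE_wf; simp)+

lemma pwN_ev [simp]: "eval (pwE cN j) x vs \<tau> = max (length x) 2 ^ j" "und (pwE cN j) x vs \<tau>" "wfe (pwE cN j) v"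
  by (rule pwE_ev pwE_wf; simp)+

definition "mvB = Ite (Var 0) (Ite (eq (Var 0) (Cn 1)) (Var 1) (mn (Add (Var 1) (Cn 1)) (Var 2))) (Sub (Var 1) (Cn 1))"

lemma mvB_ev [simp]: "eval mvB x [d, h, u] \<tau> = mvnum d h u" "und mvB x [d, h, u] \<tau>" "wfe mvB 3"
  by (auto simp: mvB_def mvnum_def)

context mach
begin

definition "cT = pwE cN k"
definition "cR = pwE cP rho"
definition "cS0 = pwE cR 6"
definition "cW = pwE cP k"

lemma cT_ev [simp]: "eval cT x vs \<tau> = T" "und cT x vs \<tau>" "wfe cT v"
  by (simp_all add: cT_def T_def N_def n_def)
lemma cR_ev [simp]: "eval cR x vs \<tau> = R" "und cR x vs \<tau>" "wfe cR v"
  by (simp_all add: cR_def R_def P_def n_def)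
lemma cS0_ev [simp]: "eval cS0 x vs \<tau> = S0" "und cS0 x vs \<tau>" "wfe cS0 v"
  unfolding cS0_def S0_def by (rule pwE_ev pwE_wf; simp)+
lemma cW_ev [simp]: "eval cW x vs \<tau> = 2 ^ w" "und cW x vs \<tau>" "wfe cW v"
  by (simp_all add: cW_def w_pow) (simp_all add: P_def n_def)
lemma pwR_ev [simp]: "eval (pwE cR j) x vs \<tau> = R ^ j" "und (pwE cR j) x vs \<tau>" "wfe (pwE cR j) v"
  by (rule pwE_ev pwE_wf; simp)+

definition "cmE j e = md (dv e (pwE cR j)) cR"

lemma cmE_ev [simp]: "eval (cmE j e) x vs \<tau> = cm j (eval e x vs \<tau>)" "und (cmE j e) x vs \<tau> = und e x vs \<tau>"
  "wfe (cmE j e) v = wfe e v"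
  by (simp_all add: cmE_def cm_def)

definition "lvE e = dv e (pwE cR 5)"

lemma lvE_ev [simp]: "eval (lvE e) x vs \<tau> = lv (eval e x vs \<tau>)" "und (lvE e) x vs \<tau> = und e x vs \<tau>"
  "wfe (lvE e) v = wfe e v"
  by (simp_all add: lvE_def lv_def)

definition "wbE e = md (dv (cmE 2 e) (cmE 3 e)) (Cn 2)"
definition "ixB = Add (mul (cmE 0 (Var 0)) (Cn 12)) (Add (mul (Inp (cmE 1 (Var 0))) (Cn 4)) (Add (mul (wbE (Var 0)) (Cn 2)) (Var 1)))"

lemma ixB_ev [simp]: "eval ixB x [y, of_bool b] \<tau> = ix y b" "und ixB x [y, b'] \<tau>" "wfe ixB 2"
  by (simp_all add: ixB_def wbE_def ix_def incode_def)

definition "tbE F = call 1 (tab F (48 * nst M)) [call 2 ixB [Var 0, Var 1]]"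

lemma tbE_ev [simp]: "eval (tbE F) x (y # of_bool b # vs) \<tau> = tb M F (ix y b)" "und (tbE F) x (y # b' # vs) \<tau>"
  "2 \<le> v \<Longrightarrow> wfe (tbE F) v"
  by (simp_all add: tbE_def tb_def)

definition "f_st i = (case dlt M i of (q, di, ww, dw, cw, dc, adv) \<Rightarrow> 4 * q + i div 24 mod 2 * 2)"
definition "f_di i = (case dlt M i of (q, di, ww, dw, cw, dc, adv) \<Rightarrow> dcode di)"
definition "f_ww i = (case dlt M i of (q, di, ww, dw, cw, dc, adv) \<Rightarrow> (of_bool ww :: nat))"
definition "f_dw i = (case dlt M i of (q, di, ww, dw, cw, dc, adv) \<Rightarrow> dcode dw)"
definition "f_cw i = (case dlt M i of (q, di, ww, dw, cw, dc, adv) \<Rightarrow> (of_bool cw :: nat))"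
definition "f_dc i = (case dlt M i of (q, di, ww, dw, cw, dc, adv) \<Rightarrow> dcode dc)"
definition "f_ad i = (case dlt M i of (q, di, ww, dw, cw, dc, adv) \<Rightarrow> (of_bool adv :: nat))"

lemmas f_defs = f_st_def f_di_def f_ww_def f_dw_def f_cw_def f_dc_def f_ad_def

lemma tb_t: "tb M f_st i = t_st M i" "tb M f_di i = t_di M i" "tb M f_ww i = t_ww M i" "tb M f_dw i = t_dw M i"
  "tb M f_cw i = t_cw M i" "tb M f_dc i = t_dc M i" "tb M f_ad i = t_ad M i"
  by (simp_all add: t_defs tb_def f_defs)

definition "pkE a b c d e f = Add a (mul cR (Add b (mul cR (Add c (mul cR (Add d (mul cR (Add e (mul cR f)))))))))"

text \<open>Frame: packed configuration, catalytic bit, fresh coin.\<close>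

definition "nx0B = pkE
  (Ite (lt (cmE 0 (Var 0)) (Cn (4 * nst M))) (Add (tbE f_st) (Ite (eq (tbE f_ad) (Cn 1)) (Var 2) (md (cmE 0 (Var 0)) (Cn 2)))) (Cn 0))
  (call 3 mvB [tbE f_di, cmE 1 (Var 0), Add Len (Cn 1)])
  (md (Add (Sub (cmE 2 (Var 0)) (mul (wbE (Var 0)) (cmE 3 (Var 0)))) (mul (tbE f_ww) (cmE 3 (Var 0)))) cW)
  (Ite (tbE f_dw) (Ite (eq (tbE f_dw) (Cn 1)) (cmE 3 (Var 0)) (mn (mul (Cn 2) (cmE 3 (Var 0))) (mx (dv cW (Cn 2)) (Cn 1))))
     (mx (dv (cmE 3 (Var 0)) (Cn 2)) (Cn 1)))
  (call 3 mvB [tbE f_dc, cmE 4 (Var 0), Sub cT (Cn 1)])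
  (Add (lvE (Var 0)) (Cn 1))"

lemma nx0B_ev [simp]: "eval nx0B x [y, of_bool b, of_bool r] \<tau> = nx0 y b r" "und nx0B x [y, b', r'] \<tau>" "wfe nx0B 3"
  by (simp_all add: nx0B_def pkE_def nx0_def pk_def tb_t wbE_def n_def)

definition "wr0B = tbE f_cw"

lemma wr0B_ev [simp]: "eval wr0B x [y, of_bool b] \<tau> = of_bool (wr0 y b r)" "und wr0B x [y, b'] \<tau>" "wfe wr0B 2"
  by (auto simp: wr0B_def wr0_def tb_t) (auto simp: t_cw_def tb_def split: prod.splits)

definition "psB = Ite (lt (cmE 4 (Var 0)) cT) (cmE 4 (Var 0)) (Cn 0)"

lemma psB_ev [simp]: "eval psB x [y] \<tau> = ps y" "und psB x [y] \<tau>" "wfe psB 1" "wfe psB (Suc 0)"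
  by (simp_all add: psB_def ps_def)

definition "accB = eq (eq (dv (cmE 0 (Var 0)) (Cn 4)) (Cn (qacc M))) (bt2 (dv (cmE 0 (Var 0)) (Cn 2)))"

lemma accB_ev [simp]: "eval accB x [y] \<tau> = of_bool (acc y)" "und accB x [y] \<tau>" "wfe accB 1" "wfe accB (Suc 0)"
  by (auto simp: accB_def acc_def)

definition "ktopE = mul (pwE cR 5) (Add cT (Cn 1))"
definition "kbotE = Add ktopE (Cn 1)"
definition "startE b g = Add (Cn (4 * q0 M + 2 * of_bool g + of_bool b)) (pwE cR 3)"

lemma ktopE_ev [simp]: "eval ktopE x vs \<tau> = ktop" "und ktopE x vs \<tau>" "wfe ktopE v"
  by (simp_all add: ktopE_def ktop_def)
lemma kbotE_ev [simp]: "eval kbotE x vs \<tau> = kbot" "und kbotE x vs \<tau>" "wfe kbotE v"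
  by (simp_all add: kbotE_def kbot_def) (simp add: ktop_def)
lemma startE_ev [simp]: "eval (startE b g) x vs \<tau> = startk g b" "und (startE b g) x vs \<tau>" "wfe (startE b g) v"
  by (simp_all add: startE_def startk_def pk_def power3_eq_cube)

end

section \<open>Programming the tours\<close>

text \<open>The exponents solve two requirements. \<open>bt\<close> is chosen so that 8 (T + 1) m S0
  \<le> Y: the codes of long tours then fill at most a quarter of the range below Y.
  \<open>mu\<close> is chosen so that 2 T S0 E^3 Y \<le> m^2 for this Y: the pairs of a time and a
  rank of a bad seed then fill at most another quarter.\<close>

locale alg = mach +
  fixes gm mu bt :: nat
  assumes mu: "mu = 5 + 2 * k + 12 * rho + 3 * gm" and bt: "bt = mu + 6 * rho + k + 4"
begin

definition "m = P ^ mu"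
definition "E = P ^ gm"
definition "Y = P ^ bt"
definition "l = bt * lg n"
text \<open>A block consists of T cells for the tape of the machine and T + 1 fields of l bits:
  field 0 holds the number to be stored and later its code, field t + 1 the seed of time t.\<close>

definition "BL = T + (T + 1) * l"
definition "S = m * S0"

lemma Y_l: "Y = 2 ^ l" by (simp add: Y_def l_def P_def power_mult[symmetric] mult.commute)
lemma S0_P: "S0 = P ^ (6 * rho)" by (simp add: S0_def R_def power_mult[symmetric] mult.commute)
lemma P_mono: "i \<le> j \<Longrightarrow> P ^ i \<le> P ^ j" using P2 by (intro power_increasing) auto
lemma bt_pos: "0 < bt" using bt by simp
lemma l_pos: "0 < l" using lg_pos[of n] bt_pos by (simp add: l_def)
lemma mE_pos: "0 < m" "0 < E" "0 < Y" "0 < S" using P2 tops(1) by (auto simp: m_def E_def Y_def S_def)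
lemma m_Y: "m \<le> 2 ^ l" unfolding Y_l[symmetric] m_def Y_def by (rule P_mono) (simp add: bt)

lemma T_P: "T \<le> P ^ k" unfolding T_def using NP by (intro power_mono) auto

lemma TS_Y: "8 * ((T + 1) * S) \<le> Y"
proof -
  have "(2::nat) ^ 3 \<le> P ^ 3" using P2 by (intro power_mono) auto
  moreover have "T + 1 \<le> P * P ^ k" using T_P T_pos mult_le_mono1[OF P2, of "P ^ k"] by linarith
  ultimately have "8 * ((T + 1) * S) \<le> P ^ 3 * ((P * P ^ k) * (P ^ mu * P ^ (6 * rho)))" unfolding S_def m_def S0_P by (intro mult_le_mono) auto
  also have "\<dots> = P ^ (3 + (Suc k + (mu + 6 * rho)))" by (simp only: power_add power_Suc)
  also have "3 + (Suc k + (mu + 6 * rho)) = bt" using bt by simp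
  also have "P ^ bt = Y" by (simp only: Y_def)
  finally show ?thesis .
qed

lemma S_Y: "8 * S \<le> Y" using TS_Y mult_le_mono1[of 1 "T + 1" S] by linarith

lemma m_big: "2 * T * S0 * E ^ 3 * Y \<le> m * m"
proof -
  have "2 * T * S0 * E ^ 3 * Y \<le> P * P ^ k * P ^ (6 * rho) * (P ^ gm) ^ 3 * P ^ bt"
    unfolding S0_P E_def Y_def using P2 T_P by (intro mult_le_mono) auto
  also have "\<dots> = P ^ (1 + k + 6 * rho + gm * 3 + bt)" by (simp add: power_add power_mult)
  also have "1 + k + 6 * rho + gm * 3 + bt = mu + mu" using mu bt by linarith
  finally show ?thesis by (simp add: m_def power_add)
qed

definition "cm' = pwE cP mu"
definition "cE = pwE cP gm"
definition "cY = pwE cP bt"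
definition "cl = mul (Cn bt) cL"
definition "cBL = Add cT (mul (Add cT (Cn 1)) cl)"
definition "cS = mul cm' cS0"

lemma cm'_ev [simp]: "eval cm' x vs \<tau> = m" "und cm' x vs \<tau>" "wfe cm' v" by (simp_all add: cm'_def m_def P_def n_def)
lemma cE_ev [simp]: "eval cE x vs \<tau> = E" "und cE x vs \<tau>" "wfe cE v" by (simp_all add: cE_def E_def P_def n_def)
lemma cY_ev [simp]: "eval cY x vs \<tau> = Y" "und cY x vs \<tau>" "wfe cY v" by (simp_all add: cY_def Y_def P_def n_def)
lemma cl_ev [simp]: "eval cl x vs \<tau> = l" "und cl x vs \<tau>" "wfe cl v" by (simp_all add: cl_def l_def n_def)
lemma cBL_ev [simp]: "eval cBL x vs \<tau> = BL" "und cBL x vs \<tau>" "wfe cBL v" by (simp_all add: cBL_def BL_def)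
lemma cS_ev [simp]: "eval cS x vs \<tau> = S" "und cS x vs \<tau>" "wfe cS v" by (simp_all add: cS_def S_def)

definition "fad q f p = q * BL + (T + (f * l + p))"
definition "fadB = Add (mul (Var 0) cBL) (Add cT (Add (mul (Var 1) cl) (Var 2)))"

lemma fadB_ev [simp]: "eval fadB x [q, f, p] \<tau> = fad q f p" "und fadB x [q, f, p] \<tau>" "wfe fadB 3"
  by (simp_all add: fadB_def fad_def)

definition fv :: "bool list \<Rightarrow> nat \<Rightarrow> nat \<Rightarrow> nat" where
  "fv \<tau> q f = (\<Sum>p<l. of_bool (rd \<tau> (fad q f p)) * 2 ^ p)"

definition "p2E e = p2 cY e"

lemma p2E_ev [simp]: "eval (p2E e) x vs \<tau> = min (2 ^ eval e x (vs @ [Y]) \<tau>) Y" "und (p2E e) x vs \<tau> = und e x (vs @ [Y]) \<tau>"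
  "wfe (p2E e) v = wfe e (Suc v)"
  using mE_pos(3) by (simp_all add: p2E_def Suc_le_eq)

lemma p2_small: "p < l \<Longrightarrow> min (2 ^ p) Y = 2 ^ p"
  unfolding Y_l by (intro min_absorb1 power_increasing) auto

definition "fvB = Sum cl (mul (Cat (call 3 fadB [Var 0, Var 1, Var 2])) (p2E (Var 2)))"

lemma fvB_ev [simp]: "eval fvB x [q, f] \<tau> = fv \<tau> q f" "und fvB x [q, f] \<tau>" "wfe fvB 2"
  by (simp_all add: fvB_def fv_def p2_small cong: sum.cong_simp del: sum_mult_of_bool_eq sum_of_bool_mult_eq)

definition "ipB = bt2 (Sum cl (mul (md (dv (Var 0) (p2E (Var 2))) (Cn 2)) (md (dv (Var 1) (p2E (Var 2))) (Cn 2))))"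

lemma ipB_ev [simp]: "eval ipB x [a, i] \<tau> = of_bool (ip l a i)" "und ipB x [a, i] \<tau>" "wfe ipB 2"
  by (simp_all add: ipB_def ip_def p2_small cong: sum.cong_simp)

definition "coinB = call 2 ipB [call 2 fvB [Var 0, Add (Var 1) (Cn 1)], Var 2]"

lemma coinB_ev [simp]: "eval coinB x [q, t, i] \<tau> = of_bool (ip l (fv \<tau> q (Suc t)) i)" "und coinB x [q, t, i] \<tau>" "wfe coinB 3"
  by (simp_all add: coinB_def)

definition "lvlE e = lvE (md e cS0)"
lemma lvlE_ev [simp]: "eval (lvlE e) x vs \<tau> = lv (eval e x vs \<tau> mod S0)" "und (lvlE e) x vs \<tau> = und e x vs \<tau>"
  "wfe (lvlE e) v = wfe e v"
  by (simp_all add: lvlE_def)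

definition "posB = Add (mul (Var 0) cBL) (call 1 psB [md (Var 1) cS0])"
lemma posB_ev [simp]: "eval posB x [q, s] \<tau> = q * BL + ps (s mod S0)" "und posB x [q, s] \<tau>" "wfe posB 2"
  by (simp_all add: posB_def)

definition "nxsB = Ite (lt (lvlE (Var 1)) cT)
  (Add (mul (dv (Var 1) cS0) cS0) (call 3 nx0B [md (Var 1) cS0, Var 2, call 3 coinB [Var 0, lvlE (Var 1), dv (Var 1) cS0]]))
  (Ite (call 1 accB [md (Var 1) cS0]) ktopE kbotE)"
definition "wrsB = Ite (lt (lvlE (Var 1)) cT) (call 2 wr0B [md (Var 1) cS0, Var 2]) (Var 2)"

definition nxq :: "nat \<Rightarrow> (nat \<Rightarrow> nat) \<Rightarrow> nat \<Rightarrow> bool \<Rightarrow> nat" where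
  "nxq q a s b = (if lv (s mod S0) < T then s div S0 * S0 + nx0 (s mod S0) b (ip l (a (lv (s mod S0))) (s div S0))
     else if acc (s mod S0) then ktop else kbot)"
definition wrq :: "nat \<Rightarrow> bool \<Rightarrow> bool" where
  "wrq s b = (if lv (s mod S0) < T then wr0 (s mod S0) b False else b)"

text \<open>The bit written depends on the stored coin and not on the fresh one. Hence the two
  successors of a node differ in their small state only and share one tape.\<close>

lemma wr0_any: "wr0 y b r = wr0 y b r'" by (simp add: wr0_def)

definition sd :: "bool list \<Rightarrow> nat \<Rightarrow> nat \<Rightarrow> nat" where "sd \<tau> q t = fv \<tau> q (Suc t)"

lemma nxsB_ev [simp]: "eval nxsB x [q, s, of_bool b] \<tau> = nxq q (sd \<tau> q) s b" "und nxsB x [q, s, b'] \<tau>" "wfe nxsB 3"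
  by (simp_all add: nxsB_def nxq_def sd_def)

lemma wrsB_ev [simp]: "eval wrsB x [q, s, of_bool b] \<tau> = of_bool (wrq s b)" "und wrsB x [q, s, b'] \<tau>" "wfe wrsB 3"
  by (simp_all add: wrsB_def wrq_def wr0B_ev(1)[where r = False])

definition "valB = an (nt (lt (lvlE (dv (Var 3) (Cn 2))) (Var 1))) (an (lt (lvlE (dv (Var 3) (Cn 2))) (Add cT (Cn 1)))
   (an (eq (call 3 nxsB [Var 0, dv (Var 3) (Cn 2), bt2 (Var 3)]) (Var 2))
     (eq (call 3 wrsB [Var 0, dv (Var 3) (Cn 2), bt2 (Var 3)]) (Cat (call 2 posB [Var 0, dv (Var 3) (Cn 2)])))))"

definition valq :: "nat \<Rightarrow> nat \<Rightarrow> (nat \<Rightarrow> nat) \<Rightarrow> nat \<Rightarrow> bool list \<Rightarrow> nat \<Rightarrow> bool" where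
  "valq q tm a s z e \<longleftrightarrow> tm \<le> lv (e div 2 mod S0) \<and> lv (e div 2 mod S0) < Suc T \<and> nxq q a (e div 2) (odd e) = s \<and>
     wrq (e div 2) (odd e) = rd z (q * BL + ps (e div 2 mod S0))"

lemma valB_ev [simp]: "eval valB x [q, tm, s, e] \<tau> = of_bool (valq q tm (sd \<tau> q) s \<tau> e)" "und valB x [q, tm, s, e] \<tau>" "wfe valB 4"
  by (auto simp: valB_def valq_def not_less)

definition "fnB = fndE 4 (mul (Cn 2) cS) (an (nt (lt (Var 5) (Var 3))) (call 4 valB [Var 0, Var 1, Var 2, Var 5]))"
definition "fpB = fndE 4 (Var 3) (call 4 valB [Var 0, Var 1, Var 2, Sub (Sub (Var 3) (Cn 1)) (Var 5)])"

lemma fnB_ev [simp]: "eval fnB x [q, tm, s, lo] \<tau> = fnd (2 * S) (\<lambda>e. lo \<le> e \<and> valq q tm (sd \<tau> q) s \<tau> e)"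
  "und fnB x [q, tm, s, lo] \<tau>" "wfe fnB 4"
proof -
  show "eval fnB x [q, tm, s, lo] \<tau> = fnd (2 * S) (\<lambda>e. lo \<le> e \<and> valq q tm (sd \<tau> q) s \<tau> e)"
    unfolding fnB_def by (subst fnd_ev[where Q = "\<lambda>e. lo \<le> e \<and> valq q tm (sd \<tau> q) s \<tau> e"]) (simp_all add: not_less)
  show "und fnB x [q, tm, s, lo] \<tau>" unfolding fnB_def by (rule fnd_und) simp_all
  show "wfe fnB 4" by (simp add: fnB_def)
qed

lemma fpB_ev [simp]: "eval fpB x [q, tm, s, hi] \<tau> = fnd hi (\<lambda>j. valq q tm (sd \<tau> q) s \<tau> (hi - 1 - j))"
  "und fpB x [q, tm, s, hi] \<tau>" "wfe fpB 4"
proof -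
  show "eval fpB x [q, tm, s, hi] \<tau> = fnd hi (\<lambda>j. valq q tm (sd \<tau> q) s \<tau> (hi - 1 - j))"
    unfolding fpB_def by (subst fnd_ev[where Q = "\<lambda>j. valq q tm (sd \<tau> q) s \<tau> (hi - 1 - j)"]) simp_all
  show "und fpB x [q, tm, s, hi] \<tau>" unfolding fpB_def by (rule fnd_und) simp_all
  show "wfe fpB 4" by (simp add: fpB_def)
qed

text \<open>Frame: bound, block, least level, small state, direction (1 = up), label.\<close>

definition "hf e = dv e (Cn 2)"
text \<open>The label is stored first, because the write destroys the bit that the move still needs.
  The label is also where the search for the next sibling starts.\<close>

definition "parC = CSeq (Assign 5 (Add (mul (Cn 2) (Var 3)) (Cat (call 2 posB [Var 1, Var 3]))))
   (CSeq (Write (call 2 posB [Var 1, hf (Var 5)]) (call 3 wrsB [Var 1, hf (Var 5), bt2 (Var 5)]))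
     (Assign 3 (call 3 nxsB [Var 1, hf (Var 5), bt2 (Var 5)])))"
definition "chdC = CSeq (Write (call 2 posB [Var 1, hf (Var 5)]) (bt2 (Var 5))) (Assign 3 (hf (Var 5)))"

definition "nxtC = CSeq (CIf (Var 4)
   (CIf (lt (lvlE (Var 3)) (Add cT (Cn 1)))
     (CSeq parC (CSeq (Assign 5 (call 4 fnB [Var 1, Var 2, Var 3, Add (Var 5) (Cn 1)]))
       (CIf (lt (Var 5) (mul (Cn 2) cS)) (CSeq chdC (Assign 4 (Cn 0))) (Assign 5 (Cn 0)))))
     (Assign 4 (Cn 0)))
   (CSeq (Assign 5 (call 4 fnB [Var 1, Var 2, Var 3, Cn 0]))
     (CIf (lt (Var 5) (mul (Cn 2) cS)) chdC (Assign 4 (Cn 1)))))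
   (Assign 5 (Cn 0))"

text \<open>The label variable is turned from the offset found into the label itself before descending.\<close>

definition "prvC = CSeq (CIf (Var 4)
   (CSeq (Assign 5 (call 4 fpB [Var 1, Var 2, Var 3, mul (Cn 2) cS]))
     (CIf (lt (Var 5) (mul (Cn 2) cS)) (CSeq (Assign 5 (Sub (Sub (mul (Cn 2) cS) (Cn 1)) (Var 5))) chdC) (Assign 4 (Cn 0))))
   (CIf (lt (lvlE (Var 3)) (Add cT (Cn 1)))
     (CSeq parC
       (CIf (lt (call 4 fpB [Var 1, Var 2, Var 3, Var 5]) (Var 5))
          (CSeq (Assign 5 (Sub (Sub (Var 5) (Cn 1)) (call 4 fpB [Var 1, Var 2, Var 3, Var 5]))) (CSeq chdC (Assign 4 (Cn 1))))
          (Assign 5 (Cn 0))))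
     (Assign 4 (Cn 1))))
   (Assign 5 (Cn 0))"

lemma undc_all:
  "(\<And>vs z. und e x vs z) \<Longrightarrow> undc (Assign j e) x U"
  "(\<And>vs z. und e x vs z) \<Longrightarrow> (\<And>vs z. und e' x vs z) \<Longrightarrow> undc (Write e e') x U"
  "(\<And>V. undc c x V) \<Longrightarrow> (\<And>V. undc c' x V) \<Longrightarrow> undc (CSeq c c') x U"
  "(\<And>vs z. und e x vs z) \<Longrightarrow> (\<And>V. undc c x V) \<Longrightarrow> (\<And>V. undc c' x V) \<Longrightarrow> undc (CIf e c c') x U"
  "(\<And>vs z. und e x vs z) \<Longrightarrow> (\<And>V. undc c x V) \<Longrightarrow> undc (Loop e c) x U"
  by (auto split: prod.splits)

lemma tourC_und: "undc nxtC x U" "undc prvC x U"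
  unfolding nxtC_def prvC_def parC_def chdC_def hf_def by (intro undc_all; simp)+

lemma tourC_wf: "6 \<le> v \<Longrightarrow> wfc nxtC v" "6 \<le> v \<Longrightarrow> wfc prvC v"
  by (simp_all add: nxtC_def prvC_def parC_def chdC_def hf_def)

end

section \<open>Inspecting the j-th state of a tour and returning\<close>

context alg
begin

text \<open>The tour is walked on the tape itself, with the rest of its state in variables 3 to 5; j
  steps back restore everything, whatever \<open>e\<close> has looked at.\<close>

definition "tourB e = After (Loop (Var 6) nxtC) e (Loop (Var 6) prvC)"
definition "nS q tm j = call 8 (tourB (Var 3)) [cY, q, tm, ktopE, Cn 0, Cn 0, j, Cn 0]"
definition "nD q tm j = call 8 (tourB (Var 4)) [cY, q, tm, ktopE, Cn 0, Cn 0, j, Cn 0]"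
definition "nZ q tm j p = call 8 (tourB (Cat (Var 7))) [cY, q, tm, ktopE, Cn 0, Cn 0, j, p]"
definition "backB = After (Loop (Var 6) prvC) (an (nt (lt (lvlE (Var 3)) (Add cT (Cn 1)))) (nt (Var 4))) (Loop (Var 6) nxtC)"

lemma tour_wf [simp]: "wfe (nS a b c) v \<longleftrightarrow> wfe a (Suc v) \<and> wfe b (Suc (Suc v)) \<and> wfe c (Suc (Suc (Suc (Suc (Suc (Suc v))))))"
  "wfe (nD a b c) v \<longleftrightarrow> wfe a (Suc v) \<and> wfe b (Suc (Suc v)) \<and> wfe c (Suc (Suc (Suc (Suc (Suc (Suc v))))))"
  "wfe (nZ a b c d) v \<longleftrightarrow> wfe a (Suc v) \<and> wfe b (Suc (Suc v)) \<and> wfe c (Suc (Suc (Suc (Suc (Suc (Suc v)))))) \<and> wfe d (Suc (Suc (Suc (Suc (Suc (Suc (Suc v)))))))"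
  "wfe backB 7"
  by (simp_all add: nS_def nD_def nZ_def backB_def tourB_def tourC_wf)

end

locale blockq = alg +
  fixes q Lt :: nat
  assumes qLt: "q * BL + BL \<le> Lt"
begin

sublocale b: block M k rho x "q * BL" Lt m E l
  using qLt m_Y mE_pos by unfold_locales (auto simp: BL_def)

lemma pos_q: "b.smp.pos s = q * BL + ps (s mod S0)" by (simp add: b.smp.pos_def)
lemma lvl_q: "b.smp.lvl s = lv (s mod S0)" by (simp add: b.smp.lvl_def)
lemma nxs_q: "b.smp.nxs a s v = nxq q a s v" by (simp add: b.smp.nxs_def nxq_def lvl_q)
lemma wrs_q: "b.smp.wrs a s v = wrq s v" using wr0_any by (auto simp: b.smp.wrs_def wrq_def lvl_q)

abbreviation "NX \<equiv> b.smp.F.nxt"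
abbreviation "PV \<equiv> b.smp.F.prv"

lemma pos_Lt: "q * BL + ps y < q * BL + T" "q * BL + ps y < Lt"
  using ps_less[of y] qLt by (auto simp: BL_def)

text \<open>The seeds are read from the very tape that the tour modifies; they lie behind the T
  cells on which the heads move.\<close>

lemma sd_upd: "length z = Lt \<Longrightarrow> sd (z[q * BL + ps y := v]) q = sd z q"
proof -
  have "rd (z[q * BL + ps y := v]) (fad q f p) = rd z (fad q f p)" for f p
    using ps_less[of y] by (simp add: rd_def fad_def nth_list_update)
  then show ?thesis by (simp add: sd_def fv_def fun_eq_iff)
qed

lemma val_q: "length z = Lt \<Longrightarrow> b.smp.F.valid tm a s z e \<longleftrightarrow> valq q tm a s z e"
  using pos_Lt(2) by (simp add: b.smp.F.valid_def valq_def lvl_q nxs_q wrs_q pos_q rd_def)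

lemma lab_q: "length z = Lt \<Longrightarrow> b.smp.F.lab s z = 2 * s + of_bool (rd z (q * BL + ps (s mod S0)))"
  using pos_Lt(2) by (simp add: b.smp.F.lab_def pos_q rd_def)

lemma lab_le: "length z = Lt \<Longrightarrow> s < S \<Longrightarrow> b.smp.F.lab s z < 2 * S"
  using b.smp.F.lab_less[of s z] by (simp add: S_def)

lemma parC_ex:
  assumes "b.smp.F.nok tm (s, z)" "lv (s mod S0) < Suc T" "Y \<le> lm"
  shows "exec parC x (lm # q # tm # s # d # e # ext, z) =
    (lm # q # tm # fst (b.smp.F.par (sd z q) (s, z)) # d # b.smp.F.lab s z # ext, snd (b.smp.F.par (sd z q) (s, z)))"
proof -
  have z: "length z = Lt" "s < S" using assms by (auto simp: b.smp.F.nok_def S_def)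
  define L where "L = b.smp.F.lab s z"
  have L: "L = 2 * s + of_bool (rd z (q * BL + ps (s mod S0)))" using lab_q z by (simp add: L_def)
  have Llm: "min L lm = L" using lab_le[OF z] S_Y assms(3) by (simp add: L_def)
  have Ld: "L div 2 = s" "odd L \<longleftrightarrow> z ! (q * BL + ps (s mod S0))" using z pos_Lt(2) by (auto simp: L rd_def)
  have ns: "nxq q (sd z q) s v < S" for v
    using b.smp.F.nx_less[of s "sd z q" v] z assms(2) by (simp add: S_def lvl_q nxs_q)
  then have nlm: "min (nxq q (sd z q) s v) lm = nxq q (sd z q) s v" for v using S_Y assms(3) by (metis le_add2 le_trans less_imp_le min.absorb1 mult_le_mono1 mult_1 one_le_numeral)
  have 1: "exec (Assign 5 (Add (mul (Cn 2) (Var 3)) (Cat (call 2 posB [Var 1, Var 3])))) x (lm # q # tm # s # d # e # ext, z)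
    = (lm # q # tm # s # d # L # ext, z)"
    using Llm by (simp add: L)
  let ?z = "z[q * BL + ps (s mod S0) := wrq s (odd L)]"
  have 2: "exec (Write (call 2 posB [Var 1, hf (Var 5)]) (call 3 wrsB [Var 1, hf (Var 5), bt2 (Var 5)])) x (lm # q # tm # s # d # L # ext, z)
    = (lm # q # tm # s # d # L # ext, ?z)"
    by (simp add: hf_def Ld(1))
  have 3: "exec (Assign 3 (call 3 nxsB [Var 1, hf (Var 5), bt2 (Var 5)])) x (lm # q # tm # s # d # L # ext, ?z)
    = (lm # q # tm # nxq q (sd z q) s (odd L) # d # L # ext, ?z)"
    using sd_upd[OF z(1)] nlm by (simp add: hf_def Ld(1))
  show ?thesis unfolding parC_def exec.simps(3) 1 2 3
    using Ld(2) by (simp add: b.smp.F.par_def pos_q nxs_q wrs_q L_def[symmetric])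
qed

lemma chdC_ex:
  assumes "length z = Lt" "e < 2 * S" "Y \<le> lm"
  shows "exec chdC x (lm # q # tm # s # d # e # ext, z) =
    (lm # q # tm # fst (b.smp.F.child z e) # d # e # ext, snd (b.smp.F.child z e))"
proof -
  have "e div 2 \<le> lm" using assms S_Y by linarith
  then show ?thesis by (simp add: chdC_def hf_def b.smp.F.child_def pos_q)
qed

lemma nxtC_ex:
  assumes ok: "b.smp.F.tok tm (s, d, z)" and lm: "Y \<le> lm"
  shows "exec nxtC x (lm # q # tm # s # of_bool d # 0 # ext, z) =
    (case NX tm (sd z q) (s, d, z) of (s', d', z') \<Rightarrow> (lm # q # tm # s' # of_bool d' # 0 # ext, z'))"
proof -
  have nok: "b.smp.F.nok tm (s, z)" using ok by (simp add: b.smp.F.tok_def)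
  have z: "length z = Lt" "s < S" using nok by (auto simp: b.smp.F.nok_def S_def)
  have S2: "2 * S \<le> lm" using S_Y lm by linarith
  have lm1: "Suc 0 \<le> lm" using mE_pos(3) lm by linarith
  have fle: "fnd (2 * S) Q \<le> lm" for Q
    using S2 by (cases rule: fnd_cases[of "2 * S" Q]) auto
  have reset: "exec (Assign 5 (Cn 0)) x (lm # q # tm # s' # d' # e' # ext, z') = (lm # q # tm # s' # d' # 0 # ext, z')" for s' d' e' z'
    by simp
  show ?thesis
  proof (cases d)
    case False
    define e where "e = fnd (2 * S) (b.smp.F.valid tm (sd z q) s z)"
    have e: "fnd (2 * S) (valq q tm (sd z q) s z) = e" unfolding e_def using val_q[OF z(1)] by (intro fnd_cong) auto
    have 1: "exec (Assign 5 (call 4 fnB [Var 1, Var 2, Var 3, Cn 0])) x (lm # q # tm # s # 0 # 0 # ext, z) = (lm # q # tm # s # 0 # e # ext, z)"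
      using fle[of "valq q tm (sd z q) s z"] by (simp add: e)
    show ?thesis
    proof (cases "e < 2 * S")
      case True
      then have "NX tm (sd z q) (s, d, z) = (fst (b.smp.F.child z e), False, snd (b.smp.F.child z e))"
        using False by (simp add: b.smp.F.nxt_def S_def e_def Let_def)
      then show ?thesis unfolding nxtC_def exec.simps(3)
        using False True 1 chdC_ex[OF z(1) True lm] reset by simp
    next
      case nt: False
      then have "NX tm (sd z q) (s, d, z) = (s, True, z)"
        using False by (simp add: b.smp.F.nxt_def S_def e_def Let_def)
      then show ?thesis unfolding nxtC_def exec.simps(3)
        using False nt 1 lm1 reset by simp
    qed
  next
    case True
    show ?thesis
    proof (cases "lv (s mod S0) < Suc T")
      case False
      then have "NX tm (sd z q) (s, d, z) = (s, False, z)" using True by (simp add: b.smp.F.nxt_def lvl_q)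
      then show ?thesis using True False by (simp add: nxtC_def)
    next
      case lt: True
      define s1 z1 L where "s1 = fst (b.smp.F.par (sd z q) (s, z))" and "z1 = snd (b.smp.F.par (sd z q) (s, z))" and "L = b.smp.F.lab s z"
      have z1: "length z1 = Lt" using z by (simp add: z1_def b.smp.F.par_def)
      have sd1: "sd z1 q = sd z q" using sd_upd[OF z(1)] by (simp add: z1_def b.smp.F.par_def pos_q)
      have p: "exec parC x (lm # q # tm # s # 1 # 0 # ext, z) = (lm # q # tm # s1 # 1 # L # ext, z1)"
        using parC_ex[OF nok lt lm] by (simp add: s1_def z1_def L_def)
      define e where "e = fnd (2 * S) (\<lambda>e. L < e \<and> b.smp.F.valid tm (sd z q) s1 z1 e)"
      have e: "fnd (2 * S) (\<lambda>e. Suc L \<le> e \<and> valq q tm (sd z q) s1 z1 e) = e" using val_q[OF z1] by (simp add: e_def Suc_le_eq)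
      have 1: "exec (Assign 5 (call 4 fnB [Var 1, Var 2, Var 3, Add (Var 5) (Cn 1)])) x (lm # q # tm # s1 # 1 # L # ext, z1) = (lm # q # tm # s1 # 1 # e # ext, z1)"
        using fle[of "\<lambda>e. Suc L \<le> e \<and> valq q tm (sd z q) s1 z1 e"] by (simp add: e sd1)
      have up: "NX tm (sd z q) (s, d, z) = (if e < 2 * S then (fst (b.smp.F.child z1 e), False, snd (b.smp.F.child z1 e)) else (s1, True, z1))"
        using True lt by (simp add: b.smp.F.nxt_def S_def lvl_q s1_def z1_def L_def e_def Let_def)
      show ?thesis
      proof (cases "e < 2 * S")
        case e2: True
        then show ?thesis unfolding nxtC_def exec.simps(3)
          using True lt p 1 chdC_ex[OF z1 e2 lm] up reset by simp
      next
        case e2: False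
        then show ?thesis unfolding nxtC_def exec.simps(3)
          using True lt p 1 up reset by simp
      qed
    qed
  qed
qed

lemma prvC_ex:
  assumes ok: "b.smp.F.tok tm (s, d, z)" and lm: "Y \<le> lm"
  shows "exec prvC x (lm # q # tm # s # of_bool d # 0 # ext, z) =
    (case PV tm (sd z q) (s, d, z) of (s', d', z') \<Rightarrow> (lm # q # tm # s' # of_bool d' # 0 # ext, z'))"
proof -
  have nok: "b.smp.F.nok tm (s, z)" using ok by (simp add: b.smp.F.tok_def)
  have z: "length z = Lt" "s < S" using nok by (auto simp: b.smp.F.nok_def S_def)
  have S2: "2 * S \<le> lm" using S_Y lm by linarith
  have lm1: "Suc 0 \<le> lm" using mE_pos(3) lm by linarith
  have fle: "fnd (2 * S) Q \<le> lm" for Q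
    using S2 by (cases rule: fnd_cases[of "2 * S" Q]) auto
  have reset: "exec (Assign 5 (Cn 0)) x (lm # q # tm # s' # d' # e' # ext, z') = (lm # q # tm # s' # d' # 0 # ext, z')" for s' d' e' z'
    by simp
  show ?thesis
  proof (cases d)
    case True
    define j where "j = fnd (2 * S) (\<lambda>j. b.smp.F.valid tm (sd z q) s z (2 * S - 1 - j))"
    have j: "fnd (2 * S) (\<lambda>j. valq q tm (sd z q) s z (2 * S - 1 - j)) = j" using val_q[OF z(1)] by (simp add: j_def)
    have 1: "exec (Assign 5 (call 4 fpB [Var 1, Var 2, Var 3, mul (Cn 2) cS])) x (lm # q # tm # s # 1 # 0 # ext, z) = (lm # q # tm # s # 1 # j # ext, z)"
      using fle[of "\<lambda>j. valq q tm (sd z q) s z (2 * S - 1 - j)"] j by simp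
    show ?thesis
    proof (cases "j < 2 * S")
      case jl: True
      define e where "e = 2 * S - 1 - j"
      have e: "e < 2 * S" using jl by (simp add: e_def)
      have 2: "exec (Assign 5 (Sub (Sub (mul (Cn 2) cS) (Cn 1)) (Var 5))) x (lm # q # tm # s # 1 # j # ext, z) = (lm # q # tm # s # 1 # e # ext, z)"
        using S2 by (simp add: e_def)
      have "PV tm (sd z q) (s, d, z) = (fst (b.smp.F.child z e), True, snd (b.smp.F.child z e))"
        using True jl by (simp add: b.smp.F.prv_def S_def j_def e_def Let_def)
      then show ?thesis unfolding prvC_def exec.simps(3)
        using True jl 1 2 chdC_ex[OF z(1) e lm] reset by simp
    next
      case False
      then have "PV tm (sd z q) (s, d, z) = (s, False, z)"
        using True by (simp add: b.smp.F.prv_def S_def j_def Let_def)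
      then show ?thesis unfolding prvC_def exec.simps(3) using True False 1 reset by simp
    qed
  next
    case False
    show ?thesis
    proof (cases "lv (s mod S0) < Suc T")
      case lt: False
      then have "PV tm (sd z q) (s, d, z) = (s, True, z)" using False by (simp add: b.smp.F.prv_def lvl_q)
      then show ?thesis using False lt lm1 by (simp add: prvC_def)
    next
      case lt: True
      define s1 z1 L where "s1 = fst (b.smp.F.par (sd z q) (s, z))" and "z1 = snd (b.smp.F.par (sd z q) (s, z))" and "L = b.smp.F.lab s z"
      have z1: "length z1 = Lt" using z by (simp add: z1_def b.smp.F.par_def)
      have sd1: "sd z1 q = sd z q" using sd_upd[OF z(1)] by (simp add: z1_def b.smp.F.par_def pos_q)
      have L: "L < 2 * S" using lab_le[OF z] by (simp add: L_def)
      have p: "exec parC x (lm # q # tm # s # 0 # 0 # ext, z) = (lm # q # tm # s1 # 0 # L # ext, z1)"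
        using parC_ex[OF nok lt lm] by (simp add: s1_def z1_def L_def)
      define j where "j = fnd L (\<lambda>j. b.smp.F.valid tm (sd z q) s1 z1 (L - 1 - j))"
      have j: "fnd L (\<lambda>j. valq q tm (sd z q) s1 z1 (L - 1 - j)) = j" using val_q[OF z1] by (simp add: j_def)
      have j1: "fnd L (\<lambda>j. valq q tm (sd z q) s1 z1 (L - Suc j)) = j" using j by simp
      have up: "PV tm (sd z q) (s, d, z) = (if j < L then (fst (b.smp.F.child z1 (L - 1 - j)), True, snd (b.smp.F.child z1 (L - 1 - j))) else (s1, False, z1))"
        using False lt by (simp add: b.smp.F.prv_def S_def lvl_q s1_def z1_def L_def j_def Let_def)
      show ?thesis
      proof (cases "j < L")
        case jl: True
        define e where "e = L - 1 - j"
        have e: "e < 2 * S" using jl L by (simp add: e_def)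
        have eS: "L - Suc j = e" by (simp add: e_def)
        have 2: "exec (Assign 5 (Sub (Sub (Var 5) (Cn 1)) (call 4 fpB [Var 1, Var 2, Var 3, Var 5]))) x (lm # q # tm # s1 # 0 # L # ext, z1) = (lm # q # tm # s1 # 0 # e # ext, z1)"
          using e S2 by (simp add: e_def sd1 j1)
        show ?thesis unfolding prvC_def exec.simps(3)
          using False lt p 2 jl chdC_ex[OF z1 e lm] up reset lm1 j1 sd1 eS by simp
      next
        case jl: False
        then show ?thesis unfolding prvC_def exec.simps(3)
          using False lt p up reset j1 sd1 by simp
      qed
    qed
  qed
qed


lemma rd_same:
  assumes "b.smp.F.tok tm t"
  shows "length (snd (snd ((NX tm a ^^ j) t))) = Lt" "sd (snd (snd ((NX tm a ^^ j) t))) q = sd (snd (snd t)) q"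
proof -
  have len: "length (snd (snd ((NX tm a ^^ j) t))) = Lt" for j
    using b.smp.F.tok_nxt_pow[OF assms, where a = a and n = j] by (auto simp: b.smp.F.tok_def b.smp.F.nok_def split: prod.splits)
  have ne: "b.smp.pos s \<noteq> fad q f p" for s f p using ps_less[of "s mod S0"] by (simp add: pos_q fad_def)
  have "rd (snd (snd ((NX tm a ^^ j) t))) (fad q f p) = rd (snd (snd t)) (fad q f p)" for f p
    using b.smp.F.nxt_pow_unchanged[OF assms ne, where a = a and n = j] len[of j] len[of 0]
    by (simp add: rd_def b.smp.F.tnode_def case_prod_beta)
  then show "sd (snd (snd ((NX tm a ^^ j) t))) q = sd (snd (snd t)) q" by (simp add: sd_def fv_def fun_eq_iff)
  show "length (snd (snd ((NX tm a ^^ j) t))) = Lt" by (rule len)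
qed

lemma nxt_prv_pow: "b.smp.F.tok tm t \<Longrightarrow> (NX tm a ^^ j) ((PV tm a ^^ j) t) = t"
proof (induction j)
  case (Suc j)
  have "(NX tm a ^^ Suc j) ((PV tm a ^^ Suc j) t) = (NX tm a ^^ j) (NX tm a (PV tm a ((PV tm a ^^ j) t)))"
    by (simp add: funpow_swap1)
  then show ?case using Suc b.smp.F.nxt_prv[OF b.smp.F.tok_prv_pow[OF Suc.prems, where a = a and n = j], where a = a] by simp
qed simp

lemma rd_same_prv:
  assumes "b.smp.F.tok tm t"
  shows "length (snd (snd ((PV tm a ^^ j) t))) = Lt" "sd (snd (snd ((PV tm a ^^ j) t))) q = sd (snd (snd t)) q"
  using rd_same[OF b.smp.F.tok_prv_pow[OF assms, where a = a and n = j], where a = a and j = 0] rd_same(2)[OF b.smp.F.tok_prv_pow[OF assms, where a = a and n = j], where a = a and j = j]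
    nxt_prv_pow[OF assms, where a = a and j = j] by simp_all

definition cf :: "nat \<Rightarrow> nat \<Rightarrow> nat list \<Rightarrow> tour \<Rightarrow> nat list \<times> bool list" where
  "cf lm tm ext = (\<lambda>(s, d, z). (lm # q # tm # s # of_bool d # 0 # ext, z))"

lemma nxt_loop:
  assumes "b.smp.F.tok tm t" "Y \<le> lm"
  shows "(loop1 (exec nxtC x) ^^ j) (cf lm tm ext t) = cf lm tm ext ((NX tm (sd (snd (snd t)) q) ^^ j) t)"
proof (induction j)
  case (Suc j)
  define a where "a = sd (snd (snd t)) q"
  obtain s d z where e: "(NX tm a ^^ j) t = (s, d, z)" by (cases "(NX tm a ^^ j) t") auto
  have tk: "b.smp.F.tok tm (s, d, z)" using b.smp.F.tok_nxt_pow[OF assms(1), where a = a and n = j] e by simp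
  have sdz: "sd z q = a" using rd_same(2)[OF assms(1), where a = a and j = j] e by (simp add: a_def)
  have "loop1 (exec nxtC x) (cf lm tm ext (s, d, z)) = cf lm tm ext (NX tm a (s, d, z))"
    using nxtC_ex[OF tk assms(2), of "ext @ [0]"] sdz by (auto simp: loop1_def cf_def split: prod.splits)
  then show ?case using Suc e by (simp add: a_def)
qed simp

lemma prv_loop:
  assumes "b.smp.F.tok tm t" "Y \<le> lm"
  shows "(loop1 (exec prvC x) ^^ j) (cf lm tm ext t) = cf lm tm ext ((PV tm (sd (snd (snd t)) q) ^^ j) t)"
proof (induction j)
  case (Suc j)
  define a where "a = sd (snd (snd t)) q"
  obtain s d z where e: "(PV tm a ^^ j) t = (s, d, z)" by (cases "(PV tm a ^^ j) t") auto
  have tk: "b.smp.F.tok tm (s, d, z)" using b.smp.F.tok_prv_pow[OF assms(1), where a = a and n = j] e by simp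
  have sdz: "sd z q = a" using rd_same_prv(2)[OF assms(1), where a = a and j = j] e by (simp add: a_def)
  have "loop1 (exec prvC x) (cf lm tm ext (s, d, z)) = cf lm tm ext (PV tm a (s, d, z))"
    using prvC_ex[OF tk assms(2), of "ext @ [0]"] sdz by (auto simp: loop1_def cf_def split: prod.splits)
  then show ?case using Suc e by (simp add: a_def)
qed simp

definition tr :: "nat \<Rightarrow> bool list \<Rightarrow> nat \<Rightarrow> tour" where
  "tr tm z j = (NX tm (sd z q) ^^ j) (ktop, False, z)"

lemma tok_top: "length z = Lt \<Longrightarrow> tm \<le> Suc T \<Longrightarrow> b.smp.F.tok tm (ktop, False, z)"
  using tops b.smp.snode_top[of ktop] by (simp add: b.smp.F.tok_def b.smp.F.nok_def lvl_q)

lemma tourB_ev: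
  assumes "length z = Lt" "tm \<le> Suc T"
  shows "eval (tourB e) x [Y, q, tm, ktop, 0, 0, j, p] z =
      (case tr tm z j of (s, d, z') \<Rightarrow> eval e x [Y, q, tm, s, of_bool d, 0, j, p] z')"
    "(\<And>s d z'. und e x [Y, q, tm, s, d, 0, j, p] z') \<Longrightarrow> und (tourB e) x [Y, q, tm, ktop, 0, 0, j, p] z"
proof -
  note tk = tok_top[OF assms]
  have 1: "exec (Loop (Var 6) nxtC) x ([Y, q, tm, ktop, 0, 0, j, p], z) = cf Y tm [j, p] (tr tm z j)"
    using nxt_loop[OF tk order_refl, of j "[j, p]"] by (simp add: cf_def tr_def)
  then show "eval (tourB e) x [Y, q, tm, ktop, 0, 0, j, p] z =
      (case tr tm z j of (s, d, z') \<Rightarrow> eval e x [Y, q, tm, s, of_bool d, 0, j, p] z')"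
    by (simp add: tourB_def cf_def split: prod.splits)
  obtain s d z' where t: "tr tm z j = (s, d, z')" by (cases "tr tm z j") auto
  have tk': "b.smp.F.tok tm (s, d, z')" using b.smp.F.tok_nxt_pow[OF tk, where a = "sd z q" and n = j] t by (simp add: tr_def)
  have sdz: "sd z' q = sd z q" using rd_same(2)[OF tk, where a = "sd z q" and j = j] t by (simp add: tr_def)
  have bk: "(PV tm (sd z q) ^^ j) (s, d, z') = (ktop, False, z)"
    using b.smp.F.prv_nxt_pow[OF tk le_refl[of j], where a = "sd z q"] t by (simp add: tr_def)
  have 2: "exec (Loop (Var 6) prvC) x ([Y, q, tm, s, of_bool d, 0, j, p] @ [u], z') = ([Y, q, tm, ktop, 0, 0, j, p] @ [u], z)" for u
    using prv_loop[OF tk' order_refl, of j "[j, p, u]"] bk sdz by (simp add: cf_def)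
  have ex1: "exec (Loop (Var 6) nxtC) x ([Y, q, tm, ktop, 0, 0, j, p], z) = ([Y, q, tm, s, of_bool d, 0, j, p], z')"
    using 1 t by (simp add: cf_def)
  have un: "undc (Loop (Var 6) nxtC) x U" "undc (Loop (Var 6) prvC) x U" for U
    by (intro undc_all tourC_und; simp)+
  show "und (tourB e) x [Y, q, tm, ktop, 0, 0, j, p] z" if ue: "\<And>s d z'. und e x [Y, q, tm, s, d, 0, j, p] z'"
    unfolding tourB_def und.simps ex1 prod.case 2 using un ue by simp
qed

lemma nS_ev [simp]:
  assumes "eval a x (vs @ [Y]) z = q" "eval b x (vs @ [Y, q]) z \<le> Suc T" "length z = Lt"
  shows "eval (nS a b c) x vs z = fst (tr (eval b x (vs @ [Y, q]) z) z (eval c x (vs @ [Y, q, eval b x (vs @ [Y, q]) z, ktop, 0, 0]) z))"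
    "und (nS a b c) x vs z \<longleftrightarrow> und a x (vs @ [Y]) z \<and> und b x (vs @ [Y, q]) z \<and> und c x (vs @ [Y, q, eval b x (vs @ [Y, q]) z, ktop, 0, 0]) z"
  using assms tourB_ev[OF assms(3,2)] by (simp_all add: nS_def case_prod_beta)

lemma nD_ev [simp]:
  assumes "eval a x (vs @ [Y]) z = q" "eval b x (vs @ [Y, q]) z \<le> Suc T" "length z = Lt"
  shows "eval (nD a b c) x vs z = of_bool (fst (snd (tr (eval b x (vs @ [Y, q]) z) z (eval c x (vs @ [Y, q, eval b x (vs @ [Y, q]) z, ktop, 0, 0]) z))))"
    "und (nD a b c) x vs z \<longleftrightarrow> und a x (vs @ [Y]) z \<and> und b x (vs @ [Y, q]) z \<and> und c x (vs @ [Y, q, eval b x (vs @ [Y, q]) z, ktop, 0, 0]) z"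
  using assms tourB_ev[OF assms(3,2)] by (simp_all add: nD_def case_prod_beta)

lemma nZ_ev [simp]:
  assumes "eval a x (vs @ [Y]) z = q" "eval b x (vs @ [Y, q]) z \<le> Suc T" "length z = Lt"
  shows "eval (nZ a b c d) x vs z = of_bool (rd (snd (snd (tr (eval b x (vs @ [Y, q]) z) z (eval c x (vs @ [Y, q, eval b x (vs @ [Y, q]) z, ktop, 0, 0]) z))))
      (eval d x (vs @ [Y, q, eval b x (vs @ [Y, q]) z, ktop, 0, 0, eval c x (vs @ [Y, q, eval b x (vs @ [Y, q]) z, ktop, 0, 0]) z]) z))"
    "und (nZ a b c d) x vs z \<longleftrightarrow> und a x (vs @ [Y]) z \<and> und b x (vs @ [Y, q]) z \<and> und c x (vs @ [Y, q, eval b x (vs @ [Y, q]) z, ktop, 0, 0]) z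
      \<and> und d x (vs @ [Y, q, eval b x (vs @ [Y, q]) z, ktop, 0, 0, eval c x (vs @ [Y, q, eval b x (vs @ [Y, q]) z, ktop, 0, 0]) z]) z"
  using assms tourB_ev[OF assms(3,2)] by (simp_all add: nZ_def case_prod_beta)

lemma backB_ev:
  assumes tk: "b.smp.F.tok tm (s, d, z)"
  shows "eval backB x [Y, q, tm, s, of_bool d, 0, j] z =
      of_bool (case (PV tm (sd z q) ^^ j) (s, d, z) of (s, d, z) \<Rightarrow> Suc T \<le> lv (s mod S0) \<and> \<not> d)"
    "und backB x [Y, q, tm, s, of_bool d, 0, j] z"
proof -
  obtain s1 d1 z1 where t: "(PV tm (sd z q) ^^ j) (s, d, z) = (s1, d1, z1)" by (cases "(PV tm (sd z q) ^^ j) (s, d, z)") auto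
  have 1: "exec (Loop (Var 6) prvC) x ([Y, q, tm, s, of_bool d, 0, j], z) = ([Y, q, tm, s1, of_bool d1, 0, j], z1)"
    using prv_loop[OF tk order_refl, of j "[j]"] t by (simp add: cf_def)
  show "eval backB x [Y, q, tm, s, of_bool d, 0, j] z =
      of_bool (case (PV tm (sd z q) ^^ j) (s, d, z) of (s, d, z) \<Rightarrow> Suc T \<le> lv (s mod S0) \<and> \<not> d)"
    unfolding backB_def eval.simps(12) 1 prod.case t by (auto simp: not_less)
  have tk': "b.smp.F.tok tm (s1, d1, z1)" using b.smp.F.tok_prv_pow[OF tk, where a = "sd z q" and n = j] t by simp
  have sdz: "sd z1 q = sd z q" using rd_same_prv(2)[OF tk, where a = "sd z q" and j = j] t by simp
  have 2: "exec (Loop (Var 6) nxtC) x ([Y, q, tm, s1, of_bool d1, 0, j] @ [u], z1) = ([Y, q, tm, s, of_bool d, 0, j] @ [u], z)" for u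
    using nxt_loop[OF tk' order_refl, of j "[j, u]"] nxt_prv_pow[OF tk, where a = "sd z q" and j = j] t sdz by (simp add: cf_def)
  have un: "undc (Loop (Var 6) nxtC) x U" "undc (Loop (Var 6) prvC) x U" for U
    by (intro undc_all tourC_und; simp)+
  show "und backB x [Y, q, tm, s, of_bool d, 0, j] z"
    unfolding backB_def und.simps 1 prod.case 2 using un by simp
qed

end

section \<open>Hits, long tours and bad seeds\<close>

lemma bits_sum: "v < 2 ^ l \<Longrightarrow> (\<Sum>p<l. of_bool (odd (v div 2 ^ p)) * 2 ^ p) = (v :: nat)"
proof (induction l arbitrary: v)
  case (Suc l)
  have "v div 2 < 2 ^ l" using Suc.prems by auto
  then have "(\<Sum>p<l. of_bool (odd (v div 2 div 2 ^ p)) * 2 ^ p) = v div 2" by (rule Suc.IH)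
  then have "of_bool (odd v) + 2 * (\<Sum>p<l. of_bool (odd (v div 2 div 2 ^ p)) * 2 ^ p) = v" by (simp add: mod_2_eq_odd[symmetric])
  then show ?case unfolding sum.lessThan_Suc_shift
    by (simp add: sum_distrib_left div_mult2_eq mult.left_commute del: sum_of_bool_mult_eq sum_mult_of_bool_eq)
qed simp

context sampler
begin

lemma pr_nonneg: "0 \<le> pr \<tau> n u"
  by (induction n arbitrary: u) auto

text \<open>The path followed by one sample is one outcome of the coins, so it alone makes the
  probability positive.\<close>

lemma isin_pr:
  assumes "k < S0" "i < m" "lvl0 k + n = T" "length z = Lt" "isin a \<tau> (i * S0 + k) z"
  shows "0 < pr \<tau> n (k, z)"
  using assms
proof (induction n arbitrary: k z)
  case 0
  then show ?case using isin_last[of k i z a \<tau>] by simp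
next
  case (Suc n)
  let ?u = "stp k z (ip l (a (lvl0 k)) i)"
  have lk: "lvl0 k < T" using Suc.prems by simp
  have "isin a \<tau> (i * S0 + fst ?u) (snd ?u)" using isin_step[of k i z a \<tau>] Suc.prems lk by simp
  then have "0 < pr \<tau> n (fst ?u, snd ?u)" using Suc.prems stp_ok[OF Suc.prems(1) lk, of z] by (intro Suc.IH) auto
  then show ?case using pr_nonneg[of \<tau> n "stp k z False"] pr_nonneg[of \<tau> n "stp k z True"]
    by (cases "ip l (a (lvl0 k)) i") auto
qed

end

context mach
begin

lemma startk_ok: "startk g b < S0" "lv (startk g b) = 0"
proof -
  have q: "4 * q0 M + 2 * of_bool g + of_bool b < R" using wf Rs(1) by (auto simp: wf_machine_def of_bool_def)
  show "startk g b < S0" unfolding startk_def S0_def using q Rs by (intro pk_less) auto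
  show "lv (startk g b) = 0" unfolding startk_def lv_def using q Rs by (intro pk_cmp) auto
qed

end

section \<open>Reading and writing fields\<close>

context alg
begin

definition setf :: "bool list \<Rightarrow> nat \<Rightarrow> nat \<Rightarrow> nat \<Rightarrow> nat \<Rightarrow> bool list" where
  "setf z q f v j = map (\<lambda>i. if fad q f 0 \<le> i \<and> i < fad q f 0 + j then odd (v div 2 ^ (i - fad q f 0)) else z ! i) [0..<length z]"

lemma setf_len [simp]: "length (setf z q f v j) = length z" by (simp add: setf_def)

lemma setf_nth: "i < length z \<Longrightarrow> setf z q f v j ! i = (if fad q f 0 \<le> i \<and> i < fad q f 0 + j then odd (v div 2 ^ (i - fad q f 0)) else z ! i)"
  by (simp add: setf_def)

lemma setf_0: "setf z q f v 0 = z"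
  by (rule nth_equalityI) (auto simp: setf_nth)

lemma fad_add: "fad q f p = fad q f 0 + p" by (simp add: fad_def)

lemma setf_Suc: "(setf z q f v j)[fad q f j := odd (v div 2 ^ j)] = setf z q f v (Suc j)"
  by (rule nth_equalityI) (auto simp: setf_nth nth_list_update fad_add[of q f j] less_Suc_eq)

lemma fad_other: "f' \<noteq> f \<Longrightarrow> p < l \<Longrightarrow> \<not> (fad q f 0 \<le> fad q f' p \<and> fad q f' p < fad q f 0 + l)"
proof -
  assume "f' \<noteq> f" "p < l"
  then consider "Suc f \<le> f'" | "Suc f' \<le> f" by linarith
  then show ?thesis
  proof cases
    case 1
    have "Suc f * l \<le> f' * l" using 1 by (rule mult_le_mono1)
    then show ?thesis by (simp add: fad_def)
  next
    case 2
    have "Suc f' * l \<le> f * l" using 2 by (rule mult_le_mono1)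
    then show ?thesis using \<open>p < l\<close> by (simp add: fad_def)
  qed
qed

lemma fv_bit: "p < l \<Longrightarrow> odd (fv z q f div 2 ^ p) = rd z (fad q f p)"
proof -
  assume p: "p < l"
  have "fv z q f = bitsval (map (\<lambda>p. rd z (fad q f p)) [0..<l])"
    unfolding fv_def bitsval_def by (intro sum.cong) auto
  then show ?thesis using bitsval_bit[of "map (\<lambda>p. rd z (fad q f p)) [0..<l]" p] p
    by (cases "rd z (fad q f p)") (simp_all add: rd_def[of "map _ _"] odd_iff_mod_2_eq_one)
qed

lemma fv_less: "fv z q f < Y"
proof -
  have "fv z q f = bitsval (map (\<lambda>p. rd z (fad q f p)) [0..<l])"
    unfolding fv_def bitsval_def by (intro sum.cong) auto
  then show ?thesis using bitsval_less[of "map (\<lambda>p. rd z (fad q f p)) [0..<l]"] by (simp add: Y_l)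
qed

lemma fv_setf: "fad q f 0 + l \<le> length z \<Longrightarrow> v < Y \<Longrightarrow> fv (setf z q f v l) q f = v"
proof -
  assume a: "fad q f 0 + l \<le> length z" "v < Y"
  have "fv (setf z q f v l) q f = (\<Sum>p<l. of_bool (odd (v div 2 ^ p)) * 2 ^ p)"
    unfolding fv_def
  proof (intro sum.cong refl arg_cong2[where f = times] arg_cong[where f = of_bool])
    fix p assume "p \<in> {..<l}"
    then show "rd (setf z q f v l) (fad q f p) = odd (v div 2 ^ p)" using a(1) by (simp add: rd_def setf_nth fad_add[of q f p])
  qed
  then show ?thesis using bits_sum a by (simp add: Y_l)
qed

lemma fv_setf_other: "f' \<noteq> f \<Longrightarrow> fv (setf z q f v l) q f' = fv z q f'"
  unfolding fv_def
proof (intro sum.cong refl arg_cong2[where f = times] arg_cong[where f = of_bool])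
  fix p assume "f' \<noteq> f" "p \<in> {..<l}"
  then show "rd (setf z q f v l) (fad q f' p) = rd z (fad q f' p)"
    using fad_other[of f' f p q] by (auto simp: rd_def setf_nth)
qed

lemma setf_back: "setf (setf z q f v l) q f (fv z q f) l = z"
proof (rule nth_equalityI)
  fix i assume "i < length (setf (setf z q f v l) q f (fv z q f) l)"
  then have i: "i < length z" by simp
  show "setf (setf z q f v l) q f (fv z q f) l ! i = z ! i"
  proof (cases "fad q f 0 \<le> i \<and> i < fad q f 0 + l")
    case True
    then have "fad q f (i - fad q f 0) = i" by (simp add: fad_add[of q f "i - fad q f 0"])
    moreover have "i - fad q f 0 < l" using True by linarith
    ultimately show ?thesis using True i fv_bit[of "i - fad q f 0" z q f] by (simp add: setf_nth rd_def)
  next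
    case False
    then have "\<not> fad q f 0 \<le> i \<or> \<not> i < fad q f 0 + l" by blast
    then show ?thesis using i by (auto simp: setf_nth)
  qed
qed simp

lemma fad_block: "f \<le> T \<Longrightarrow> p < l \<Longrightarrow> q * BL + T \<le> fad q f p \<and> fad q f p < q * BL + BL"
proof -
  assume a: "f \<le> T" "p < l"
  have "f * l + l \<le> (T + 1) * l" using mult_le_mono1[of "f + 1" "T + 1" l] a by simp
  then show ?thesis using a BL_def unfolding fad_def by linarith
qed

end

section \<open>Hits and bad seeds in terms of tour steps\<close>

context blockq
begin

lemma tr_len [simp]: "length z = Lt \<Longrightarrow> tm \<le> Suc T \<Longrightarrow> length (snd (snd (tr tm z j))) = Lt"
  using rd_same(1)[OF tok_top] by (simp add: tr_def)

lemma tr_ok: "length z = Lt \<Longrightarrow> tm \<le> Suc T \<Longrightarrow> b.smp.F.tok tm (tr tm z j)"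
  using b.smp.F.tok_nxt_pow[OF tok_top] by (simp add: tr_def)

lemma tr_off: "length z = Lt \<Longrightarrow> tm \<le> Suc T \<Longrightarrow> p < q * BL \<or> q * BL + T \<le> p \<Longrightarrow> snd (snd (tr tm z j)) ! p = z ! p"
proof -
  assume a: "length z = Lt" "tm \<le> Suc T" "p < q * BL \<or> q * BL + T \<le> p"
  have ne: "b.smp.pos s \<noteq> p" for s using a(3) ps_less[of "s mod S0"] by (auto simp: pos_q)
  show ?thesis using b.smp.F.nxt_pow_unchanged[OF tok_top[OF a(1,2)] ne, where a = "sd z q" and n = j]
    by (simp add: tr_def b.smp.F.tnode_def case_prod_beta)
qed

lemma tr_fv: "length z = Lt \<Longrightarrow> tm \<le> Suc T \<Longrightarrow> fv (snd (snd (tr tm z j))) q f = fv z q f"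
proof -
  assume a: "length z = Lt" "tm \<le> Suc T"
  have "rd (snd (snd (tr tm z j))) (fad q f p) = rd z (fad q f p)" for p
    using tr_off[OF a, of "fad q f p" j] a by (simp add: rd_def fad_def)
  then show ?thesis by (simp add: fv_def)
qed

lemma tr_sd: "length z = Lt \<Longrightarrow> tm \<le> Suc T \<Longrightarrow> sd (snd (snd (tr tm z j))) q = sd z q"
  by (simp add: sd_def tr_fv fun_eq_iff)

abbreviation "sh tm z \<equiv> b.smp.F.short tm (sd z q) Y (ktop, z)"

lemma sh_tr: "sh tm z \<longleftrightarrow> (\<exists>j<Y. Suc T \<le> lv (fst (tr tm z j) mod S0) \<and> fst (snd (tr tm z j)))"
  by (simp add: b.smp.F.short_def tr_def lvl_q case_prod_beta)

lemma tr_isin: "length z = Lt \<Longrightarrow> tm \<le> Suc T \<Longrightarrow> b.smp.isin (sd z q) z (fst (tr tm z j)) (snd (snd (tr tm z j)))"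
proof -
  assume a: "length z = Lt" "tm \<le> Suc T"
  have "b.smp.F.root (sd z q) (b.smp.F.tnode (tr tm z j)) = b.smp.F.root (sd z q) (ktop, z)"
    using b.smp.F.root_nxt_pow[OF tok_top[OF a], where a = "sd z q" and n = j] by (simp add: tr_def b.smp.F.tnode_def)
  also have "\<dots> = (ktop, z)" using tops by (intro b.smp.F.root_top) (simp add: lvl_q)
  finally show ?thesis by (simp add: b.smp.isin_def b.smp.rt_def b.smp.F.tnode_def case_prod_beta)
qed

lemma isin_tr:
  assumes z: "length z = Lt" "tm \<le> Suc T" and s: "sh tm z" and ok: "b.smp.F.nok tm (s, z')"
  shows "b.smp.isin (sd z q) z s z' \<longleftrightarrow> (\<exists>j<Y. fst (tr tm z j) = s \<and> snd (snd (tr tm z j)) = z')"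
proof
  assume "b.smp.isin (sd z q) z s z'"
  then have rt: "b.smp.F.root (sd z q) (s, z') = (ktop, z)" by (simp add: b.smp.isin_def b.smp.rt_def)
  have "b.smp.F.nok tm (ktop, z)" using tok_top[OF z] by (simp add: b.smp.F.tok_def)
  moreover have "Suc T \<le> b.smp.lvl ktop" using tops by (simp add: lvl_q)
  ultimately obtain j where "j < Y" "tr tm z j = (s, False, z')"
    using b.smp.F.short_covers[OF _ _ s ok rt] by (auto simp: tr_def)
  then show "\<exists>j<Y. fst (tr tm z j) = s \<and> snd (snd (tr tm z j)) = z'" by (intro exI[of _ j]) simp
next
  assume "\<exists>j<Y. fst (tr tm z j) = s \<and> snd (snd (tr tm z j)) = z'"
  then show "b.smp.isin (sd z q) z s z'" using tr_isin[OF z] by auto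
qed

text \<open>A tape is too long to be written down, so a node is named by a small state and a step j
  of the tour at which its tape occurs. Tapes of two steps are compared on the T cells of the block,
  outside of which they agree anyway.\<close>

definition mem :: "bool list \<Rightarrow> nat \<Rightarrow> nat \<Rightarrow> nat \<Rightarrow> bool" where
  "mem z tm j s \<longleftrightarrow> (\<exists>j'<Y. fst (tr tm z j') = s \<and>
     (\<forall>p<T. rd (snd (snd (tr tm z j'))) (q * BL + p) = rd (snd (snd (tr tm z j))) (q * BL + p)))"

lemma tr_eq:
  assumes z: "length z = Lt" "tm \<le> Suc T"
  shows "snd (snd (tr tm z j')) = snd (snd (tr tm z j)) \<longleftrightarrow>
    (\<forall>p<T. rd (snd (snd (tr tm z j'))) (q * BL + p) = rd (snd (snd (tr tm z j))) (q * BL + p))"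
proof
  assume r: "\<forall>p<T. rd (snd (snd (tr tm z j'))) (q * BL + p) = rd (snd (snd (tr tm z j))) (q * BL + p)"
  show "snd (snd (tr tm z j')) = snd (snd (tr tm z j))"
  proof (rule nth_equalityI)
    fix i assume "i < length (snd (snd (tr tm z j')))"
    then have i: "i < Lt" using z by simp
    show "snd (snd (tr tm z j')) ! i = snd (snd (tr tm z j)) ! i"
    proof (cases "i < q * BL \<or> q * BL + T \<le> i")
      case True
      then show ?thesis using tr_off[OF z True] by simp
    next
      case False
      then have "q * BL + (i - q * BL) = i" "i - q * BL < T" by auto
      then show ?thesis using r i z by (metis rd_def tr_len)
    qed
  qed (use z in simp)
qed simp

lemma mem_isin:
  assumes z: "length z = Lt" "tm \<le> Suc T" and s: "sh tm z" and ok: "b.smp.F.nok tm (s, snd (snd (tr tm z j)))"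
  shows "mem z tm j s \<longleftrightarrow> b.smp.isin (sd z q) z s (snd (snd (tr tm z j)))"
  unfolding isin_tr[OF z s ok] mem_def tr_eq[OF z] ..

definition cn :: "bool list \<Rightarrow> nat \<Rightarrow> nat \<Rightarrow> (nat \<Rightarrow> nat) \<Rightarrow> nat" where
  "cn z tm j h = card {i. i < m \<and> mem z tm j (i * S0 + h i)}"

text \<open>\<open>badat\<close> for the node whose state is y and whose successors have the tape of
  tour step j, b being the bit overwritten. The condition on \<open>wr0\<close> ensures that this
  tape can result from writing at y.\<close>

definition badC :: "bool list \<Rightarrow> nat \<Rightarrow> nat \<Rightarrow> nat \<Rightarrow> nat \<Rightarrow> bool \<Rightarrow> bool" where
  "badC z t a' j y b \<longleftrightarrow> lv y = t \<and> wr0 y b False = rd (snd (snd (tr (Suc t) z j))) (q * BL + ps y) \<and>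
    2 * E * cn z (Suc t) j (\<lambda>i. nx0 y b (ip l a' i)) + 2 * m
      < E * (cn z (Suc t) j (\<lambda>i. nx0 y b False) + cn z (Suc t) j (\<lambda>i. nx0 y b True))"

lemma badat_cn:
  assumes z: "length z = Lt" and t: "t < T" and s: "sh (Suc t) z" and y: "y < S0" "lv y = t"
    and zc: "length zc = Lt" and zj: "snd (snd (tr (Suc t) z j)) = zc[q * BL + ps y := wr0 y (zc ! (q * BL + ps y)) False]"
  shows "b.smp.badat (sd z q) z y zc a' \<longleftrightarrow> badC z t a' j y (zc ! (q * BL + ps y))"
proof -
  define b where "b = zc ! (q * BL + ps y)"
  define Z where "Z = snd (snd (tr (Suc t) z j))"
  have t1: "Suc t \<le> Suc T" using t by simp
  have ZL: "length Z = Lt" using tr_len[OF z t1] by (simp add: Z_def)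
  have stp: "b.smp.stp y zc r = (nx0 y b r, Z)" for r
    using zj wr0_any[of y b r False] by (simp add: b.smp.stp_def b_def Z_def)
  have mi: "mem z (Suc t) j (i * S0 + nx0 y b r) \<longleftrightarrow> b.smp.isin (sd z q) z (i * S0 + nx0 y b r) Z" if "i < m" for i r
  proof -
    have "b.smp.F.nok (Suc t) (i * S0 + nx0 y b r, Z)"
      using b.smp.node_ok[OF _ that, of "nx0 y b r" Z] nx0_ok[of y b r] y t ZL b.smp.snode[OF _ that, of "nx0 y b r"]
      by (simp add: b.smp.F.nok_def lvl_q)
    then show ?thesis using mem_isin[OF z t1 s, of "i * S0 + nx0 y b r" j] by (simp add: Z_def)
  qed
  have c1: "b.smp.cntin (sd z q) z (b.smp.stp y zc r) = cn z (Suc t) j (\<lambda>i. nx0 y b r)" for r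
    unfolding b.smp.cntin_def cn_def stp using mi by (intro arg_cong[where f = card] Collect_cong) auto
  have c2: "b.smp.hits (sd z q) z y zc a' = cn z (Suc t) j (\<lambda>i. nx0 y b (ip l a' i))"
    unfolding b.smp.hits_def cn_def stp using mi by (intro arg_cong[where f = card] Collect_cong) auto
  have "wr0 y b False = rd Z (q * BL + ps y)" using pos_Lt(2)[of y] zj zc by (simp add: rd_def Z_def b_def)
  then show ?thesis unfolding b.smp.badat_def badC_def c1 c2 b_def[symmetric] Z_def using y(2) by simp
qed

text \<open>A priori badness quantifies over all tapes. But where a seed is bad, some successor has
  a positive count, hence lies in the tree of the root and occurs on the short tour; so it suffices
  to search through tour steps, states and bits.\<close>

lemma bad_C:
  assumes z: "length z = Lt" and t: "t < T" and s: "sh (Suc t) z"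
  shows "b.smp.bad (sd z q) z t a' \<longleftrightarrow> (\<exists>j<Y. \<exists>y<S0. \<exists>b. badC z t a' j y b)"
proof
  assume "b.smp.bad (sd z q) z t a'"
  then obtain y zc where y: "y < S0" "lv y = t" "length zc = Lt" and ba: "b.smp.badat (sd z q) z y zc a'"
    by (auto simp: b.smp.bad_def)
  have "0 < E * (b.smp.cntin (sd z q) z (b.smp.stp y zc False) + b.smp.cntin (sd z q) z (b.smp.stp y zc True))"
    using ba unfolding b.smp.badat_def by (rule le_less_trans[OF le0])
  then obtain r where "b.smp.cntin (sd z q) z (b.smp.stp y zc r) \<noteq> 0" by (metis add_is_0 less_irrefl mult_0_right)
  then have "{i. i < m \<and> b.smp.isin (sd z q) z (i * S0 + fst (b.smp.stp y zc r)) (snd (b.smp.stp y zc r))} \<noteq> {}"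
    unfolding b.smp.cntin_def by (metis card.empty)
  then obtain i where i: "i < m" "b.smp.isin (sd z q) z (i * S0 + fst (b.smp.stp y zc r)) (snd (b.smp.stp y zc r))" by auto
  note so = b.smp.stp_ok[of y zc r]
  have "b.smp.F.nok (Suc t) (i * S0 + fst (b.smp.stp y zc r), snd (b.smp.stp y zc r))"
    using b.smp.node_ok[OF _ i(1)] so y t b.smp.snode[OF _ i(1)] by (simp add: b.smp.F.nok_def lvl_q)
  then obtain j where j: "j < Y" "snd (snd (tr (Suc t) z j)) = snd (b.smp.stp y zc r)"
    using isin_tr[OF z _ s] i(2) t by auto
  then have "snd (snd (tr (Suc t) z j)) = zc[q * BL + ps y := wr0 y (zc ! (q * BL + ps y)) False]"
    using wr0_any[of y _ r False] by (simp add: b.smp.stp_def)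
  from badat_cn[OF z t s y this] ba have "badC z t a' j y (zc ! (q * BL + ps y))" by simp
  then show "\<exists>j<Y. \<exists>y<S0. \<exists>b. badC z t a' j y b" using j y by blast
next
  assume "\<exists>j<Y. \<exists>y<S0. \<exists>b. badC z t a' j y b"
  then obtain j y b where y: "y < S0" and bc: "badC z t a' j y b" by auto
  let ?p = "q * BL + ps y"
  define Z where "Z = snd (snd (tr (Suc t) z j))"
  have ZL: "length Z = Lt" using tr_len[OF z, of "Suc t"] t by (simp add: Z_def)
  have lv: "lv y = t" and Zp: "Z ! ?p = wr0 y b False" using bc pos_Lt(2)[of y] ZL by (auto simp: badC_def Z_def rd_def)
  have n: "Z[?p := b] ! ?p = b" using pos_Lt(2)[of y] ZL by simp
  have zz: "Z = (Z[?p := b])[?p := wr0 y (Z[?p := b] ! ?p) False]" unfolding n using list_update_id[of Z ?p] Zp by simp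
  then have "b.smp.badat (sd z q) z y (Z[?p := b]) a' \<longleftrightarrow> badC z t a' j y b"
    using badat_cn[OF z t s y lv _ zz[unfolded Z_def], folded Z_def, of a'] ZL unfolding n by (simp del: nth_list_update_eq)
  then have "b.smp.badat (sd z q) z y (Z[?p := b]) a'" using bc by (rule iffD2)
  then show "b.smp.bad (sd z q) z t a'" unfolding b.smp.bad_def
    using y lv ZL by (intro exI[of _ y] exI[of _ "Z[?p := b]"]) simp
qed

text \<open>The sample index is ignored: a start state of any sample is informative. So is any first
  coin b.\<close>

definition hitQ :: "bool list \<Rightarrow> bool \<Rightarrow> bool" where
  "hitQ z g \<longleftrightarrow> (\<exists>j<Y. \<exists>b. fst (tr 0 z j) mod S0 = startk g b)"

lemma emb_tr: "length z = Lt \<Longrightarrow> b.emb z (b.blk (snd (snd (tr 0 z j)))) = snd (snd (tr 0 z j))"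
proof -
  assume z: "length z = Lt"
  define Z where "Z = snd (snd (tr 0 z j))"
  have ZL: "length Z = Lt" and off: "\<And>p. p < q * BL \<or> q * BL + T \<le> p \<Longrightarrow> Z ! p = z ! p"
    using tr_len[OF z, of 0] tr_off[OF z, of 0] by (simp_all add: Z_def)
  have "take (q * BL) z = take (q * BL) Z" "drop (q * BL + T) z = drop (q * BL + T) Z"
    using off z ZL by (auto intro!: nth_equalityI)
  then have "b.emb z (b.blk Z) = b.emb Z (b.blk Z)" by (simp add: b.emb_def)
  then show ?thesis using b.emb_blk[OF ZL] by (simp add: Z_def)
qed

text \<open>The start state lies in the tree of \<open>ktop\<close>, so some coins lead from it to
  an answer equal to the guess. As the answer is the same for all coins and all tapes, the guess is
  right.\<close>

lemma hit_sound:
  assumes z: "length z = Lt" and h: "hitQ z g" and TL: "T < L'"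
    and G: "\<And>r u. length r = L' \<Longrightarrow> length u = T \<Longrightarrow> st (run M x r w u T) = qacc M \<longleftrightarrow> G"
  shows "g = G"
proof -
  obtain j b where jb: "fst (tr 0 z j) mod S0 = startk g b" using h by (auto simp: hitQ_def)
  define Z s where "Z = snd (snd (tr 0 z j))" and "s = fst (tr 0 z j)"
  have ZL: "length Z = Lt" using tr_len[OF z, of 0] by (simp add: Z_def)
  have "s < m * S0" using tr_ok[OF z, of 0 j] by (auto simp: s_def b.smp.F.tok_def b.smp.F.nok_def split: prod.splits)
  then have i: "s div S0 < m" by (simp add: less_mult_imp_div_less)
  have s: "s div S0 * S0 + startk g b = s" using jb div_mult_mod_eq[of s S0] by (simp add: s_def)
  have "b.smp.isin (sd z q) z (s div S0 * S0 + startk g b) Z" using tr_isin[OF z, of 0 j] s by (simp add: s_def Z_def)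
  then have p: "0 < b.smp.pr z T (startk g b, Z)"
    using b.smp.isin_pr[OF startk_ok(1) i _ ZL, of g b T] startk_ok(2) by simp
  let ?i = "init M w (b.blk Z)"
  have vi: "vc ?i" using b.init_enc b.blk_len ZL by blast
  have [simp]: "rh ?i = 0" "ct ?i = b.blk Z" by (simp_all add: init_def)
  have "b.smp.pr z T (startk g b, Z) * 2 ^ (L' - 1) =
      real (card {s. length s = L' - Suc (rh ?i) \<and> (let f = (step M x ([b] @ s) ^^ T) ?i in (st f = qacc M \<longleftrightarrow> g) \<and> ct f = b.blk z)})"
    using b.pr_count[OF vi z, of T L' "[b]" b 0 g] TL b.start_enc emb_tr[OF z, of j, folded Z_def] by simp
  then have "card {s. length s = L' - Suc (rh ?i) \<and> (let f = (step M x ([b] @ s) ^^ T) ?i in (st f = qacc M \<longleftrightarrow> g) \<and> ct f = b.blk z)} \<noteq> 0"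
    using p mult_pos_pos[OF p, of "2 ^ (L' - 1)"] by auto
  then have "{s. length s = L' - Suc (rh ?i) \<and> (let f = (step M x ([b] @ s) ^^ T) ?i in (st f = qacc M \<longleftrightarrow> g) \<and> ct f = b.blk z)} \<noteq> {}"
    by (metis card.empty)
  then obtain s' where s': "length s' = L' - 1" "st ((step M x (b # s') ^^ T) ?i) = qacc M \<longleftrightarrow> g"
    by (auto simp: Let_def)
  have "length (b # s') = L'" using s'(1) TL by simp
  then show ?thesis by (rule trans[OF s'(2)[symmetric] G[OF _ b.blk_len[OF ZL], unfolded run_def]])
qed

text \<open>Were no seed bad, the sampled count at a likely start state carrying the tape
  \<open>z\<close> itself and the right guess would be at least m (1 - \<delta>) - m T/E > 0. Some
  sample would then return to \<open>z\<close>, its start would lie on the short tour, and that is a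
  hit.\<close>

lemma nohit_bad:
  assumes z: "length z = Lt" and h: "\<not> hitQ z True" "\<not> hitQ z False" and s: "sh 0 z" and TL: "T < L'"
    and G: "\<And>r u. length r = L' \<Longrightarrow> length u = T \<Longrightarrow> st (run M x r w u T) = qacc M \<longleftrightarrow> G"
    and p: "\<And>u. length u = T \<Longrightarrow> real (card {r. length r = L' \<and> ct (run M x r w u T) = u}) \<ge> (1 - \<delta>) * 2 ^ L'"
    and E: "real T < real E * (1 - \<delta>)"
  shows "\<exists>t<T. b.smp.bad (sd z q) z t (sd z q t)"
proof (rule ccontr)
  assume "\<not> ?thesis"
  then have nb: "\<And>t. t < T \<Longrightarrow> \<not> b.smp.bad (sd z q) z t (sd z q t)" by blast
  obtain b where b: "1 - \<delta> \<le> b.smp.pr z T (startk G b, z)"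
    using b.some_start_likely[OF z TL p[OF b.blk_len[OF z]] G[OF _ b.blk_len[OF z]]] by auto
  have 1: "real E * real (b.smp.cntin (sd z q) z (startk G b, z)) \<ge> real E * real m * b.smp.pr z T (startk G b, z) - real m * real T"
    using b.smp.good_seeds_count[OF nb startk_ok(1) _ z, of G b T] startk_ok(2) by simp
  have 2: "real E * real m * b.smp.pr z T (startk G b, z) \<ge> real m * (real E * (1 - \<delta>))"
    using mult_left_mono[OF b, of "real E * real m"] by (simp add: algebra_simps)
  have "real m * real T < real m * (real E * (1 - \<delta>))" using E mE_pos by (intro mult_strict_left_mono) auto
  then have "0 < real E * real (b.smp.cntin (sd z q) z (startk G b, z))" using 1 2 by linarith
  then have "b.smp.cntin (sd z q) z (startk G b, z) \<noteq> 0" by (metis less_irrefl mult_zero_right of_nat_0)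
  then have "{i. i < m \<and> b.smp.isin (sd z q) z (i * S0 + startk G b) z} \<noteq> {}"
    unfolding b.smp.cntin_def by (metis card.empty fst_conv snd_conv)
  then obtain i where i: "i < m" "b.smp.isin (sd z q) z (i * S0 + startk G b) z" by auto
  have "b.smp.F.nok 0 (i * S0 + startk G b, z)" using b.smp.node_ok[OF startk_ok(1) i(1) _ z] startk_ok(2) by simp
  then obtain j where "j < Y" "fst (tr 0 z j) = i * S0 + startk G b" using isin_tr[OF z _ s] i(2) by auto
  then have "j < Y \<and> fst (tr 0 z j) mod S0 = startk G b" using startk_ok(1)[of G b] by simp
  then have "hitQ z G" unfolding hitQ_def by blast
  then show False using h by (cases "G = True") simp_all
qed

lemma bad_few:
  assumes z: "length z = Lt" and t: "t < T" and s: "sh (Suc t) z"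
  shows "card {a'. a' < Y \<and> b.smp.bad (sd z q) z t a'} * T \<le> Y div 4"
proof -
  define c where "c = card {a'. a' < Y \<and> b.smp.bad (sd z q) z t a'}"
  define K where "K = S0 * E ^ 3 * Y"
  have K: "0 < K" using mE_pos tops(1) by (simp add: K_def)
  have 1: "c * (2 * m * m) \<le> K * Y" using b.smp.bad_card[OF t z s] by (simp add: c_def K_def Y_l)
  have "c * (2 * T * K) \<le> c * (m * m)" using m_big by (intro mult_le_mono2) (simp add: K_def mult.assoc)
  moreover have "(c * T * 4) * K = 2 * (c * (2 * T * K))" "c * (2 * m * m) = 2 * (c * (m * m))" by simp_all
  ultimately have "(c * T * 4) * K \<le> K * Y" using 1 by linarith
  then have "c * T * 4 \<le> Y" using K mult.commute[of "c * T * 4" K] nat_mult_le_cancel1[of K "c * T * 4" Y] by simp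
  then show ?thesis unfolding c_def[symmetric] by (simp add: less_eq_div_iff_mult_less_eq)
qed

end

section \<open>Programming hits, long tours and bad seeds\<close>

definition "exE n p = Ite (Sum n p) (Cn 1) (Cn 0)"

lemma exE_ev [simp]: "eval (exE n p) x vs \<tau> = of_bool (\<exists>i<eval n x vs \<tau>. eval p x (vs @ [i]) \<tau> \<noteq> 0)"
  "und (exE n p) x vs \<tau> \<longleftrightarrow> und n x vs \<tau> \<and> (\<forall>i<eval n x vs \<tau>. und p x (vs @ [i]) \<tau>)"
  "wfe (exE n p) v \<longleftrightarrow> wfe n v \<and> wfe p (Suc v)"
  by (auto simp: exE_def)

lemma ex_less_2: "(\<exists>i<2. Q i) \<longleftrightarrow> (\<exists>b. Q (of_bool b))" for Q :: "nat \<Rightarrow> bool"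
  by (auto simp: less_2_cases_iff ex_bool_eq)

context alg
begin

definition "cellE q p = Add (mul q cBL) p"

lemma cellE_ev [simp]: "eval (cellE a p) x vs z = eval a x vs z * BL + eval p x (vs @ [eval a x vs z * BL]) z"
  "und (cellE a p) x vs z \<longleftrightarrow> und a x vs z \<and> und p x (vs @ [eval a x vs z * BL]) z"
  "wfe (cellE a p) v \<longleftrightarrow> wfe a v \<and> wfe p (Suc v)"
  by (simp_all add: cellE_def)

definition "shortB = exE cY (an (nt (lt (lvlE (nS (Var 0) (Var 1) (Var 2))) (Add cT (Cn 1)))) (nD (Var 0) (Var 1) (Var 2)))"

definition "memB = exE cY (an (eq (nS (Var 0) (Var 1) (Var 4)) (Var 3))
   (nt (exE cT (nt (eq (nZ (Var 0) (Var 1) (Var 4) (cellE (Var 0) (Var 5))) (nZ (Var 0) (Var 1) (Var 2) (cellE (Var 0) (Var 5))))))))"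

definition "cntB = Sum cm' (call 4 memB [Var 0, Add (Var 1) (Cn 1), Var 2,
   Add (mul (Var 6) cS0) (call 3 nx0B [Var 3, Var 4, Var 5])])"

definition "hitsB = Sum cm' (call 4 memB [Var 0, Add (Var 1) (Cn 1), Var 3,
   Add (mul (Var 6) cS0) (call 3 nx0B [Var 4, Var 5, call 2 ipB [Var 2, Var 6]])])"

definition "badCB = an (eq (lvE (Var 4)) (Var 1)) (an
   (eq (call 2 wr0B [Var 4, Var 5]) (nZ (Var 0) (Add (Var 1) (Cn 1)) (Var 3) (cellE (Var 0) (call 1 psB [Var 4]))))
   (lt (Add (mul (mul (Cn 2) cE) (call 6 hitsB [Var 0, Var 1, Var 2, Var 3, Var 4, Var 5])) (mul (Cn 2) cm'))
     (mul cE (Add (call 6 cntB [Var 0, Var 1, Var 3, Var 4, Var 5, Cn 0]) (call 6 cntB [Var 0, Var 1, Var 3, Var 4, Var 5, Cn 1])))))"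

definition "badB = exE cY (exE cS0 (exE (Cn 2) (call 6 badCB [Var 0, Var 1, Var 2, Var 3, Var 4, Var 5])))"
definition "tB = fndE 1 cT (call 3 badB [Var 0, Var 2, call 2 fvB [Var 0, Add (Var 2) (Cn 1)]])"
definition "tmB = fndE 1 (Add cT (Cn 1)) (nt (call 2 shortB [Var 0, Var 2]))"
definition "rkB = Sum (Var 2) (call 3 badB [Var 0, Var 1, Var 3])"
definition "unrkB = fndE 3 cY (an (call 3 badB [Var 0, Var 1, Var 4]) (eq (call 3 rkB [Var 0, Var 1, Var 4]) (Var 2)))"
definition "bkB = fndE 4 cY (call 7 backB [cY, Var 0, Var 1, Var 2, Var 3, Cn 0, Var 5])"
definition "hitB g = exE cY (nt (an (nt (eq (md (nS (Var 0) (Cn 0) (Var 1)) cS0) (startE False g)))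
   (nt (eq (md (nS (Var 0) (Cn 0) (Var 1)) cS0) (startE True g)))))"

lemma F5_wf [simp]: "wfe shortB 2" "wfe memB 4" "wfe cntB 6" "wfe hitsB 6" 
  by (simp_all add: shortB_def memB_def cntB_def hitsB_def)
lemma badB_wf [simp]: "wfe badCB 6" "wfe badB 3" by (simp_all add: badCB_def badB_def)
lemma rkB_wf [simp]: "wfe rkB 3" "wfe unrkB 3" by (simp_all add: rkB_def unrkB_def)
lemma tB_wf [simp]: "wfe tB 1" "wfe tB (Suc 0)" "wfe tmB 1" "wfe tmB (Suc 0)" "wfe (hitB g) 1" "wfe (hitB g) (Suc 0)"
  "wfe bkB 4"
  using fnd_wf[of 1] by (simp_all add: tB_def tmB_def hitB_def bkB_def)

end

context blockq
begin

lemma shortB_ev [simp]: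
  assumes "length z = Lt" "tm \<le> Suc T"
  shows "eval shortB x [q, tm] z = of_bool (sh tm z)" "und shortB x [q, tm] z"
  using assms by (simp_all add: shortB_def sh_tr not_less)

lemma memB_ev [simp]:
  assumes "length z = Lt" "tm \<le> Suc T"
  shows "eval memB x [q, tm, j, s] z = of_bool (mem z tm j s)" "und memB x [q, tm, j, s] z"
  using assms by (simp_all add: memB_def mem_def of_bool_eq_iff split del: split_of_bool)

lemma cn_sum: "cn z tm j h = (\<Sum>i<m. of_bool (mem z tm j (i * S0 + h i)))"
  by (simp add: cn_def lessThan_def Collect_conj_eq)

lemma cntB_ev [simp]:
  assumes "length z = Lt" "t < T"
  shows "eval cntB x [q, t, j, y, of_bool b, of_bool r] z = cn z (Suc t) j (\<lambda>i. nx0 y b r)"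
    "eval cntB x [q, t, j, y, of_bool b, 0] z = cn z (Suc t) j (\<lambda>i. nx0 y b False)"
    "eval cntB x [q, t, j, y, of_bool b, Suc 0] z = cn z (Suc t) j (\<lambda>i. nx0 y b True)"
    "und cntB x [q, t, j, y, b', r'] z"
proof -
  show 1: "eval cntB x [q, t, j, y, of_bool b, of_bool r] z = cn z (Suc t) j (\<lambda>i. nx0 y b r)" for r
    using assms by (simp add: cntB_def cn_sum)
  show "eval cntB x [q, t, j, y, of_bool b, 0] z = cn z (Suc t) j (\<lambda>i. nx0 y b False)"
    "eval cntB x [q, t, j, y, of_bool b, Suc 0] z = cn z (Suc t) j (\<lambda>i. nx0 y b True)"
    using 1[of False] 1[of True] by simp_all
  show "und cntB x [q, t, j, y, b', r'] z" using assms by (simp add: cntB_def)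
qed

lemma hitsB_ev [simp]:
  assumes "length z = Lt" "t < T"
  shows "eval hitsB x [q, t, a', j, y, of_bool b] z = cn z (Suc t) j (\<lambda>i. nx0 y b (ip l a' i))"
    "und hitsB x [q, t, a', j, y, b'] z"
  using assms by (simp_all add: hitsB_def cn_sum)

lemma badCB_ev [simp]:
  assumes "length z = Lt" "t < T"
  shows "eval badCB x [q, t, a', j, y, of_bool b] z = of_bool (badC z t a' j y b)" "und badCB x [q, t, a', j, y, b'] z"
  using assms by (simp_all add: badCB_def badC_def wr0B_ev(1)[where r = False])

abbreviation "bd z t a' \<equiv> b.smp.bad (sd z q) z t a'"

lemma badB_ev [simp]:
  assumes "length z = Lt" "t < T"
  shows "sh (Suc t) z \<Longrightarrow> eval badB x [q, t, a'] z = of_bool (bd z t a')" "und badB x [q, t, a'] z"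
  using assms by (simp_all add: badB_def bad_C ex_less_2)

definition rk :: "bool list \<Rightarrow> nat \<Rightarrow> nat \<Rightarrow> nat" where "rk z t a' = card {a. a < a' \<and> bd z t a}"

lemma rkB_ev [simp]:
  assumes "length z = Lt" "t < T"
  shows "sh (Suc t) z \<Longrightarrow> eval rkB x [q, t, a'] z = rk z t a'" "und rkB x [q, t, a'] z"
  using assms by (simp_all add: rkB_def rk_def lessThan_def Collect_conj_eq)

lemma unrkB_ev [simp]:
  assumes "length z = Lt" "t < T"
  shows "sh (Suc t) z \<Longrightarrow> eval unrkB x [q, t, r] z = fnd Y (\<lambda>a. bd z t a \<and> rk z t a = r)" "und unrkB x [q, t, r] z"
proof -
  show "eval unrkB x [q, t, r] z = fnd Y (\<lambda>a. bd z t a \<and> rk z t a = r)" if "sh (Suc t) z"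
    unfolding unrkB_def using assms that by (subst fnd_ev[where Q = "\<lambda>a. bd z t a \<and> rk z t a = r"]) simp_all
  show "und unrkB x [q, t, r] z" unfolding unrkB_def using assms by (intro fnd_und) simp_all
qed

lemma tmB_ev [simp]:
  assumes "length z = Lt"
  shows "eval tmB x [q] z = fnd (Suc T) (\<lambda>tm. \<not> sh tm z)" "und tmB x [q] z"
proof -
  show "eval tmB x [q] z = fnd (Suc T) (\<lambda>tm. \<not> sh tm z)"
    unfolding tmB_def using assms by (subst fnd_ev[where Q = "\<lambda>tm. \<not> sh tm z"]) simp_all
  show "und tmB x [q] z" unfolding tmB_def using assms by (intro fnd_und) simp_all
qed

lemma tB_ev [simp]:
  assumes "length z = Lt"
  shows "(\<And>t. t < T \<Longrightarrow> sh (Suc t) z) \<Longrightarrow> eval tB x [q] z = fnd T (\<lambda>t. bd z t (sd z q t))" "und tB x [q] z"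
proof -
  show "eval tB x [q] z = fnd T (\<lambda>t. bd z t (sd z q t))" if "\<And>t. t < T \<Longrightarrow> sh (Suc t) z"
    unfolding tB_def using assms that by (subst fnd_ev[where Q = "\<lambda>t. bd z t (sd z q t)"]) (simp_all add: sd_def)
  show "und tB x [q] z" unfolding tB_def using assms by (intro fnd_und) simp_all
qed

lemma bkB_ev:
  assumes "b.smp.F.tok tm (s, d, z)"
  shows "eval bkB x [q, tm, s, of_bool d] z = fnd Y (\<lambda>j. case (PV tm (sd z q) ^^ j) (s, d, z) of (s, d, z) \<Rightarrow> Suc T \<le> lv (s mod S0) \<and> \<not> d)"
    "und bkB x [q, tm, s, of_bool d] z"
proof -
  show "eval bkB x [q, tm, s, of_bool d] z = fnd Y (\<lambda>j. case (PV tm (sd z q) ^^ j) (s, d, z) of (s, d, z) \<Rightarrow> Suc T \<le> lv (s mod S0) \<and> \<not> d)"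
    unfolding bkB_def by (subst fnd_ev[where Q = "\<lambda>j. case (PV tm (sd z q) ^^ j) (s, d, z) of (s, d, z) \<Rightarrow> Suc T \<le> lv (s mod S0) \<and> \<not> d"])
      (simp_all add: backB_ev[OF assms])
  show "und bkB x [q, tm, s, of_bool d] z" unfolding bkB_def by (intro fnd_und) (simp_all add: backB_ev[OF assms])
qed

lemma hitB_ev [simp]:
  assumes "length z = Lt"
  shows "eval (hitB g) x [q] z = of_bool (hitQ z g)" "und (hitB g) x [q] z"
  using assms by (simp_all add: hitB_def hitQ_def ex_bool_eq disj_commute of_bool_eq_iff split del: split_of_bool)

end

section \<open>Freeing one cell of a block\<close>

context forest
begin

text \<open>The tour consults only cells under heads, so overwriting another cell commutes with each
  of its steps.\<close>

lemma nxt_upd: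
  assumes s: "s < S" and off: "\<And>s. s < S \<Longrightarrow> pos s \<noteq> p"
  shows "nxt (s, d, z[p := v]) = (case nxt (s, d, z) of (s', d', z') \<Rightarrow> (s', d', z'[p := v]))"
proof -
  have off2: "pos (e div 2) \<noteq> p" if "e < 2 * S" for e using off[of "e div 2"] that by auto
  have V: "valid s' (u[p := v]) e = valid s' u e" if "e < 2 * S" for s' u e
    using off2[OF that] by (simp add: valid_def)
  have C: "child (u[p := v]) e = (fst (child u e), (snd (child u e))[p := v])" if "e < 2 * S" for u e
    using off2[OF that] by (simp add: child_def list_update_swap)
  have Pa: "par (s, u[p := v]) = (fst (par (s, u)), (snd (par (s, u)))[p := v])" for u
    using off[OF s] by (auto simp: par_def list_update_swap)
  have L: "lab s (u[p := v]) = lab s u" for u using off[OF s] by (simp add: lab_def)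
  have F1: "fnd (2 * S) (valid s' (u[p := v])) = fnd (2 * S) (valid s' u)" for s' u
    by (rule fnd_cong) (simp_all add: V)
  have F2: "fnd (2 * S) (\<lambda>e. a < e \<and> valid s' (u[p := v]) e) = fnd (2 * S) (\<lambda>e. a < e \<and> valid s' u e)" for s' u a
    by (rule fnd_cong) (simp_all add: V)
  show ?thesis by (auto simp: nxt_def Let_def F1 F2 Pa L C)
qed

end

context sampler
begin

text \<open>Nodes below level \<open>tm\<close> are never entered, so the seeds of earlier times are
  never consulted.\<close>

lemma nxt_cong:
  assumes "F.tok tm (s, d, z)" and ab: "\<And>t. tm \<le> t \<Longrightarrow> a t = b t"
  shows "F.nxt tm a (s, d, z) = F.nxt tm b (s, d, z)"
proof -
  have s: "tm \<le> lvl s" using assms(1) by (simp add: F.tok_def F.nok_def)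
  have n: "nxs a u c = nxs b u c" "wrs a u c = wrs b u c" if "tm \<le> lvl u" for u c using ab[OF that] by (simp_all add: nxs_def wrs_def)
  have V: "F.valid tm a = F.valid tm b" using n by (fastforce simp: F.valid_def fun_eq_iff)
  have Pa: "F.par a (s, z) = F.par b (s, z)" using n[OF s] by (simp add: F.par_def)
  show ?thesis by (simp add: F.nxt_def V Pa)
qed

end

section \<open>The encoder and the decoder of a block\<close>

context alg
begin

lemma T1_Y: "Suc T \<le> Y" "ktop \<le> Y" "l < Y" "2 * S * (T + 1) \<le> Y div 4"
proof -
  have "(T + 1) * 1 \<le> (T + 1) * S" using mE_pos(4) by (intro mult_le_mono2) simp
  then have "8 * (T + 1) \<le> 8 * ((T + 1) * S)" by (intro mult_le_mono2) simp
  then show "Suc T \<le> Y" using le_trans[OF _ TS_Y, of "8 * (T + 1)"] by simp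
  have "S0 \<le> S" using mE_pos by (simp add: S_def)
  then show "ktop \<le> Y" using S_Y tops(1) by linarith
  show "l < Y" by (simp add: Y_l)
  show "2 * S * (T + 1) \<le> Y div 4" using TS_Y by (simp add: less_eq_div_iff_mult_less_eq algebra_simps)
qed

text \<open>Frame: bound, block, least level, small state, direction, label, saved field 0, index of the field
to write, value to write, bit position, code.\<close>

definition fr :: "nat \<Rightarrow> nat \<Rightarrow> nat \<Rightarrow> nat \<Rightarrow> nat \<Rightarrow> nat \<Rightarrow> nat \<Rightarrow> nat \<Rightarrow> nat list \<Rightarrow> nat list" where
  "fr q tm s d y f v c ext = Y # q # tm # s # d # 0 # y # f # v # 0 # c # ext"

definition "wlC = CSeq (Write (call 3 fadB [Var 1, Var 7, Var 9]) (bt2 (dv (Var 8) (p2E (Var 9))))) (Assign 9 (Add (Var 9) (Cn 1)))"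
definition "wfC = CSeq (Loop cl wlC) (Assign 9 (Cn 0))"

lemma wl_loop: "j \<le> l \<Longrightarrow> (loop1 (exec wlC x) ^^ j) (fr q tm s d y f v c ext, z) =
    (Y # q # tm # s # d # 0 # y # f # v # j # c # ext, setf z q f v j)"
proof (induction j)
  case (Suc j)
  have "min (Suc j) Y = Suc j" using Suc.prems T1_Y(3) by simp
  then show ?case using Suc p2_small[of j] setf_Suc[of z q f v j] by (simp add: loop1_def wlC_def)
qed (simp add: setf_0 fr_def)

lemma wfC_ex [simp]: "exec wfC x (fr q tm s d y f v c ext, z) = (fr q tm s d y f v c ext, setf z q f v l)"
  using wl_loop[of l q tm s d y f v c ext z] by (simp add: wfC_def) (simp add: fr_def)

lemma wfC_und [simp]: "undc wfC x U"
  unfolding wfC_def wlC_def by (intro undc_all; simp)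

lemma wfC_wf [simp]: "11 \<le> v \<Longrightarrow> wfc wfC v" by (simp add: wfC_def wlC_def)

lemma loop_und [simp]: "undc (Loop (Var j) nxtC) x U" "undc (Loop (Var j) prvC) x U"
  by (intro undc_all tourC_und; simp)+

lemma loop_wf [simp]: "6 \<le> v \<Longrightarrow> j < v \<Longrightarrow> wfc (Loop (Var j) nxtC) v" "6 \<le> v \<Longrightarrow> j < v \<Longrightarrow> wfc (Loop (Var j) prvC) v"
  by (simp_all add: tourC_wf)

lemma fr_assign [simp]: 
  "exec (Assign 1 e) x (fr q tm s d y f v c ext, z) = (fr (min (eval e x (fr q tm s d y f v c ext) z) Y) tm s d y f v c ext, z)"
  "exec (Assign 2 e) x (fr q tm s d y f v c ext, z) = (fr q (min (eval e x (fr q tm s d y f v c ext) z) Y) s d y f v c ext, z)"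
  "exec (Assign 3 e) x (fr q tm s d y f v c ext, z) = (fr q tm (min (eval e x (fr q tm s d y f v c ext) z) Y) d y f v c ext, z)"
  "exec (Assign 4 e) x (fr q tm s d y f v c ext, z) = (fr q tm s (min (eval e x (fr q tm s d y f v c ext) z) Y) y f v c ext, z)"
  "exec (Assign 6 e) x (fr q tm s d y f v c ext, z) = (fr q tm s d (min (eval e x (fr q tm s d y f v c ext) z) Y) f v c ext, z)"
  "exec (Assign 7 e) x (fr q tm s d y f v c ext, z) = (fr q tm s d y (min (eval e x (fr q tm s d y f v c ext) z) Y) v c ext, z)"
  "exec (Assign 8 e) x (fr q tm s d y f v c ext, z) = (fr q tm s d y f (min (eval e x (fr q tm s d y f v c ext) z) Y) c ext, z)"
  "exec (Assign 10 e) x (fr q tm s d y f v c ext, z) = (fr q tm s d y f v (min (eval e x (fr q tm s d y f v c ext) z) Y) ext, z)"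
  by (simp_all add: fr_def)

declare exec.simps(1) [simp del]

lemma fr_nth [simp]: "fr q tm s d y f v c ext ! 1 = q" "fr q tm s d y f v c ext ! Suc 0 = q" "fr q tm s d y f v c ext ! 2 = tm"
  "fr q tm s d y f v c ext ! 3 = s" "fr q tm s d y f v c ext ! 4 = d" "fr q tm s d y f v c ext ! 6 = y"
  "fr q tm s d y f v c ext ! 7 = f" "fr q tm s d y f v c ext ! 8 = v" "fr q tm s d y f v c ext ! 10 = c"
  by (simp_all add: fr_def)

lemma fr_app [simp]: "fr q tm s d y f v c ext @ ws = fr q tm s d y f v c (ext @ ws)"
  "length (fr q tm s d y f v c ext) = 11 + length ext"
  by (simp_all add: fr_def)

lemma fr_drop [simp]: "drop (11 + j) (fr q tm s d y f v c ext) = drop j ext"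
  "drop 11 (fr q tm s d y f v c ext) = ext"
proof -
  show 1: "drop 11 (fr q tm s d y f v c ext) = ext" by (simp add: fr_def)
  show "drop (11 + j) (fr q tm s d y f v c ext) = drop j ext" unfolding add.commute[of 11 j] drop_drop[symmetric] 1 ..
qed

text \<open>Rank and time are packed in base T; the offset Y div 4 separates these codes from those
  of long tours.\<close>

definition "cdB = Add (dv cY (Cn 4)) (Add (mul (call 3 rkB [Var 0, Sub (Var 1) (Cn 1), call 2 fvB [Var 0, Var 1]]) cT) (Sub (Var 1) (Cn 1)))"

text \<open>Field 0 is zeroed before anything else, so that the tours, whose states contain the whole tape, are
the same when encoding and when decoding. A long tour moves to its y-th state and leaves a code
below Y div 4; a bad seed is replaced by y and leaves a code in between Y div 4 and 2 (Y div 4). In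
either case the top bit of field 0 becomes free.\<close>

definition "zeroC = CSeq (Assign 6 (call 2 fvB [Var 1, Cn 0])) wfC"
definition "encA = CSeq (Loop (Var 6) nxtC) (CSeq (Assign 10 (Add (mul (Var 2) (mul (Cn 2) cS)) (Add (mul (Cn 2) (Var 3)) (Var 4))))
   (CSeq (Assign 3 ktopE) (Assign 4 (Cn 0))))"
definition "encB = CSeq (Assign 2 (Cn 0)) (CSeq (Assign 7 (Add (call 1 tB [Var 1]) (Cn 1))) (CSeq (Assign 10 (call 2 cdB [Var 1, Var 7]))
   (CSeq (Assign 8 (Var 6)) (CSeq wfC (Assign 7 (Cn 0))))))"
definition "clC = CSeq (Assign 8 (Cn 0)) (CSeq (Assign 10 (Cn 0)) (CSeq (Assign 6 (Cn 0)) (Assign 2 (Cn 0))))"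
definition "finC j = CSeq (Assign 8 (Var j)) (CSeq wfC clC)"
definition "encC = CSeq zeroC (CSeq (Assign 2 (call 1 tmB [Var 1])) (CSeq (CIf (lt (Var 2) (Add cT (Cn 1))) encA encB)
   (CSeq (finC 10) (Assign 1 (Add (Var 1) (Cn 1))))))"
definition "decA = CSeq (Assign 2 (dv (Var 10) (mul (Cn 2) cS))) (CSeq (Assign 3 (dv (md (Var 10) (mul (Cn 2) cS)) (Cn 2)))
   (CSeq (Assign 4 (bt2 (md (Var 10) (mul (Cn 2) cS)))) (CSeq (Assign 6 (call 4 bkB [Var 1, Var 2, Var 3, Var 4])) (Loop (Var 6) prvC))))"
definition "decB = CSeq (Assign 7 (Add (md (Sub (Var 10) (dv cY (Cn 4))) cT) (Cn 1))) (CSeq (Assign 6 (call 2 fvB [Var 1, Var 7]))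
   (CSeq (Assign 8 (call 3 unrkB [Var 1, Sub (Var 7) (Cn 1), dv (Sub (Var 10) (dv cY (Cn 4))) cT])) (CSeq wfC (Assign 7 (Cn 0)))))"
text \<open>At its first use \<open>wfC\<close> runs with variables 7 and 8 equal to 0, so it zeroes
  field 0 and recreates the tape on which the encoder has worked.\<close>

definition "decC = CSeq (Assign 1 (Sub (Var 1) (Cn 1))) (CSeq (Assign 10 (call 2 fvB [Var 1, Cn 0])) (CSeq wfC
   (CSeq (CIf (lt (Var 10) (dv cY (Cn 4))) decA decB) (finC 6))))"
text \<open>Hits are sought with field 0 zeroed, since this is the tape for which
  \<open>encC\<close> needs the absence of hits.\<close>

definition "hzB g = call 11 (After zeroC (call 1 (hitB g) [Var 1]) (finC 6)) [cY, Var 0, Cn 0, ktopE, Cn 0, Cn 0, Cn 0, Cn 0, Cn 0, Cn 0, Cn 0]"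

lemma encdec_wf [simp]: "11 \<le> v \<Longrightarrow> wfc encC v" "11 \<le> v \<Longrightarrow> wfc decC v" "wfe (hzB g) 1" "wfe (hzB g) (Suc 0)"
  by (simp_all add: encC_def decC_def zeroC_def encA_def encB_def decA_def decB_def finC_def clC_def hzB_def cdB_def tourC_wf)

lemma zeroC_ex: "exec zeroC x (fr q tm s d y 0 0 c ext, z) = (fr q tm s d (fv z q 0) 0 0 c ext, setf z q 0 0 l)"
  "undc zeroC x (fr q tm s d y 0 0 c ext, z)"
  using fv_less[of z q 0] by (simp_all add: zeroC_def)

lemma finC_ex:
  "c \<le> Y \<Longrightarrow> exec (finC 10) x (fr q tm s d y 0 v c ext, z) = (fr q 0 s d 0 0 0 0 ext, setf z q 0 c l)"
  "y \<le> Y \<Longrightarrow> exec (finC 6) x (fr q tm s d y 0 v c ext, z) = (fr q 0 s d 0 0 0 0 ext, setf z q 0 y l)"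
  "undc (finC j) x U"
proof -
  show "undc (finC j) x U" unfolding finC_def clC_def by (intro undc_all wfC_und; simp)
qed (simp_all add: finC_def clC_def)

end

section \<open>The decoder inverts the encoder\<close>

context blockq
begin

lemma cf_fr: "cf Y tm (y # f # v # 0 # c # ext) (s, d, z) = (fr q tm s (of_bool d) y f v c ext, z)"
  by (simp add: cf_def fr_def)

lemma len_ok: "f \<le> T \<Longrightarrow> fad q f 0 + l \<le> Lt"
  using fad_block[of f "l - 1" q] l_pos qLt fad_add[of q f "l - 1"] by linarith

text \<open>The field of the seed of time t lies off all head positions, and the tour from level t +
  1 on does not consult that seed. So overwriting the field neither steers the tour differently nor
  is disturbed by it.\<close>

lemma tr_upd:
  assumes z: "length z = Lt" and t: "t < T"
  shows "tr (Suc t) (setf z q (Suc t) v l) j = (case tr (Suc t) z j of (s, d, z') \<Rightarrow> (s, d, setf z' q (Suc t) v l))"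
proof (induction j)
  case 0
  show ?case by (simp add: tr_def)
next
  case (Suc j)
  define z2 where "z2 = setf z q (Suc t) v l"
  obtain s d z' where e: "tr (Suc t) z j = (s, d, z')" by (cases "tr (Suc t) z j") auto
  have t1: "Suc t \<le> Suc T" using t by simp
  have ok: "b.smp.F.tok (Suc t) (s, d, z')" using tr_ok[OF z t1, of j] e by simp
  have e2: "tr (Suc t) z2 j = (s, d, setf z' q (Suc t) v l)" using Suc e by (simp add: z2_def)
  have ok2: "b.smp.F.tok (Suc t) (s, d, setf z' q (Suc t) v l)" using tr_ok[of z2 "Suc t" j] z t1 e2 by (simp add: z2_def)
  have s: "s < m * S0" using ok by (simp add: b.smp.F.tok_def b.smp.F.nok_def)
  have off: "b.smp.pos u \<noteq> fad q (Suc t) i" for u i using ps_less[of "u mod S0"] by (simp add: pos_q fad_def)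
  have U: "NX (Suc t) (sd z q) (s, d, setf z' q (Suc t) v i) =
      (case NX (Suc t) (sd z q) (s, d, z') of (s1, d1, z1) \<Rightarrow> (s1, d1, setf z1 q (Suc t) v i))" for i
  proof (induction i)
    case 0
    show ?case by (simp add: setf_0 split: prod.splits)
  next
    case (Suc i)
    then show ?case unfolding setf_Suc[symmetric] 
      by (simp add: b.smp.F.nxt_upd[OF s off] case_prod_beta)
  qed
  have "NX (Suc t) (sd z2 q) (s, d, setf z' q (Suc t) v l) = NX (Suc t) (sd z q) (s, d, setf z' q (Suc t) v l)"
    using ok2 by (rule b.smp.nxt_cong) (simp add: sd_def z2_def fv_setf_other)
  then show ?case using U[of l] e e2 by (simp add: tr_def z2_def)
qed

text \<open>The decoder sees the tape with the seed of time t already replaced. It can still list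
  the bad seeds of time t, because shortness and badness are read off the tour from level t + 1
  on.\<close>

lemma bd_upd:
  assumes z: "length z = Lt" and t: "t < T" and s: "sh (Suc t) z"
  shows "sh (Suc t) (setf z q (Suc t) v l)" "bd (setf z q (Suc t) v l) t a' = bd z t a'" "rk (setf z q (Suc t) v l) t a' = rk z t a'"
proof -
  define z2 where "z2 = setf z q (Suc t) v l"
  have f: "fst (tr (Suc t) z2 j) = fst (tr (Suc t) z j)" "fst (snd (tr (Suc t) z2 j)) = fst (snd (tr (Suc t) z j))" for j
    using tr_upd[OF z t] by (simp_all add: z2_def case_prod_beta)
  have r: "rd (snd (snd (tr (Suc t) z2 j))) (q * BL + p) = rd (snd (snd (tr (Suc t) z j))) (q * BL + p)" if "p < T" for j p
    using tr_upd[OF z t] that by (simp add: z2_def case_prod_beta rd_def setf_nth fad_def)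
  show s2: "sh (Suc t) (setf z q (Suc t) v l)" using s unfolding sh_tr z2_def[symmetric] f .
  have mm: "mem z2 (Suc t) j s = mem z (Suc t) j s" for j s unfolding mem_def f using r by auto
  have "badC z2 t a' j y b = badC z t a' j y b" for a' j y b
    unfolding badC_def cn_def mm using r[OF ps_less] by simp
  then show bb: "bd (setf z q (Suc t) v l) t a' = bd z t a'" for a'
    using bad_C[OF z t s] bad_C[OF _ t s2] z by (simp add: z2_def)
  then show "rk (setf z q (Suc t) v l) t a' = rk z t a'" by (simp add: rk_def)
qed

lemma rk_less: "bd z t a \<Longrightarrow> a < a' \<Longrightarrow> rk z t a < rk z t a'"
  unfolding rk_def by (rule psubset_card_mono) auto

text \<open>The rank of a seed below Y is less than the number of bad seeds, and T times that number
  is at most Y div 4; t fits into the gap left by the strict inequality.\<close>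

lemma rk_bound:
  assumes "length z = Lt" "t < T" "sh (Suc t) z" "bd z t a" "a < Y"
  shows "rk z t a * T + t < Y div 4"
proof -
  have "rk z t a < card {a'. a' < Y \<and> bd z t a'}"
    unfolding rk_def using assms by (intro psubset_card_mono) auto
  then have "Suc (rk z t a) * T \<le> card {a'. a' < Y \<and> bd z t a'} * T" by (intro mult_le_mono1) simp
  then show ?thesis using bad_few[OF assms(1-3)] assms(2) by simp
qed

lemma unrank: "bd z t a \<Longrightarrow> a < Y \<Longrightarrow> fnd Y (\<lambda>a'. bd z t a' \<and> rk z t a' = rk z t a) = a"
  by (rule fnd_eq) (auto dest: rk_less)

lemma encA_ex:
  assumes z: "length z = Lt" and tm: "tm \<le> T" and y: "y < Y" and e: "tr tm z y = (s, d, z2)"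
  shows "exec encA x (fr q tm ktop 0 y 0 0 0 ext, z) = (fr q tm ktop 0 y 0 0 (tm * (2 * S) + (2 * s + of_bool d)) ext, z2)"
    "undc encA x (fr q tm ktop 0 y 0 0 0 ext, z)" "tm * (2 * S) + (2 * s + of_bool d) < Y div 4" "s < S"
proof -
  have tm1: "tm \<le> Suc T" using tm by simp
  have ok: "b.smp.F.tok tm (s, d, z2)" using tr_ok[OF z tm1, of y] e by simp
  show s: "s < S" using ok by (simp add: b.smp.F.tok_def b.smp.F.nok_def S_def)
  have c: "2 * s + of_bool d < 2 * S" using s by (simp add: of_bool_def)
  have "Suc tm * (2 * S) \<le> (T + 1) * (2 * S)" using tm by (intro mult_le_mono1) simp
  then show code: "tm * (2 * S) + (2 * s + of_bool d) < Y div 4" using c T1_Y(4) mult.commute[of "2 * S" "T + 1"] unfolding mult_Suc by linarith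
  have L: "exec (Loop (Var 6) nxtC) x (fr q tm ktop 0 y 0 0 0 ext, z) = (fr q tm s (of_bool d) y 0 0 0 ext, z2)"
    using nxt_loop[OF tok_top[OF z tm1] order_refl, of y "y # 0 # 0 # 0 # 0 # ext"] e
    by (simp add: cf_fr tr_def[symmetric])
  have mn: "min (tm * (2 * S) + (2 * s + of_bool d)) Y = tm * (2 * S) + (2 * s + of_bool d)"
    using code by simp
  show "exec encA x (fr q tm ktop 0 y 0 0 0 ext, z) = (fr q tm ktop 0 y 0 0 (tm * (2 * S) + (2 * s + of_bool d)) ext, z2)"
    unfolding encA_def exec.simps(3) L using mn T1_Y(2) by (simp split del: split_of_bool)
  show "undc encA x (fr q tm ktop 0 y 0 0 0 ext, z)"
    unfolding encA_def undc.simps(3) L by (simp add: tourC_und case_prod_beta)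
qed

lemma decA_ex:
  assumes z: "length z = Lt" and tm: "tm \<le> T" and y: "y < Y" and e: "tr tm z y = (s, d, z2)" and ns: "\<not> sh tm z"
  shows "exec decA x (fr q 0 ktop 0 0 0 0 (tm * (2 * S) + (2 * s + of_bool d)) ext, z2) =
      (fr q tm ktop 0 y 0 0 (tm * (2 * S) + (2 * s + of_bool d)) ext, z)"
    "undc decA x (fr q 0 ktop 0 0 0 0 (tm * (2 * S) + (2 * s + of_bool d)) ext, z2)"
proof -
  have tm1: "tm \<le> Suc T" using tm by simp
  have ok: "b.smp.F.tok tm (s, d, z2)" using tr_ok[OF z tm1, of y] e by simp
  have tk: "b.smp.F.tok tm (ktop, False, z)" by (rule tok_top[OF z tm1])
  have s: "s < S" using ok by (simp add: b.smp.F.tok_def b.smp.F.nok_def S_def)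
  define c where "c = tm * (2 * S) + (2 * s + of_bool d)"
  have c1: "2 * s + of_bool d < 2 * S" using s by (simp add: of_bool_def)
  have cd: "c div (2 * S) = tm" "c mod (2 * S) = 2 * s + of_bool d" using c1 by (simp_all add: c_def)
  have s2: "(2 * s + of_bool d) div 2 = s" "odd (2 * s + of_bool d) = d" by auto
  have mn: "min tm Y = tm" "min s Y = s" "min y Y = y" "min (of_bool d) Y = of_bool d" using tm s S_Y T1_Y y by auto
  have sz: "sd z2 q = sd z q" using tr_sd[OF z tm1, of y] e by simp
  have nt: "(NX tm (sd z q) ^^ y) (ktop, False, z) = (s, d, z2)" using e by (simp add: tr_def)
  \<comment> \<open>The search for the starting root succeeds only because the tour is long: on a
    closed tour the count would be known modulo the period only.\<close>
  have "fnd Y (\<lambda>j. case (PV tm (sd z q) ^^ j) (s, d, z2) of (s, d, z) \<Rightarrow> Suc T \<le> lv (s mod S0) \<and> \<not> d) = y"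
    using b.smp.F.long_decode[OF _ _ ns y] tk tops unfolding nt by (simp add: b.smp.F.tok_def lvl_q)
  then have bk: "eval bkB x [q, tm, s, of_bool d] z2 = y" using bkB_ev(1)[OF ok] sz by simp
  have L: "exec (Loop (Var 6) prvC) x (fr q tm s (of_bool d) y 0 0 c ext, z2) = (fr q tm ktop 0 y 0 0 c ext, z)"
    using prv_loop[OF ok order_refl, of y "y # 0 # 0 # 0 # c # ext"] b.smp.F.prv_nxt_pow[OF tk le_refl[of y], where a = "sd z q"] sz nt
    by (simp add: cf_fr)
  have a: "exec (Assign 2 (dv (Var 10) (mul (Cn 2) cS))) x (fr q 0 ktop 0 0 0 0 c ext, z2) = (fr q tm ktop 0 0 0 0 c ext, z2)"
    "exec (Assign 3 (dv (md (Var 10) (mul (Cn 2) cS)) (Cn 2))) x (fr q tm ktop 0 0 0 0 c ext, z2) = (fr q tm s 0 0 0 0 c ext, z2)"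
    "exec (Assign 4 (bt2 (md (Var 10) (mul (Cn 2) cS)))) x (fr q tm s 0 0 0 0 c ext, z2) = (fr q tm s (of_bool d) 0 0 0 c ext, z2)"
    "exec (Assign 6 (call 4 bkB [Var 1, Var 2, Var 3, Var 4])) x (fr q tm s (of_bool d) 0 0 0 c ext, z2) = (fr q tm s (of_bool d) y 0 0 c ext, z2)"
    using cd s2 mn bk by (simp_all split del: split_of_bool)
  show "exec decA x (fr q 0 ktop 0 0 0 0 (tm * (2 * S) + (2 * s + of_bool d)) ext, z2) =
      (fr q tm ktop 0 y 0 0 (tm * (2 * S) + (2 * s + of_bool d)) ext, z)"
    by (simp only: decA_def exec.simps(3) c_def[symmetric] a L)
  show "undc decA x (fr q 0 ktop 0 0 0 0 (tm * (2 * S) + (2 * s + of_bool d)) ext, z2)"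
    unfolding decA_def undc.simps(3) c_def[symmetric] a using bkB_ev(2)[OF ok] by (simp add: tourC_und case_prod_beta split del: split_of_bool)
qed

lemma cdB_ev:
  assumes "length z = Lt" "t < T"
  shows "sh (Suc t) z \<Longrightarrow> eval cdB x [q, Suc t] z = Y div 4 + (rk z t (sd z q t) * T + t)" "und cdB x [q, Suc t] z"
  using assms by (simp_all add: cdB_def sd_def)

lemma encB_ex:
  assumes z: "length z = Lt" and sha: "\<forall>t<T. sh (Suc t) z" and y: "y < Y"
    and t: "fnd T (\<lambda>t. bd z t (sd z q t)) = t" "t < T" and b: "bd z t (sd z q t)"
  defines "c \<equiv> Y div 4 + (rk z t (sd z q t) * T + t)"
  shows "exec encB x (fr q tm ktop 0 y 0 0 0 ext, z) = (fr q 0 ktop 0 y 0 y c ext, setf z q (Suc t) y l)"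
    "undc encB x (fr q tm ktop 0 y 0 0 0 ext, z)" "c < 2 * (Y div 4)"
proof -
  have sh: "\<And>t. t < T \<Longrightarrow> sh (Suc t) z" using sha by blast
  have sdY: "sd z q t < Y" using fv_less by (simp add: sd_def)
  show cb: "c < 2 * (Y div 4)" using rk_bound[OF z t(2) sh[OF t(2)] b sdY] by (simp add: c_def)
  then have mn: "min c Y = c" "min y Y = y" "min (Suc t) Y = Suc t" using y t T1_Y by auto
  have tBv: "eval tB x [q] z = t" using tB_ev(1)[OF z sh] t by simp
  have cdv: "eval cdB x [q, Suc t] z = c" using cdB_ev(1)[OF z t(2) sh[OF t(2)]] by (simp add: c_def)
  have a: "exec (Assign 2 (Cn 0)) x (fr q tm ktop 0 y 0 0 0 ext, z) = (fr q 0 ktop 0 y 0 0 0 ext, z)"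
    "exec (Assign 7 (Add (call 1 tB [Var 1]) (Cn 1))) x (fr q 0 ktop 0 y 0 0 0 ext, z) = (fr q 0 ktop 0 y (Suc t) 0 0 ext, z)"
    "exec (Assign 10 (call 2 cdB [Var 1, Var 7])) x (fr q 0 ktop 0 y (Suc t) 0 0 ext, z) = (fr q 0 ktop 0 y (Suc t) 0 c ext, z)"
    "exec (Assign 8 (Var 6)) x (fr q 0 ktop 0 y (Suc t) 0 c ext, z) = (fr q 0 ktop 0 y (Suc t) y c ext, z)"
    "exec (Assign 7 (Cn 0)) x (fr q 0 ktop 0 y (Suc t) y c ext, u) = (fr q 0 ktop 0 y 0 y c ext, u)" for u
    using mn tBv cdv by simp_all
  show "exec encB x (fr q tm ktop 0 y 0 0 0 ext, z) = (fr q 0 ktop 0 y 0 y c ext, setf z q (Suc t) y l)"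
    by (simp only: encB_def exec.simps(3) a wfC_ex)
  show "undc encB x (fr q tm ktop 0 y 0 0 0 ext, z)"
    unfolding encB_def undc.simps(3) a wfC_ex using tB_ev(2)[OF z] cdB_ev(2)[OF z t(2)] by simp
qed

lemma decB_ex:
  assumes z: "length z = Lt" and sh: "sh (Suc t) z" and y: "y < Y" and t: "t < T" and b: "bd z t (sd z q t)"
  defines "c \<equiv> Y div 4 + (rk z t (sd z q t) * T + t)"
  shows "exec decB x (fr q 0 ktop 0 0 0 0 c ext, setf z q (Suc t) y l) = (fr q 0 ktop 0 y 0 (sd z q t) c ext, z)"
    "undc decB x (fr q 0 ktop 0 0 0 0 c ext, setf z q (Suc t) y l)"
proof -
  define z2 where "z2 = setf z q (Suc t) y l"
  have z2: "length z2 = Lt" using z by (simp add: z2_def)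
  note u = bd_upd[OF z t sh, of y, folded z2_def]
  have sdY: "sd z q t < Y" using fv_less by (simp add: sd_def)
  have T1: "Suc t \<le> T" using t by simp
  have fy: "fv z2 q (Suc t) = y" unfolding z2_def using len_ok[OF T1] z y by (intro fv_setf) auto
  have cd: "(c - Y div 4) mod T = t" "(c - Y div 4) div T = rk z t (sd z q t)" using t by (simp_all add: c_def)
  have ur: "eval unrkB x [q, t, rk z t (sd z q t)] z2 = sd z q t"
    using unrkB_ev(1)[OF z2 t u(1)] unrank[OF b sdY] by (simp add: u)
  have mn: "min (Suc t) Y = Suc t" "min y Y = y" "min (sd z q t) Y = sd z q t" using t T1_Y y sdY by auto
  have a: "exec (Assign 7 (Add (md (Sub (Var 10) (dv cY (Cn 4))) cT) (Cn 1))) x (fr q 0 ktop 0 0 0 0 c ext, z2) = (fr q 0 ktop 0 0 (Suc t) 0 c ext, z2)"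
    "exec (Assign 6 (call 2 fvB [Var 1, Var 7])) x (fr q 0 ktop 0 0 (Suc t) 0 c ext, z2) = (fr q 0 ktop 0 y (Suc t) 0 c ext, z2)"
    "exec (Assign 8 (call 3 unrkB [Var 1, Sub (Var 7) (Cn 1), dv (Sub (Var 10) (dv cY (Cn 4))) cT])) x (fr q 0 ktop 0 y (Suc t) 0 c ext, z2) = (fr q 0 ktop 0 y (Suc t) (sd z q t) c ext, z2)"
    "exec (Assign 7 (Cn 0)) x (fr q 0 ktop 0 y (Suc t) (sd z q t) c ext, v) = (fr q 0 ktop 0 y 0 (sd z q t) c ext, v)" for v
    using cd mn fy ur by simp_all
  have bk: "setf z2 q (Suc t) (sd z q t) l = z" unfolding z2_def sd_def by (rule setf_back)
  show "exec decB x (fr q 0 ktop 0 0 0 0 c ext, setf z q (Suc t) y l) = (fr q 0 ktop 0 y 0 (sd z q t) c ext, z)"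
    by (simp only: decB_def exec.simps(3) z2_def[symmetric] a wfC_ex bk)
  show "undc decB x (fr q 0 ktop 0 0 0 0 c ext, setf z q (Suc t) y l)"
    unfolding decB_def undc.simps(3) z2_def[symmetric] a wfC_ex using unrkB_ev(2)[OF z2 t] by simp
qed

lemma hzB_ev:
  assumes z: "length z = Lt"
  shows "eval (hzB g) x [q] z = of_bool (hitQ (setf z q 0 0 l) g)" "und (hzB g) x [q] z"
proof -
  let ?z = "setf z q 0 0 l"
  have z2: "length ?z = Lt" using z by simp
  have f: "[Y, q, 0, ktop, 0, 0, 0, 0, 0, 0, 0] = fr q 0 ktop 0 0 0 0 0 []" by (simp add: fr_def)
  have e: "exec zeroC x ([Y, q, 0, ktop, 0, 0, 0, 0, 0, 0, 0], z) = (fr q 0 ktop 0 (fv z q 0) 0 0 0 [], ?z)"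
    unfolding f by (rule zeroC_ex)
  have e2: "exec (finC 6) x (fr q 0 ktop 0 (fv z q 0) 0 0 0 [u], ?z) = (fr q 0 ktop 0 0 0 0 0 [u], z)" for u
    using finC_ex(2)[of "fv z q 0" q 0 ktop 0 0 0 "[u]" ?z] fv_less[of z q 0] setf_back[of z q 0 0] by simp
  show "eval (hzB g) x [q] z = of_bool (hitQ (setf z q 0 0 l) g)"
    using e hitB_ev(1)[OF z2] by (simp add: hzB_def)
  have "und (After zeroC (call 1 (hitB g) [Var 1]) (finC 6)) x [Y, q, 0, ktop, 0, 0, 0, 0, 0, 0, 0] z"
    unfolding und.simps(12) e prod.case fr_app using e2 hitB_ev(2)[OF z2] finC_ex(3) zeroC_ex(2)[of q 0 ktop 0 0 0 "[]" z]
    by (simp add: f)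
  then show "und (hzB g) x [q] z" by (simp add: hzB_def)
qed

end

context blockq
begin

text \<open>\<open>z0\<close> is the tape after field 0 has been saved in a variable and zeroed;
  encoder and decoder meet on it. The hypothesis \<open>bad\<close> supplies a bad seed if all tours
  are short, so the two cases of the encoder are exhaustive.\<close>

lemma enc_dec:
  fixes z defines "z0 \<equiv> setf z q 0 0 l"
  assumes z: "length z = Lt" and q: "q < T"
    and bad: "(\<forall>tm\<le>T. sh tm z0) \<longrightarrow> (\<exists>t<T. bd z0 t (sd z0 q t))"
  obtains z' where "\<And>ext. exec encC x (fr q 0 ktop 0 0 0 0 0 ext, z) = (fr (Suc q) 0 ktop 0 0 0 0 0 ext, z')"
    "\<And>ext. undc encC x (fr q 0 ktop 0 0 0 0 0 ext, z)" "length z' = Lt" "\<not> rd z' (fad q 0 (l - 1))"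
    "\<And>i. i < q * BL \<or> q * BL + BL \<le> i \<Longrightarrow> rd z' i = rd z i"
    "\<And>ext. exec decC x (fr (Suc q) 0 ktop 0 0 0 0 0 ext, z') = (fr q 0 ktop 0 0 0 0 0 ext, z)"
    "\<And>ext. undc decC x (fr (Suc q) 0 ktop 0 0 0 0 0 ext, z')"
proof -
  define y where "y = fv z q 0"
  have y: "y < Y" using fv_less by (simp add: y_def)
  have z0: "length z0 = Lt" "fv z0 q 0 = 0" using z len_ok[of 0] mE_pos fv_setf[of q 0 z 0] by (simp_all add: z0_def)
  define tm where "tm = fnd (Suc T) (\<lambda>tm. \<not> sh tm z0)"
  have off0: "setf u q f c l ! i = u ! i" if "i < q * BL \<or> q * BL + BL \<le> i" "f \<le> T" "i < length u" for u f c i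
    using that fad_block[of f 0 q] fad_block[of f "l - 1" q] fad_add[of q f "l - 1"] l_pos by (auto simp: setf_nth)
  define encI decI where "encI = CIf (lt (Var 2) (Add cT (Cn 1))) encA encB" and "decI = CIf (lt (Var 10) (dv cY (Cn 4))) decA decB"
  \<comment> \<open>The numbers \<open>tm1\<close>, \<open>v1\<close>, \<open>tm2\<close> and
    \<open>v2\<close> are what the two branches leave in variables 2 and 8. \<open>finC\<close>
    clears both, so that the cases can be finished together.\<close>
  have "\<exists>c z2 tm1 v1 tm2 v2. c < 2 * (Y div 4) \<and> length z2 = Lt \<and> fv z2 q 0 = 0 \<and>
    (\<forall>i. i < Lt \<longrightarrow> i < q * BL \<or> q * BL + BL \<le> i \<longrightarrow> z2 ! i = z0 ! i) \<and>
    (\<forall>ext. exec encI x (fr q tm ktop 0 y 0 0 0 ext, z0) = (fr q tm1 ktop 0 y 0 v1 c ext, z2) \<and> undc encI x (fr q tm ktop 0 y 0 0 0 ext, z0) \<and>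
       exec decI x (fr q 0 ktop 0 0 0 0 c ext, z2) = (fr q tm2 ktop 0 y 0 v2 c ext, z0) \<and> undc decI x (fr q 0 ktop 0 0 0 0 c ext, z2))"
  proof (cases rule: fnd_cases[of "Suc T" "\<lambda>tm. \<not> sh tm z0"])
    case some
    then have tmT: "tm \<le> T" "tm \<le> Suc T" and ns: "\<not> sh tm z0" by (auto simp: tm_def)
    obtain s d z2 where e: "tr tm z0 y = (s, d, z2)" by (cases "tr tm z0 y") auto
    define C where "C = tm * (2 * S) + (2 * s + of_bool d)"
    note A = encA_ex[OF z0(1) tmT(1) y e, folded C_def]
    note D = decA_ex[OF z0(1) tmT(1) y e ns, folded C_def]
    have en: "exec encI x (fr q tm ktop 0 y 0 0 0 ext, z0) = (fr q tm ktop 0 y 0 0 C ext, z2)" "undc encI x (fr q tm ktop 0 y 0 0 0 ext, z0)" for ext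
      using tmT(1) by (simp_all add: encI_def A(1,2))
    have de: "exec decI x (fr q 0 ktop 0 0 0 0 C ext, z2) = (fr q tm ktop 0 y 0 0 C ext, z0)" "undc decI x (fr q 0 ktop 0 0 0 0 C ext, z2)" for ext
      using A(3) by (simp_all add: decI_def D)
    have "length z2 = Lt" "fv z2 q 0 = 0" using tr_len[OF z0(1) tmT(2), of y] tr_fv[OF z0(1) tmT(2), of y 0] z0 e by simp_all
    moreover have "z2 ! i = z0 ! i" if "i < q * BL \<or> q * BL + BL \<le> i" for i
    proof -
      have "T \<le> BL" by (simp add: BL_def)
      then have "i < q * BL \<or> q * BL + T \<le> i" using that by linarith
      from tr_off[OF z0(1) tmT(2) this, of y] show ?thesis using e by simp
    qed
    moreover have "C < 2 * (Y div 4)" using A(3) by linarith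
    ultimately show ?thesis
      by (intro exI[of _ C] exI[of _ z2] exI[of _ tm] exI[of _ 0] exI[of _ tm] exI[of _ 0] conjI allI impI en de)
  next
    case none
    then have sh: "\<And>tm. tm \<le> T \<Longrightarrow> sh tm z0" and tmT: "tm = Suc T" by (auto simp: tm_def less_Suc_eq_le)
    have sh': "\<forall>t<T. sh (Suc t) z0" using sh Suc_leI by blast
    define t where "t = fnd T (\<lambda>t. bd z0 t (sd z0 q t))"
    have "t < T \<and> bd z0 t (sd z0 q t)"
    proof (cases rule: fnd_cases[of T "\<lambda>t. bd z0 t (sd z0 q t)"])
      case none
      then show ?thesis using bad sh by blast
    next
      case some
      then show ?thesis by (simp add: t_def)
    qed
    then have t: "t < T" "bd z0 t (sd z0 q t)" by (rule conjunct1, rule conjunct2)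
    define C where "C = Y div 4 + (rk z0 t (sd z0 q t) * T + t)"
    note B = encB_ex[OF z0(1) sh' y t_def[symmetric] t, folded C_def]
    note D = decB_ex[OF z0(1) sh'[rule_format, OF t(1)] y t, folded C_def]
    have en: "exec encI x (fr q tm ktop 0 y 0 0 0 ext, z0) = (fr q 0 ktop 0 y 0 y C ext, setf z0 q (Suc t) y l)" "undc encI x (fr q tm ktop 0 y 0 0 0 ext, z0)" for ext
      using tmT by (simp_all add: encI_def B(1,2))
    have "\<not> C < Y div 4" by (simp add: C_def)
    then have de: "exec decI x (fr q 0 ktop 0 0 0 0 C ext, setf z0 q (Suc t) y l) = (fr q 0 ktop 0 y 0 (sd z0 q t) C ext, z0)"
      "undc decI x (fr q 0 ktop 0 0 0 0 C ext, setf z0 q (Suc t) y l)" for ext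
      by (simp_all add: decI_def D)
    have z2: "length (setf z0 q (Suc t) y l) = Lt" "fv (setf z0 q (Suc t) y l) q 0 = 0" using z0 fv_setf_other[of 0 "Suc t" z0 q y] by simp_all
    have "setf z0 q (Suc t) y l ! i = z0 ! i" if "i < Lt" "i < q * BL \<or> q * BL + BL \<le> i" for i
      using off0[OF that(2), of "Suc t" z0 y] that(1) t(1) z0(1) by simp
    then show ?thesis
      by (intro exI[of _ C] exI[of _ "setf z0 q (Suc t) y l"] exI[of _ 0] exI[of _ y] exI[of _ 0] exI[of _ "sd z0 q t"] conjI allI impI en de z2 B(3))
  qed
  then obtain c z2 tm1 v1 tm2 v2 where c: "c < 2 * (Y div 4)" and z2: "length z2 = Lt" "fv z2 q 0 = 0"
    and o2: "\<And>i. i < Lt \<Longrightarrow> i < q * BL \<or> q * BL + BL \<le> i \<Longrightarrow> z2 ! i = z0 ! i"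
    and eI: "\<And>ext. exec encI x (fr q tm ktop 0 y 0 0 0 ext, z0) = (fr q tm1 ktop 0 y 0 v1 c ext, z2)"
      "\<And>ext. undc encI x (fr q tm ktop 0 y 0 0 0 ext, z0)"
      "\<And>ext. exec decI x (fr q 0 ktop 0 0 0 0 c ext, z2) = (fr q tm2 ktop 0 y 0 v2 c ext, z0)"
      "\<And>ext. undc decI x (fr q 0 ktop 0 0 0 0 c ext, z2)"
    by blast
  define z' where "z' = setf z2 q 0 c l"
  have cY: "c < Y" using c by linarith
  have z': "length z' = Lt" "fv z' q 0 = c" using z2 len_ok[of 0] cY fv_setf[of q 0 z2 c] by (simp_all add: z'_def)
  have b1: "setf z' q 0 0 l = z2" using setf_back[of z2 q 0 c] z2(2) by (simp add: z'_def)
  have b2: "setf z0 q 0 y l = z" unfolding z0_def y_def by (rule setf_back)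
  have tmY: "min tm Y = tm" using T1_Y(1) by (cases rule: fnd_cases[of "Suc T" "\<lambda>tm. \<not> sh tm z0"]) (auto simp: tm_def)
  have tmE: "exec (Assign 2 (call 1 tmB [Var 1])) x (fr q 0 ktop 0 y 0 0 0 ext, z0) = (fr q tm ktop 0 y 0 0 0 ext, z0)" for ext
    using tmB_ev(1)[OF z0(1)] tmY by (simp add: tm_def)
  have qE: "exec (Assign 1 (Add (Var 1) (Cn 1))) x (fr q 0 ktop 0 0 0 0 0 ext, u) = (fr (Suc q) 0 ktop 0 0 0 0 0 ext, u)"
    "exec (Assign 1 (Sub (Var 1) (Cn 1))) x (fr (Suc q) 0 ktop 0 0 0 0 0 ext, u) = (fr q 0 ktop 0 0 0 0 0 ext, u)" for ext u
    unfolding fr_assign(1) using q T1_Y(1) by simp_all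
  have cE: "exec (Assign 10 (call 2 fvB [Var 1, Cn 0])) x (fr q 0 ktop 0 0 0 0 0 ext, z') = (fr q 0 ktop 0 0 0 0 c ext, z')" for ext
    using z' cY by simp
  have cle: "c \<le> Y" "y \<le> Y" using cY y by simp_all
  show thesis
  proof (rule that[of z'])
    show "exec encC x (fr q 0 ktop 0 0 0 0 0 ext, z) = (fr (Suc q) 0 ktop 0 0 0 0 0 ext, z')" for ext
      unfolding z'_def by (simp only: encC_def exec.simps(3) zeroC_ex z0_def[symmetric] y_def[symmetric] tmE encI_def[symmetric] eI finC_ex(1)[OF cle(1)] qE)
    have "undc (CSeq (finC 10) (Assign 1 (Add (Var 1) (Cn 1)))) x U" for U by (intro undc_all finC_ex; simp)
    then show "undc encC x (fr q 0 ktop 0 0 0 0 0 ext, z)" for ext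
      unfolding encC_def undc.simps(3)[of zeroC] undc.simps(3)[of "Assign 2 (call 1 tmB [Var 1])"] undc.simps(3)[of "CIf _ _ _"]
        zeroC_ex z0_def[symmetric] y_def[symmetric] tmE encI_def[symmetric] eI
      using zeroC_ex(2) eI(2) tmB_ev(2)[OF z0(1)] by simp
    show "length z' = Lt" by (rule z')
    \<comment> \<open>The code is below Y/2, hence the highest bit of field 0 is 0: this is the cell
      gained.\<close>
    have "Y = 2 * 2 ^ (l - 1)" using l_pos by (simp add: Y_l flip: power_Suc)
    then have "c < 2 ^ (l - 1)" using c by linarith
    then show "\<not> rd z' (fad q 0 (l - 1))" using fv_bit[of "l - 1" z' q 0] l_pos z'(2) by simp
    show "rd z' i = rd z i" if i: "i < q * BL \<or> q * BL + BL \<le> i" for i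
      using off0[OF i, of 0 z2 c] o2[OF _ i] off0[OF i, of 0 z 0] z z2 z' by (simp add: rd_def z'_def z0_def)
    show "exec decC x (fr (Suc q) 0 ktop 0 0 0 0 0 ext, z') = (fr q 0 ktop 0 0 0 0 0 ext, z)" for ext
      by (simp only: decC_def exec.simps(3) qE cE wfC_ex b1 decI_def[symmetric] eI finC_ex(2)[OF cle(2)] b2)
    show "undc decC x (fr (Suc q) 0 ktop 0 0 0 0 0 ext, z')" for ext
      unfolding decC_def undc.simps(3) qE cE wfC_ex b1 decI_def[symmetric] eI using eI(4) finC_ex(3) by simp
  qed
qed

end

section \<open>The simulation on the freed cells\<close>

context alg
begin

text \<open>The highest bit of field 0 in block p. It serves as cell p of the tape of the simulated
  machine.\<close>

definition fc :: "nat \<Rightarrow> nat" where "fc p = fad p 0 (l - 1)"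

lemma fc_eq: "fc p = p * BL + (T + (l - 1))" and fc_BL: "T + (l - 1) < BL" and fc_div: "i = fc p \<longleftrightarrow> i div BL = p \<and> i mod BL = T + (l - 1)"
proof -
  show f: "fc p = p * BL + (T + (l - 1))" by (simp add: fc_def fad_def)
  have "l \<le> (T + 1) * l" by simp
  then show b: "T + (l - 1) < BL" using l_pos unfolding BL_def by linarith
  show "i = fc p \<longleftrightarrow> i div BL = p \<and> i mod BL = T + (l - 1)"
  proof
    show "i div BL = p \<and> i mod BL = T + (l - 1) \<Longrightarrow> i = fc p" unfolding f by (metis div_mult_mod_eq)
    show "i = fc p \<Longrightarrow> i div BL = p \<and> i mod BL = T + (l - 1)" unfolding f using b by simp
  qed
qed

definition ovl :: "bool list \<Rightarrow> bool list \<Rightarrow> bool list" where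
  "ovl \<sigma> u = map (\<lambda>i. if i div BL < T \<and> i mod BL = T + (l - 1) then u ! (i div BL) else \<sigma> ! i) [0..<length \<sigma>]"

lemma ovl_len [simp]: "length (ovl \<sigma> u) = length \<sigma>" by (simp add: ovl_def)

lemma fc_less: "p < T \<Longrightarrow> T * BL \<le> L \<Longrightarrow> fc p < L"
proof -
  assume a: "p < T" "T * BL \<le> L"
  have "Suc p * BL \<le> T * BL" using a by (intro mult_le_mono1) simp
  then show ?thesis using a fc_BL unfolding fc_eq by simp
qed

lemma ovl_rd: "p < T \<Longrightarrow> T * BL \<le> length \<sigma> \<Longrightarrow> rd (ovl \<sigma> u) (fc p) = u ! p"
  using fc_less[of p "length \<sigma>"] fc_div[of "fc p" p] by (simp add: rd_def ovl_def)

lemma ovl_upd: "p < T \<Longrightarrow> length u = T \<Longrightarrow> (ovl \<sigma> u)[fc p := v] = ovl \<sigma> (u[p := v])"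
proof (rule nth_equalityI)
  fix i assume a: "p < T" "length u = T" "i < length ((ovl \<sigma> u)[fc p := v])"
  then show "(ovl \<sigma> u)[fc p := v] ! i = ovl \<sigma> (u[p := v]) ! i"
    using fc_div[of i p] by (auto simp: ovl_def nth_list_update)
qed simp

lemma ovl_id: "(\<And>p. p < T \<Longrightarrow> \<not> rd \<sigma> (fc p)) \<Longrightarrow> ovl \<sigma> (replicate T False) = \<sigma>"
proof (rule nth_equalityI)
  fix i assume a: "\<And>p. p < T \<Longrightarrow> \<not> rd \<sigma> (fc p)" "i < length (ovl \<sigma> (replicate T False))"
  show "ovl \<sigma> (replicate T False) ! i = \<sigma> ! i"
  proof (cases "i div BL < T \<and> i mod BL = T + (l - 1)")
    case True
    then have "fc (i div BL) = i" using fc_div by metis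
    then have "\<not> rd \<sigma> i" using a(1)[of "i div BL"] True by simp
    then show ?thesis using True a(2) by (simp add: ovl_def rd_def)
  next
    case False
    then show ?thesis using a(2) by (auto simp: ovl_def)
  qed
qed simp

definition "fcE p = call 3 fadB [p, Cn 0, Sub cl (Cn 1)]"

lemma fcE_ev [simp]: "eval (fcE p) x vs z = fc (eval p x vs z)" "und (fcE p) x vs z = und p x vs z" "wfe (fcE p) v = wfe p v"
  by (simp_all add: fcE_def fc_def)

definition "simC = CSeq (Assign 2 (Cat (fcE (call 1 psB [Var 1])))) (CSeq (Write (fcE (call 1 psB [Var 1])) (call 2 wr0B [Var 1, Var 2]))
   (Assign 1 (call 3 nx0B [Var 1, Var 2, Cn 0])))"
definition "wipeC = CSeq (Write (fcE (Var 2)) (Cn 0)) (Assign 2 (Add (Var 2) (Cn 1)))"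
text \<open>The simulated run may leave anything on the freed cells. There is no need to reverse it:
  their original content is known to be 0, so wiping them is an undo.\<close>

definition "simB = After (Loop cT simC) (eq (dv (cmE 0 (Var 1)) (Cn 4)) (Cn (qacc M)))
   (CSeq (Assign 2 (Cn 0)) (CSeq (Loop cT wipeC) (CSeq (Assign 2 (Cn 0)) (Assign 1 (startE False False)))))"
definition "simE = call 3 simB [cS0, startE False False, Cn 0]"

lemma simE_wf [simp]: "wfe simE v" by (simp add: simE_def simB_def simC_def wipeC_def)

lemma sim_loop:
  assumes \<sigma>: "T * BL \<le> length \<sigma>" and j: "j \<le> T"
  shows "\<exists>p. let c = (step M x (replicate L' False) ^^ j) (init M w (replicate T False)) in vc c \<and> encc False False j c < S0 \<and>
    (loop1 (exec simC x) ^^ j) ([S0, startk False False, 0], ovl \<sigma> (replicate T False)) = ([S0, encc False False j c, p], ovl \<sigma> (ct c))"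
  using j
proof (induction j)
  case 0
  have v: "vc (init M w (replicate T False))" using wf T_pos by (auto simp: vc_def init_def wf_machine_def)
  have "bitsval (replicate w False) = 0" by (simp add: bitsval_def)
  then have "encc False False 0 (init M w (replicate T False)) = startk False False" by (simp add: encc_def init_def startk_def)
  then show ?case using v startk_ok(1) by (simp add: init_def)
next
  case (Suc j)
  let ?r = "replicate L' False"
  define c where "c = (step M x ?r ^^ j) (init M w (replicate T False))"
  define y where "y = encc False False j c"
  obtain p where p: "vc c" "y < S0" "(loop1 (exec simC x) ^^ j) ([S0, startk False False, 0], ovl \<sigma> (replicate T False)) = ([S0, y, p], ovl \<sigma> (ct c))"
    using Suc by (auto simp: Let_def c_def y_def)
  have rr: "rd ?r (rh c) = False" by (simp add: rd_def)
  define c' where "c' = step M x ?r c"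
  define v where "v = ct c ! ch c"
  note es = enc_step(1)[OF p(1) rr, folded c'_def] enc_step(2,3)[OF p(1) rr, where g = False and t = j and r' = False, folded c'_def y_def v_def]
  have chT: "ch c < T" "length (ct c) = T" using p(1) by (auto simp: vc_def)
  have ps: "ps y = ch c" using encc_cm[OF p(1)] chT by (simp add: ps_def y_def)
  have lv: "lv y = j" using encc_cm[OF p(1)] by (simp add: y_def)
  have nx: "nx0 y v False = encc False False (Suc j) c'" using es(2) by simp
  have nxS: "nx0 y v False < S0" using nx0_ok(1)[OF p(2)] lv Suc.prems by simp
  have mv: "min (of_bool v) S0 = of_bool v" "min (nx0 y v False) S0 = nx0 y v False" using tops(1) nxS by simp_all
  have "loop1 (exec simC x) ([S0, y, p], ovl \<sigma> (ct c)) = ([S0, nx0 y v False, of_bool v], ovl \<sigma> (ct c'))"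
    using ps ovl_rd[OF chT(1) \<sigma>, of "ct c"] ovl_upd[OF chT(1,2), of \<sigma>] es(3) mv nx0B_ev(1)[of y v False]
    by (simp add: loop1_def simC_def v_def[symmetric] exec.simps(1) wr0B_ev(1)[where r = False] split del: split_of_bool)
  then show ?case using p(3) es(1) nx nxS unfolding Let_def c'_def c_def by (intro exI[of _ "of_bool v"]) simp
qed

lemma wipe_loop:
  assumes "length u = T" "j \<le> T"
  shows "(loop1 (exec wipeC x) ^^ j) (S0 # y # 0 # ext, ovl \<sigma> u) = (S0 # y # j # ext, ovl \<sigma> (replicate j False @ drop j u))"
  using assms(2)
proof (induction j)
  case (Suc j)
  have "T < S0" using Rs(4) self_le_power[of R 6] Rs(5) unfolding S0_def by linarith
  then have mn: "min (Suc j) S0 = Suc j" using Suc.prems by simp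
  have "(replicate j False @ drop j u)[j := False] = replicate (Suc j) False @ drop (Suc j) u"
    using Suc.prems assms(1) Cons_nth_drop_Suc[of j u, symmetric] by (simp add: list_update_append replicate_append_same[symmetric])
  then have "(ovl \<sigma> (replicate j False @ drop j u))[fc j := False] = ovl \<sigma> (replicate (Suc j) False @ drop (Suc j) u)"
    using Suc.prems assms(1) ovl_upd[of j "replicate j False @ drop j u" \<sigma> False] by simp
  then show ?case using Suc mn by (simp add: loop1_def wipeC_def exec.simps(1))
qed simp

lemma simE_ev:
  assumes \<sigma>: "T * BL \<le> length \<sigma>" "\<And>p. p < T \<Longrightarrow> \<not> rd \<sigma> (fc p)"
  shows "eval simE x vs \<sigma> = of_bool (st (run M x (replicate L' False) w (replicate T False) T) = qacc M)" "und simE x vs \<sigma>"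
proof -
  define c where "c = (step M x (replicate L' False) ^^ T) (init M w (replicate T False))"
  define y where "y = encc False False T c"
  have id: "ovl \<sigma> (replicate T False) = \<sigma>" by (rule ovl_id[OF \<sigma>(2)])
  obtain p where p: "vc c" "(loop1 (exec simC x) ^^ T) ([S0, startk False False, 0], \<sigma>) = ([S0, y, p], ovl \<sigma> (ct c))"
    using sim_loop[OF \<sigma>(1) order_refl, of L'] id by (auto simp: Let_def c_def y_def)
  have cT: "length (ct c) = T" using p(1) by (simp add: vc_def)
  have L: "exec (Loop cT simC) x ([S0, startk False False, 0], \<sigma>) = ([S0, y, p], ovl \<sigma> (ct c))" using p(2) by simp
  have d: "cm 0 y div 4 = st c" using encc_cm(1)[OF p(1)] by (simp add: y_def)
  have "eval simB x [S0, startk False False, 0] \<sigma> = of_bool (st c = qacc M)"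
    unfolding simB_def eval.simps(12) L using d by simp
  then show "eval simE x vs \<sigma> = of_bool (st (run M x (replicate L' False) w (replicate T False) T) = qacc M)"
    by (simp add: simE_def run_def c_def)
  have s0: "min (startk False False) S0 = startk False False" using startk_ok(1) by (simp add: less_imp_le)
  have wu: "exec (CSeq (Assign 2 (Cn 0)) (CSeq (Loop cT wipeC) (CSeq (Assign 2 (Cn 0)) (Assign 1 (startE False False))))) x ([S0, y, p] @ [u], ovl \<sigma> (ct c))
      = ([S0, startk False False, 0] @ [u], \<sigma>)" for u
    using wipe_loop[OF cT order_refl, of y "[u]" \<sigma>] id s0 cT by (simp add: exec.simps(1))
  have un: "undc (Loop cT simC) x U" "undc (CSeq (Assign 2 (Cn 0)) (CSeq (Loop cT wipeC) (CSeq (Assign 2 (Cn 0)) (Assign 1 (startE False False))))) x U" for U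
    unfolding simC_def wipeC_def by (intro undc_all; simp)+
  have "und simB x [S0, startk False False, 0] \<sigma>"
    unfolding simB_def und.simps(12) L prod.case wu using un by simp
  then show "und simE x vs \<sigma>" by (simp add: simE_def)
qed

end

section \<open>The whole program\<close>

context alg
begin

text \<open>A block with a hit is left alone and the block counter is not advanced, so the loop stays there.\<close>

definition "encL = CIf (Ite (call 1 (hzB True) [Var 1]) (Cn 1) (call 1 (hzB False) [Var 1])) (Assign 9 (Cn 0)) encC"
text \<open>\<open>Loop\<close> evaluates its count once on entry, so exactly as many blocks are
  decoded as were encoded, in reverse order, although each round decreases variable 1.\<close>

definition "mainB = After (Loop cT encL) (Ite (lt (Var 1) cT) (call 1 (hzB True) [Var 1]) simE) (Loop (Var 1) decC)"
definition "mainE = call 11 mainB [cY, Cn 0, Cn 0, ktopE, Cn 0, Cn 0, Cn 0, Cn 0, Cn 0, Cn 0, Cn 0]"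

lemma mainE_wf: "wfe mainE 0"
  by (simp add: mainE_def mainB_def encL_def)

definition K :: "nat \<Rightarrow> nat list \<Rightarrow> nat list" where "K q ext = fr q 0 ktop 0 0 0 0 0 ext"

lemma K_simps [simp]: "K q ext @ ws = K q (ext @ ws)" "K q ext ! 1 = q" "K q ext ! Suc 0 = q"
  "length (K q ext) = 11 + length ext" "drop (11 + j) (K q ext) = drop j ext" "drop 11 (K q ext) = ext"
  by (simp_all add: K_def)

lemma K_take: "take (length (K q ext)) (K q' (ext @ ws)) = K q' ext"
proof -
  have "length (K q ext) = length (K q' ext)" by simp
  then show ?thesis unfolding K_simps(1)[symmetric] by (simp only: append_eq_conv_conj[THEN iffD1, OF refl] take_append) simp
qed

lemma loop1_K: "(\<And>ext. F (K q ext, z) = (K q' ext, z')) \<Longrightarrow> loop1 F (K q ext, z) = (K q' ext, z')"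
  unfolding loop1_def prod.case K_simps(1) by (simp only: prod.case K_take)

end

locale main = alg +
  fixes Lt L' :: nat and G :: bool and \<delta> :: real
  assumes tl: "T * BL \<le> Lt" and TL: "T < L'"
    and G: "\<And>r u. length r = L' \<Longrightarrow> length u = T \<Longrightarrow> st (run M x r w u T) = qacc M \<longleftrightarrow> G"
    and p: "\<And>u. length u = T \<Longrightarrow> real (card {r. length r = L' \<and> ct (run M x r w u T) = u}) \<ge> (1 - \<delta>) * 2 ^ L'"
    and E: "real T < real E * (1 - \<delta>)"
begin

lemma bq: "q < T \<Longrightarrow> blockq M k rho x gm mu bt q Lt"
proof
  assume "q < T"
  then have "Suc q * BL \<le> T * BL" by (intro mult_le_mono1) simp
  then show "q * BL + BL \<le> Lt" using tl by simp
qed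

lemma hit_G:
  assumes q: "q < T" and z: "length z = Lt" and h: "eval (hzB g) x [q] z \<noteq> 0"
  shows "g = G"
proof -
  interpret B: blockq M k rho x gm mu bt q Lt by (rule bq[OF q])
  have hq: "B.hitQ (setf z q 0 0 l) g" using h B.hzB_ev(1)[OF z, of g] by simp
  have len: "length (setf z q 0 0 l) = Lt" using z by simp
  show ?thesis by (rule B.hit_sound[OF len hq TL]) (rule G)
qed

lemma hz_und: "q < T \<Longrightarrow> length z = Lt \<Longrightarrow> und (hzB g) x [q] z"
  using blockq.hzB_ev(2)[OF bq] by blast

lemma enc_step':
  assumes q: "q < T" and z: "length z = Lt" and h: "\<And>g. eval (hzB g) x [q] z = 0"
  obtains z' where "\<And>ext. exec encC x (K q ext, z) = (K (Suc q) ext, z')" "\<And>ext. undc encC x (K q ext, z)"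
    "length z' = Lt" "\<not> rd z' (fc q)" "\<And>i. i < q * BL \<or> q * BL + BL \<le> i \<Longrightarrow> rd z' i = rd z i"
    "\<And>ext. exec decC x (K (Suc q) ext, z') = (K q ext, z)" "\<And>ext. undc decC x (K (Suc q) ext, z')"
proof -
  interpret B: blockq M k rho x gm mu bt q Lt by (rule bq[OF q])
  have nh: "\<not> B.hitQ (setf z q 0 0 l) g" for g using h[of g] B.hzB_ev(1)[OF z, of g] by simp
  have bad: "(\<forall>tm\<le>T. B.sh tm (setf z q 0 0 l)) \<longrightarrow> (\<exists>t<T. B.bd (setf z q 0 0 l) t (sd (setf z q 0 0 l) q t))"
  proof (rule impI, rule B.nohit_bad[OF _ nh nh _ TL])
    assume "\<forall>tm\<le>T. B.sh tm (setf z q 0 0 l)"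
    then show "B.sh 0 (setf z q 0 0 l)" by simp
    show "length (setf z q 0 0 l) = Lt" using z by simp
    show "\<And>r u. length r = L' \<Longrightarrow> length u = T \<Longrightarrow> (st (run M x r w u T) = qacc M) = G" by (rule G)
    show "\<And>u. length u = T \<Longrightarrow> real (card {r. length r = L' \<and> ct (run M x r w u T) = u}) \<ge> (1 - \<delta>) * 2 ^ L'" by (rule p)
    show "real T < real E * (1 - \<delta>)" by (rule E)
  qed
  show thesis by (rule B.enc_dec[OF z q bad]) (rule that[unfolded K_def fc_def])
qed

text \<open>A counter q that lags behind the number j of rounds means that the loop is stuck at a
  block with a hit. Together with the free cells, the invariant carries the promise that q decoding
  rounds restore the original tape.\<close>

definition inv :: "bool list \<Rightarrow> nat \<Rightarrow> nat \<Rightarrow> bool list \<Rightarrow> bool" where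
  "inv \<tau> j q z \<longleftrightarrow> q \<le> j \<and> length z = Lt \<and> (\<forall>i<q. \<not> rd z (fc i)) \<and> (q < j \<longrightarrow> (\<exists>g. eval (hzB g) x [q] z \<noteq> 0)) \<and>
     (\<forall>u. (loop1 (exec decC x) ^^ q) (K q [u], z) = (K 0 [u], \<tau>)) \<and> (\<forall>u. undc (Loop (Var 1) decC) x (K q [u], z))"

lemma main_inv:
  assumes \<tau>: "length \<tau> = Lt" and j: "j \<le> T"
  shows "\<exists>q z. (loop1 (exec encL x) ^^ j) (K 0 [], \<tau>) = (K q [], z) \<and> inv \<tau> j q z"
  using j
proof (induction j)
  case 0
  show ?case using \<tau> by (auto simp: inv_def)
next
  case (Suc j)
  then obtain q z where e: "(loop1 (exec encL x) ^^ j) (K 0 [], \<tau>) = (K q [], z)" and i: "inv \<tau> j q z" by auto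
  have q: "q < T" "q \<le> j" and z: "length z = Lt" using i Suc.prems by (auto simp: inv_def)
  show ?case
  proof (cases "\<exists>g. eval (hzB g) x [q] z \<noteq> 0")
    case True
    then have h: "eval (hzB True) x [q] z \<noteq> 0 \<or> eval (hzB False) x [q] z \<noteq> 0" by (metis (full_types))
    \<comment> \<open>The language has no skip; assigning 0 to variable 9, which is 0 already, takes
      its place.\<close>
    have "exec encL x (K q ext, z) = (K q ext, z)" for ext
      using h by (auto simp: encL_def exec.simps(1)) (simp_all add: K_def fr_def)
    then have "loop1 (exec encL x) (K q [], z) = (K q [], z)" by (rule loop1_K)
    then show ?thesis using e i True by (intro exI[of _ q] exI[of _ z]) (auto simp: inv_def)
  next
    case False
    then have h: "\<And>g. eval (hzB g) x [q] z = 0" by simp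
    have qj: "q = j" using i False by (auto simp: inv_def)
    from enc_step'[OF q(1) z h] obtain z' where
      s: "\<And>ext. exec encC x (K q ext, z) = (K (Suc q) ext, z')" "length z' = Lt" "\<not> rd z' (fc q)"
        "\<And>i. i < q * BL \<or> q * BL + BL \<le> i \<Longrightarrow> rd z' i = rd z i"
        "\<And>ext. exec decC x (K (Suc q) ext, z') = (K q ext, z)" "\<And>ext. undc decC x (K (Suc q) ext, z')" by blast
    have "exec encL x (K q ext, z) = (K (Suc q) ext, z')" for ext using h s(1) by (simp add: encL_def)
    then have l1: "loop1 (exec encL x) (K q [], z) = (K (Suc q) [], z')" by (rule loop1_K)
    have d1: "loop1 (exec decC x) (K (Suc q) ext, z') = (K q ext, z)" for ext by (rule loop1_K) (rule s(5))
    have free: "\<not> rd z' (fc i)" if "i < Suc q" for i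
    proof (cases "i = q")
      case ne: False
      then have "Suc i * BL \<le> q * BL" using that by (intro mult_le_mono1) simp
      then have "fc i < q * BL" using fc_BL unfolding fc_eq by simp
      then show ?thesis using s(4)[of "fc i"] i ne that by (auto simp: inv_def)
    qed (use s(3) in simp)
    have dl: "(loop1 (exec decC x) ^^ Suc q) (K (Suc q) [u], z') = (K 0 [u], \<tau>)" for u
      unfolding funpow_Suc_right o_apply d1 using i by (simp add: inv_def)
    have ud: "undc (Loop (Var 1) decC) x (K (Suc q) [u], z')" for u
    proof -
      have "case (loop1 (exec decC x) ^^ i') (K (Suc q) [u], z') of (us, \<sigma>) \<Rightarrow> undc decC x (us @ [0], \<sigma>)" if "i' < Suc q" for i'
      proof (cases i')
        case 0
        then show ?thesis using s(6) by simp
      next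
        case (Suc i1)
        have "undc (Loop (Var 1) decC) x (K q [u], z)" using i by (simp add: inv_def)
        then show ?thesis unfolding Suc funpow_Suc_right o_apply d1 using that Suc by simp
      qed
      then show ?thesis by simp
    qed
    have "inv \<tau> (Suc j) (Suc q) z'" unfolding inv_def using qj s(2) free dl ud by auto
    then show ?thesis using e l1 by (intro exI[of _ "Suc q"] exI[of _ z']) simp
  qed
qed

lemma encL_und:
  assumes q: "q < T" and z: "length z = Lt"
  shows "undc encL x (K q ext, z)"
proof (cases "\<exists>g. eval (hzB g) x [q] z \<noteq> 0")
  case True
  then have h: "eval (hzB True) x [q] z \<noteq> 0 \<or> eval (hzB False) x [q] z \<noteq> 0" by (metis (full_types))
  then show ?thesis using hz_und[OF q z] by (auto simp: encL_def)
next
  case False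
  then have h: "\<And>g. eval (hzB g) x [q] z = 0" by simp
  then show ?thesis using hz_und[OF q z] enc_step'[OF q z h] by (simp add: encL_def) blast
qed

text \<open>If the loop got stuck, the hit found is sound for either guess, so testing the guess
  True is enough. Otherwise all T cells are free and a single run decides, because the answer is
  right for every coin string and every initial tape.\<close>

lemma mainE_ev:
  assumes \<tau>: "length \<tau> = Lt"
  shows "und mainE x [] \<tau> \<and> (eval mainE x [] \<tau> \<noteq> 0 \<longleftrightarrow> G)"
proof -
  obtain q z where e: "(loop1 (exec encL x) ^^ T) (K 0 [], \<tau>) = (K q [], z)" and i: "inv \<tau> T q z" using main_inv[OF \<tau> order_refl] by blast
  have qT: "q \<le> T" and z: "length z = Lt" and fr: "\<And>i. i < q \<Longrightarrow> \<not> rd z (fc i)" using i by (auto simp: inv_def)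
  have L: "exec (Loop cT encL) x (K 0 [], \<tau>) = (K q [], z)" using e by simp
  let ?e = "Ite (lt (Var 1) cT) (call 1 (hzB True) [Var 1]) simE"
  have ev: "(eval ?e x (K q []) z \<noteq> 0 \<longleftrightarrow> G) \<and> und ?e x (K q []) z"
  proof (cases "q < T")
    case True
    then obtain g where g: "eval (hzB g) x [q] z \<noteq> 0" using i by (auto simp: inv_def)
    have "eval (hzB True) x [q] z \<noteq> 0 \<longleftrightarrow> G"
    proof
      show "eval (hzB True) x [q] z \<noteq> 0 \<Longrightarrow> G" using hit_G[OF True z, of True] by simp
      show "G \<Longrightarrow> eval (hzB True) x [q] z \<noteq> 0" using hit_G[OF True z g] g by simp
    qed
    then show ?thesis using True hz_und[OF True z] by simp
  next
    case False
    then have "q = T" using qT by simp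
    then have f: "\<And>p. p < T \<Longrightarrow> \<not> rd z (fc p)" using fr by simp
    have "eval simE x (K q []) z = of_bool G" "und simE x (K q []) z"
      using simE_ev(1)[of z, OF _ f, where L' = L'] simE_ev(2)[of z, OF _ f] tl z G[of "replicate L' False" "replicate T False"] by simp_all
    then show ?thesis using False by simp
  qed
  have d: "exec (Loop (Var 1) decC) x (K q [u], z) = (K 0 [u], \<tau>)" "undc (Loop (Var 1) decC) x (K q [u], z)" for u
    using i by (auto simp: inv_def)
  have "undc (Loop cT encL) x (K 0 [], \<tau>)"
  proof -
    have "case (loop1 (exec encL x) ^^ j) (K 0 [], \<tau>) of (us, \<sigma>) \<Rightarrow> undc encL x (us @ [0], \<sigma>)" if jT: "j < T" for j
    proof -
      obtain q z where "(loop1 (exec encL x) ^^ j) (K 0 [], \<tau>) = (K q [], z)" "inv \<tau> j q z" using main_inv[OF \<tau> less_imp_le[OF jT]] by blast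
      then show ?thesis using encL_und[of q z "[0]"] jT by (simp add: inv_def)
    qed
    then show ?thesis by simp
  qed
  then have "und mainB x (K 0 []) \<tau>" unfolding mainB_def und.simps(12) L prod.case K_simps(1) append_Nil d using d(2) ev by blast
  moreover have "eval mainB x (K 0 []) \<tau> \<noteq> 0 \<longleftrightarrow> G" unfolding mainB_def eval.simps(12) L prod.case using ev by blast
  moreover have "[Y, 0, 0, ktop, 0, 0, 0, 0, 0, 0, 0] = K 0 []" by (simp add: K_def fr_def)
  ultimately show ?thesis by (simp add: mainE_def)
qed

end

section \<open>The two inclusions\<close>

lemma BPCLP_subset: assumes "\<delta> < 1" shows "BPCLP \<delta> \<subseteq> CLP"
proof
  fix L assume "L \<in> BPCLP \<delta>"
  then obtain k M where wf: "wf_machine M" and spec: "\<And>x \<tau>. length \<tau> = polyb k (length x) \<Longrightarrow>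
     (\<forall>r \<in> bitstrings (2 ^ polyb k (length x)). halted M (run M x r (logb k (length x)) \<tau> (polyb k (length x))) \<and>
        (st (run M x r (logb k (length x)) \<tau> (polyb k (length x))) = qacc M \<longleftrightarrow> x \<in> L)) \<and>
     real (card {r \<in> bitstrings (2 ^ polyb k (length x)). ct (run M x r (logb k (length x)) \<tau> (polyb k (length x))) = \<tau>})
       \<ge> (1 - \<delta>) * 2 ^ (2 ^ polyb k (length x))"
    unfolding BPCLP_def Let_def by blast
  \<comment> \<open>This is where \<delta> < 1 enters: since P \<ge> 2, the value E = P^(k + d)
    exceeds T/(1 - \<delta>).\<close>
  obtain d where d: "1 / (1 - \<delta>) < 2 ^ d" using real_arch_pow[of 2 "1 / (1 - \<delta>)"] by auto
  define rho gm where "rho = k + 4 * nst M + 3" and "gm = k + d"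
  define mu where "mu = 5 + 2 * k + 12 * rho + 3 * gm"
  define bt where "bt = mu + 6 * rho + k + 4"
  \<comment> \<open>T \<le> N^k and BL \<le> N^(k + bt + 3), so a tape of length N^D has room for T
    blocks.\<close>
  define D where "D = 2 * k + bt + 3"
  have alg: "alg M k rho gm mu bt" for x :: "bool list" using wf by unfold_locales (simp_all add: rho_def mu_def bt_def)
  show "L \<in> CLP"
  proof (rule exp_in_CLP[of "alg.mainE M k rho gm mu bt" D])
    show "wfe (alg.mainE M k rho gm mu bt) 0" using alg.mainE_wf[OF alg] .
    fix x \<tau> :: "bool list" assume len: "max (length x) 2 ^ D \<le> length \<tau>"
    interpret A: alg M k rho x gm mu bt by (rule alg)
    have T: "A.T = polyb k (length x)" by (simp add: A.T_def A.N_def A.n_def polyb_def)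
    have w: "A.w = logb k (length x)" by (simp add: A.w_def A.n_def lg_def logb_def)
    have "A.T * A.BL \<le> A.N ^ D"
    proof -
      have N1: "1 \<le> A.N ^ i" for i using A.N2 by simp
      have "bt \<le> 2 ^ bt" by simp
      also have "\<dots> \<le> A.N ^ bt" using A.N2 by (intro power_mono) auto
      finally have "A.l \<le> A.N ^ bt * A.N" unfolding A.l_def using lg_le[of A.n] by (intro mult_le_mono) (auto simp: A.N_def)
      moreover have "A.T + 1 \<le> A.N ^ k * A.N" using mult_le_mono2[OF A.N2, of "A.N ^ k"] N1[of k] unfolding A.T_def by linarith
      ultimately have "(A.T + 1) * A.l \<le> (A.N ^ k * A.N) * (A.N ^ bt * A.N)" by (intro mult_le_mono)
      also have "\<dots> = A.N ^ (k + bt + 2)" by (simp add: power_add power2_eq_square)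
      finally have "A.BL \<le> A.N ^ (k + bt + 2) + A.N ^ (k + bt + 2)"
        unfolding A.BL_def A.T_def using power_increasing[of k "k + bt + 2" A.N] A.N2 by linarith
      also have "\<dots> \<le> A.N ^ (k + bt + 2) * A.N" using mult_le_mono2[OF A.N2, of "A.N ^ (k + bt + 2)"] by linarith
      finally have "A.T * A.BL \<le> A.N ^ k * (A.N ^ (k + bt + 2) * A.N)" unfolding A.T_def by (intro mult_le_mono2)
      also have "\<dots> = A.N ^ D" by (simp add: D_def power_add mult_ac numeral_eq_Suc)
      finally show ?thesis .
    qed
    then have tl: "A.T * A.BL \<le> length \<tau>" using len by (simp add: A.N_def A.n_def)
    have E: "real A.T < real A.E * (1 - \<delta>)"
    proof -
      have "real (2 ^ d) \<le> real (A.P ^ d)" using A.P2 by (intro of_nat_mono power_mono) auto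
      moreover have "1 < 2 ^ d * (1 - \<delta>)" using d assms by (simp add: field_simps)
      moreover have "real (2 ^ d) * (1 - \<delta>) \<le> real (A.P ^ d) * (1 - \<delta>)" using calculation(1) assms by (intro mult_right_mono) auto
      ultimately have "1 < real (A.P ^ d) * (1 - \<delta>)" by simp
      then have "real (A.P ^ k) * 1 < real (A.P ^ k) * (real (A.P ^ d) * (1 - \<delta>))" using A.P2 by (intro mult_strict_left_mono) auto
      moreover have "real A.T \<le> real (A.P ^ k)" using A.T_P by (intro of_nat_mono)
      moreover have "A.P ^ gm = A.P ^ k * A.P ^ d" by (simp only: gm_def power_add)
      then have "real A.E * (1 - \<delta>) = real (A.P ^ k) * (real (A.P ^ d) * (1 - \<delta>))" unfolding A.E_def by simp
      ultimately show ?thesis by linarith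
    qed
    \<comment> \<open>The random string has 2^T bits and a run reads at most T + 1 of them, so it
      never runs past the end of the string.\<close>
    interpret main M k rho x gm mu bt "length \<tau>" "2 ^ A.T" "x \<in> L" \<delta>
    proof
      show "A.T * A.BL \<le> length \<tau>" "A.T < 2 ^ A.T" "real A.T < real A.E * (1 - \<delta>)" using tl E by simp_all
      show "st (run M x r A.w u A.T) = qacc M \<longleftrightarrow> x \<in> L" if "length r = 2 ^ A.T" "length u = A.T" for r u
        using spec[of u x] that unfolding T w bitstrings_def by blast
      show "(1 - \<delta>) * 2 ^ 2 ^ A.T \<le> real (card {r. length r = 2 ^ A.T \<and> ct (run M x r A.w u A.T) = u})" if "length u = A.T" for u
        using spec[of u x] that unfolding T w bitstrings_def by simp
    qed
    show "und (alg.mainE M k rho gm mu bt) x [] \<tau> \<and> (eval (alg.mainE M k rho gm mu bt) x [] \<tau> \<noteq> 0 \<longleftrightarrow> x \<in> L)"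
      by (rule mainE_ev) simp
  qed
qed

lemma CLP_subset: assumes "0 \<le> \<delta>" shows "CLP \<subseteq> BPCLP \<delta>"
proof
  fix L assume "L \<in> CLP"
  then obtain k M where wf: "wf_machine M" and spec: "\<And>x \<tau>. length \<tau> = polyb k (length x) \<Longrightarrow>
     halted M (run M x [] (logb k (length x)) \<tau> (polyb k (length x))) \<and>
     (st (run M x [] (logb k (length x)) \<tau> (polyb k (length x))) = qacc M \<longleftrightarrow> x \<in> L) \<and>
     ct (run M x [] (logb k (length x)) \<tau> (polyb k (length x))) = \<tau>"
    unfolding CLP_def Let_def by blast
  \<comment> \<open>On the empty random string every coin reads as False; \<open>M'\<close> does the
    same on every string.\<close>
  define M' where "M' = M\<lparr>delta := \<lambda>q a b c d. delta M q a b c False\<rparr>"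
  have h: "halted M' = halted M" "qacc M' = qacc M" by (simp_all add: M'_def halted_def fun_eq_iff)
  have dl: "delta M' = (\<lambda>q a b c d. delta M q a b c False)" by (simp add: M'_def)
  have rd0: "rd [] i = False" for i by (simp add: rd_def)
  have "step M' x r = step M x []" for x r
    by (rule ext) (simp only: step_def h(1) dl rd0)
  moreover have "init M' = init M" by (simp add: init_def M'_def fun_eq_iff)
  ultimately have run: "run M' x r w \<tau> t = run M x [] w \<tau> t" for x r w \<tau> t by (simp add: run_def)
  have "wf_machine M'" using wf by (simp add: wf_machine_def M'_def)
  moreover have "real (card (bitstrings n)) \<ge> (1 - \<delta>) * 2 ^ n" for n
  proof -
    have "card (bitstrings n) = 2 ^ n" using card_lists_length_eq[of "UNIV :: bool set" n] by (simp add: bitstrings_def)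
    then show ?thesis using assms mult_right_mono[of "1 - \<delta>" 1 "2 ^ n"] by simp
  qed
  ultimately show "L \<in> BPCLP \<delta>" unfolding BPCLP_def Let_def using spec
    by (intro CollectI exI[of _ k] exI[of _ M'] conjI allI impI) (simp_all add: run h)
qed

theorem theorem4p11:
  fixes \<delta> :: real
  assumes "0 \<le> \<delta>" and "\<delta> < 1"
  shows "BPCLP \<delta> = CLP"
  using BPCLP_subset[OF assms(2)] CLP_subset[OF assms(1)] by (rule equalityI)

end
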